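(* Let $H:[0,\infty)\to[\mu,\nu]\subset(0,1)$ be $\beta$-Hölder continuous with $\sup_{s\ge0}H(s)<\beta$, and let $B=(B(t),\,t\ge0)$ be a multifractional Brownian motion with Hurst function $H$ (in either the moving average or the harmonizable representation). Fix $t_0\ge0$ and denote by $\ell(t,x)$ the local time of the fractional Brownian motion with Hurst parameter $H(t_0)$. Let $f\in L^1(\mathbb{R})$ be such that $$\int_{\mathbb{R}}|f(x)||x|^{\xi}\,dx<\infty\ \text{ for some }\ 0<\xi<\frac{1}{2\sup_{t\ge0}H(t)}-\frac12,\qquad\text{and}\qquad\int_{\mathbb{R}}f(x)\,dx\neq0.$$ Let $\theta(\cdot)$ and $\psi(\cdot)$ be positive functions of $\rho>0$ satisfying $\frac{\psi(\rho)}{\theta(\rho)}=\rho^{1-H(t_0)}$ and $\frac{\theta(\rho)}{\rho^{H(t_0)}}=o(1)$ as $\rho\to0^+$. Then, for every $t\ge0$ and $y\in\mathbb{R}$, the following convergence in law holds: $$\frac{1}{\psi(\rho)}\int_{t_0}^{\rho t+t_0}f\left(\frac{B(s)-B(t_0)-\rho^{H(t_0)}y}{\theta(\rho)}\right)ds\ \longrightarrow\ \int_{\mathbb{R}}f(x)\,dx\cdot\ell(t,y)\qquad\text{as }\rho\to0^+.$$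
   Context: Multifractional Brownian motion with Hurst function $H$ is given by either of the following representations. Moving average representation: $B(t)=\frac{1}{\Gamma(H(t)+1/2)}\Big(\int_{-\infty}^{0}[(t-u)^{H(t)-1/2}-(-u)^{H(t)-1/2}]\,W(du)+\int_0^t(t-u)^{H(t)-1/2}\,W(du)\Big)$, $t\ge 0$, with $W$ a standard Brownian motion on $(-\infty,\infty)$. Harmonizable representation: $B(t)=\int_{\mathbb{R}}\frac{e^{it\xi}-1}{|\xi|^{H(t)+1/2}}\,\widehat W(d\xi)$, where $\widehat W$ is the Fourier transform of real white noise $W$, i.e. $\int f\,d\widehat W=\int\widehat f\,dW$ for $f\in L^2(\mathbb{R})$, with $\widehat f$ the unitary Fourier transform; this process is real-valued. The fractional Brownian motion with Hurst parameter $H(t_0)$ is the process $B^{H(t_0)}$ obtained from the same representation with constant Hurst function equal to $H(t_0)$. Its local time is $\ell(t,x)=\ell([0,t],x)$, where $\ell(A,\cdot)$ is the density with respect to Lebesgue measure $\lambda$ of the occupation measure $D\mapsto\lambda\{s\in A:B^{H(t_0)}(s)\in D\}$; the version jointly continuous in $(t,x)$ (known to exist) is used. *)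

theory Defs
  imports "HOL-Probability.Probability" "HOL-Library.Landau_Symbols"
begin

definition std_brownian_motion :: "'a measure \<Rightarrow> (real \<Rightarrow> 'a \<Rightarrow> real) \<Rightarrow> bool" where
  "std_brownian_motion M W \<longleftrightarrow>
     prob_space M \<and>
     (\<forall>t. W t \<in> borel_measurable M) \<and>
     (AE \<omega> in M. W 0 \<omega> = 0) \<and>
     (AE \<omega> in M. continuous_on UNIV (\<lambda>t. W t \<omega>)) \<and>
     (\<forall>s t. s < t \<longrightarrow>
        distributed M lborel (\<lambda>\<omega>. W t \<omega> - W s \<omega>) (normal_density 0 (sqrt (t - s)))) \<and>
     (\<forall>\<tau> :: nat \<Rightarrow> real. \<forall>n. strict_mono \<tau> \<longrightarrow>
        prob_space.indep_vars M (\<lambda>_. borel)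
          (\<lambda>i \<omega>. W (\<tau> (Suc i)) \<omega> - W (\<tau> i) \<omega>) {..<n})"

text \<open>
  A triple \<open>(c, a, b)\<close> with \<open>a \<le> b\<close> encodes the function equal to \<open>c\<close> on \<open>(a, b]\<close> and to
  \<open>0\<close> elsewhere; a list of triples encodes the sum of these functions.
\<close>

type_synonym 'b steps = "('b \<times> real \<times> real) list"

definition step_fun :: "'b::real_vector steps \<Rightarrow> real \<Rightarrow> 'b" where
  "step_fun xs u = (\<Sum>(c, a, b)\<leftarrow>xs. indicator {a<..b} u *\<^sub>R c)"

definition step_integral :: "(real \<Rightarrow> 'a \<Rightarrow> real) \<Rightarrow> 'b::real_vector steps \<Rightarrow> 'a \<Rightarrow> 'b" where
  "step_integral W xs \<omega> = (\<Sum>(c, a, b)\<leftarrow>xs. (W b \<omega> - W a \<omega>) *\<^sub>R c)"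

text \<open>
  The random variable \<open>X\<close> is a version of the Wiener integral of \<open>f\<close> over \<open>S\<close>: it is the limit
  in \<open>L\<^sup>2\<close> of integrals of step functions that converge to \<open>f\<close> in \<open>L\<^sup>2\<close>. This determines \<open>X\<close> up
  to null sets. Square integrability of \<open>f\<close> on \<open>S\<close> and of \<open>X\<close> is implied, because the distances
  are nonnegative integrals.
\<close>

definition has_wiener_integral ::
  "'a measure \<Rightarrow> (real \<Rightarrow> 'a \<Rightarrow> real) \<Rightarrow> real set \<Rightarrow> (real \<Rightarrow> 'b::euclidean_space) \<Rightarrow> ('a \<Rightarrow> 'b) \<Rightarrow> bool"
where
  "has_wiener_integral M W S f X \<longleftrightarrow>
     set_borel_measurable lborel S f \<and>
     X \<in> borel_measurable M \<and>
     (\<exists>\<phi> :: nat \<Rightarrow> 'b steps.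
        (\<forall>n. \<forall>(c, a, b)\<in>set (\<phi> n). a \<le> b) \<and>
        (\<lambda>n. \<integral>\<^sup>+u. ennreal ((norm (step_fun (\<phi> n) u - indicator S u *\<^sub>R f u))\<^sup>2) \<partial>lborel)
           \<longlonglongrightarrow> 0 \<and>
        (\<lambda>n. \<integral>\<^sup>+\<omega>. ennreal ((norm (step_integral W (\<phi> n) \<omega> - X \<omega>))\<^sup>2) \<partial>M)
           \<longlonglongrightarrow> 0)"

text \<open>
  The function \<open>g\<close> is a version of the unitary Fourier transform of \<open>f \<in> L\<^sup>2\<close>, i.e. the limit
  in \<open>L\<^sup>2\<close> of the transforms of the truncations of \<open>f\<close> to \<open>[-n, n]\<close>, which are integrable.
\<close>

definition has_fourier_transform :: "(real \<Rightarrow> complex) \<Rightarrow> (real \<Rightarrow> complex) \<Rightarrow> bool" where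
  "has_fourier_transform f g \<longleftrightarrow>
     f \<in> borel_measurable lborel \<and>
     integrable lborel (\<lambda>x. (norm (f x))\<^sup>2) \<and>
     g \<in> borel_measurable lborel \<and>
     (\<lambda>n. \<integral>\<^sup>+u. ennreal ((norm
          ((1 / sqrt (2 * pi)) *\<^sub>R
             (CLINT x:{- real n..real n}|lborel. exp (- \<i> * of_real (u * x)) * f x)
           - g u))\<^sup>2) \<partial>lborel) \<longlonglongrightarrow> 0"

text \<open>The integral of \<open>f\<close> against the Fourier transform of the white noise of \<open>W\<close>.\<close>

definition has_spectral_integral ::
  "'a measure \<Rightarrow> (real \<Rightarrow> 'a \<Rightarrow> real) \<Rightarrow> (real \<Rightarrow> complex) \<Rightarrow> ('a \<Rightarrow> complex) \<Rightarrow> bool"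
where
  "has_spectral_integral M W f Z \<longleftrightarrow>
     (\<exists>g. has_fourier_transform f g \<and> has_wiener_integral M W UNIV g Z)"

datatype mbm_representation = Moving_Average | Harmonizable

fun is_mbm_value ::
  "mbm_representation \<Rightarrow> 'a measure \<Rightarrow> (real \<Rightarrow> 'a \<Rightarrow> real) \<Rightarrow> real \<Rightarrow> real \<Rightarrow> ('a \<Rightarrow> real) \<Rightarrow> bool"
where
  "is_mbm_value Moving_Average M W h t X \<longleftrightarrow>
     (\<exists>I J. has_wiener_integral M W {..0}
              (\<lambda>u. (t - u) powr (h - 1/2) - (- u) powr (h - 1/2)) I \<and>
            has_wiener_integral M W {0..t} (\<lambda>u. (t - u) powr (h - 1/2)) J \<and>
            (AE \<omega> in M. X \<omega> = 1 / Gamma (h + 1/2) * (I \<omega> + J \<omega>)))"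
| "is_mbm_value Harmonizable M W h t X \<longleftrightarrow>
     has_spectral_integral M W
       (\<lambda>\<xi>. (exp (\<i> * of_real (t * \<xi>)) - 1) / of_real (\<bar>\<xi>\<bar> powr (h + 1/2)))
       (\<lambda>\<omega>. complex_of_real (X \<omega>))"

text \<open>
  The representations determine each \<open>B t\<close> only almost surely. Joint measurability (which holds
  in particular for versions with continuous paths) makes the integrals of functions of \<open>B s\<close>
  with respect to \<open>s\<close> well defined up to null sets.
\<close>

definition multifractional_bm ::
  "mbm_representation \<Rightarrow> 'a measure \<Rightarrow> (real \<Rightarrow> 'a \<Rightarrow> real) \<Rightarrow> (real \<Rightarrow> real) \<Rightarrow> (real \<Rightarrow> 'a \<Rightarrow> real) \<Rightarrow> bool"
where
  "multifractional_bm r M W H B \<longleftrightarrow>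
     std_brownian_motion M W \<and>
     (\<lambda>(t, \<omega>). B t \<omega>) \<in> borel_measurable (restrict_space borel {0..} \<Otimes>\<^sub>M M) \<and>
     (\<forall>t\<ge>0. is_mbm_value r M W (H t) t (B t))"

abbreviation fractional_bm ::
  "mbm_representation \<Rightarrow> 'a measure \<Rightarrow> (real \<Rightarrow> 'a \<Rightarrow> real) \<Rightarrow> real \<Rightarrow> (real \<Rightarrow> 'a \<Rightarrow> real) \<Rightarrow> bool"
where
  "fractional_bm r M W h B \<equiv> multifractional_bm r M W (\<lambda>_. h) B"

definition occupation_measure :: "(real \<Rightarrow> real) \<Rightarrow> real set \<Rightarrow> real measure" where
  "occupation_measure b A = distr (restrict_space lborel A) borel b"

text \<open>
  Nonnegativity has to be required separately, because \<open>ennreal\<close> maps negative numbers to \<open>0\<close>.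
\<close>

definition continuous_local_time ::
  "'a measure \<Rightarrow> (real \<Rightarrow> 'a \<Rightarrow> real) \<Rightarrow> (real \<Rightarrow> real \<Rightarrow> 'a \<Rightarrow> real) \<Rightarrow> bool"
where
  "continuous_local_time M Y l \<longleftrightarrow>
     (\<forall>t\<ge>0. \<forall>x. l t x \<in> borel_measurable M) \<and>
     (AE \<omega> in M.
        continuous_on ({0..} \<times> UNIV) (\<lambda>(t, x). l t x \<omega>) \<and>
        (\<forall>t\<ge>0. (\<forall>x. 0 \<le> l t x \<omega>) \<and>
           occupation_measure (\<lambda>s. Y s \<omega>) {0..t} = density lborel (\<lambda>x. ennreal (l t x \<omega>))))"

text \<open>
  Convergence in law as \<open>\<rho> \<rightarrow> 0+\<close>, along every sequence of positive numbers tending to \<open>0\<close>. The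
  limit may live on another probability space.
\<close>

definition conv_in_law_at_right_0 ::
  "'a measure \<Rightarrow> (real \<Rightarrow> 'a \<Rightarrow> real) \<Rightarrow> 'b measure \<Rightarrow> ('b \<Rightarrow> real) \<Rightarrow> bool"
where
  "conv_in_law_at_right_0 M X N Y \<longleftrightarrow>
     (\<forall>r :: nat \<Rightarrow> real. (\<forall>n. 0 < r n) \<and> r \<longlonglongrightarrow> 0 \<longrightarrow>
        weak_conv_m (\<lambda>n. distr M borel (X (r n))) (distr N borel Y))"

end

theory Submission
  imports Defs
begin

text \<open>
  By self-similarity, the functional equals the average of \<open>t f ((X\<^sub>\<rho> - y) / \<delta>) / \<delta>\<close> over \<open>[0, t]\<close>, where
  \<open>X\<^sub>\<rho> s = (B (t\<^sub>0 + \<rho> s) - B t\<^sub>0) / \<rho> powr h\<close>, \<open>h = H t\<^sub>0\<close> and \<open>\<delta> = \<theta> \<rho> / \<rho> powr h\<close>. The covariances of the centred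
  Gaussian process \<open>X\<^sub>\<rho>\<close> converge to those of the fractional Brownian motion, because the kernel is Lipschitz
  in the Hurst parameter and \<open>h \<le> sup H < \<beta>\<close> makes the variation of \<open>H\<close> negligible. Moreover, the Gram determinant of
  \<open>X\<^sub>\<rho> s\<close> and \<open>X\<^sub>\<rho> u\<close> is at least \<open>(c (min s u \<bar>s - u\<bar>) powr \<nu>)\<^sup>2\<close>, uniformly in small \<open>\<rho>\<close>, so that the joint density is
  dominated by a function that is integrable in \<open>(s, u)\<close>. Hence, for integrable \<open>f\<close> and \<open>g\<close>, the mixed second
  moments of the functionals of \<open>f\<close> and \<open>g\<close>, at scales that tend to \<open>0\<close>, have the same limit up to the factor
  \<open>\<integral>f \<cdot> \<integral>g\<close>. Taking a Gaussian density for \<open>g\<close>, at a small scale \<open>\<epsilon>\<close> that does not depend on \<open>\<rho>\<close>, the functional of \<open>f\<close> is close in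
  \<open>L\<^sup>2\<close> to \<open>\<integral>f\<close> times a bounded smooth functional. The latter converges in law as \<open>\<rho> \<rightarrow> 0\<close>, by the method of moments, to
  the same functional of the fractional Brownian motion, which tends to the local time as \<open>\<epsilon> \<rightarrow> 0\<close>.
\<close>

section \<open>Wiener integrals\<close>

text \<open>Only two-point densities are under control, so for a merely integrable \<open>f\<close>
  only second moments of the functional are available; moments of all orders are taken of the
  smoothed functional alone, which is bounded and whose moments are integrals of finite-dimensional
  characteristic functions. The local time may live on another probability space than
  \<open>B\<close>, so the two are compared through characteristic functions, with the smoothing
  scale fixed before \<rho> tends to 0. The representations enter only through the \<open>L2\<close>
  geometry of deterministic kernels: linearity and the characteristic function of a single integral
  yield all finite-dimensional laws. As \<open>H\<close> varies, increments are not stationary; on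
  small intervals they are compared with those of the kernel whose Hurst parameter is frozen at the
  earlier time. The error is of order \<open>z powr \<beta>\<close>, against increments of order
  \<open>z powr a\<close> with \<open>a\<close> a value of \<open>H\<close>, so it is relatively
  small uniformly in the pair of times.\<close>

lemma (in pair_sigma_finite) integrable_fst_mult_snd:
  fixes f :: "'a \<Rightarrow> 'c::{real_normed_field, banach, second_countable_topology}"
  assumes f: "integrable M1 f" and g: "integrable M2 g"
  shows "integrable (M1 \<Otimes>\<^sub>M M2) (\<lambda>p. f (fst p) * g (snd p))"
    and "(\<integral>p. f (fst p) * g (snd p) \<partial>(M1 \<Otimes>\<^sub>M M2)) = (\<integral>x. f x \<partial>M1) * (\<integral>y. g y \<partial>M2)"
proof -
  have [measurable]: "f \<in> borel_measurable M1" "g \<in> borel_measurable M2" using f g by auto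
  have "(\<integral>\<^sup>+p. ennreal (norm (f (fst p) * g (snd p))) \<partial>(M1 \<Otimes>\<^sub>M M2))
      = (\<integral>\<^sup>+x. ennreal (norm (f x)) \<partial>M1) * (\<integral>\<^sup>+y. ennreal (norm (g y)) \<partial>M2)"
    by (subst M2.nn_integral_fst[symmetric])
      (auto simp: norm_mult ennreal_mult nn_integral_cmult nn_integral_multc)
  also have "\<dots> < \<infinity>" using f g by (auto simp: integrable_iff_bounded ennreal_mult_less_top)
  finally show i: "integrable (M1 \<Otimes>\<^sub>M M2) (\<lambda>p. f (fst p) * g (snd p))"
    by (simp add: integrable_iff_bounded)
  show "(\<integral>p. f (fst p) * g (snd p) \<partial>(M1 \<Otimes>\<^sub>M M2)) = (\<integral>x. f x \<partial>M1) * (\<integral>y. g y \<partial>M2)"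
    using integral_fst'[OF i] by simp
qed

section \<open>Square means and characteristic functions\<close>

lemma nn_integral_L2_lincomb_le:
  fixes p q :: "'s \<Rightarrow> 'b::euclidean_space"
  assumes [measurable]: "p \<in> borel_measurable N" "q \<in> borel_measurable N"
  shows "(\<integral>\<^sup>+u. ennreal ((norm (a *\<^sub>R p u + b *\<^sub>R q u))\<^sup>2) \<partial>N)
    \<le> ennreal (2 * a\<^sup>2) * (\<integral>\<^sup>+u. ennreal ((norm (p u))\<^sup>2) \<partial>N)
      + ennreal (2 * b\<^sup>2) * (\<integral>\<^sup>+u. ennreal ((norm (q u))\<^sup>2) \<partial>N)"
proof -
  have *: "(norm (a *\<^sub>R p u + b *\<^sub>R q u))\<^sup>2 \<le> 2 * a\<^sup>2 * (norm (p u))\<^sup>2 + 2 * b\<^sup>2 * (norm (q u))\<^sup>2" for u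
  proof -
    have "norm (a *\<^sub>R p u + b *\<^sub>R q u) \<le> \<bar>a\<bar> * norm (p u) + \<bar>b\<bar> * norm (q u)"
      by (metis norm_scaleR norm_triangle_ineq)
    then have "(norm (a *\<^sub>R p u + b *\<^sub>R q u))\<^sup>2 \<le> (\<bar>a\<bar> * norm (p u) + \<bar>b\<bar> * norm (q u))\<^sup>2"
      by (intro power_mono) auto
    also have "\<dots> \<le> 2 * (\<bar>a\<bar> * norm (p u))\<^sup>2 + 2 * (\<bar>b\<bar> * norm (q u))\<^sup>2"
      using sum_squares_ge_zero[of "\<bar>a\<bar> * norm (p u) - \<bar>b\<bar> * norm (q u)" 0]
      by (simp add: power2_eq_square algebra_simps)
    finally show ?thesis by (simp add: power_mult_distrib)
  qed
  have "(\<integral>\<^sup>+u. ennreal ((norm (a *\<^sub>R p u + b *\<^sub>R q u))\<^sup>2) \<partial>N)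
    \<le> (\<integral>\<^sup>+u. ennreal (2 * a\<^sup>2) * ennreal ((norm (p u))\<^sup>2) + ennreal (2 * b\<^sup>2) * ennreal ((norm (q u))\<^sup>2) \<partial>N)"
    using * by (intro nn_integral_mono) (simp flip: ennreal_mult ennreal_plus)
  also have "\<dots> = ennreal (2 * a\<^sup>2) * (\<integral>\<^sup>+u. ennreal ((norm (p u))\<^sup>2) \<partial>N)
      + ennreal (2 * b\<^sup>2) * (\<integral>\<^sup>+u. ennreal ((norm (q u))\<^sup>2) \<partial>N)"
    by (simp add: nn_integral_add nn_integral_cmult)
  finally show ?thesis .
qed

lemma tendsto_L2_lincomb:
  fixes p q :: "nat \<Rightarrow> 's \<Rightarrow> 'b::euclidean_space"
  assumes [measurable]: "\<And>n. p n \<in> borel_measurable N" "\<And>n. q n \<in> borel_measurable N"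
    and p: "(\<lambda>n. \<integral>\<^sup>+u. ennreal ((norm (p n u))\<^sup>2) \<partial>N) \<longlonglongrightarrow> 0"
    and q: "(\<lambda>n. \<integral>\<^sup>+u. ennreal ((norm (q n u))\<^sup>2) \<partial>N) \<longlonglongrightarrow> 0"
  shows "(\<lambda>n. \<integral>\<^sup>+u. ennreal ((norm (a *\<^sub>R p n u + b *\<^sub>R q n u))\<^sup>2) \<partial>N) \<longlonglongrightarrow> 0"
proof (rule tendsto_sandwich[OF _ _ tendsto_const])
  show "(\<lambda>n. ennreal (2 * a\<^sup>2) * (\<integral>\<^sup>+u. ennreal ((norm (p n u))\<^sup>2) \<partial>N)
      + ennreal (2 * b\<^sup>2) * (\<integral>\<^sup>+u. ennreal ((norm (q n u))\<^sup>2) \<partial>N)) \<longlonglongrightarrow> 0"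
    using tendsto_add[OF ennreal_tendsto_cmult[OF _ p, of "ennreal (2 * a\<^sup>2)"]
        ennreal_tendsto_cmult[OF _ q, of "ennreal (2 * b\<^sup>2)"]] by simp
qed (auto intro!: always_eventually nn_integral_L2_lincomb_le)

lemma integrable_norm_power2_iff:
  fixes f :: "'s \<Rightarrow> 'b::euclidean_space"
  assumes [measurable]: "f \<in> borel_measurable N"
  shows "integrable N (\<lambda>u. (norm (f u))\<^sup>2) \<longleftrightarrow> (\<integral>\<^sup>+u. ennreal ((norm (f u))\<^sup>2) \<partial>N) < \<infinity>"
  by (simp add: integrable_iff_bounded)

lemma integrable_L2_lincomb:
  fixes p q :: "'s \<Rightarrow> 'b::euclidean_space"
  assumes [measurable]: "p \<in> borel_measurable N" "q \<in> borel_measurable N"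
    and p: "integrable N (\<lambda>u. (norm (p u))\<^sup>2)" and q: "integrable N (\<lambda>u. (norm (q u))\<^sup>2)"
  shows "integrable N (\<lambda>u. (norm (a *\<^sub>R p u + b *\<^sub>R q u))\<^sup>2)"
proof -
  have "(\<integral>\<^sup>+u. ennreal ((norm (p u))\<^sup>2) \<partial>N) < \<infinity>" "(\<integral>\<^sup>+u. ennreal ((norm (q u))\<^sup>2) \<partial>N) < \<infinity>"
    using p q by (auto simp: integrable_norm_power2_iff)
  then have "ennreal (2 * a\<^sup>2) * (\<integral>\<^sup>+u. ennreal ((norm (p u))\<^sup>2) \<partial>N)
      + ennreal (2 * b\<^sup>2) * (\<integral>\<^sup>+u. ennreal ((norm (q u))\<^sup>2) \<partial>N) < \<infinity>"
    by (auto simp: ennreal_mult_less_top)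
  then show ?thesis
    by (subst integrable_norm_power2_iff) (auto intro: le_less_trans[OF nn_integral_L2_lincomb_le])
qed

text \<open>Young's inequality with a free weight: the term in \<open>b\<close> does not tend to 0
  in the application, so it carries the factor \<eta>, which is chosen small, while the large factor
  falls on the difference.\<close>

lemma norm_power2_diff_le:
  fixes a b :: "'b::real_normed_vector"
  assumes "0 < \<eta>"
  shows "\<bar>(norm a)\<^sup>2 - (norm b)\<^sup>2\<bar> \<le> (1 + 1 / \<eta>) * (norm (a - b))\<^sup>2 + \<eta> * (norm b)\<^sup>2"
proof -
  define x y d where "x = norm a" and "y = norm b" and "d = norm (a - b)"
  have xy: "\<bar>x - y\<bar> \<le> d" "0 \<le> y" "0 \<le> d" "0 \<le> x"
    unfolding x_def y_def d_def by (auto intro: norm_triangle_ineq3)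
  have "\<bar>x\<^sup>2 - y\<^sup>2\<bar> = \<bar>x - y\<bar> * (x + y)"
    using xy by (simp add: power2_eq_square square_diff_square_factored abs_mult)
  also have "\<dots> \<le> d * (d + 2 * y)" using xy by (intro mult_mono) auto
  also have "\<dots> \<le> (1 + 1 / \<eta>) * d\<^sup>2 + \<eta> * y\<^sup>2"
  proof -
    \<comment> \<open>Expanding this square gives
      \<open>2 * d * y \<le> d\<^sup>2 / \<eta> + \<eta> * y\<^sup>2\<close>.\<close>
    have "0 \<le> (d / \<eta> - y)\<^sup>2 * \<eta>" using assms by simp
    also have "\<dots> = d\<^sup>2 / \<eta> - 2 * d * y + \<eta> * y\<^sup>2"
      using assms by (simp add: power2_eq_square field_simps)
    finally show ?thesis by (simp add: algebra_simps power2_eq_square)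
  qed
  finally show ?thesis by (simp add: x_def y_def d_def)
qed

text \<open>The comparison functions \<open>f n\<close> may vary with \<open>n\<close> as long as
  their squared norm stays equal to \<open>I\<close>. This covers rescaled fractional increments,
  which need not converge in \<open>L2\<close> but have a constant norm by self-similarity.\<close>

lemma integral_norm_power2_tendsto:
  fixes \<phi> f :: "nat \<Rightarrow> 's \<Rightarrow> 'b::euclidean_space"
  assumes meas: "\<And>n. \<phi> n \<in> borel_measurable N" "\<And>n. f n \<in> borel_measurable N"
    and sq: "\<And>n. integrable N (\<lambda>u. (norm (\<phi> n u))\<^sup>2)" "\<And>n. integrable N (\<lambda>u. (norm (f n u))\<^sup>2)"
    and I: "\<And>n. (\<integral>u. (norm (f n u))\<^sup>2 \<partial>N) = I"
    and lim: "(\<lambda>n. \<integral>u. (norm (\<phi> n u - f n u))\<^sup>2 \<partial>N) \<longlonglongrightarrow> 0"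
  shows "(\<lambda>n. \<integral>u. (norm (\<phi> n u))\<^sup>2 \<partial>N) \<longlonglongrightarrow> I"
proof (rule tendstoI)
  fix r :: real assume "r > 0"
  define e where "e n = (\<integral>u. (norm (\<phi> n u - f n u))\<^sup>2 \<partial>N)" for n
  have int: "integrable N (\<lambda>u. (norm (\<phi> n u - f n u))\<^sup>2)" for n
    using integrable_L2_lincomb[OF meas(1)[of n] meas(2)[of n] sq(1)[of n] sq(2)[of n], of 1 "-1"] by simp
  have "I \<ge> 0" using I[of 0, symmetric] by simp
  \<comment> \<open>The choice gives \<open>\<eta> * I < r / 2\<close>; the \<open>+ 1\<close>
    covers \<open>I = 0\<close>. The remaining term is eventually below
    \<open>r / 4\<close>.\<close>
  define \<eta> where "\<eta> = r / (2 * (I + 1))"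
  have \<eta>: "\<eta> > 0" "\<eta> * I < r / 2 + r / 2 / 2"
    using \<open>r > 0\<close> \<open>I \<ge> 0\<close> mult_nonneg_nonneg[of I r] by (auto simp: \<eta>_def field_simps add_pos_nonneg)
  have bd: "\<bar>(\<integral>u. (norm (\<phi> n u))\<^sup>2 \<partial>N) - I\<bar> \<le> (1 + 1 / \<eta>) * e n + \<eta> * I" for n
  proof -
    have "\<bar>(\<integral>u. (norm (\<phi> n u))\<^sup>2 \<partial>N) - I\<bar> = \<bar>\<integral>u. (norm (\<phi> n u))\<^sup>2 - (norm (f n u))\<^sup>2 \<partial>N\<bar>"
      using sq I by simp
    also have "\<dots> \<le> (\<integral>u. \<bar>(norm (\<phi> n u))\<^sup>2 - (norm (f n u))\<^sup>2\<bar> \<partial>N)" by (rule integral_abs_bound)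
    also have "\<dots> \<le> (\<integral>u. (1 + 1 / \<eta>) * (norm (\<phi> n u - f n u))\<^sup>2 + \<eta> * (norm (f n u))\<^sup>2 \<partial>N)"
      using sq int norm_power2_diff_le[OF \<eta>(1)] by (intro integral_mono) auto
    also have "\<dots> = (1 + 1 / \<eta>) * e n + \<eta> * I"
      using sq int I by (simp add: e_def)
    finally show ?thesis .
  qed
  have "(\<lambda>n. (1 + 1 / \<eta>) * e n) \<longlonglongrightarrow> (1 + 1 / \<eta>) * 0"
    unfolding e_def by (intro tendsto_intros lim)
  then have "\<forall>\<^sub>F n in sequentially. (1 + 1 / \<eta>) * e n < r / 4"
    using \<open>r > 0\<close> by (intro order_tendstoD) auto
  then show "\<forall>\<^sub>F n in sequentially. dist (\<integral>u. (norm (\<phi> n u))\<^sup>2 \<partial>N) I < r"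
  proof eventually_elim
    case (elim n)
    then show ?case using bd[of n] \<eta>(2) unfolding dist_real_def by linarith
  qed
qed

text \<open>Square integrability of the limit is part of the conclusion: once the distance to some
  \<open>\<phi> n0\<close> is finite, \<open>f\<close> is a difference of two square-integrable
  functions.\<close>

lemma L2_norm_tendsto:
  fixes \<phi> :: "nat \<Rightarrow> 's \<Rightarrow> 'b::euclidean_space"
  assumes [measurable]: "\<And>n. \<phi> n \<in> borel_measurable N" "f \<in> borel_measurable N"
    and sq: "\<And>n. integrable N (\<lambda>u. (norm (\<phi> n u))\<^sup>2)"
    and lim: "(\<lambda>n. \<integral>\<^sup>+u. ennreal ((norm (\<phi> n u - f u))\<^sup>2) \<partial>N) \<longlonglongrightarrow> 0"
  shows "integrable N (\<lambda>u. (norm (f u))\<^sup>2)"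
    and "(\<lambda>n. \<integral>u. (norm (\<phi> n u))\<^sup>2 \<partial>N) \<longlonglongrightarrow> (\<integral>u. (norm (f u))\<^sup>2 \<partial>N)"
proof -
  have "\<forall>\<^sub>F n in sequentially. (\<integral>\<^sup>+u. ennreal ((norm (\<phi> n u - f u))\<^sup>2) \<partial>N) < 1"
    using lim by (rule order_tendstoD) simp
  then obtain n0 where n0: "(\<integral>\<^sup>+u. ennreal ((norm (\<phi> n u - f u))\<^sup>2) \<partial>N) < 1" if "n \<ge> n0" for n
    by (auto simp: eventually_sequentially)
  have "integrable N (\<lambda>u. (norm (\<phi> n0 u - f u))\<^sup>2)"
    using n0[of n0] by (subst integrable_norm_power2_iff) (auto intro: less_trans[OF _ ennreal_one_less_top])
  then have "integrable N (\<lambda>u. (norm (1 *\<^sub>R \<phi> n0 u + (-1) *\<^sub>R (\<phi> n0 u - f u)))\<^sup>2)"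
    by (intro integrable_L2_lincomb sq) auto
  then show f: "integrable N (\<lambda>u. (norm (f u))\<^sup>2)" by simp
  have int: "integrable N (\<lambda>u. (norm (\<phi> n u - f u))\<^sup>2)" for n
    using integrable_L2_lincomb[OF _ _ sq f, of n 1 "-1"] by simp
  have "(\<lambda>n. ennreal (\<integral>u. (norm (\<phi> n u - f u))\<^sup>2 \<partial>N)) \<longlonglongrightarrow> ennreal 0"
    using lim by (simp add: nn_integral_eq_integral[OF int])
  then have "(\<lambda>n. \<integral>u. (norm (\<phi> n u - f u))\<^sup>2 \<partial>N) \<longlonglongrightarrow> 0"
    by (subst (asm) tendsto_ennreal_iff) auto
  then show "(\<lambda>n. \<integral>u. (norm (\<phi> n u))\<^sup>2 \<partial>N) \<longlonglongrightarrow> (\<integral>u. (norm (f u))\<^sup>2 \<partial>N)"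
    by (rule integral_norm_power2_tendsto[where f = "\<lambda>_. f", OF assms(1) assms(2) sq f refl])
qed

lemma (in prob_space) abs_expectation_le_L2:
  fixes d :: "'a \<Rightarrow> real"
  assumes [measurable]: "d \<in> borel_measurable M" and sq: "integrable M (\<lambda>w. (d w)\<^sup>2)"
  shows "integrable M d" and "expectation (\<lambda>w. \<bar>d w\<bar>) \<le> sqrt (expectation (\<lambda>w. (d w)\<^sup>2))"
proof -
  have "integrable M (\<lambda>w. 1 + (d w)\<^sup>2)" using sq by simp
  then have i: "integrable M (\<lambda>w. \<bar>d w\<bar>)"
  proof (rule Bochner_Integration.integrable_bound, safe intro!: AE_I2)
    fix w
    have "0 \<le> (\<bar>d w\<bar> - 1)\<^sup>2 + (d w)\<^sup>2 + 1" by simp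
    then show "norm \<bar>d w\<bar> \<le> norm (1 + (d w)\<^sup>2)" by (simp add: power2_diff)
  qed simp
  then show "integrable M d" by (rule integrable_abs_cancel) simp
  have "0 \<le> variance (\<lambda>w. \<bar>d w\<bar>)" by (rule variance_positive)
  also have "\<dots> = expectation (\<lambda>w. (d w)\<^sup>2) - (expectation (\<lambda>w. \<bar>d w\<bar>))\<^sup>2"
    using i sq by (subst variance_eq) auto
  finally show "expectation (\<lambda>w. \<bar>d w\<bar>) \<le> sqrt (expectation (\<lambda>w. (d w)\<^sup>2))"
    by (intro real_le_rsqrt) simp
qed

lemma norm_iexp_diff_le: "norm (iexp a - iexp b) \<le> \<bar>a - b\<bar>"
proof -
  have "iexp a - iexp b = iexp b * (iexp (a - b) - 1)"
    by (simp add: algebra_simps flip: exp_add)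
  then have "norm (iexp a - iexp b) = norm (iexp (a - b) - 1)" by (simp add: norm_mult)
  also have "\<dots> \<le> \<bar>a - b\<bar>" using iexp_approx1[of "a - b" 0] by simp
  finally show ?thesis .
qed

lemma (in prob_space) integrable_iexp_rv:
  assumes [measurable]: "X \<in> borel_measurable M"
  shows "integrable M (\<lambda>w. iexp (X w))"
  by (rule integrable_const_bound[where B = 1]) auto

text \<open>This continuity of characteristic functions in \<open>L2\<close> is what carries
  \<open>L2\<close> approximations over to laws, both for Wiener integrals and for the local
  functionals.\<close>

lemma (in prob_space) norm_iexp_expectation_diff_le:
  fixes X Y :: "'a \<Rightarrow> real"
  assumes [measurable]: "X \<in> borel_measurable M" "Y \<in> borel_measurable M"
    and sq: "integrable M (\<lambda>w. (X w - Y w)\<^sup>2)"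
  shows "norm ((CLINT w|M. iexp (X w)) - (CLINT w|M. iexp (Y w))) \<le> sqrt (expectation (\<lambda>w. (X w - Y w)\<^sup>2))"
proof -
  have "norm ((CLINT w|M. iexp (X w)) - (CLINT w|M. iexp (Y w))) = norm (CLINT w|M. iexp (X w) - iexp (Y w))"
    by (subst Bochner_Integration.integral_diff) (auto intro!: integrable_iexp_rv)
  also have "\<dots> \<le> expectation (\<lambda>w. norm (iexp (X w) - iexp (Y w)))" by (rule integral_norm_bound)
  also have "\<dots> \<le> expectation (\<lambda>w. \<bar>X w - Y w\<bar>)"
    using abs_expectation_le_L2(1)[OF _ sq]
    by (intro integral_mono integrable_norm Bochner_Integration.integrable_diff integrable_iexp_rv norm_iexp_diff_le) auto
  also have "\<dots> \<le> sqrt (expectation (\<lambda>w. (X w - Y w)\<^sup>2))"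
    by (rule abs_expectation_le_L2(2)[OF _ sq]) auto
  finally show ?thesis .
qed

section \<open>Characteristic functions of Wiener integrals\<close>

lemma normal_iexp_expectation:
  assumes "prob_space M" and X: "distributed M lborel X (normal_density 0 s)" and "0 < s"
  shows "(CLINT w|M. iexp (c * X w)) = of_real (exp (- (c\<^sup>2 * s\<^sup>2) / 2))"
proof -
  interpret prob_space M by fact
  have "distributed M lborel (\<lambda>w. (X w - 0) / s) std_normal_density"
    using X \<open>0 < s\<close> by (subst normal_standard_normal_convert[symmetric]) auto
  then have D: "distr M lborel (\<lambda>w. X w / s) = std_normal_distribution"
    by (simp add: distributed_def)
  have [measurable]: "X \<in> borel_measurable M" using distributed_measurable[OF X] by simp
  have "(CLINT w|M. iexp (c * X w)) = (CLINT x|distr M lborel (\<lambda>w. X w / s). iexp ((c * s) * x))"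
    using \<open>0 < s\<close> by (subst integral_distr) auto
  also have "\<dots> = char std_normal_distribution (c * s)" by (simp add: D char_def)
  finally show ?thesis by (simp add: char_std_normal_distribution power_mult_distrib)
qed

text \<open>Independence over the grid turns the characteristic function into a product of Gaussian
  factors. The grid is an infinite sequence, as in the definition of Brownian motion, and only its
  first \<open>m\<close> steps enter.\<close>

lemma brownian_grid_iexp:
  assumes BM: "std_brownian_motion M W" and \<tau>: "strict_mono \<tau>"
  shows "(CLINT w|M. iexp (\<Sum>i<m. c i * (W (\<tau> (Suc i)) w - W (\<tau> i) w)))
    = of_real (exp (- (\<Sum>i<m. (c i)\<^sup>2 * (\<tau> (Suc i) - \<tau> i)) / 2))"
proof -
  interpret prob_space M using BM by (simp add: std_brownian_motion_def)
  define D where "D i w = W (\<tau> (Suc i)) w - W (\<tau> i) w" for i w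
  have [measurable]: "W t \<in> borel_measurable M" for t using BM by (simp add: std_brownian_motion_def)
  have [measurable]: "D i \<in> borel_measurable M" for i by (simp add: D_def[abs_def])
  have ind: "indep_vars (\<lambda>_. borel) D {..<m}"
    using BM \<tau> by (simp add: std_brownian_motion_def D_def[abs_def])
  have "indep_vars (\<lambda>_. borel) (\<lambda>i w. iexp (c i * D i w)) {..<m}"
    by (rule indep_vars_compose2[OF ind]) auto
  then have "(CLINT w|M. (\<Prod>i<m. iexp (c i * D i w))) = (\<Prod>i<m. CLINT w|M. iexp (c i * D i w))"
    by (intro indep_vars_lebesgue_integral integrable_iexp_rv) measurable
  also have "\<dots> = (\<Prod>i<m. of_real (exp (- ((c i)\<^sup>2 * (\<tau> (Suc i) - \<tau> i)) / 2)))"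
  proof (rule prod.cong)
    fix i
    have lt: "\<tau> i < \<tau> (Suc i)" using \<tau> by (simp add: strict_mono_def)
    then have "distributed M lborel (D i) (normal_density 0 (sqrt (\<tau> (Suc i) - \<tau> i)))"
      using BM by (simp add: std_brownian_motion_def D_def[abs_def])
    from normal_iexp_expectation[OF prob_space_axioms this] lt
    show "(CLINT w|M. iexp (c i * D i w)) = of_real (exp (- ((c i)\<^sup>2 * (\<tau> (Suc i) - \<tau> i)) / 2))"
      by simp
  qed simp
  also have "\<dots> = of_real (exp (- (\<Sum>i<m. (c i)\<^sup>2 * (\<tau> (Suc i) - \<tau> i)) / 2))"
    by (simp add: sum_negf sum_divide_distrib flip: of_real_prod exp_sum)
  also have "(CLINT w|M. (\<Prod>i<m. iexp (c i * D i w))) = (CLINT w|M. iexp (\<Sum>i<m. c i * (W (\<tau> (Suc i)) w - W (\<tau> i) w)))"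
    by (simp add: D_def exp_sum sum_distrib_left)
  finally show ?thesis .
qed

text \<open>Independence of increments is stated along infinite strictly increasing sequences, so
  the finitely many endpoints of a step function are enumerated in order and continued by unit steps
  beyond the largest one.\<close>

lemma finite_subset_strict_mono_range:
  fixes E :: "real set"
  assumes "finite E"
  shows "\<exists>\<tau> m. strict_mono \<tau> \<and> E = \<tau> ` {..<m::nat}"
  using assms
proof (induction rule: finite_linorder_max_induct)
  case empty
  have "strict_mono real" by (simp add: strict_mono_def)
  then show ?case by (intro exI[of _ real] exI[of _ 0]) simp
next
  case (insert b A)
  then obtain \<tau> m where \<tau>: "strict_mono \<tau>" "A = \<tau> ` {..<m::nat}" by auto
  define \<sigma> where "\<sigma> i = (if i < m then \<tau> i else b + real (i - m))" for i
  have "strict_mono \<sigma>"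
  proof (rule strict_monoI)
    fix i j :: nat assume "i < j"
    show "\<sigma> i < \<sigma> j"
    proof (cases "i < m")
      case True
      then have "\<tau> i < b" using insert \<tau> by auto
      with True \<open>i < j\<close> \<tau>(1) show ?thesis by (auto simp: \<sigma>_def strict_mono_def)
    qed (use \<open>i < j\<close> in \<open>auto simp: \<sigma>_def\<close>)
  qed
  moreover have "insert b A = \<sigma> ` {..<Suc m}"
    by (auto simp: lessThan_Suc \<sigma>_def \<tau>(2))
  ultimately show ?case by blast
qed

text \<open>The coefficients \<open>d\<close> are chosen before \<open>V\<close>, so that one choice
  serves a Brownian path and an indicator at once: the step function and its integral receive the
  same coefficients on the same grid.\<close>

lemma step_sum_grid:
  fixes xs :: "real steps"
  assumes \<tau>: "strict_mono \<tau>" and E: "\<forall>(c, a, b)\<in>set xs. a \<le> b \<and> a \<in> \<tau> ` {..<m} \<and> b \<in> \<tau> ` {..<m}"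
  shows "\<exists>d. \<forall>V :: real \<Rightarrow> real. (\<Sum>(c, a, b)\<leftarrow>xs. (V b - V a) * c) = (\<Sum>i<m. d i * (V (\<tau> (Suc i)) - V (\<tau> i)))"
  using E
proof (induction xs)
  case Nil
  show ?case by (intro exI[of _ "\<lambda>_. 0"]) simp
next
  case (Cons x xs)
  obtain c a b where x: "x = (c, a, b)" by (cases x)
  from Cons obtain d where d: "\<forall>V :: real \<Rightarrow> real. (\<Sum>(c, a, b)\<leftarrow>xs. (V b - V a) * c) = (\<Sum>i<m. d i * (V (\<tau> (Suc i)) - V (\<tau> i)))"
    by auto
  from Cons.prems x obtain p q where pq: "a = \<tau> p" "b = \<tau> q" "p < m" "q < m" "\<tau> p \<le> \<tau> q" by auto
  have "p \<le> q" using \<tau> pq(5) by (simp add: strict_mono_less_eq)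
  have *: "V b - V a = (\<Sum>i<m. (if p \<le> i \<and> i < q then 1 else 0) * (V (\<tau> (Suc i)) - V (\<tau> i)))"
    for V :: "real \<Rightarrow> real"
  proof -
    have "(\<Sum>i<m. (if p \<le> i \<and> i < q then 1 else 0) * (V (\<tau> (Suc i)) - V (\<tau> i)))
        = (\<Sum>i\<in>{p..<q}. V (\<tau> (Suc i)) - V (\<tau> i))"
      using pq by (intro sum.mono_neutral_cong_right) auto
    also have "\<dots> = V b - V a" using \<open>p \<le> q\<close> pq sum_Suc_diff'[of p q "\<lambda>i. V (\<tau> i)"] by simp
    finally show ?thesis by simp
  qed
  have "(\<Sum>(c, a, b)\<leftarrow>x # xs. (V b - V a) * c)
      = (\<Sum>i<m. (d i + c * (if p \<le> i \<and> i < q then 1 else 0)) * (V (\<tau> (Suc i)) - V (\<tau> i)))"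
    for V :: "real \<Rightarrow> real"
  proof -
    have "(\<Sum>(c, a, b)\<leftarrow>x # xs. (V b - V a) * c) = c * (V b - V a) + (\<Sum>(c, a, b)\<leftarrow>xs. (V b - V a) * c)"
      by (simp add: x)
    also have "\<dots> = (\<Sum>i<m. c * ((if p \<le> i \<and> i < q then 1 else 0) * (V (\<tau> (Suc i)) - V (\<tau> i))))
       + (\<Sum>i<m. d i * (V (\<tau> (Suc i)) - V (\<tau> i)))" using d *[of V] by (simp add: sum_distrib_left)
    also have "\<dots> = (\<Sum>i<m. (d i + c * (if p \<le> i \<and> i < q then 1 else 0)) * (V (\<tau> (Suc i)) - V (\<tau> i)))"
      unfolding sum.distrib[symmetric] by (rule sum.cong[OF refl]) (simp add: algebra_simps)
    finally show ?thesis .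
  qed
  then show ?case by (intro exI allI)
qed

text \<open>The triples may overlap, but on a common grid the intervals are disjoint. The square of
  the step function then has the coefficients \<open>(d i)\<^sup>2\<close>, which are also the
  weights of the interval lengths in the Gaussian exponent.\<close>

lemma step_integral_iexp:
  fixes xs :: "real steps"
  assumes BM: "std_brownian_motion M W" and xs: "\<forall>(c, a, b)\<in>set xs. a \<le> b"
  shows "integrable lborel (\<lambda>u. (step_fun xs u)\<^sup>2)"
    and "(CLINT w|M. iexp (step_integral W xs w)) = of_real (exp (- (\<integral>u. (step_fun xs u)\<^sup>2 \<partial>lborel) / 2))"
proof -
  define E where "E = (\<Union>(c, a, b)\<in>set xs. {a, b})"
  have "finite E" by (auto simp: E_def)
  from finite_subset_strict_mono_range[OF this] obtain \<tau> m where \<tau>: "strict_mono \<tau>" "E = \<tau> ` {..<m::nat}"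
    by auto
  have "\<forall>(c, a, b)\<in>set xs. a \<le> b \<and> a \<in> \<tau> ` {..<m} \<and> b \<in> \<tau> ` {..<m}"
    using xs unfolding \<tau>(2)[symmetric] by (fastforce simp: E_def)
  from step_sum_grid[OF \<tau>(1) this] obtain d where
    d: "\<And>V :: real \<Rightarrow> real. (\<Sum>(c, a, b)\<leftarrow>xs. (V b - V a) * c) = (\<Sum>i<m. d i * (V (\<tau> (Suc i)) - V (\<tau> i)))"
    by blast
  define J where "J i = {\<tau> i<..\<tau> (Suc i)}" for i
  have [simp]: "\<tau> i \<le> \<tau> (Suc i)" for i using \<tau>(1) by (simp add: strict_mono_less_eq)
  have int: "step_integral W xs w = (\<Sum>i<m. d i * (W (\<tau> (Suc i)) w - W (\<tau> i) w))" for w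
    using d[of "\<lambda>t. W t w"] by (simp add: step_integral_def)
  \<comment> \<open>As a function of the endpoints, the indicator of \<open>{a<..b}\<close> at
    \<open>u\<close> is the increment of \<open>V = indicator {u..}\<close>; this is the second use
    of \<open>d\<close>.\<close>
  have ind: "indicator {a<..b} u = indicator {u..} b - (indicator {u..} a :: real)" if "a \<le> b" for a b u :: real
    using that by (auto simp: indicator_def)
  have fn: "step_fun xs u = (\<Sum>i<m. d i * indicator (J i) u)" for u
  proof -
    have "step_fun xs u = (\<Sum>(c, a, b)\<leftarrow>xs. (indicator {u..} b - indicator {u..} a) * c)"
      unfolding step_fun_def using xs
      by (intro arg_cong[where f = sum_list] map_cong) (auto simp: ind)
    also have "\<dots> = (\<Sum>i<m. d i * indicator (J i) u)"
      by (simp add: d J_def ind)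
    finally show ?thesis .
  qed
  have disj: "indicator (J i) u * indicator (J j) u = (if i = j then indicator (J i) u else (0::real))" for i j u
  proof (cases "i = j")
    case False
    have "\<tau> (Suc (min i j)) \<le> \<tau> (max i j)" using False \<tau>(1) by (simp add: strict_mono_less_eq)
    then have "J (min i j) \<inter> J (max i j) = {}" by (auto simp: J_def)
    then have "J i \<inter> J j = {}" by (auto simp: min_def max_def split: if_splits)
    then show ?thesis using False by (auto simp: indicator_def)
  qed (auto simp: indicator_def)
  have sq: "(step_fun xs u)\<^sup>2 = (\<Sum>i<m. (d i)\<^sup>2 * indicator (J i) u)" for u
  proof -
    have "(step_fun xs u)\<^sup>2 = (\<Sum>i<m. \<Sum>j<m. d i * d j * (indicator (J i) u * indicator (J j) u))"
      unfolding fn power2_eq_square sum_product by (intro sum.cong refl) (simp only: mult_ac)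
    also have "\<dots> = (\<Sum>i<m. (d i)\<^sup>2 * indicator (J i) u)"
      unfolding disj by (simp add: if_distrib[of "\<lambda>x. _ * x"] power2_eq_square cong: if_cong)
    finally show ?thesis .
  qed
  have i: "integrable lborel (\<lambda>u. (d i)\<^sup>2 * indicator (J i) u)" for i
    by (intro integrable_mult_right integrable_real_indicator) (auto simp: J_def)
  show "integrable lborel (\<lambda>u. (step_fun xs u)\<^sup>2)" unfolding sq by (intro Bochner_Integration.integrable_sum i)
  have "(\<integral>u. (step_fun xs u)\<^sup>2 \<partial>lborel) = (\<Sum>i<m. (d i)\<^sup>2 * (\<tau> (Suc i) - \<tau> i))"
    unfolding sq by (subst Bochner_Integration.integral_sum[OF i]) (simp add: J_def)
  then show "(CLINT w|M. iexp (step_integral W xs w)) = of_real (exp (- (\<integral>u. (step_fun xs u)\<^sup>2 \<partial>lborel) / 2))"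
    unfolding int by (simp only: brownian_grid_iexp[OF BM \<tau>(1)])
qed

lemma borel_measurable_step_fun [measurable]:
  fixes xs :: "'b::euclidean_space steps"
  shows "step_fun xs \<in> borel_measurable borel"
proof -
  have "(\<lambda>u. step_fun xs u) \<in> borel_measurable borel"
  proof (induction xs)
    case (Cons x xs)
    obtain c a b where "x = (c, a, b)" by (cases x)
    then have "step_fun (x # xs) = (\<lambda>u. indicator {a<..b} u *\<^sub>R c + step_fun xs u)"
      by (auto simp: step_fun_def)
    with Cons show ?case by simp
  qed (simp add: step_fun_def)
  then show ?thesis .
qed

lemma borel_measurable_step_integral [measurable (raw)]:
  fixes xs :: "'b::euclidean_space steps"
  assumes [measurable]: "\<And>t. W t \<in> borel_measurable M"
  shows "step_integral W xs \<in> borel_measurable M"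
proof -
  have "(\<lambda>w. step_integral W xs w) \<in> borel_measurable M"
  proof (induction xs)
    case (Cons x xs)
    obtain c a b where "x = (c, a, b)" by (cases x)
    then have "step_integral W (x # xs) = (\<lambda>w. (W b w - W a w) *\<^sub>R c + step_integral W xs w)"
      by (auto simp: step_integral_def)
    with Cons show ?case by simp
  qed (simp add: step_integral_def)
  then show ?thesis .
qed

text \<open>Both sides are continuous in \<open>L2\<close>, so the identity passes from step
  functions to the limit. Applied to linear combinations, it gives Gaussianity, centring and
  covariances at once.\<close>

lemma has_wiener_integral_iexp:
  fixes f :: "real \<Rightarrow> real"
  assumes BM: "std_brownian_motion M W" and I: "has_wiener_integral M W UNIV f X"
  shows "integrable lborel (\<lambda>u. (f u)\<^sup>2)"
    and "(CLINT w|M. iexp (X w)) = of_real (exp (- (\<integral>u. (f u)\<^sup>2 \<partial>lborel) / 2))"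
proof -
  interpret prob_space M using BM by (simp add: std_brownian_motion_def)
  have [measurable]: "W t \<in> borel_measurable M" for t using BM by (simp add: std_brownian_motion_def)
  from I have [measurable]: "f \<in> borel_measurable borel" "X \<in> borel_measurable M"
    by (auto simp: has_wiener_integral_def set_borel_measurable_def)
  from I obtain \<phi> where le: "\<And>n. \<forall>(c, a, b)\<in>set (\<phi> n). a \<le> b"
    and f: "(\<lambda>n. \<integral>\<^sup>+u. ennreal ((norm (step_fun (\<phi> n) u - f u))\<^sup>2) \<partial>lborel) \<longlonglongrightarrow> 0"
    and X: "(\<lambda>n. \<integral>\<^sup>+w. ennreal ((norm (step_integral W (\<phi> n) w - X w))\<^sup>2) \<partial>M) \<longlonglongrightarrow> 0"
    by (auto simp: has_wiener_integral_def)
  have sq: "integrable lborel (\<lambda>u. (norm (step_fun (\<phi> n) u))\<^sup>2)" for n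
    using step_integral_iexp(1)[OF BM le] by simp
  note L2 = L2_norm_tendsto[OF _ _ sq f]
  show "integrable lborel (\<lambda>u. (f u)\<^sup>2)" using L2(1) by simp
  have "(\<lambda>n. of_real (exp (- (\<integral>u. (step_fun (\<phi> n) u)\<^sup>2 \<partial>lborel) / 2)) :: complex)
      \<longlonglongrightarrow> of_real (exp (- (\<integral>u. (f u)\<^sup>2 \<partial>lborel) / 2))"
    using L2(2) by (intro tendsto_intros) auto
  then have l1: "(\<lambda>n. CLINT w|M. iexp (step_integral W (\<phi> n) w)) \<longlonglongrightarrow> of_real (exp (- (\<integral>u. (f u)\<^sup>2 \<partial>lborel) / 2))"
    by (simp add: step_integral_iexp(2)[OF BM le])
  \<comment> \<open>The distances are known to be finite only from some index on, so the passage to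
    Bochner integrals is made for large \<open>n\<close>.\<close>
  have "\<forall>\<^sub>F n in sequentially. (\<integral>\<^sup>+w. ennreal ((norm (step_integral W (\<phi> n) w - X w))\<^sup>2) \<partial>M) < 1"
    using X by (rule order_tendstoD) simp
  then have ev: "\<forall>\<^sub>F n in sequentially. integrable M (\<lambda>w. (step_integral W (\<phi> n) w - X w)\<^sup>2)"
    by eventually_elim (auto simp: integrable_iff_bounded intro: less_trans[OF _ ennreal_one_less_top])
  have "(\<lambda>n. sqrt (expectation (\<lambda>w. (step_integral W (\<phi> n) w - X w)\<^sup>2))) \<longlonglongrightarrow> sqrt 0"
  proof (intro tendsto_real_sqrt)
    have "(\<lambda>n. ennreal (expectation (\<lambda>w. (step_integral W (\<phi> n) w - X w)\<^sup>2))) \<longlonglongrightarrow> ennreal 0"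
    proof (rule Lim_transform_eventually)
      show "(\<lambda>n. \<integral>\<^sup>+w. ennreal ((norm (step_integral W (\<phi> n) w - X w))\<^sup>2) \<partial>M) \<longlonglongrightarrow> ennreal 0"
        using X by simp
      show "\<forall>\<^sub>F n in sequentially. (\<integral>\<^sup>+w. ennreal ((norm (step_integral W (\<phi> n) w - X w))\<^sup>2) \<partial>M)
          = ennreal (expectation (\<lambda>w. (step_integral W (\<phi> n) w - X w)\<^sup>2))"
        using ev by eventually_elim (simp add: nn_integral_eq_integral)
    qed
    then show "(\<lambda>n. expectation (\<lambda>w. (step_integral W (\<phi> n) w - X w)\<^sup>2)) \<longlonglongrightarrow> 0"
      by (subst (asm) tendsto_ennreal_iff) auto
  qed
  then have "(\<lambda>n. (CLINT w|M. iexp (step_integral W (\<phi> n) w)) - (CLINT w|M. iexp (X w))) \<longlonglongrightarrow> 0"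
    by (intro Lim_null_comparison[OF _ \<open>(\<lambda>n. sqrt _) \<longlonglongrightarrow> sqrt 0\<close>[unfolded real_sqrt_zero]] eventually_mono[OF ev]
        norm_iexp_expectation_diff_le) auto
  then have l2: "(\<lambda>n. CLINT w|M. iexp (step_integral W (\<phi> n) w)) \<longlonglongrightarrow> (CLINT w|M. iexp (X w))"
    by (rule LIM_zero_cancel)
  show "(CLINT w|M. iexp (X w)) = of_real (exp (- (\<integral>u. (f u)\<^sup>2 \<partial>lborel) / 2))"
    by (rule LIMSEQ_unique[OF l2 l1])
qed

section \<open>Linear operations on Wiener integrals\<close>

lemma step_fun_lincomb:
  fixes xs ys :: "'b::real_vector steps"
  shows "step_fun (map (\<lambda>(c, x, y). (a *\<^sub>R c, x, y)) xs @ map (\<lambda>(c, x, y). (b *\<^sub>R c, x, y)) ys) u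
    = a *\<^sub>R step_fun xs u + b *\<^sub>R step_fun ys u"
proof -
  have "step_fun (map (\<lambda>(c, x, y). (a *\<^sub>R c, x, y)) xs) u = a *\<^sub>R step_fun xs u"
    for a and xs :: "'b steps"
    by (induction xs) (auto simp: step_fun_def scaleR_add_right)
  moreover have "step_fun (xs @ ys) u = step_fun xs u + step_fun ys u" for xs ys :: "'b steps"
    by (simp add: step_fun_def)
  ultimately show ?thesis by simp
qed

lemma step_integral_lincomb:
  fixes xs ys :: "'b::real_vector steps"
  shows "step_integral W (map (\<lambda>(c, x, y). (a *\<^sub>R c, x, y)) xs @ map (\<lambda>(c, x, y). (b *\<^sub>R c, x, y)) ys) w
    = a *\<^sub>R step_integral W xs w + b *\<^sub>R step_integral W ys w"
proof -
  have "step_integral W (map (\<lambda>(c, x, y). (a *\<^sub>R c, x, y)) xs) w = a *\<^sub>R step_integral W xs w"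
    for a and xs :: "'b steps"
    by (induction xs) (auto simp: step_integral_def scaleR_add_right)
  moreover have "step_integral W (xs @ ys) w = step_integral W xs w + step_integral W ys w" for xs ys :: "'b steps"
    by (simp add: step_integral_def)
  ultimately show ?thesis by simp
qed

lemma has_wiener_integral_lincomb:
  fixes f g :: "real \<Rightarrow> 'b::euclidean_space"
  assumes [measurable]: "\<And>t. W t \<in> borel_measurable M"
    and f: "has_wiener_integral M W UNIV f X" and g: "has_wiener_integral M W UNIV g Y"
  shows "has_wiener_integral M W UNIV (\<lambda>u. a *\<^sub>R f u + b *\<^sub>R g u) (\<lambda>w. a *\<^sub>R X w + b *\<^sub>R Y w)"
proof -
  from f g have [measurable]: "f \<in> borel_measurable borel" "X \<in> borel_measurable M"
      "g \<in> borel_measurable borel" "Y \<in> borel_measurable M"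
    by (auto simp: has_wiener_integral_def set_borel_measurable_def)
  from f obtain \<phi> where \<phi>: "\<And>n. \<forall>(c, a, b)\<in>set (\<phi> n). a \<le> b"
    "(\<lambda>n. \<integral>\<^sup>+u. ennreal ((norm (step_fun (\<phi> n) u - f u))\<^sup>2) \<partial>lborel) \<longlonglongrightarrow> 0"
    "(\<lambda>n. \<integral>\<^sup>+w. ennreal ((norm (step_integral W (\<phi> n) w - X w))\<^sup>2) \<partial>M) \<longlonglongrightarrow> 0"
    by (auto simp: has_wiener_integral_def)
  from g obtain \<psi> where \<psi>: "\<And>n. \<forall>(c, a, b)\<in>set (\<psi> n). a \<le> b"
    "(\<lambda>n. \<integral>\<^sup>+u. ennreal ((norm (step_fun (\<psi> n) u - g u))\<^sup>2) \<partial>lborel) \<longlonglongrightarrow> 0"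
    "(\<lambda>n. \<integral>\<^sup>+w. ennreal ((norm (step_integral W (\<psi> n) w - Y w))\<^sup>2) \<partial>M) \<longlonglongrightarrow> 0"
    by (auto simp: has_wiener_integral_def)
  define \<zeta> where "\<zeta> n = map (\<lambda>(c, x, y). (a *\<^sub>R c, x, y)) (\<phi> n) @ map (\<lambda>(c, x, y). (b *\<^sub>R c, x, y)) (\<psi> n)" for n
  have e: "a *\<^sub>R p + b *\<^sub>R q - (a *\<^sub>R p' + b *\<^sub>R q') = a *\<^sub>R (p - p') + b *\<^sub>R (q - q')" for p q p' q' :: 'b
    by (simp add: algebra_simps)
  have "\<forall>(c, a, b)\<in>set (\<zeta> n). a \<le> b" for n using \<phi>(1)[of n] \<psi>(1)[of n] by (fastforce simp: \<zeta>_def)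
  moreover have "(\<lambda>n. \<integral>\<^sup>+u. ennreal ((norm (step_fun (\<zeta> n) u - (a *\<^sub>R f u + b *\<^sub>R g u)))\<^sup>2) \<partial>lborel) \<longlonglongrightarrow> 0"
    unfolding \<zeta>_def step_fun_lincomb e by (intro tendsto_L2_lincomb \<phi> \<psi>) auto
  moreover have "(\<lambda>n. \<integral>\<^sup>+w. ennreal ((norm (step_integral W (\<zeta> n) w - (a *\<^sub>R X w + b *\<^sub>R Y w)))\<^sup>2) \<partial>M) \<longlonglongrightarrow> 0"
    unfolding \<zeta>_def step_integral_lincomb e by (intro tendsto_L2_lincomb \<phi> \<psi>) measurable
  ultimately show ?thesis unfolding has_wiener_integral_def set_borel_measurable_def
    by (intro conjI exI[of _ \<zeta>]) auto
qed

text \<open>The coefficients of the approximating step functions are mapped by \<open>T\<close>, and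
  the contraction property preserves both limits. The relevant maps are \<open>Re\<close> and
  \<open>Im\<close>, which reduce complex integrands to real ones.\<close>

lemma has_wiener_integral_contraction:
  fixes f :: "real \<Rightarrow> 'b::euclidean_space" and T :: "'b \<Rightarrow> 'c::euclidean_space"
  assumes [measurable]: "\<And>t. W t \<in> borel_measurable M"
    and f: "has_wiener_integral M W UNIV f X" and T: "linear T" "\<And>x. norm (T x) \<le> norm x"
  shows "has_wiener_integral M W UNIV (\<lambda>u. T (f u)) (\<lambda>w. T (X w))"
proof -
  have "bounded_linear T" using T(1) by (simp add: linear_conv_bounded_linear)
  then have [measurable]: "T \<in> borel_measurable borel"
    by (intro borel_measurable_continuous_onI linear_continuous_on)
  from f have [measurable]: "f \<in> borel_measurable borel" "X \<in> borel_measurable M"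
    by (auto simp: has_wiener_integral_def set_borel_measurable_def)
  from f obtain \<phi> where \<phi>: "\<And>n. \<forall>(c, a, b)\<in>set (\<phi> n). a \<le> b"
    "(\<lambda>n. \<integral>\<^sup>+u. ennreal ((norm (step_fun (\<phi> n) u - f u))\<^sup>2) \<partial>lborel) \<longlonglongrightarrow> 0"
    "(\<lambda>n. \<integral>\<^sup>+w. ennreal ((norm (step_integral W (\<phi> n) w - X w))\<^sup>2) \<partial>M) \<longlonglongrightarrow> 0"
    by (auto simp: has_wiener_integral_def)
  define \<zeta> where "\<zeta> n = map (\<lambda>(c, x, y). (T c, x, y)) (\<phi> n)" for n
  have "step_fun (map (\<lambda>(c, x, y). (T c, x, y)) xs) u = T (step_fun xs u)" for xs u
    by (induction xs) (auto simp: step_fun_def linear_0[OF T(1)] linear_add[OF T(1)] linear_scale[OF T(1)])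
  then have sf: "step_fun (\<zeta> n) u = T (step_fun (\<phi> n) u)" for n u
    by (simp add: \<zeta>_def)
  have "step_integral W (map (\<lambda>(c, x, y). (T c, x, y)) xs) w = T (step_integral W xs w)" for xs w
    by (induction xs) (auto simp: step_integral_def linear_0[OF T(1)] linear_add[OF T(1)] linear_scale[OF T(1)])
  then have si: "step_integral W (\<zeta> n) w = T (step_integral W (\<phi> n) w)" for n w
    by (simp add: \<zeta>_def)
  have le: "(\<integral>\<^sup>+u. ennreal ((norm (T (p u) - T (q u)))\<^sup>2) \<partial>N) \<le> (\<integral>\<^sup>+u. ennreal ((norm (p u - q u))\<^sup>2) \<partial>N)"
    for p q and N :: "'s measure"
    using T(2) by (intro nn_integral_mono ennreal_leI power_mono) (auto simp flip: linear_diff[OF T(1)])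
  have "\<forall>(c, a, b)\<in>set (\<zeta> n). a \<le> b" for n using \<phi>(1)[of n] by (fastforce simp: \<zeta>_def)
  moreover have "(\<lambda>n. \<integral>\<^sup>+u. ennreal ((norm (step_fun (\<zeta> n) u - T (f u)))\<^sup>2) \<partial>lborel) \<longlonglongrightarrow> 0"
    unfolding sf by (rule tendsto_sandwich[OF _ _ tendsto_const \<phi>(2)]) (auto intro!: always_eventually le)
  moreover have "(\<lambda>n. \<integral>\<^sup>+w. ennreal ((norm (step_integral W (\<zeta> n) w - T (X w)))\<^sup>2) \<partial>M) \<longlonglongrightarrow> 0"
    unfolding si by (rule tendsto_sandwich[OF _ _ tendsto_const \<phi>(3)])
      (auto intro!: always_eventually nn_integral_mono ennreal_leI power_mono T(2) simp flip: linear_diff[OF T(1)])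
  ultimately show ?thesis unfolding has_wiener_integral_def set_borel_measurable_def
    by (intro conjI exI[of _ \<zeta>]) auto
qed

text \<open>A change of the integration set is included through the indicators: an integral over a
  part of the line becomes one over the whole line, of the integrand extended by 0.\<close>

lemma has_wiener_integral_cong_AE:
  assumes f: "has_wiener_integral M W S f X"
    and [measurable]: "set_borel_measurable lborel S f" "set_borel_measurable lborel T g" "Y \<in> borel_measurable M"
    and eq: "AE u in lborel. indicator S u *\<^sub>R f u = indicator T u *\<^sub>R g u" "AE w in M. X w = Y w"
  shows "has_wiener_integral M W T g Y"
proof -
  have 1: "(\<integral>\<^sup>+u. ennreal ((norm (step_fun xs u - indicator T u *\<^sub>R g u))\<^sup>2) \<partial>lborel)
      = (\<integral>\<^sup>+u. ennreal ((norm (step_fun xs u - indicator S u *\<^sub>R f u))\<^sup>2) \<partial>lborel)" for xs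
    using eq(1) by (intro nn_integral_cong_AE) auto
  have 2: "(\<integral>\<^sup>+w. ennreal ((norm (step_integral W xs w - Y w))\<^sup>2) \<partial>M)
      = (\<integral>\<^sup>+w. ennreal ((norm (step_integral W xs w - X w))\<^sup>2) \<partial>M)" for xs
    using eq(2) by (intro nn_integral_cong_AE) auto
  show ?thesis using f assms(3,4) unfolding has_wiener_integral_def 1 2 by auto
qed

section \<open>The Plancherel theorem and spectral integrals\<close>

lemma borel_measurable_cnj [measurable (raw)]:
  "f \<in> borel_measurable M \<Longrightarrow> (\<lambda>x. cnj (f x)) \<in> borel_measurable M"
  by (rule borel_measurable_continuous_on[OF _ _]) (auto intro: continuous_intros)

lemma norm_add_power2_le: "(norm (x + y))\<^sup>2 \<le> 2 * (norm x)\<^sup>2 + 2 * (norm y)\<^sup>2"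
  for x y :: "'b::real_normed_vector"
proof -
  have "(norm (x + y))\<^sup>2 \<le> (norm x + norm y)\<^sup>2" by (intro power_mono norm_triangle_ineq) auto
  also have "\<dots> \<le> 2 * (norm x)\<^sup>2 + 2 * (norm y)\<^sup>2"
    using zero_le_power2[of "norm x - norm y"] by (simp add: power2_eq_square algebra_simps)
  finally show ?thesis .
qed

text \<open>Truncation in height and range costs little by dominated convergence. The truncated
  function is an almost everywhere limit of continuous functions, and these are forced to share a
  bound and a compact support, so that dominated convergence applies again.\<close>

lemma L2_approx_continuous:
  fixes \<phi> :: "real \<Rightarrow> complex"
  assumes [measurable]: "\<phi> \<in> borel_measurable borel" and sq: "integrable lborel (\<lambda>x. (norm (\<phi> x))\<^sup>2)"
    and "e > 0"
  obtains \<psi> K where "continuous_on UNIV \<psi>" "\<And>x. norm (\<psi> x) \<le> K * indicator {-K..K} x"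
    "integrable lborel (\<lambda>x. (norm (\<phi> x - \<psi> x))\<^sup>2)" "(\<integral>x. (norm (\<phi> x - \<psi> x))\<^sup>2 \<partial>lborel) < e"
proof -
  define \<phi>' where "\<phi>' k x = (if norm (\<phi> x) \<le> real k \<and> \<bar>x\<bar> \<le> real k then \<phi> x else 0)" for k x
  have m[measurable]: "\<phi>' k \<in> borel_measurable borel" for k unfolding \<phi>'_def[abs_def] by measurable
  have "(\<lambda>k. \<integral>x. (norm (\<phi> x - \<phi>' k x))\<^sup>2 \<partial>lborel) \<longlonglongrightarrow> (\<integral>x. 0 \<partial>(lborel :: real measure))"
  proof (rule integral_dominated_convergence[OF _ _ sq])
    show "AE x in lborel. (\<lambda>k. (norm (\<phi> x - \<phi>' k x))\<^sup>2) \<longlonglongrightarrow> 0"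
    proof (rule AE_I2)
      fix x
      obtain k0 :: nat where k0: "max (norm (\<phi> x)) \<bar>x\<bar> \<le> real k0" using real_arch_simple by blast
      have "\<forall>\<^sub>F k in sequentially. (norm (\<phi> x - \<phi>' k x))\<^sup>2 = 0"
        using eventually_ge_at_top[of k0] by eventually_elim (use k0 in \<open>auto simp: \<phi>'_def\<close>)
      then show "(\<lambda>k. (norm (\<phi> x - \<phi>' k x))\<^sup>2) \<longlonglongrightarrow> 0" by (rule tendsto_eventually)
    qed
    show "AE x in lborel. norm ((norm (\<phi> x - \<phi>' k x))\<^sup>2) \<le> (norm (\<phi> x))\<^sup>2" for k
      by (auto simp: \<phi>'_def)
  qed auto
  then have "\<forall>\<^sub>F k in sequentially. (\<integral>x. (norm (\<phi> x - \<phi>' k x))\<^sup>2 \<partial>lborel) < e / 4"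
    using \<open>e > 0\<close> by (intro order_tendstoD) auto
  then obtain k where k: "(\<integral>x. (norm (\<phi> x - \<phi>' k x))\<^sup>2 \<partial>lborel) < e / 4"
    by (auto simp: eventually_sequentially)
  have ik: "integrable lborel (\<lambda>x. (norm (\<phi> x - \<phi>' k x))\<^sup>2)"
    by (rule Bochner_Integration.integrable_bound[OF sq]) (auto simp: \<phi>'_def)
  have "\<phi>' k measurable_on UNIV"
    using measurable_completion[of "\<phi>' k" lborel borel] m[of k]
    by (intro lebesgue_measurable_imp_measurable_on) auto
  then obtain N g where N: "negligible N" and g: "\<And>n. continuous_on UNIV (g n)"
    "\<And>x. x \<notin> N \<Longrightarrow> (\<lambda>n. g n x) \<longlonglongrightarrow> \<phi>' k x"
    by (auto simp: measurable_on_def)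
  define K where "K = real k + 1"
  \<comment> \<open>The cutoff \<open>c\<close> is continuous, equal to 1 for
    \<open>\<bar>x\<bar> \<le> K - 1\<close> and to 0 for \<open>\<bar>x\<bar> \<ge> K\<close>; the
    factor \<open>K / max K (norm (g n x))\<close> retracts values to the ball of radius
    \<open>K\<close>. Neither alters the limit \<open>\<phi>' k\<close>, because
    \<open>K = k + 1\<close>.\<close>
  define c where "c x = max 0 (min 1 (K - \<bar>x\<bar>))" for x :: real
  define \<psi> where "\<psi> n x = of_real (c x * (K / max K (norm (g n x)))) * g n x" for n x
  have K: "K > 0" by (simp add: K_def)
  have \<psi>c: "continuous_on UNIV (\<psi> n)" for n
    unfolding \<psi>_def c_def using K by (intro continuous_intros g(1)) (auto simp: max_def)
  have \<psi>m[measurable]: "\<psi> n \<in> borel_measurable borel" for n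
    by (intro borel_measurable_continuous_onI \<psi>c)
  have \<psi>K: "norm (\<psi> n x) \<le> K * indicator {-K..K} x" for n x
  proof -
    have "K / max K (norm (g n x)) * norm (g n x) \<le> K"
      using K by (auto simp: max_def field_simps)
    moreover have "0 \<le> c x" "c x \<le> indicator {-K..K} x" by (auto simp: c_def indicator_def)
    ultimately have "c x * (K / max K (norm (g n x)) * norm (g n x)) \<le> indicator {-K..K} x * K"
      using K by (intro mult_mono) (auto simp: max_def)
    moreover have "\<bar>c x * (K / max K (norm (g n x)))\<bar> = c x * (K / max K (norm (g n x)))"
      using K \<open>0 \<le> c x\<close> by (intro abs_of_nonneg mult_nonneg_nonneg divide_nonneg_nonneg) auto
    ultimately show ?thesis
      unfolding \<psi>_def norm_mult norm_of_real by (simp add: mult_ac)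
  qed
  have "AE x in lebesgue. x \<notin> N" using N by (simp add: negligible_iff_null_sets AE_not_in)
  then have AE: "AE x in lborel. x \<notin> N" by (simp add: AE_completion_iff)
  have dom: "(norm (\<phi>' k x - \<psi> n x))\<^sup>2 \<le> 4 * K\<^sup>2 * indicator {-K..K} x" for n x
  proof -
    have "norm (\<phi>' k x) \<le> K * indicator {-K..K} x" by (auto simp: \<phi>'_def K_def indicator_def)
    with \<psi>K[of n x] have "norm (\<phi>' k x - \<psi> n x) \<le> 2 * K * indicator {-K..K} x"
      using norm_triangle_ineq4[of "\<phi>' k x" "\<psi> n x"] by linarith
    then have "(norm (\<phi>' k x - \<psi> n x))\<^sup>2 \<le> (2 * K * indicator {-K..K} x)\<^sup>2" by (intro power_mono) auto
    then show ?thesis by (cases "x \<in> {-K..K}") (auto simp: power_mult_distrib)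
  qed
  have idom: "integrable lborel (\<lambda>x. 4 * K\<^sup>2 * indicator {-K..K} x :: real)"
    by (intro integrable_mult_right integrable_real_indicator) (auto simp: emeasure_lborel_Icc_eq)
  have i\<psi>: "integrable lborel (\<lambda>x. (norm (\<phi>' k x - \<psi> n x))\<^sup>2)" for n
    by (rule Bochner_Integration.integrable_bound[OF idom]) (auto simp: abs_of_nonneg intro: dom)
  have "(\<lambda>n. \<integral>x. (norm (\<phi>' k x - \<psi> n x))\<^sup>2 \<partial>lborel) \<longlonglongrightarrow> (\<integral>x. 0 \<partial>(lborel :: real measure))"
  proof (rule integral_dominated_convergence[OF _ _ idom])
    show "AE x in lborel. (\<lambda>n. (norm (\<phi>' k x - \<psi> n x))\<^sup>2) \<longlonglongrightarrow> 0"
      using AE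
    proof eventually_elim
      case (elim x)
      have lim: "(\<lambda>n. \<psi> n x) \<longlonglongrightarrow> of_real (c x * (K / max K (norm (\<phi>' k x)))) * \<phi>' k x"
        unfolding \<psi>_def using K by (intro tendsto_intros g(2) elim) (auto simp: max_def)
      have "of_real (c x * (K / max K (norm (\<phi>' k x)))) * \<phi>' k x = \<phi>' k x"
      proof (cases "\<phi>' k x = 0")
        case False
        then have *: "norm (\<phi> x) \<le> real k" "\<bar>x\<bar> \<le> real k" by (auto simp: \<phi>'_def split: if_splits)
        then have "c x = 1" "max K (norm (\<phi>' k x)) = K" by (auto simp: c_def K_def \<phi>'_def)
        then show ?thesis using K by simp
      qed simp
      with lim have "(\<lambda>n. (norm (\<phi>' k x - \<psi> n x))\<^sup>2) \<longlonglongrightarrow> (norm (\<phi>' k x - \<phi>' k x))\<^sup>2"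
        by (intro tendsto_intros) simp
      then show ?case by simp
    qed
  qed (auto intro: dom)
  then have "\<forall>\<^sub>F n in sequentially. (\<integral>x. (norm (\<phi>' k x - \<psi> n x))\<^sup>2 \<partial>lborel) < e / 4"
    using \<open>e > 0\<close> by (intro order_tendstoD) auto
  then obtain n where n: "(\<integral>x. (norm (\<phi>' k x - \<psi> n x))\<^sup>2 \<partial>lborel) < e / 4"
    by (auto simp: eventually_sequentially)
  have le: "(norm (\<phi> x - \<psi> n x))\<^sup>2 \<le> 2 * (norm (\<phi> x - \<phi>' k x))\<^sup>2 + 2 * (norm (\<phi>' k x - \<psi> n x))\<^sup>2" for x
    using norm_add_power2_le[of "\<phi> x - \<phi>' k x" "\<phi>' k x - \<psi> n x"] by simp
  have i2: "integrable lborel (\<lambda>x. 2 * (norm (\<phi> x - \<phi>' k x))\<^sup>2 + 2 * (norm (\<phi>' k x - \<psi> n x))\<^sup>2)"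
    using ik i\<psi> by simp
  have i: "integrable lborel (\<lambda>x. (norm (\<phi> x - \<psi> n x))\<^sup>2)"
    by (rule Bochner_Integration.integrable_bound[OF i2]) (auto intro: order_trans[OF le])
  have "(\<integral>x. (norm (\<phi> x - \<psi> n x))\<^sup>2 \<partial>lborel)
     \<le> (\<integral>x. 2 * (norm (\<phi> x - \<phi>' k x))\<^sup>2 + 2 * (norm (\<phi>' k x - \<psi> n x))\<^sup>2 \<partial>lborel)"
    by (intro integral_mono i i2 le)
  also have "\<dots> < e" using k n ik i\<psi> by simp
  finally show ?thesis using that \<psi>c \<psi>K i by blast
qed

text \<open>Translation is an isometry of \<open>L2\<close>, so it suffices to translate a
  continuous function with compact support, where dominated convergence applies.\<close>

lemma L2_translation_continuous:
  fixes \<phi> :: "real \<Rightarrow> complex"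
  assumes [measurable]: "\<phi> \<in> borel_measurable borel" and sq: "integrable lborel (\<lambda>x. (norm (\<phi> x))\<^sup>2)"
    and h: "h \<longlonglongrightarrow> 0"
  shows "(\<lambda>n. \<integral>x. (norm (\<phi> (x + h n) - \<phi> x))\<^sup>2 \<partial>lborel) \<longlonglongrightarrow> 0"
proof (rule LIMSEQ_I)
  fix r :: real assume "r > 0"
  \<comment> \<open>The final estimate is 8 times the integral of \<open>d\<close> plus 2 times that
    of \<open>q n\<close>, hence below \<open>10 * (r / 12)\<close>.\<close>
  obtain \<psi> K where \<psi>: "continuous_on UNIV \<psi>" "\<And>x. norm (\<psi> x) \<le> K * indicator {-K..K} x"
    "integrable lborel (\<lambda>x. (norm (\<phi> x - \<psi> x))\<^sup>2)" "(\<integral>x. (norm (\<phi> x - \<psi> x))\<^sup>2 \<partial>lborel) < r / 12"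
    by (rule L2_approx_continuous[OF assms(1) sq, of "r / 12"]) (use \<open>r > 0\<close> in auto)
  have [measurable]: "\<psi> \<in> borel_measurable borel" by (intro borel_measurable_continuous_onI \<psi>(1))
  define d where "d x = (norm (\<phi> x - \<psi> x))\<^sup>2" for x
  define q where "q n x = (norm (\<psi> (x + h n) - \<psi> x))\<^sup>2" for n x
  have [measurable]: "d \<in> borel_measurable borel" "q n \<in> borel_measurable borel" for n
    unfolding d_def[abs_def] q_def[abs_def] by measurable
  have di: "integrable lborel d" using \<psi>(3) by (simp add: d_def[abs_def])
  have dt: "integrable lborel (\<lambda>x. d (x + a))" "(\<integral>x. d (x + a) \<partial>lborel) = (\<integral>x. d x \<partial>lborel)" for a
    using lborel_integrable_real_affine[OF di, of 1 a] lborel_integral_real_affine[of 1 d a]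
    by (auto simp: add.commute)
  \<comment> \<open>The interval is widened by 1 on both sides, which accommodates every shift with
    \<open>\<bar>h n\<bar> < 1\<close>.\<close>
  define D where "D x = 4 * K\<^sup>2 * indicator {-\<bar>K\<bar> - 1..\<bar>K\<bar> + 1} x" for x :: real
  have Di: "integrable lborel D" unfolding D_def by (intro integrable_mult_right integrable_real_indicator) (auto simp: emeasure_lborel_Icc_eq)
  obtain n0 where n0: "\<bar>h n\<bar> < 1" if "n \<ge> n0" for n
    using LIMSEQ_D[OF h, of 1] by auto
  have qD: "q n x \<le> D x" if "n \<ge> n0" for n x
  proof -
    have "norm (\<psi> (x + h n)) \<le> \<bar>K\<bar> * indicator {-\<bar>K\<bar> - 1..\<bar>K\<bar> + 1} x"
      using \<psi>(2)[of "x + h n"] n0[OF that]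
      by (cases "- K \<le> x + h n \<and> x + h n \<le> K") (auto simp: indicator_def)
    moreover have "norm (\<psi> x) \<le> \<bar>K\<bar> * indicator {-\<bar>K\<bar> - 1..\<bar>K\<bar> + 1} x"
      using \<psi>(2)[of x] by (cases "- K \<le> x \<and> x \<le> K") (auto simp: indicator_def)
    ultimately have "norm (\<psi> (x + h n) - \<psi> x) \<le> 2 * \<bar>K\<bar> * indicator {-\<bar>K\<bar> - 1..\<bar>K\<bar> + 1} x"
      using norm_triangle_ineq4[of "\<psi> (x + h n)" "\<psi> x"] by linarith
    then have "q n x \<le> (2 * \<bar>K\<bar> * indicator {-\<bar>K\<bar> - 1..\<bar>K\<bar> + 1} x)\<^sup>2" unfolding q_def by (intro power_mono) auto
    then show ?thesis
      by (cases "x \<in> {-\<bar>K\<bar> - 1..\<bar>K\<bar> + 1}") (auto simp: D_def power_mult_distrib)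
  qed
  have "(\<lambda>n. \<integral>x. q (n + n0) x \<partial>lborel) \<longlonglongrightarrow> (\<integral>x. 0 \<partial>(lborel :: real measure))"
  proof (rule integral_dominated_convergence[OF _ _ Di])
    show "AE x in lborel. (\<lambda>n. q (n + n0) x) \<longlonglongrightarrow> 0"
    proof (rule AE_I2)
      fix x
      have "isCont \<psi> x" using \<psi>(1) by (simp add: continuous_on_eq_continuous_at)
      then have "(\<lambda>n. \<psi> (x + h (n + n0))) \<longlonglongrightarrow> \<psi> x"
        by (rule isCont_tendsto_compose) (use tendsto_add[OF tendsto_const[of x] LIMSEQ_ignore_initial_segment[OF h, of n0]] in simp)
      then have "(\<lambda>n. q (n + n0) x) \<longlonglongrightarrow> (norm (\<psi> x - \<psi> x))\<^sup>2" unfolding q_def by (intro tendsto_intros)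
      then show "(\<lambda>n. q (n + n0) x) \<longlonglongrightarrow> 0" by simp
    qed
    show "AE x in lborel. norm (q (n + n0) x) \<le> D x" for n
      using qD[of "n + n0"] by (auto simp: q_def)
  qed auto
  then have "(\<lambda>n. \<integral>x. q n x \<partial>lborel) \<longlonglongrightarrow> 0" by (simp add: LIMSEQ_offset)
  from LIMSEQ_D[OF this, of "r / 12"] obtain n1 where n1: "norm ((\<integral>x. q n x \<partial>lborel) - 0) < r / 12" if "n \<ge> n1" for n
    using \<open>r > 0\<close> by (metis zero_less_divide_iff zero_less_numeral)
  show "\<exists>no. \<forall>n\<ge>no. norm ((\<integral>x. (norm (\<phi> (x + h n) - \<phi> x))\<^sup>2 \<partial>lborel) - 0) < r"
  proof (intro exI allI impI)
    fix n assume n: "max n0 n1 \<le> n"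
    have qi: "integrable lborel (q n)"
      by (rule Bochner_Integration.integrable_bound[OF Di]) (use qD[of n] n in \<open>auto simp: q_def intro!: AE_I2 intro: order_trans[OF _ abs_ge_self]\<close>)
    have le: "(norm (\<phi> (x + h n) - \<phi> x))\<^sup>2 \<le> 4 * d (x + h n) + 4 * d x + 2 * q n x" for x
    proof -
      have "(norm (\<phi> (x + h n) - \<phi> x))\<^sup>2
        \<le> 2 * (norm ((\<phi> (x + h n) - \<psi> (x + h n)) + (\<psi> x - \<phi> x)))\<^sup>2 + 2 * q n x"
        using norm_add_power2_le[of "(\<phi> (x + h n) - \<psi> (x + h n)) + (\<psi> x - \<phi> x)" "\<psi> (x + h n) - \<psi> x"]
        by (simp add: q_def)
      also have "(norm ((\<phi> (x + h n) - \<psi> (x + h n)) + (\<psi> x - \<phi> x)))\<^sup>2 \<le> 2 * d (x + h n) + 2 * d x"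
        using norm_add_power2_le[of "\<phi> (x + h n) - \<psi> (x + h n)" "\<psi> x - \<phi> x"]
        by (simp add: d_def norm_minus_commute)
      finally show ?thesis by simp
    qed
    have i: "integrable lborel (\<lambda>x. 4 * d (x + h n) + 4 * d x + 2 * q n x)"
      using dt(1) di qi by simp
    have i': "integrable lborel (\<lambda>x. (norm (\<phi> (x + h n) - \<phi> x))\<^sup>2)"
      by (rule Bochner_Integration.integrable_bound[OF i]) (auto intro!: AE_I2 order_trans[OF le abs_ge_self])
    have "(\<integral>x. (norm (\<phi> (x + h n) - \<phi> x))\<^sup>2 \<partial>lborel) \<le> (\<integral>x. 4 * d (x + h n) + 4 * d x + 2 * q n x \<partial>lborel)"
      by (intro integral_mono i i' le)
    also have "\<dots> = 8 * (\<integral>x. d x \<partial>lborel) + 2 * (\<integral>x. q n x \<partial>lborel)"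
      using dt di qi by simp
    also have "\<dots> < r" using \<psi>(4) n1[of n] n by (simp add: d_def[abs_def])
    finally show "norm ((\<integral>x. (norm (\<phi> (x + h n) - \<phi> x))\<^sup>2 \<partial>lborel) - 0) < r" by simp
  qed
qed

section \<open>The Plancherel identity by Gaussian regularisation\<close>

lemma integral_normal_density_iexp:
  assumes "0 < s"
  shows "(CLINT u|density lborel (normal_density 0 s). iexp (u * c)) = of_real (exp (- (c\<^sup>2 * s\<^sup>2) / 2))"
proof -
  let ?G = "density lborel (normal_density 0 s)"
  have "prob_space ?G" using assms by (rule prob_space_normal_density)
  moreover have "distributed ?G lborel (\<lambda>x. x) (normal_density 0 s)"
    unfolding distributed_def
    by (auto simp: distr_id2 cong: distr_cong intro!: distr_id2)
  ultimately show ?thesis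
    using normal_iexp_expectation[of ?G "\<lambda>x. x" s c] assms by (simp add: mult.commute)
qed

definition fourier_L1 :: "(real \<Rightarrow> complex) \<Rightarrow> real \<Rightarrow> complex" where
  "fourier_L1 \<phi> u = (1 / sqrt (2 * pi)) *\<^sub>R (CLINT x|lborel. exp (- \<i> * of_real (u * x)) * \<phi> x)"

lemma borel_measurable_fourier_L1 [measurable]:
  assumes [measurable]: "\<phi> \<in> borel_measurable borel"
  shows "fourier_L1 \<phi> \<in> borel_measurable borel"
  unfolding fourier_L1_def[abs_def] by measurable

text \<open>The squared modulus of the transform is a double integral of characters of
  \<open>snd p - fst p\<close>. A Gaussian probability weight in \<open>u\<close> makes the triple
  integral absolutely convergent, so Fubini applies, and integrating the characters over
  \<open>u\<close> gives the Gaussian factor.\<close>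

lemma gaussian_weighted_fourier_L1:
  fixes \<phi> :: "real \<Rightarrow> complex"
  assumes [measurable]: "\<phi> \<in> borel_measurable borel" and L1: "integrable lborel \<phi>" and "0 < s"
  shows "of_real (2 * pi * (\<integral>u. (norm (fourier_L1 \<phi> u))\<^sup>2 \<partial>density lborel (normal_density 0 s)))
    = (CLINT p|lborel \<Otimes>\<^sub>M lborel. \<phi> (fst p) * cnj (\<phi> (snd p)) * of_real (exp (- ((snd p - fst p)\<^sup>2 * s\<^sup>2) / 2)))"
proof -
  define G where "G = density lborel (\<lambda>x. ennreal (normal_density 0 s x))"
  have [measurable_cong]: "sets G = sets borel" by (simp add: G_def)
  interpret G: prob_space G unfolding G_def using \<open>0 < s\<close> by (rule prob_space_normal_density)
  define P where "P = (lborel \<Otimes>\<^sub>M lborel :: (real \<times> real) measure)"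
  interpret P: sigma_finite_measure P unfolding P_def ..
  interpret GP: pair_sigma_finite G P ..
  have [measurable_cong]: "sets P = sets (borel \<Otimes>\<^sub>M borel)" unfolding P_def by (intro sets_pair_measure_cong) auto
  define q where "q p = \<phi> (fst p) * cnj (\<phi> (snd p))" for p
  have [measurable]: "q \<in> borel_measurable P" unfolding q_def[abs_def] by measurable
  have c: "integrable lborel (\<lambda>z. cnj (\<phi> z))" using L1 by simp
  have qi: "integrable P q"
    unfolding P_def q_def[abs_def]
    by (rule lborel_pair.integrable_fst_mult_snd(1)[OF L1 c])
  have pt: "of_real (2 * pi * (norm (fourier_L1 \<phi> u))\<^sup>2) = (CLINT p|P. iexp (u * (snd p - fst p)) * q p)" for u
  proof -
    let ?F = "CLINT x|lborel. exp (- \<i> * of_real (u * x)) * \<phi> x"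
    have i1: "integrable lborel (\<lambda>x. exp (- \<i> * of_real (u * x)) * \<phi> x)"
      by (rule Bochner_Integration.integrable_bound[OF L1]) (auto simp: norm_mult)
    have "integrable lborel (\<lambda>z. cnj (exp (- \<i> * of_real (u * z)) * \<phi> z))"
      using i1 by (subst complex_integrable_cnj)
    then have i2: "integrable lborel (\<lambda>z. exp (\<i> * of_real (u * z)) * cnj (\<phi> z))"
      by (simp add: exp_cnj)
    have i3: "integrable (lborel \<Otimes>\<^sub>M lborel) (\<lambda>p. iexp (u * (snd p - fst p)) * q p)"
      by (rule Bochner_Integration.integrable_bound[OF qi[unfolded P_def]]) (auto simp: norm_mult)
    have "of_real (2 * pi * (norm (fourier_L1 \<phi> u))\<^sup>2) = of_real ((norm ?F)\<^sup>2)"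
      by (simp add: fourier_L1_def power_divide real_sqrt_pow2 del: of_real_power)
    also have "\<dots> = ?F * cnj ?F" by (rule complex_norm_square)
    also have "cnj ?F = (CLINT z|lborel. cnj (exp (- \<i> * of_real (u * z)) * \<phi> z))"
      by (rule Bochner_Integration.integral_cnj[symmetric])
    also have "\<dots> = (CLINT z|lborel. exp (\<i> * of_real (u * z)) * cnj (\<phi> z))"
      by (intro Bochner_Integration.integral_cong refl) (simp add: exp_cnj)
    also have "?F * \<dots> = (CLINT x|lborel. CLINT z|lborel.
        exp (- \<i> * of_real (u * x)) * \<phi> x * (exp (\<i> * of_real (u * z)) * cnj (\<phi> z)))"
      using i1 i2 by simp
    also have "\<dots> = (CLINT x|lborel. CLINT z|lborel. iexp (u * (z - x)) * q (x, z))"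
      by (intro Bochner_Integration.integral_cong refl) (simp add: q_def algebra_simps exp_add exp_diff exp_minus field_simps)
    also have "\<dots> = (CLINT p|P. iexp (u * (snd p - fst p)) * q p)"
      unfolding P_def using lborel_pair.integral_fst'[OF i3] by simp
    finally show ?thesis .
  qed
  have i4: "integrable (G \<Otimes>\<^sub>M P) (\<lambda>(u, p). iexp (u * (snd p - fst p)) * q p)"
  proof -
    have "(\<integral>\<^sup>+v. ennreal (norm (case v of (u, p) \<Rightarrow> iexp (u * (snd p - fst p)) * q p)) \<partial>(G \<Otimes>\<^sub>M P))
       = (\<integral>\<^sup>+u. \<integral>\<^sup>+p. ennreal (norm (q p)) \<partial>P \<partial>G)"
      by (subst P.nn_integral_fst[symmetric]) (auto simp: norm_mult)
    also have "\<dots> < \<infinity>" using qi by (simp add: integrable_iff_bounded G.emeasure_space_1)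
    finally show ?thesis by (simp add: integrable_iff_bounded)
  qed
  have "of_real (2 * pi * (\<integral>u. (norm (fourier_L1 \<phi> u))\<^sup>2 \<partial>G)) = (CLINT u|G. of_real (2 * pi * (norm (fourier_L1 \<phi> u))\<^sup>2))"
    unfolding integral_complex_of_real by simp
  also have "\<dots> = (CLINT u|G. CLINT p|P. iexp (u * (snd p - fst p)) * q p)" by (simp only: pt)
  also have "\<dots> = (CLINT p|P. CLINT u|G. iexp (u * (snd p - fst p)) * q p)"
    using GP.Fubini_integral[OF i4] by simp
  also have "\<dots> = (CLINT p|P. q p * of_real (exp (- ((snd p - fst p)\<^sup>2 * s\<^sup>2) / 2)))"
  proof (intro Bochner_Integration.integral_cong refl)
    fix p
    have "(CLINT u|G. iexp (u * (snd p - fst p)) * q p) = (CLINT u|G. iexp (u * (snd p - fst p))) * q p"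
      by (rule integral_mult_left_zero)
    then show "(CLINT u|G. iexp (u * (snd p - fst p)) * q p) = q p * of_real (exp (- ((snd p - fst p)\<^sup>2 * s\<^sup>2) / 2))"
      unfolding G_def integral_normal_density_iexp[OF \<open>0 < s\<close>] by (simp only: mult.commute)
  qed
  finally show ?thesis by (simp add: G_def P_def q_def)
qed

text \<open>The substitution \<open>x = z + \<sigma> * w\<close> turns the Gaussian factor of width
  \<sigma> into a standard normal average of the autocorrelation of \<phi> at the shift
  \<open>\<sigma> * w\<close>.\<close>

lemma gaussian_autocorrelation:
  fixes \<phi> :: "real \<Rightarrow> complex"
  assumes [measurable]: "\<phi> \<in> borel_measurable borel" and sq: "integrable lborel (\<lambda>x. (norm (\<phi> x))\<^sup>2)"
    and L1: "integrable lborel \<phi>" and "0 < \<sigma>"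
  shows "(CLINT p|lborel \<Otimes>\<^sub>M lborel. \<phi> (fst p) * cnj (\<phi> (snd p)) * of_real (exp (- ((snd p - fst p)\<^sup>2 * (1 / \<sigma>)\<^sup>2) / 2)))
    = of_real (\<sigma> * sqrt (2 * pi)) * (CLINT w|std_normal_distribution. CLINT z|lborel. \<phi> (z + \<sigma> * w) * cnj (\<phi> z))"
proof -
  define g where "g v = exp (- (v\<^sup>2 * (1 / \<sigma>)\<^sup>2) / 2)" for v :: real
  have [measurable]: "g \<in> borel_measurable borel" unfolding g_def[abs_def] by measurable
  interpret N: prob_space std_normal_distribution by (rule prob_space_normal_density) simp
  interpret LN: pair_sigma_finite lborel std_normal_distribution ..
  have shift: "(\<integral>\<^sup>+z. ennreal ((norm (\<phi> (z + a)))\<^sup>2) \<partial>lborel) = (\<integral>\<^sup>+z. ennreal ((norm (\<phi> z))\<^sup>2) \<partial>lborel)" for a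
    using nn_integral_real_affine[of "\<lambda>z. ennreal ((norm (\<phi> z))\<^sup>2)" 1 a] by (simp add: add.commute)
  have fin: "(\<integral>\<^sup>+z. ennreal ((norm (\<phi> z))\<^sup>2) \<partial>lborel) < \<infinity>"
    using sq by (simp add: integrable_norm_power2_iff)
  have [measurable]: "(\<lambda>p. \<phi> (fst p) * cnj (\<phi> (snd p)) * of_real (g (snd p - fst p))) \<in> borel_measurable (lborel \<Otimes>\<^sub>M lborel)"
    by measurable
  have i1: "integrable (lborel \<Otimes>\<^sub>M lborel) (\<lambda>p. \<phi> (fst p) * cnj (\<phi> (snd p)) * of_real (g (snd p - fst p)))"
  proof (rule Bochner_Integration.integrable_bound)
    show "integrable (lborel \<Otimes>\<^sub>M lborel) (\<lambda>p. \<phi> (fst p) * cnj (\<phi> (snd p)))"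
      using L1 by (intro lborel_pair.integrable_fst_mult_snd) auto
    have "\<bar>g v\<bar> \<le> 1" for v by (simp add: g_def)
    then have "norm (\<phi> (fst p)) * norm (\<phi> (snd p)) * \<bar>g (snd p - fst p)\<bar> \<le> norm (\<phi> (fst p)) * norm (\<phi> (snd p)) * 1" for p
      by (intro mult_left_mono) auto
    then show "AE p in lborel \<Otimes>\<^sub>M lborel. norm (\<phi> (fst p) * cnj (\<phi> (snd p)) * of_real (g (snd p - fst p)))
        \<le> norm (\<phi> (fst p) * cnj (\<phi> (snd p)))"
      by (intro AE_I2) (simp add: norm_mult)
  qed simp
  have i2: "integrable (lborel \<Otimes>\<^sub>M std_normal_distribution) (\<lambda>(z, w). \<phi> (z + \<sigma> * w) * cnj (\<phi> z))"
  proof -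
    have "(\<integral>\<^sup>+v. ennreal (norm (case v of (z, w) \<Rightarrow> \<phi> (z + \<sigma> * w) * cnj (\<phi> z))) \<partial>(lborel \<Otimes>\<^sub>M std_normal_distribution))
        \<le> (\<integral>\<^sup>+v. ennreal ((norm (\<phi> (fst v + \<sigma> * snd v)))\<^sup>2) + ennreal ((norm (\<phi> (fst v)))\<^sup>2) \<partial>(lborel \<Otimes>\<^sub>M std_normal_distribution))"
    proof (rule nn_integral_mono)
      fix v :: "real \<times> real"
      have ab: "a * b \<le> a\<^sup>2 + b\<^sup>2" for a b :: real
      proof -
        have "0 \<le> (a - b)\<^sup>2 + a\<^sup>2 + b\<^sup>2" by simp
        then show ?thesis by (simp add: power2_diff)
      qed
      show "ennreal (norm (case v of (z, w) \<Rightarrow> \<phi> (z + \<sigma> * w) * cnj (\<phi> z)))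
          \<le> ennreal ((norm (\<phi> (fst v + \<sigma> * snd v)))\<^sup>2) + ennreal ((norm (\<phi> (fst v)))\<^sup>2)"
        using ab by (auto simp: norm_mult split: prod.splits simp flip: ennreal_plus)
    qed
    also have "\<dots> = (\<integral>\<^sup>+w. \<integral>\<^sup>+z. ennreal ((norm (\<phi> (z + \<sigma> * w)))\<^sup>2) + ennreal ((norm (\<phi> z))\<^sup>2) \<partial>lborel \<partial>std_normal_distribution)"
      by (subst LN.nn_integral_snd[symmetric]) auto
    also have "\<dots> = (\<integral>\<^sup>+w. 2 * (\<integral>\<^sup>+z. ennreal ((norm (\<phi> z))\<^sup>2) \<partial>lborel) \<partial>std_normal_distribution)"
      by (subst nn_integral_add) (auto simp: shift mult_2)
    also have "\<dots> < \<infinity>" using fin by (simp add: N.emeasure_space_1[simplified] ennreal_mult_less_top)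
    finally show ?thesis by (simp add: integrable_iff_bounded)
  qed
  have "(CLINT p|lborel \<Otimes>\<^sub>M lborel. \<phi> (fst p) * cnj (\<phi> (snd p)) * of_real (g (snd p - fst p)))
     = (CLINT z|lborel. CLINT x|lborel. \<phi> x * cnj (\<phi> z) * of_real (g (z - x)))"
    using lborel_pair.integral_snd[of "\<lambda>x z. \<phi> x * cnj (\<phi> z) * of_real (g (z - x))"] i1
    by (simp add: case_prod_beta')
  also have "\<dots> = (CLINT z|lborel. of_real (\<sigma> * sqrt (2 * pi)) * (CLINT w|std_normal_distribution. \<phi> (z + \<sigma> * w) * cnj (\<phi> z)))"
  proof (intro Bochner_Integration.integral_cong refl)
    fix z
    have "(CLINT x|lborel. \<phi> x * cnj (\<phi> z) * of_real (g (z - x)))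
        = \<sigma> *\<^sub>R (CLINT w|lborel. \<phi> (z + \<sigma> * w) * cnj (\<phi> z) * of_real (g (- (\<sigma> * w))))"
      using lborel_integral_real_affine[of \<sigma> "\<lambda>x. \<phi> x * cnj (\<phi> z) * of_real (g (z - x))" z] \<open>0 < \<sigma>\<close> by simp
    also have "(\<lambda>w. \<phi> (z + \<sigma> * w) * cnj (\<phi> z) * of_real (g (- (\<sigma> * w))))
        = (\<lambda>w. sqrt (2 * pi) *\<^sub>R (std_normal_density w *\<^sub>R (\<phi> (z + \<sigma> * w) * cnj (\<phi> z))))"
      using \<open>0 < \<sigma>\<close> by (auto simp: fun_eq_iff g_def std_normal_density_def scaleR_conv_of_real power_mult_distrib field_simps)
    also have "\<sigma> *\<^sub>R (CLINT w|lborel. sqrt (2 * pi) *\<^sub>R (std_normal_density w *\<^sub>R (\<phi> (z + \<sigma> * w) * cnj (\<phi> z))))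
        = of_real (\<sigma> * sqrt (2 * pi)) * (CLINT w|std_normal_distribution. \<phi> (z + \<sigma> * w) * cnj (\<phi> z))"
      by (subst integral_density) (auto simp: scaleR_conv_of_real)
    finally show "(CLINT x|lborel. \<phi> x * cnj (\<phi> z) * of_real (g (z - x)))
      = of_real (\<sigma> * sqrt (2 * pi)) * (CLINT w|std_normal_distribution. \<phi> (z + \<sigma> * w) * cnj (\<phi> z))" .
  qed
  also have "\<dots> = of_real (\<sigma> * sqrt (2 * pi)) * (CLINT z|lborel. CLINT w|std_normal_distribution. \<phi> (z + \<sigma> * w) * cnj (\<phi> z))"
    by simp
  also have "(CLINT z|lborel. CLINT w|std_normal_distribution. \<phi> (z + \<sigma> * w) * cnj (\<phi> z))
     = (CLINT w|std_normal_distribution. CLINT z|lborel. \<phi> (z + \<sigma> * w) * cnj (\<phi> z))"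
    by (rule LN.Fubini_integral[OF i2, symmetric])
  finally show ?thesis by (simp add: g_def)
qed

text \<open>The weights \<open>exp (- (\<sigma>\<^sup>2 * u\<^sup>2) / 2)\<close> increase to 1 as
  \<sigma> decreases. The weighted energy of the transform is an average of the autocorrelation at
  the shifts \<open>\<sigma> * w\<close>, which tends to the energy of \<phi> by continuity of
  translations; monotone convergence identifies the limit with the energy of the transform and shows
  that it is finite.\<close>

lemma plancherel_L1_L2:
  fixes \<phi> :: "real \<Rightarrow> complex"
  assumes [measurable]: "\<phi> \<in> borel_measurable borel" and sq: "integrable lborel (\<lambda>x. (norm (\<phi> x))\<^sup>2)"
    and L1: "integrable lborel \<phi>"
  shows "integrable lborel (\<lambda>u. (norm (fourier_L1 \<phi> u))\<^sup>2)"
    and "(\<integral>u. (norm (fourier_L1 \<phi> u))\<^sup>2 \<partial>lborel) = (\<integral>x. (norm (\<phi> x))\<^sup>2 \<partial>lborel)"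
proof -
  define E where "E = (\<integral>x. (norm (\<phi> x))\<^sup>2 \<partial>lborel)"
  define D where "D h = (\<integral>x. (norm (\<phi> (x + h) - \<phi> x))\<^sup>2 \<partial>lborel)" for h
  define C where "C h = (CLINT z|lborel. \<phi> (z + h) * cnj (\<phi> z))" for h
  define \<sigma> where "\<sigma> n = 1 / real (Suc n)" for n
  have \<sigma>: "0 < \<sigma> n" "\<sigma> \<longlonglongrightarrow> 0" for n
    using LIMSEQ_inverse_real_of_nat by (auto simp: \<sigma>_def[abs_def] inverse_eq_divide)
  interpret N: prob_space std_normal_distribution by (rule prob_space_normal_density) simp
  have [measurable]: "D \<in> borel_measurable borel" "C \<in> borel_measurable borel"
    unfolding D_def[abs_def] C_def[abs_def] by measurable
  have sh: "integrable lborel (\<lambda>x. (norm (\<phi> (x + h)))\<^sup>2)" "(\<integral>x. (norm (\<phi> (x + h)))\<^sup>2 \<partial>lborel) = E" for h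
    using lborel_integrable_real_affine[OF sq, of 1 h] lborel_integral_real_affine[of 1 "\<lambda>x. (norm (\<phi> x))\<^sup>2" h]
    by (auto simp: add.commute E_def)
  have Di: "integrable lborel (\<lambda>x. (norm (\<phi> (x + h) - \<phi> x))\<^sup>2)" for h
    using integrable_L2_lincomb[OF _ _ sh(1) sq, of h 1 "-1"] by simp
  have Re_eq: "Re (a * cnj b) = ((norm a)\<^sup>2 + (norm b)\<^sup>2 - (norm (a - b))\<^sup>2) / 2" for a b
    by (simp only: cmod_power2) (simp add: power2_eq_square field_simps)
  \<comment> \<open>Polarisation expresses the autocorrelation through the translation error
    \<open>D h\<close>, which tends to 0 with the shift. The real part suffices because the energies
    are real.\<close>
  have ReC: "Re (C h) = E - D h / 2" for h
  proof -
    have "integrable lborel (\<lambda>z. \<phi> (z + h) * cnj (\<phi> z))"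
    proof (rule Bochner_Integration.integrable_bound[of _ "\<lambda>x. (norm (\<phi> (x + h)))\<^sup>2 + (norm (\<phi> x))\<^sup>2"])
      have ab: "a * b \<le> a\<^sup>2 + b\<^sup>2" for a b :: real
      proof -
        have "0 \<le> (a - b)\<^sup>2 + a\<^sup>2 + b\<^sup>2" by simp
        then show ?thesis by (simp add: power2_diff)
      qed
      then show "AE x in lborel. norm (\<phi> (x + h) * cnj (\<phi> x)) \<le> norm ((norm (\<phi> (x + h)))\<^sup>2 + (norm (\<phi> x))\<^sup>2)"
        by (intro AE_I2) (auto simp: norm_mult)
    qed (use sh sq in auto)
    then have "Re (C h) = (\<integral>z. Re (\<phi> (z + h) * cnj (\<phi> z)) \<partial>lborel)"
      unfolding C_def by (rule integral_Re[symmetric])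
    also have "\<dots> = (E + E - D h) / 2" using sh sq Di by (simp only: Re_eq) (simp add: E_def D_def)
    finally show ?thesis by (simp add: field_simps)
  qed
  have D0: "0 \<le> D h" for h by (simp add: D_def)
  have D4: "D h \<le> 4 * E" for h
  proof -
    have "D h \<le> (\<integral>x. 2 * (norm (\<phi> (x + h)))\<^sup>2 + 2 * (norm (\<phi> x))\<^sup>2 \<partial>lborel)"
      unfolding D_def using norm_add_power2_le[of "\<phi> (x + h)" "- \<phi> x" for x] sh(1) sq
      by (intro integral_mono Di) auto
    also have "\<dots> = 4 * E" using sh sq by (simp add: E_def)
    finally show ?thesis .
  qed
  have Ci: "norm (C h) \<le> E" for h
  proof -
    have "norm (C h) \<le> (\<integral>z. norm (\<phi> (z + h) * cnj (\<phi> z)) \<partial>lborel)" unfolding C_def by (rule integral_norm_bound)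
    also have "\<dots> \<le> (\<integral>z. ((norm (\<phi> (z + h)))\<^sup>2 + (norm (\<phi> z))\<^sup>2) / 2 \<partial>lborel)"
    proof (rule integral_mono')
      show "integrable lborel (\<lambda>z. ((norm (\<phi> (z + h)))\<^sup>2 + (norm (\<phi> z))\<^sup>2) / 2)" using sh sq by simp
      show "norm (\<phi> (z + h) * cnj (\<phi> z)) \<le> ((norm (\<phi> (z + h)))\<^sup>2 + (norm (\<phi> z))\<^sup>2) / 2" for z
        using zero_le_power2[of "norm (\<phi> (z + h)) - norm (\<phi> z)"] by (simp add: norm_mult power2_diff)
    qed simp
    also have "\<dots> = E" using sh sq by (simp add: E_def)
    finally show ?thesis .
  qed
  define F2 where "F2 u = (norm (fourier_L1 \<phi> u))\<^sup>2" for u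
  have F20: "0 \<le> F2 u" for u by (simp add: F2_def)
  have [measurable]: "F2 \<in> borel_measurable borel" unfolding F2_def[abs_def] by measurable
  have F2b: "F2 u \<le> ((1 / sqrt (2 * pi)) * (\<integral>x. norm (\<phi> x) \<partial>lborel))\<^sup>2" for u
  proof -
    have "norm (CLINT x|lborel. exp (- \<i> * of_real (u * x)) * \<phi> x) \<le> (\<integral>x. norm (exp (- \<i> * of_real (u * x)) * \<phi> x) \<partial>lborel)"
      by (rule integral_norm_bound)
    also have "\<dots> = (\<integral>x. norm (\<phi> x) \<partial>lborel)" by (simp add: norm_mult)
    finally show ?thesis unfolding F2_def fourier_L1_def norm_scaleR by (intro power_mono mult_mono) auto
  qed
  have main: "(\<integral>u. F2 u * exp (- ((\<sigma> n)\<^sup>2 * u\<^sup>2) / 2) \<partial>lborel) = (\<integral>w. Re (C (\<sigma> n * w)) \<partial>std_normal_distribution)" for n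
  proof -
    define G where "G = density lborel (\<lambda>x. ennreal (normal_density 0 (1 / \<sigma> n) x))"
    have nd: "normal_density 0 (1 / \<sigma> n) u = \<sigma> n / sqrt (2 * pi) * exp (- ((\<sigma> n)\<^sup>2 * u\<^sup>2) / 2)" for u
      using \<sigma>(1)[of n] by (simp add: normal_density_def real_sqrt_mult real_sqrt_divide power_divide field_simps)
    have "(\<integral>u. F2 u \<partial>G) = (\<integral>u. \<sigma> n / sqrt (2 * pi) * (F2 u * exp (- ((\<sigma> n)\<^sup>2 * u\<^sup>2) / 2)) \<partial>lborel)"
      unfolding G_def using \<sigma>(1)[of n] by (subst integral_real_density) (auto simp: nd mult_ac intro!: AE_I2)
    also have "\<dots> = \<sigma> n / sqrt (2 * pi) * (\<integral>u. F2 u * exp (- ((\<sigma> n)\<^sup>2 * u\<^sup>2) / 2) \<partial>lborel)" by simp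
    finally have 1: "2 * pi * (\<integral>u. F2 u \<partial>G) = \<sigma> n * sqrt (2 * pi) * (\<integral>u. F2 u * exp (- ((\<sigma> n)\<^sup>2 * u\<^sup>2) / 2) \<partial>lborel)"
    proof -
      assume J: "(\<integral>u. F2 u \<partial>G) = \<sigma> n / sqrt (2 * pi) * (\<integral>u. F2 u * exp (- ((\<sigma> n)\<^sup>2 * u\<^sup>2) / 2) \<partial>lborel)"
      have sq2: "sqrt (2 * pi) * sqrt (2 * pi) = 2 * pi" by simp
      have "r * r * (a / r * b) = a * r * b" if "r > 0" for a b r :: real using that by simp
      from this[of "sqrt (2 * pi)", unfolded sq2] show ?thesis unfolding J by simp
    qed
    have "of_real (2 * pi * (\<integral>u. F2 u \<partial>G)) = of_real (\<sigma> n * sqrt (2 * pi)) * (CLINT w|std_normal_distribution. C (\<sigma> n * w))"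
      unfolding F2_def G_def C_def
      by (subst gaussian_weighted_fourier_L1[OF _ L1]) (use \<sigma>(1)[of n] gaussian_autocorrelation[OF _ sq L1, of "\<sigma> n"] in auto)
    then have "Re (of_real (2 * pi * (\<integral>u. F2 u \<partial>G))) = Re (of_real (\<sigma> n * sqrt (2 * pi)) * (CLINT w|std_normal_distribution. C (\<sigma> n * w)))"
      by (rule arg_cong)
    then have 2: "2 * pi * (\<integral>u. F2 u \<partial>G) = \<sigma> n * sqrt (2 * pi) * Re (CLINT w|std_normal_distribution. C (\<sigma> n * w))"
      unfolding Re_complex_of_real times_complex.sel Im_complex_of_real by simp
    have "integrable std_normal_distribution (\<lambda>w. C (\<sigma> n * w))"
      by (rule N.integrable_const_bound[of _ E]) (auto simp: Ci)
    then have "Re (CLINT w|std_normal_distribution. C (\<sigma> n * w)) = (\<integral>w. Re (C (\<sigma> n * w)) \<partial>std_normal_distribution)" by simp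
    with 1 2 \<sigma>(1)[of n] show ?thesis by simp
  qed
  have "(\<lambda>n. \<integral>w. Re (C (\<sigma> n * w)) \<partial>std_normal_distribution) \<longlonglongrightarrow> (\<integral>w. E \<partial>std_normal_distribution)"
  proof (rule integral_dominated_convergence[where w = "\<lambda>_. E"])
    show "AE w in std_normal_distribution. (\<lambda>n. Re (C (\<sigma> n * w))) \<longlonglongrightarrow> E"
    proof (rule AE_I2)
      fix w
      have "(\<lambda>n. \<sigma> n * w) \<longlonglongrightarrow> 0" using tendsto_mult_right[OF \<sigma>(2), of w] by simp
      from L2_translation_continuous[OF _ sq this] have "(\<lambda>n. D (\<sigma> n * w)) \<longlonglongrightarrow> 0" by (simp add: D_def)
      then have "(\<lambda>n. E - D (\<sigma> n * w) / 2) \<longlonglongrightarrow> E - 0 / 2" by (intro tendsto_intros) auto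
      then show "(\<lambda>n. Re (C (\<sigma> n * w))) \<longlonglongrightarrow> E" by (simp add: ReC)
    qed
    show "AE w in std_normal_distribution. norm (Re (C (\<sigma> n * w))) \<le> E" for n
      by (intro AE_I2) (metis Ci abs_Re_le_cmod order_trans real_norm_def)
  qed auto
  then have lim: "(\<lambda>n. \<integral>u. F2 u * exp (- ((\<sigma> n)\<^sup>2 * u\<^sup>2) / 2) \<partial>lborel) \<longlonglongrightarrow> E"
    unfolding main using N.prob_space[simplified] by simp
  have int: "integrable lborel (\<lambda>u. F2 u * exp (- ((\<sigma> n)\<^sup>2 * u\<^sup>2) / 2))" for n
  proof -
    define B where "B = ((1 / sqrt (2 * pi)) * (\<integral>x. norm (\<phi> x) \<partial>lborel))\<^sup>2"
    have nd: "exp (- ((\<sigma> n)\<^sup>2 * u\<^sup>2) / 2) = sqrt (2 * pi) / \<sigma> n * normal_density 0 (1 / \<sigma> n) u" for u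
      using \<sigma>(1)[of n] by (simp add: normal_density_def real_sqrt_mult real_sqrt_divide power_divide field_simps)
    have "integrable lborel (\<lambda>u. B * exp (- ((\<sigma> n)\<^sup>2 * u\<^sup>2) / 2))"
      unfolding nd using \<sigma>(1)[of n] by (intro integrable_mult_right integrable_normal_density) auto
    then show ?thesis
      by (rule Bochner_Integration.integrable_bound)
        (use F2b in \<open>auto simp: abs_mult F2_def B_def intro!: AE_I2 mult_right_mono\<close>)
  qed
  have "(\<lambda>n. \<integral>\<^sup>+u. ennreal (F2 u * exp (- ((\<sigma> n)\<^sup>2 * u\<^sup>2) / 2)) \<partial>lborel) \<longlonglongrightarrow> (\<integral>\<^sup>+u. ennreal (F2 u) \<partial>lborel)"
  proof (rule nn_integral_LIMSEQ)
    show "incseq (\<lambda>n u. ennreal (F2 u * exp (- ((\<sigma> n)\<^sup>2 * u\<^sup>2) / 2)))"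
    proof (intro incseq_SucI le_funI ennreal_leI mult_left_mono)
      fix n u
      have "(\<sigma> (Suc n))\<^sup>2 \<le> (\<sigma> n)\<^sup>2" by (intro power_mono) (auto simp: \<sigma>_def frac_le)
      then show "exp (- ((\<sigma> n)\<^sup>2 * u\<^sup>2) / 2) \<le> exp (- ((\<sigma> (Suc n))\<^sup>2 * u\<^sup>2) / 2)"
        by (simp add: mult_right_mono)
    qed (simp add: F2_def)
    fix u
    have "(\<lambda>n. F2 u * exp (- ((\<sigma> n)\<^sup>2 * u\<^sup>2) / 2)) \<longlonglongrightarrow> F2 u * exp (- (0\<^sup>2 * u\<^sup>2) / 2)"
      by (intro tendsto_intros \<sigma>) simp
    then show "(\<lambda>n. ennreal (F2 u * exp (- ((\<sigma> n)\<^sup>2 * u\<^sup>2) / 2))) \<longlonglongrightarrow> ennreal (F2 u)" by (intro tendsto_ennrealI) simp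
  qed auto
  moreover have "(\<lambda>n. \<integral>\<^sup>+u. ennreal (F2 u * exp (- ((\<sigma> n)\<^sup>2 * u\<^sup>2) / 2)) \<partial>lborel) \<longlonglongrightarrow> ennreal E"
    using lim by (subst nn_integral_eq_integral[OF int]) (auto simp: F2_def intro: tendsto_ennrealI)
  ultimately have nn: "(\<integral>\<^sup>+u. ennreal (F2 u) \<partial>lborel) = ennreal E" by (rule LIMSEQ_unique)
  then have F2i: "integrable lborel F2" by (simp add: integrable_iff_bounded F2_def[abs_def])
  moreover have "(\<integral>u. F2 u \<partial>lborel) = E"
  proof -
    have "ennreal (\<integral>u. F2 u \<partial>lborel) = ennreal E"
      using nn nn_integral_eq_integral[OF F2i] F20 by simp
    then show ?thesis using F20 by (subst (asm) ennreal_inj) (auto simp: E_def)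
  qed
  ultimately show "integrable lborel (\<lambda>u. (norm (fourier_L1 \<phi> u))\<^sup>2)"
    and "(\<integral>u. (norm (fourier_L1 \<phi> u))\<^sup>2 \<partial>lborel) = (\<integral>x. (norm (\<phi> x))\<^sup>2 \<partial>lborel)"
    unfolding F2_def[abs_def] E_def by blast+
qed

lemma integrable_truncation:
  fixes f :: "real \<Rightarrow> complex"
  assumes [measurable]: "f \<in> borel_measurable borel" and sq: "integrable lborel (\<lambda>x. (norm (f x))\<^sup>2)"
  shows "integrable lborel (\<lambda>x. indicator {a..b} x *\<^sub>R f x)"
proof (rule Bochner_Integration.integrable_bound[of _ "\<lambda>x. indicator {a..b} x + (norm (f x))\<^sup>2"])
  show "integrable lborel (\<lambda>x. indicator {a..b} x + (norm (f x))\<^sup>2)"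
    by (intro Bochner_Integration.integrable_add integrable_real_indicator sq) (auto simp: emeasure_lborel_Icc_eq)
  have "a \<le> 1 + a\<^sup>2" for a :: real
  proof -
    have "0 \<le> (a - 1)\<^sup>2 + a\<^sup>2 + 1" by simp
    then show ?thesis by (simp add: power2_diff)
  qed
  then show "AE x in lborel. norm (indicator {a..b} x *\<^sub>R f x) \<le> norm (indicator {a..b} x + (norm (f x))\<^sup>2)"
    by (intro AE_I2) (auto simp: indicator_def)
qed simp

text \<open>The truncations of \<open>f\<close> lie in \<open>L1\<close> and in \<open>L2\<close>,
  and both norms converge along them: on the side of \<open>f\<close> by dominated convergence, on
  the side of \<open>g\<close> by the definition of the transform.\<close>

lemma has_fourier_transform_plancherel:
  assumes FT: "has_fourier_transform f g"
  shows "integrable lborel (\<lambda>u. (norm (g u))\<^sup>2)"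
    and "(\<integral>u. (norm (g u))\<^sup>2 \<partial>lborel) = (\<integral>x. (norm (f x))\<^sup>2 \<partial>lborel)"
proof -
  from FT have [measurable]: "f \<in> borel_measurable borel" "g \<in> borel_measurable borel"
    and sq: "integrable lborel (\<lambda>x. (norm (f x))\<^sup>2)" by (auto simp: has_fourier_transform_def)
  define f' where "f' n x = indicator {- real n..real n} x *\<^sub>R f x" for n x
  have [measurable]: "f' n \<in> borel_measurable borel" for n unfolding f'_def[abs_def] by measurable
  have f'1: "integrable lborel (f' n)" for n
    unfolding f'_def[abs_def] by (rule integrable_truncation[OF _ sq]) simp
  have le: "(norm (f' n x))\<^sup>2 \<le> (norm (f x))\<^sup>2" for n x by (auto simp: f'_def indicator_def)
  have f'2: "integrable lborel (\<lambda>x. (norm (f' n x))\<^sup>2)" for n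
    by (rule Bochner_Integration.integrable_bound[OF sq]) (auto simp: le)
  have "(1 / sqrt (2 * pi)) *\<^sub>R (CLINT x:{- real n..real n}|lborel. exp (- \<i> * of_real (u * x)) * f x)
      = fourier_L1 (f' n) u" for n u
    by (simp add: fourier_L1_def set_lebesgue_integral_def f'_def)
  with FT have lim: "(\<lambda>n. \<integral>\<^sup>+u. ennreal ((norm (fourier_L1 (f' n) u - g u))\<^sup>2) \<partial>lborel) \<longlonglongrightarrow> 0"
    by (simp add: has_fourier_transform_def)
  note P = plancherel_L1_L2[OF _ f'2 f'1]
  note L2 = L2_norm_tendsto[OF _ _ P(1) lim]
  show "integrable lborel (\<lambda>u. (norm (g u))\<^sup>2)" by (rule L2(1)) auto
  have "(\<lambda>n. \<integral>x. (norm (f' n x))\<^sup>2 \<partial>lborel) \<longlonglongrightarrow> (\<integral>x. (norm (f x))\<^sup>2 \<partial>lborel)"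
  proof (rule integral_dominated_convergence[OF _ _ sq])
    show "AE x in lborel. (\<lambda>n. (norm (f' n x))\<^sup>2) \<longlonglongrightarrow> (norm (f x))\<^sup>2"
    proof (rule AE_I2)
      fix x
      obtain k0 :: nat where k0: "\<bar>x\<bar> \<le> real k0" using real_arch_simple by blast
      have "\<forall>\<^sub>F k in sequentially. (norm (f' k x))\<^sup>2 = (norm (f x))\<^sup>2"
        using eventually_ge_at_top[of k0] by eventually_elim (use k0 in \<open>auto simp: f'_def indicator_def\<close>)
      then show "(\<lambda>k. (norm (f' k x))\<^sup>2) \<longlonglongrightarrow> (norm (f x))\<^sup>2" by (rule tendsto_eventually)
    qed
  qed (auto simp: le)
  moreover have "(\<lambda>n. \<integral>x. (norm (f' n x))\<^sup>2 \<partial>lborel) \<longlonglongrightarrow> (\<integral>u. (norm (g u))\<^sup>2 \<partial>lborel)"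
    using L2(2) by (simp add: P(2))
  ultimately show "(\<integral>u. (norm (g u))\<^sup>2 \<partial>lborel) = (\<integral>x. (norm (f x))\<^sup>2 \<partial>lborel)"
    by (intro LIMSEQ_unique)
qed

lemma has_fourier_transform_lincomb:
  assumes f: "has_fourier_transform f g" and f': "has_fourier_transform f' g'"
  shows "has_fourier_transform (\<lambda>x. a *\<^sub>R f x + b *\<^sub>R f' x) (\<lambda>u. a *\<^sub>R g u + b *\<^sub>R g' u)"
proof -
  from f f' have [measurable]: "f \<in> borel_measurable borel" "g \<in> borel_measurable borel"
      "f' \<in> borel_measurable borel" "g' \<in> borel_measurable borel"
    and sq: "integrable lborel (\<lambda>x. (norm (f x))\<^sup>2)" "integrable lborel (\<lambda>x. (norm (f' x))\<^sup>2)"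
    by (auto simp: has_fourier_transform_def)
  define F where "F h n u = (1 / sqrt (2 * pi)) *\<^sub>R (CLINT x:{- real n..real n}|lborel. exp (- \<i> * of_real (u * x)) * h x)"
    for h n u
  have Fm[measurable]: "F h n \<in> borel_measurable borel" if [measurable]: "h \<in> borel_measurable borel" for h n
    unfolding F_def[abs_def] set_lebesgue_integral_def by measurable
  have si: "set_integrable lborel {- real n..real n} (\<lambda>x. exp (- \<i> * of_real (u * x)) * h x)"
    if [measurable]: "h \<in> borel_measurable borel" and "integrable lborel (\<lambda>x. (norm (h x))\<^sup>2)" for h n u
    unfolding set_integrable_def
    by (rule Bochner_Integration.integrable_bound[OF integrable_truncation[OF that, of "- real n" "real n"]])
      (auto simp: norm_mult)
  have Flin: "F (\<lambda>x. a *\<^sub>R f x + b *\<^sub>R f' x) n u = a *\<^sub>R F f n u + b *\<^sub>R F f' n u" for n u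
  proof -
    have "(CLINT x:{- real n..real n}|lborel. exp (- \<i> * of_real (u * x)) * (a *\<^sub>R f x + b *\<^sub>R f' x))
        = (CLINT x:{- real n..real n}|lborel. a *\<^sub>R (exp (- \<i> * of_real (u * x)) * f x) + b *\<^sub>R (exp (- \<i> * of_real (u * x)) * f' x))"
      by (simp add: algebra_simps)
    also have "\<dots> = a *\<^sub>R (CLINT x:{- real n..real n}|lborel. exp (- \<i> * of_real (u * x)) * f x)
        + b *\<^sub>R (CLINT x:{- real n..real n}|lborel. exp (- \<i> * of_real (u * x)) * f' x)"
      using si[OF _ sq(1), of n u] si[OF _ sq(2), of n u]
      by (subst set_integral_add(2)) (auto intro!: set_integrable_scaleR_right)
    finally show ?thesis by (simp add: F_def algebra_simps)
  qed
  have e: "a *\<^sub>R p + b *\<^sub>R q - (a *\<^sub>R p' + b *\<^sub>R q') = a *\<^sub>R (p - p') + b *\<^sub>R (q - q')" for p q p' q' :: complex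
    by (simp add: algebra_simps)
  from f f' have l: "(\<lambda>n. \<integral>\<^sup>+u. ennreal ((norm (F f n u - g u))\<^sup>2) \<partial>lborel) \<longlonglongrightarrow> 0"
    "(\<lambda>n. \<integral>\<^sup>+u. ennreal ((norm (F f' n u - g' u))\<^sup>2) \<partial>lborel) \<longlonglongrightarrow> 0"
    by (auto simp: has_fourier_transform_def F_def)
  have "(\<lambda>n. \<integral>\<^sup>+u. ennreal ((norm (F (\<lambda>x. a *\<^sub>R f x + b *\<^sub>R f' x) n u - (a *\<^sub>R g u + b *\<^sub>R g' u)))\<^sup>2) \<partial>lborel) \<longlonglongrightarrow> 0"
    unfolding Flin e by (intro tendsto_L2_lincomb l) auto
  then show ?thesis
    using integrable_L2_lincomb[OF _ _ sq, of a b] by (auto simp: has_fourier_transform_def F_def)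
qed

lemma has_spectral_integral_lincomb:
  assumes W: "\<And>t. W t \<in> borel_measurable M"
    and "has_spectral_integral M W f X" "has_spectral_integral M W g Y"
  shows "has_spectral_integral M W (\<lambda>u. a *\<^sub>R f u + b *\<^sub>R g u) (\<lambda>w. a *\<^sub>R X w + b *\<^sub>R Y w)"
  using assms(2,3) has_fourier_transform_lincomb has_wiener_integral_lincomb[where W = W, OF W]
  unfolding has_spectral_integral_def by blast

text \<open>As the integral is real, the imaginary part of the transform of the integrand vanishes,
  because its Wiener integral has variance \<open>0\<close>.\<close>

lemma has_spectral_integral_iexp:
  fixes X :: "'a \<Rightarrow> real"
  assumes BM: "std_brownian_motion M W" and I: "has_spectral_integral M W f (\<lambda>w. complex_of_real (X w))"
  shows "f \<in> borel_measurable borel" and "integrable lborel (\<lambda>u. (norm (f u))\<^sup>2)"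
    and "(CLINT w|M. iexp (X w)) = of_real (exp (- (\<integral>u. (norm (f u))\<^sup>2 \<partial>lborel) / 2))"
proof -
  interpret prob_space M using BM by (simp add: std_brownian_motion_def)
  have W: "W t \<in> borel_measurable M" for t using BM by (simp add: std_brownian_motion_def)
  from I obtain g where FT: "has_fourier_transform f g"
    and wi: "has_wiener_integral M W UNIV g (\<lambda>w. complex_of_real (X w))"
    by (auto simp: has_spectral_integral_def)
  from FT show "f \<in> borel_measurable borel" "integrable lborel (\<lambda>u. (norm (f u))\<^sup>2)"
    by (auto simp: has_fourier_transform_def)
  have linear: "linear Re" "linear Im" by (auto intro!: linearI)
  have "has_wiener_integral M W UNIV (\<lambda>u. Re (g u)) X" "has_wiener_integral M W UNIV (\<lambda>u. Im (g u)) (\<lambda>_. 0)"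
    using has_wiener_integral_contraction[OF W wi linear(1)] has_wiener_integral_contraction[OF W wi linear(2)]
    by (auto simp: abs_Re_le_cmod abs_Im_le_cmod)
  note R = has_wiener_integral_iexp[OF BM this(1)] and I = has_wiener_integral_iexp[OF BM this(2)]
  have "of_real (exp (- (\<integral>u. (Im (g u))\<^sup>2 \<partial>lborel) / 2)) = (1 :: complex)"
    using I(2) by (simp add: prob_space)
  then have "(\<integral>u. (Im (g u))\<^sup>2 \<partial>lborel) = 0" by simp
  then have "(\<integral>u. (norm (g u))\<^sup>2 \<partial>lborel) = (\<integral>u. (Re (g u))\<^sup>2 \<partial>lborel)"
    using R(1) I(1) by (simp add: cmod_power2)
  with R(2) has_fourier_transform_plancherel(2)[OF FT]
  show "(CLINT w|M. iexp (X w)) = of_real (exp (- (\<integral>u. (norm (f u))\<^sup>2 \<partial>lborel) / 2))" by simp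
qed

section \<open>The harmonizable kernel\<close>

text \<open>The interface between the two representations and the rest of the argument.
  \<open>V h\<close> is the variance at time 1; the representations are normalised differently.
  \<open>hurst_lipschitz\<close> is what controls a Hurst parameter that changes with time.\<close>

locale hurst_kernel =
  fixes k :: "real \<Rightarrow> real \<Rightarrow> real \<Rightarrow> 'c::euclidean_space" and V :: "real \<Rightarrow> real"
  assumes measurable_kernel [measurable]: "k h t \<in> borel_measurable borel"
    and kernel_0: "k h 0 u = 0"
    and square_integrable: "0 < h \<Longrightarrow> h < 1 \<Longrightarrow> 0 \<le> t \<Longrightarrow> integrable lborel (\<lambda>u. (norm (k h t u))\<^sup>2)"
    and increment: "0 < h \<Longrightarrow> h < 1 \<Longrightarrow> 0 \<le> s \<Longrightarrow> 0 \<le> t \<Longrightarrow>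
      (\<integral>u. (norm (k h t u - k h s u))\<^sup>2 \<partial>lborel) = V h * \<bar>t - s\<bar> powr (2 * h)"
    and V_pos: "0 < h \<Longrightarrow> h < 1 \<Longrightarrow> 0 < V h"
    and hurst_lipschitz: "0 < \<mu> \<Longrightarrow> \<mu> \<le> \<nu> \<Longrightarrow> \<nu> < 1 \<Longrightarrow> 0 \<le> T \<Longrightarrow> \<exists>D\<ge>0. \<forall>h\<in>{\<mu>..\<nu>}. \<forall>h'\<in>{\<mu>..\<nu>}. \<forall>t\<in>{0..T}.
      (\<integral>u. (norm (k h t u - k h' t u))\<^sup>2 \<partial>lborel) \<le> D * (h - h')\<^sup>2"

section \<open>Integrals and differences of powers\<close>

lemma powr_integrable_at_0:
  fixes c :: real
  assumes "-1 < c" "0 \<le> b"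
  shows "integrable lborel (\<lambda>x. indicator {0<..b} x * x powr c)"
proof -
  have "(\<lambda>x. x powr c) absolutely_integrable_on {0<..b}"
    by (rule nonnegative_absolutely_integrable_1[OF integrable_on_powr_from_0'[OF assms]]) auto
  then show ?thesis by (simp add: set_integrable_def integrable_completion)
qed

lemma powr_integrable_at_inf:
  fixes c :: real
  assumes "c < -1"
  shows "integrable lborel (\<lambda>x. indicator {1..} x * x powr c)"
proof -
  have "(\<lambda>x. x powr c) integrable_on {1..}"
    using has_integral_powr_to_inf[of c 1] assms unfolding integrable_on_def by auto
  then have "(\<lambda>x. x powr c) absolutely_integrable_on {1..}"
    by (rule nonnegative_absolutely_integrable_1) auto
  then show ?thesis by (simp add: set_integrable_def integrable_completion)
qed

lemma powr_integrable_two_sided: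
  fixes a b :: real
  assumes "-1 < a" "b < -1"
  shows "integrable lborel (\<lambda>x. if \<bar>x\<bar> \<le> 1 then \<bar>x\<bar> powr a else \<bar>x\<bar> powr b)"
proof -
  define g where "g x = indicator {0<..1} x * x powr a + indicator {1..} x * x powr b" for x :: real
  have g: "integrable lborel g" unfolding g_def
    using powr_integrable_at_0[of a 1] powr_integrable_at_inf[of b] assms by simp
  then have g': "integrable lborel (\<lambda>x. g (- x))"
    using lborel_integrable_real_affine[of g "-1" 0] by simp
  show ?thesis
  proof (rule Bochner_Integration.integrable_bound[OF Bochner_Integration.integrable_add[OF g g']])
    have g0: "0 \<le> g x" for x by (simp add: g_def)
    have "\<bar>if \<bar>x\<bar> \<le> 1 then \<bar>x\<bar> powr a else \<bar>x\<bar> powr b\<bar> \<le> g x + g (- x)" for x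
    proof (cases x "0 :: real" rule: linorder_cases)
      case less
      then have "\<bar>if \<bar>x\<bar> \<le> 1 then \<bar>x\<bar> powr a else \<bar>x\<bar> powr b\<bar> \<le> g (- x)" by (auto simp: g_def indicator_def)
      then show ?thesis using g0[of x] by linarith
    next
      case greater
      then have "\<bar>if \<bar>x\<bar> \<le> 1 then \<bar>x\<bar> powr a else \<bar>x\<bar> powr b\<bar> \<le> g x" by (auto simp: g_def indicator_def)
      then show ?thesis using g0[of "- x"] by linarith
    qed (simp add: g0)
    then show "AE x in lborel. norm (if \<bar>x\<bar> \<le> 1 then \<bar>x\<bar> powr a else \<bar>x\<bar> powr b) \<le> norm (g x + g (- x))"
      by (intro AE_I2) (use g0 in \<open>auto intro!: order_trans[OF _ abs_ge_self]\<close>)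
  qed measurable
qed

text \<open>The power with the smaller exponent dominates below 1, the one with the larger exponent
  above 1; each factor is at most twice its dominating power.\<close>

lemma powr_add_half_le:
  fixes x :: real
  assumes "0 < x" "0 < \<eta>" "a \<le> b"
  shows "(x powr (- \<eta>) + x powr \<eta>) * (x powr a + x powr b) \<le> 4 * (x powr (a - \<eta>) + x powr (b + \<eta>))"
proof (cases "x \<le> 1")
  case True
  then have "x powr \<eta> \<le> x powr (- \<eta>)" "x powr b \<le> x powr a" using assms by (auto intro: powr_mono')
  then have "(x powr (- \<eta>) + x powr \<eta>) * (x powr a + x powr b) \<le> (2 * x powr (- \<eta>)) * (2 * x powr a)"
    by (intro mult_mono) auto
  also have "\<dots> = 4 * x powr (a - \<eta>)" using assms by (simp flip: powr_add)
  finally show ?thesis by (smt (verit) powr_ge_zero)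
next
  case False
  then have "x powr (- \<eta>) \<le> x powr \<eta>" "x powr a \<le> x powr b" using assms by (auto intro: powr_mono)
  then have "(x powr (- \<eta>) + x powr \<eta>) * (x powr a + x powr b) \<le> (2 * x powr \<eta>) * (2 * x powr b)"
    by (intro mult_mono) auto
  also have "\<dots> = 4 * x powr (b + \<eta>)" using assms by (simp add: add.commute flip: powr_add)
  finally show ?thesis by (smt (verit) powr_ge_zero)
qed

text \<open>The mean value theorem in the exponent produces \<open>ln x\<close>, which is absorbed
  by a small power on either side: the interval of exponents is enlarged by \<eta>, at the price of
  the factor \<open>4 / \<eta>\<close>.\<close>

lemma powr_exponent_lipschitz:
  fixes x :: real
  assumes x: "0 < x" and ab: "a \<in> {a0..a1}" "b \<in> {a0..a1}" and \<eta>: "0 < \<eta>"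
  shows "\<bar>x powr a - x powr b\<bar> \<le> \<bar>a - b\<bar> * (4 / \<eta> * (x powr (a0 - \<eta>) + x powr (a1 + \<eta>)))"
proof -
  have main: "\<bar>x powr b - x powr a\<bar> \<le> \<bar>a - b\<bar> * (4 / \<eta> * (x powr (a0 - \<eta>) + x powr (a1 + \<eta>)))"
    if ab: "a \<in> {a0..a1}" "b \<in> {a0..a1}" and "a < b" for a b
  proof -
    have "\<exists>z. a < z \<and> z < b \<and> x powr b - x powr a = (b - a) * (x powr z * ln x)"
      using x by (intro MVT2 \<open>a < b\<close>) (auto intro!: derivative_eq_intros)
    then obtain z where z: "a < z" "z < b" "x powr b - x powr a = (b - a) * (x powr z * ln x)" by blast
    have 1: "x powr z \<le> x powr a0 + x powr a1"
    proof (cases "x \<le> 1")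
      case True
      then have "x powr z \<le> x powr a0" using z ab x by (intro powr_mono') auto
      then show ?thesis by (smt (verit) powr_ge_zero)
    next
      case False
      then have "x powr z \<le> x powr a1" using z ab x by (intro powr_mono) auto
      then show ?thesis by (smt (verit) powr_ge_zero)
    qed
    have 2: "\<bar>ln x\<bar> \<le> (x powr (- \<eta>) + x powr \<eta>) / \<eta>"
    proof -
      have "\<eta> * ln x \<le> x powr \<eta>" "- \<eta> * ln x \<le> x powr (- \<eta>)"
        using ln_le_minus_one[of "x powr \<eta>"] ln_le_minus_one[of "x powr (- \<eta>)"] x by (auto simp: ln_powr)
      then have "\<eta> * \<bar>ln x\<bar> \<le> x powr (- \<eta>) + x powr \<eta>"
        using powr_ge_zero[of x \<eta>] powr_ge_zero[of x "- \<eta>"]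
        by (cases "ln x < 0") (auto simp: abs_if simp del: powr_ge_zero)
      then show ?thesis using \<eta> by (simp add: field_simps)
    qed
    have "x powr z * \<bar>ln x\<bar> \<le> (x powr a0 + x powr a1) * ((x powr (- \<eta>) + x powr \<eta>) / \<eta>)"
      by (intro mult_mono 1 2) auto
    also have "\<dots> = (x powr (- \<eta>) + x powr \<eta>) * (x powr a0 + x powr a1) / \<eta>" by simp
    also have "\<dots> \<le> 4 * (x powr (a0 - \<eta>) + x powr (a1 + \<eta>)) / \<eta>"
      using \<eta> x ab by (intro divide_right_mono powr_add_half_le) auto
    finally have "\<bar>b - a\<bar> * (x powr z * \<bar>ln x\<bar>) \<le> \<bar>b - a\<bar> * (4 * (x powr (a0 - \<eta>) + x powr (a1 + \<eta>)) / \<eta>)"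
      by (intro mult_left_mono) auto
    then show ?thesis by (simp add: z(3) abs_mult abs_minus_commute)
  qed
  show ?thesis
    using main[of a b] main[of b a] ab by (cases a b rule: linorder_cases) (auto simp: abs_minus_commute)
qed

section \<open>Scaling and regularity of the harmonizable kernel\<close>

definition harmonizable_kernel :: "real \<Rightarrow> real \<Rightarrow> real \<Rightarrow> complex" where
  "harmonizable_kernel h t \<xi> = (exp (\<i> * of_real (t * \<xi>)) - 1) / of_real (\<bar>\<xi>\<bar> powr (h + 1/2))"

lemma harmonizable_kernel_alt:
  "harmonizable_kernel h t \<xi> = (iexp (t * \<xi>) - 1) * of_real (\<bar>\<xi>\<bar> powr (- h - 1/2))"
proof -
  have e: "- h - 1/2 = - (h + 1/2)" by simp
  show ?thesis unfolding harmonizable_kernel_def e powr_minus by (simp only: divide_inverse of_real_inverse)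
qed

lemma norm_harmonizable_kernel_power2:
  "(norm (harmonizable_kernel h t \<xi>))\<^sup>2 = (norm (iexp (t * \<xi>) - 1))\<^sup>2 * \<bar>\<xi>\<bar> powr (- 2 * h - 1)"
proof -
  have e: "- 2 * h - 1 = (- h - 1/2) + (- h - 1/2)" by simp
  show ?thesis
    unfolding harmonizable_kernel_alt norm_mult norm_of_real power_mult_distrib power2_abs e powr_add
    by (simp only: power2_eq_square)
qed

lemma borel_measurable_harmonizable_kernel [measurable]: "harmonizable_kernel h t \<in> borel_measurable borel"
  unfolding harmonizable_kernel_def[abs_def] by measurable

text \<open>Near 0 the numerator is at most \<open>\<bar>t * \<xi>\<bar>\<close>, which leaves the
  exponent \<open>1 - 2 * h > - 1\<close>; for large frequencies it is at most 2, which leaves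
  \<open>- 2 * h - 1 < - 1\<close>.\<close>

lemma harmonizable_kernel_square_integrable:
  assumes "0 < h" "h < 1"
  shows "integrable lborel (\<lambda>\<xi>. (norm (harmonizable_kernel h t \<xi>))\<^sup>2)"
proof -
  define w where "w x = (if \<bar>x\<bar> \<le> 1 then \<bar>x\<bar> powr (1 - 2 * h) else \<bar>x\<bar> powr (- 2 * h - 1))" for x :: real
  have "integrable lborel w" unfolding w_def using assms by (intro powr_integrable_two_sided) auto
  then have "integrable lborel (\<lambda>x. (t\<^sup>2 + 4) * w x)" by (rule integrable_mult_right)
  then show ?thesis
  proof (rule Bochner_Integration.integrable_bound)
    have "(norm (harmonizable_kernel h t \<xi>))\<^sup>2 \<le> (t\<^sup>2 + 4) * w \<xi>" for \<xi>
    proof (cases "\<bar>\<xi>\<bar> \<le> 1")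
      case True
      have "norm (iexp (t * \<xi>) - 1) \<le> \<bar>t * \<xi>\<bar>" using norm_iexp_diff_le[of "t * \<xi>" 0] by simp
      then have "(norm (iexp (t * \<xi>) - 1))\<^sup>2 \<le> \<bar>t * \<xi>\<bar>\<^sup>2" by (intro power_mono) auto
      then have "(norm (harmonizable_kernel h t \<xi>))\<^sup>2 \<le> \<bar>t * \<xi>\<bar>\<^sup>2 * \<bar>\<xi>\<bar> powr (- 2 * h - 1)"
        unfolding norm_harmonizable_kernel_power2 by (rule mult_right_mono) simp
      also have "\<dots> = t\<^sup>2 * (\<bar>\<xi>\<bar>\<^sup>2 * \<bar>\<xi>\<bar> powr (- 2 * h - 1))" by (simp add: power_mult_distrib)
      also have "\<bar>\<xi>\<bar>\<^sup>2 * \<bar>\<xi>\<bar> powr (- 2 * h - 1) = w \<xi>"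
      proof (cases "\<xi> = 0")
        case False
        then have "\<bar>\<xi>\<bar>\<^sup>2 = \<bar>\<xi>\<bar> powr 2" by simp
        then show ?thesis using True by (simp only: w_def flip: powr_add) simp
      qed (simp add: w_def)
      also have "t\<^sup>2 * w \<xi> \<le> (t\<^sup>2 + 4) * w \<xi>" by (intro mult_right_mono) (auto simp: w_def)
      finally show ?thesis .
    next
      case False
      have "norm (iexp (t * \<xi>) - 1) \<le> 2" using norm_triangle_ineq4[of "iexp (t * \<xi>)" 1] by simp
      then have "(norm (iexp (t * \<xi>) - 1))\<^sup>2 \<le> 2\<^sup>2" by (intro power_mono) auto
      then have "(norm (harmonizable_kernel h t \<xi>))\<^sup>2 \<le> 4 * w \<xi>"
        unfolding norm_harmonizable_kernel_power2 using False by (auto simp: w_def intro!: mult_right_mono)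
      also have "\<dots> \<le> (t\<^sup>2 + 4) * w \<xi>" by (intro mult_right_mono) (auto simp: w_def)
      finally show ?thesis .
    qed
    then show "AE \<xi> in lborel. norm ((norm (harmonizable_kernel h t \<xi>))\<^sup>2) \<le> norm ((t\<^sup>2 + 4) * w \<xi>)"
      by (auto intro!: AE_I2 intro: order_trans[OF _ abs_ge_self])
  qed measurable
qed

lemma harmonizable_kernel_scale:
  assumes "c \<noteq> 0"
  shows "(\<integral>\<xi>. (norm (harmonizable_kernel h c \<xi>))\<^sup>2 \<partial>lborel)
    = \<bar>c\<bar> powr (2 * h) * (\<integral>\<xi>. (norm (harmonizable_kernel h 1 \<xi>))\<^sup>2 \<partial>lborel)"
proof -
  have "(\<integral>\<xi>. (norm (harmonizable_kernel h c \<xi>))\<^sup>2 \<partial>lborel)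
      = \<bar>1 / c\<bar> * (\<integral>\<xi>. (norm (harmonizable_kernel h c (0 + 1 / c * \<xi>)))\<^sup>2 \<partial>lborel)"
    using lborel_integral_real_affine[of "1 / c" "\<lambda>\<xi>. (norm (harmonizable_kernel h c \<xi>))\<^sup>2" 0] assms by simp
  also have "(\<lambda>\<xi>. (norm (harmonizable_kernel h c (0 + 1 / c * \<xi>)))\<^sup>2)
      = (\<lambda>\<xi>. \<bar>c\<bar> powr (2 * h + 1) * (norm (harmonizable_kernel h 1 \<xi>))\<^sup>2)"
  proof
    fix \<xi>
    have "\<bar>1 / c * \<xi>\<bar> powr (- 2 * h - 1) = \<bar>c\<bar> powr (2 * h + 1) * \<bar>\<xi>\<bar> powr (- 2 * h - 1)"
    proof -
      have "\<bar>1 / c * \<xi>\<bar> = \<bar>\<xi>\<bar> / \<bar>c\<bar>" by (simp add: abs_divide)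
      then have "\<bar>1 / c * \<xi>\<bar> powr (- 2 * h - 1) = \<bar>\<xi>\<bar> powr (- 2 * h - 1) / \<bar>c\<bar> powr (- 2 * h - 1)"
        by (simp add: powr_divide)
      also have "\<bar>c\<bar> powr (- 2 * h - 1) = inverse (\<bar>c\<bar> powr (2 * h + 1))" by (simp flip: powr_minus)
      finally show ?thesis by (simp add: divide_inverse mult.commute)
    qed
    then show "(norm (harmonizable_kernel h c (0 + 1 / c * \<xi>)))\<^sup>2 = \<bar>c\<bar> powr (2 * h + 1) * (norm (harmonizable_kernel h 1 \<xi>))\<^sup>2"
      unfolding norm_harmonizable_kernel_power2 using assms by simp
  qed
  also have "\<bar>1 / c\<bar> * (\<integral>\<xi>. \<bar>c\<bar> powr (2 * h + 1) * (norm (harmonizable_kernel h 1 \<xi>))\<^sup>2 \<partial>lborel)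
      = \<bar>c\<bar> powr (2 * h) * (\<integral>\<xi>. (norm (harmonizable_kernel h 1 \<xi>))\<^sup>2 \<partial>lborel)"
    using assms by (simp add: powr_add abs_divide)
  finally show ?thesis .
qed

text \<open>The increment is the kernel at time \<open>t - s\<close> times the unimodular factor
  \<open>iexp (s * \<xi>)\<close>; this is the stationarity of the increments.\<close>

lemma harmonizable_kernel_increment:
  "(norm (harmonizable_kernel h t \<xi> - harmonizable_kernel h s \<xi>))\<^sup>2 = (norm (harmonizable_kernel h (t - s) \<xi>))\<^sup>2"
proof -
  have "harmonizable_kernel h t \<xi> - harmonizable_kernel h s \<xi> = iexp (s * \<xi>) * harmonizable_kernel h (t - s) \<xi>"
  proof -
    have "iexp (t * \<xi>) = iexp (s * \<xi>) * iexp ((t - s) * \<xi>)" by (simp add: algebra_simps flip: exp_add)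
    then show ?thesis unfolding harmonizable_kernel_def by (simp add: algebra_simps diff_divide_distrib)
  qed
  then show ?thesis by (simp add: norm_mult)
qed

text \<open>The powers that dominate the difference belong again to kernels, with parameters
  \<open>\<nu> + \<eta>\<close> and \<open>\<mu> - \<eta>\<close>, so their square integrability is
  available. The constant 32 is \<open>4\<^sup>2\<close> from the Lipschitz bound times 2 from
  squaring a sum.\<close>

lemma harmonizable_kernel_hurst_diff:
  assumes h: "h \<in> {\<mu>..\<nu>}" "h' \<in> {\<mu>..\<nu>}" and "0 < \<eta>"
  shows "(norm (harmonizable_kernel h t \<xi> - harmonizable_kernel h' t \<xi>))\<^sup>2
    \<le> (h - h')\<^sup>2 * (32 / \<eta>\<^sup>2 * ((norm (harmonizable_kernel (\<nu> + \<eta>) t \<xi>))\<^sup>2 + (norm (harmonizable_kernel (\<mu> - \<eta>) t \<xi>))\<^sup>2))"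
proof (cases "\<xi> = 0")
  case False
  define x where "x = \<bar>\<xi>\<bar>"
  have x: "x > 0" using False by (simp add: x_def)
  define e where "e = norm (iexp (t * \<xi>) - 1)"
  have "harmonizable_kernel h t \<xi> - harmonizable_kernel h' t \<xi>
      = (iexp (t * \<xi>) - 1) * of_real (x powr (- h - 1/2) - x powr (- h' - 1/2))"
    unfolding harmonizable_kernel_alt x_def[symmetric] of_real_diff right_diff_distrib ..
  then have "norm (harmonizable_kernel h t \<xi> - harmonizable_kernel h' t \<xi>) = e * \<bar>x powr (- h - 1/2) - x powr (- h' - 1/2)\<bar>"
    by (simp only: norm_mult norm_of_real e_def)
  also have "\<dots> \<le> e * (\<bar>(- h - 1/2) - (- h' - 1/2)\<bar> * (4 / \<eta> * (x powr ((- \<nu> - 1/2) - \<eta>) + x powr ((- \<mu> - 1/2) + \<eta>))))"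
    using h by (intro mult_left_mono powr_exponent_lipschitz x \<open>0 < \<eta>\<close>) (auto simp: e_def)
  finally have "(norm (harmonizable_kernel h t \<xi> - harmonizable_kernel h' t \<xi>))\<^sup>2
    \<le> (e * (\<bar>(- h - 1/2) - (- h' - 1/2)\<bar> * (4 / \<eta> * (x powr ((- \<nu> - 1/2) - \<eta>) + x powr ((- \<mu> - 1/2) + \<eta>)))))\<^sup>2"
    by (intro power_mono) auto
  also have "\<dots> = (h - h')\<^sup>2 * (16 / \<eta>\<^sup>2 * (e\<^sup>2 * (x powr ((- \<nu> - 1/2) - \<eta>) + x powr ((- \<mu> - 1/2) + \<eta>))\<^sup>2))"
    unfolding power_mult_distrib power_divide by (simp add: power2_commute)
  also have "\<dots> \<le> (h - h')\<^sup>2 * (16 / \<eta>\<^sup>2 * (e\<^sup>2 * (2 * x powr (- 2 * (\<nu> + \<eta>) - 1) + 2 * x powr (- 2 * (\<mu> - \<eta>) - 1))))"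
  proof (intro mult_left_mono)
    have "(x powr ((- \<nu> - 1/2) - \<eta>) + x powr ((- \<mu> - 1/2) + \<eta>))\<^sup>2
        \<le> 2 * (x powr ((- \<nu> - 1/2) - \<eta>))\<^sup>2 + 2 * (x powr ((- \<mu> - 1/2) + \<eta>))\<^sup>2"
      using norm_add_power2_le[of "x powr ((- \<nu> - 1/2) - \<eta>)" "x powr ((- \<mu> - 1/2) + \<eta>)"] by simp
    also have "(x powr ((- \<nu> - 1/2) - \<eta>))\<^sup>2 = x powr (- 2 * (\<nu> + \<eta>) - 1)"
      unfolding power2_eq_square powr_add[symmetric] by (rule arg_cong[where f = "(powr) x"]) simp
    also have "(x powr ((- \<mu> - 1/2) + \<eta>))\<^sup>2 = x powr (- 2 * (\<mu> - \<eta>) - 1)"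
      unfolding power2_eq_square powr_add[symmetric] by (rule arg_cong[where f = "(powr) x"]) simp
    finally show "(x powr ((- \<nu> - 1/2) - \<eta>) + x powr ((- \<mu> - 1/2) + \<eta>))\<^sup>2
        \<le> 2 * x powr (- 2 * (\<nu> + \<eta>) - 1) + 2 * x powr (- 2 * (\<mu> - \<eta>) - 1)" .
  qed auto
  also have "\<dots> = (h - h')\<^sup>2 * (32 / \<eta>\<^sup>2 * ((norm (harmonizable_kernel (\<nu> + \<eta>) t \<xi>))\<^sup>2 + (norm (harmonizable_kernel (\<mu> - \<eta>) t \<xi>))\<^sup>2))"
    unfolding norm_harmonizable_kernel_power2 e_def[symmetric] x_def[symmetric] by (simp add: algebra_simps)
  finally show ?thesis .
qed (simp add: harmonizable_kernel_def)

lemma integrable_L2_diff: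
  fixes p q :: "'s \<Rightarrow> 'b::euclidean_space"
  assumes "p \<in> borel_measurable N" "q \<in> borel_measurable N"
    and "integrable N (\<lambda>u. (norm (p u))\<^sup>2)" "integrable N (\<lambda>u. (norm (q u))\<^sup>2)"
  shows "integrable N (\<lambda>u. (norm (p u - q u))\<^sup>2)"
  using integrable_L2_lincomb[OF assms, of 1 "-1"] by simp

lemma AE_lborel_interval_contradiction:
  assumes "AE x in lborel. P x" and "\<And>x. a < x \<Longrightarrow> x < b \<Longrightarrow> \<not> P x" and "a < (b::real)"
  shows False
proof -
  have "AE x in lborel. x \<notin> {a<..<b}" using assms(1) by eventually_elim (use assms(2) in auto)
  then have "emeasure lborel {a<..<b} = 0" by (subst (asm) AE_iff_null_sets[symmetric]) (auto simp: null_sets_def)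
  then show False using assms(3) by simp
qed

lemma L2_norm_pos:
  fixes g :: "real \<Rightarrow> 'b::euclidean_space"
  assumes "integrable lborel (\<lambda>u. (norm (g u))\<^sup>2)" and "\<And>x. a < x \<Longrightarrow> x < b \<Longrightarrow> g x \<noteq> 0" and "a < b"
  shows "0 < (\<integral>u. (norm (g u))\<^sup>2 \<partial>lborel)"
proof (rule ccontr)
  assume "\<not> ?thesis"
  moreover have "0 \<le> (\<integral>u. (norm (g u))\<^sup>2 \<partial>lborel)" by simp
  ultimately have "(\<integral>u. (norm (g u))\<^sup>2 \<partial>lborel) = 0" by linarith
  then have "AE u in lborel. (norm (g u))\<^sup>2 = 0"
    using assms(1) by (subst (asm) integral_nonneg_eq_0_iff_AE) auto
  then show False by (rule AE_lborel_interval_contradiction[OF _ _ assms(3)]) (use assms(2) in auto)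
qed

lemma hurst_kernel_harmonizable:
  "hurst_kernel harmonizable_kernel (\<lambda>h. \<integral>\<xi>. (norm (harmonizable_kernel h 1 \<xi>))\<^sup>2 \<partial>lborel)"
proof
  fix h :: real assume h: "0 < h" "h < 1"
  show "0 < (\<integral>\<xi>. (norm (harmonizable_kernel h 1 \<xi>))\<^sup>2 \<partial>lborel)"
  proof (rule L2_norm_pos[OF harmonizable_kernel_square_integrable[OF h]])
    fix x :: real assume x: "0 < x" "x < 1"
    \<comment> \<open>On the open unit interval the imaginary part of \<open>iexp x\<close> is
      positive, so the numerator of the kernel does not vanish there.\<close>
    have "sin x > 0" using x pi_gt3 by (intro sin_gt_zero) auto
    then have "Im (iexp x) \<noteq> 0" by (simp add: Im_exp)
    then have "iexp x \<noteq> 1" by (metis one_complex.sel(2))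
    then show "harmonizable_kernel h 1 x \<noteq> 0" using x by (simp add: harmonizable_kernel_def)
  qed simp
next
  fix h s t :: real
  show "(\<integral>u. (norm (harmonizable_kernel h t u - harmonizable_kernel h s u))\<^sup>2 \<partial>lborel)
      = (\<integral>\<xi>. (norm (harmonizable_kernel h 1 \<xi>))\<^sup>2 \<partial>lborel) * \<bar>t - s\<bar> powr (2 * h)"
  proof (cases "t = s")
    case False
    then show ?thesis unfolding harmonizable_kernel_increment
      by (subst harmonizable_kernel_scale) (simp_all add: mult.commute)
  qed simp
next
  fix \<mu> \<nu> T :: real assume a: "0 < \<mu>" "\<mu> \<le> \<nu>" "\<nu> < 1" "0 \<le> T"
  \<comment> \<open>Half the distance of \<open>{\<mu>..\<nu>}\<close> to the endpoints 0 and 1, so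
    that \<open>\<mu> - \<eta>\<close> and \<open>\<nu> + \<eta>\<close> are still admissible Hurst
    parameters.\<close>
  define \<eta> where "\<eta> = min \<mu> (1 - \<nu>) / 2"
  have \<eta>: "0 < \<eta>" "\<nu> + \<eta> < 1" "0 < \<mu> - \<eta>" "0 < \<nu> + \<eta>" "\<mu> - \<eta> < 1" using a by (auto simp: \<eta>_def min_def field_simps)
  define V where "V h = (\<integral>\<xi>. (norm (harmonizable_kernel h 1 \<xi>))\<^sup>2 \<partial>lborel)" for h
  have V0: "0 \<le> V h" for h by (simp add: V_def)
  define D where "D = 32 / \<eta>\<^sup>2 * (V (\<nu> + \<eta>) * (T + 1)\<^sup>2 + V (\<mu> - \<eta>) * (T + 1)\<^sup>2)"
  have int: "integrable lborel (\<lambda>\<xi>. (norm (harmonizable_kernel (\<nu> + \<eta>) t \<xi>))\<^sup>2)"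
    "integrable lborel (\<lambda>\<xi>. (norm (harmonizable_kernel (\<mu> - \<eta>) t \<xi>))\<^sup>2)" for t
    using \<eta> a by (auto intro!: harmonizable_kernel_square_integrable)
  have Vt: "(\<integral>\<xi>. (norm (harmonizable_kernel h t \<xi>))\<^sup>2 \<partial>lborel) \<le> V h * (T + 1)\<^sup>2"
    if "0 < h" "h < 1" "t \<in> {0..T}" for h t
  proof (cases "t = 0")
    case False
    have "\<bar>t\<bar> powr (2 * h) \<le> (T + 1) powr (2 * h)" using that by (intro powr_mono2) auto
    also have "\<dots> \<le> (T + 1) powr 2" using that a by (intro powr_mono) auto
    finally have "\<bar>t\<bar> powr (2 * h) \<le> (T + 1)\<^sup>2" using a by (simp add: powr_numeral)
    then show ?thesis using False V0[of h] by (simp add: harmonizable_kernel_scale V_def[symmetric] mult.commute mult_left_mono)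
  qed (simp add: V0 harmonizable_kernel_def)
  show "\<exists>D\<ge>0. \<forall>h\<in>{\<mu>..\<nu>}. \<forall>h'\<in>{\<mu>..\<nu>}. \<forall>t\<in>{0..T}.
      (\<integral>u. (norm (harmonizable_kernel h t u - harmonizable_kernel h' t u))\<^sup>2 \<partial>lborel) \<le> D * (h - h')\<^sup>2"
  proof (intro exI[of _ D] conjI ballI)
    show "D \<ge> 0" using V0 by (simp add: D_def)
    fix h h' t assume h: "h \<in> {\<mu>..\<nu>}" "h' \<in> {\<mu>..\<nu>}" and t: "t \<in> {0..T}"
    have "(\<integral>u. (norm (harmonizable_kernel h t u - harmonizable_kernel h' t u))\<^sup>2 \<partial>lborel)
      \<le> (\<integral>\<xi>. (h - h')\<^sup>2 * (32 / \<eta>\<^sup>2 * ((norm (harmonizable_kernel (\<nu> + \<eta>) t \<xi>))\<^sup>2 + (norm (harmonizable_kernel (\<mu> - \<eta>) t \<xi>))\<^sup>2)) \<partial>lborel)"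
      using int h a
      by (intro integral_mono harmonizable_kernel_hurst_diff \<eta> integrable_mult_right Bochner_Integration.integrable_add
          integrable_L2_diff harmonizable_kernel_square_integrable) (use \<eta> in auto)
    also have "\<dots> = (h - h')\<^sup>2 * (32 / \<eta>\<^sup>2 * ((\<integral>\<xi>. (norm (harmonizable_kernel (\<nu> + \<eta>) t \<xi>))\<^sup>2 \<partial>lborel)
        + (\<integral>\<xi>. (norm (harmonizable_kernel (\<mu> - \<eta>) t \<xi>))\<^sup>2 \<partial>lborel)))"
      using int by simp
    also have "\<dots> \<le> (h - h')\<^sup>2 * D"
      unfolding D_def using t \<eta> a by (intro mult_left_mono add_mono Vt) auto
    finally show "(\<integral>u. (norm (harmonizable_kernel h t u - harmonizable_kernel h' t u))\<^sup>2 \<partial>lborel) \<le> D * (h - h')\<^sup>2"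
      by (simp add: mult.commute)
  qed
qed (auto simp: harmonizable_kernel_square_integrable, auto simp: harmonizable_kernel_def)

section \<open>The moving average kernel\<close>

text \<open>The truncated power: with it the two integrals of the moving average representation have
  a single integrand on the whole line.\<close>

definition pos_powr :: "real \<Rightarrow> real \<Rightarrow> real" where
  "pos_powr a x = (if 0 < x then x powr a else 0)"

lemma borel_measurable_pos_powr [measurable (raw)]:
  assumes [measurable]: "f \<in> borel_measurable M"
  shows "(\<lambda>x. pos_powr a (f x)) \<in> borel_measurable M"
  unfolding pos_powr_def[abs_def] by measurable

text \<open>The kernel of Mandelbrot and Van Ness for \<open>a = h - 1/2\<close>, without the Gamma
  factor.\<close>

definition fractional_kernel :: "real \<Rightarrow> real \<Rightarrow> real \<Rightarrow> real" where
  "fractional_kernel a t u = pos_powr a (t - u) - pos_powr a (- u)"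

lemma borel_measurable_fractional_kernel [measurable]: "fractional_kernel a t \<in> borel_measurable borel"
  unfolding fractional_kernel_def[abs_def] by measurable

lemma pos_powr_mult: "0 < c \<Longrightarrow> pos_powr a (c * x) = c powr a * pos_powr a x"
  by (auto simp: pos_powr_def powr_mult zero_less_mult_iff)

text \<open>For \<open>u \<ge> - 1\<close> it suffices that each power is Lipschitz in its exponent.
  For \<open>u < - 1\<close> this is too weak, because the single bounds are not square integrable
  at infinity; there the mean value theorem in time gains one power, and \<open>D\<close> decays
  like \<open>(- u) powr (a1 - 1 + \<eta>)\<close> with \<open>a1 + \<eta> < 1/2\<close>.\<close>

lemma fractional_kernel_hurst_bound:
  fixes a0 a1 \<eta> :: real
  assumes a: "- 1/2 < a0" "a0 \<le> a1" "a1 < 1/2" and \<eta>: "0 < \<eta>" "\<eta> < a0 + 1/2" "\<eta> < 1/2 - a1"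
  obtains D where "D \<in> borel_measurable borel" "\<And>u. 0 \<le> D u" "integrable lborel (\<lambda>u. (D u)\<^sup>2)"
    "\<And>a b u. a \<in> {a0..a1} \<Longrightarrow> b \<in> {a0..a1} \<Longrightarrow>
      \<bar>fractional_kernel a 1 u - fractional_kernel b 1 u\<bar> \<le> \<bar>a - b\<bar> * D u"
proof -
  define E where "E x = 4 / \<eta> * (pos_powr (a0 - \<eta>) x + pos_powr (a1 + \<eta>) x)" for x
  \<comment> \<open>The 1 bounds the change of the prefactor and \<open>8 / \<eta>\<close> the
    change of the power in the derivative \<open>a * z powr (a - 1)\<close>. The latter is twice
    \<open>4 / \<eta>\<close>, because for \<open>z > 1\<close> both dominating powers are bounded
    by the same one.\<close>
  define C where "C = 1 + 8 / \<eta>"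
  define D where "D u = (if u < - 1 then C * (- u) powr (a1 - 1 + \<eta>) else E (1 - u) + E (- u))" for u
  have E0: "0 \<le> E x" for x using \<eta> by (auto simp: E_def pos_powr_def)
  have [measurable]: "E \<in> borel_measurable borel" unfolding E_def[abs_def] by measurable
  have C0: "0 < C" using \<eta> by (simp add: C_def add_pos_pos)
  have Dm: "D \<in> borel_measurable borel" unfolding D_def[abs_def] by measurable
  have D0: "0 \<le> D u" for u using E0 C0 by (auto simp: D_def)
  have E_bd: "\<bar>pos_powr a x - pos_powr b x\<bar> \<le> \<bar>a - b\<bar> * E x" if "a \<in> {a0..a1}" "b \<in> {a0..a1}" for a b x
    using powr_exponent_lipschitz[of x a a0 a1 b \<eta>] that \<eta> by (auto simp: pos_powr_def E_def)
  have bound: "\<bar>fractional_kernel a 1 u - fractional_kernel b 1 u\<bar> \<le> \<bar>a - b\<bar> * D u"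
    if ab: "a \<in> {a0..a1}" "b \<in> {a0..a1}" for a b u
  proof (cases "u < - 1")
    case False
    have "\<bar>fractional_kernel a 1 u - fractional_kernel b 1 u\<bar>
      \<le> \<bar>pos_powr a (1 - u) - pos_powr b (1 - u)\<bar> + \<bar>pos_powr a (- u) - pos_powr b (- u)\<bar>"
      unfolding fractional_kernel_def by linarith
    also have "\<dots> \<le> \<bar>a - b\<bar> * E (1 - u) + \<bar>a - b\<bar> * E (- u)" by (intro add_mono E_bd ab)
    finally show ?thesis using False by (simp add: D_def algebra_simps)
  next
    case True
    \<comment> \<open>The mean value theorem is applied in time to the difference of the two powers,
      on the unit interval from \<open>- u\<close> to \<open>1 - u\<close>.\<close>
    define \<phi> where "\<phi> z = z powr a - z powr b" for z :: real
    have "\<exists>z. - u < z \<and> z < 1 - u \<and> \<phi> (1 - u) - \<phi> (- u) = (1 - u - (- u)) * (a * z powr (a - 1) - b * z powr (b - 1))"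
      unfolding \<phi>_def using True by (intro MVT2) (auto intro!: derivative_eq_intros)
    then obtain z where z: "- u < z" "z < 1 - u"
      "\<phi> (1 - u) - \<phi> (- u) = (1 - u - (- u)) * (a * z powr (a - 1) - b * z powr (b - 1))" by blast
    have z1: "1 < z" using z True by linarith
    define w where "w = z powr (a1 - 1 + \<eta>)"
    have 1: "z powr (a - 1) \<le> w" unfolding w_def using z1 ab \<eta> by (intro powr_mono) auto
    have "\<bar>z powr (a - 1) - z powr (b - 1)\<bar> \<le> \<bar>(a - 1) - (b - 1)\<bar> * (4 / \<eta> * (z powr ((a0 - 1) - \<eta>) + z powr ((a1 - 1) + \<eta>)))"
      using ab z1 \<eta> by (intro powr_exponent_lipschitz) auto
    also have "\<dots> \<le> \<bar>(a - 1) - (b - 1)\<bar> * (4 / \<eta> * (w + w))"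
      using z1 a \<eta> unfolding w_def by (intro mult_left_mono add_mono powr_mono) auto
    also have "\<dots> = \<bar>a - b\<bar> * (8 / \<eta> * w)" by simp
    finally have 2: "\<bar>z powr (a - 1) - z powr (b - 1)\<bar> \<le> \<bar>a - b\<bar> * (8 / \<eta> * w)" .
    have "\<bar>fractional_kernel a 1 u - fractional_kernel b 1 u\<bar> = \<bar>\<phi> (1 - u) - \<phi> (- u)\<bar>"
      using True by (simp add: fractional_kernel_def pos_powr_def \<phi>_def algebra_simps)
    also have "\<dots> = \<bar>(a - b) * z powr (a - 1) + b * (z powr (a - 1) - z powr (b - 1))\<bar>"
      unfolding z(3) by (simp add: algebra_simps)
    also have "\<dots> \<le> \<bar>a - b\<bar> * z powr (a - 1) + \<bar>b\<bar> * \<bar>z powr (a - 1) - z powr (b - 1)\<bar>"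
      by (intro order_trans[OF abs_triangle_ineq]) (simp add: abs_mult)
    also have "\<dots> \<le> \<bar>a - b\<bar> * w + 1 * (\<bar>a - b\<bar> * (8 / \<eta> * w))"
      using ab a by (intro add_mono mult_left_mono mult_mono 1 2) auto
    also have "\<dots> = \<bar>a - b\<bar> * (C * w)" by (simp add: C_def algebra_simps)
    also have "\<dots> \<le> \<bar>a - b\<bar> * (C * (- u) powr (a1 - 1 + \<eta>))"
      using C0 z True a \<eta> unfolding w_def by (intro mult_left_mono powr_mono2') auto
    finally show ?thesis using True by (simp add: D_def)
  qed
  have pp: "(pos_powr c x)\<^sup>2 = pos_powr (2 * c) x" for c x
    by (auto simp: pos_powr_def power2_eq_square simp flip: powr_add)
  have ind_pp: "indicator {0<..2} x * pos_powr c x = indicator {0<..2} x * x powr c" for c x :: real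
    by (auto simp: pos_powr_def indicator_def)
  \<comment> \<open>For \<open>u \<ge> - 1\<close> both arguments \<open>1 - u\<close> and
    \<open>- u\<close> of \<open>E\<close> are at most 2, so \<open>F\<close> can be cut off there
    and remain integrable.\<close>
  define F where "F x = 32 / \<eta>\<^sup>2 * (indicator {0<..2} x * pos_powr (2 * (a0 - \<eta>)) x + indicator {0<..2} x * pos_powr (2 * (a1 + \<eta>)) x)"
    for x :: real
  have F: "integrable lborel F" unfolding F_def ind_pp using a \<eta>
    by (intro integrable_mult_right Bochner_Integration.integrable_add powr_integrable_at_0) auto
  have F0: "0 \<le> F x" for x by (auto simp: F_def pos_powr_def)
  have EF: "(E x)\<^sup>2 \<le> F x" if "x \<le> 2" for x
  proof (cases "0 < x")
    case True
    have "(E x)\<^sup>2 = 16 / \<eta>\<^sup>2 * (pos_powr (a0 - \<eta>) x + pos_powr (a1 + \<eta>) x)\<^sup>2"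
      unfolding E_def power_mult_distrib power_divide by simp
    also have "\<dots> \<le> 16 / \<eta>\<^sup>2 * (2 * (pos_powr (a0 - \<eta>) x)\<^sup>2 + 2 * (pos_powr (a1 + \<eta>) x)\<^sup>2)"
      using norm_add_power2_le[of "pos_powr (a0 - \<eta>) x" "pos_powr (a1 + \<eta>) x"] by (intro mult_left_mono) auto
    also have "\<dots> = F x" using True that by (simp add: F_def pp algebra_simps)
    finally show ?thesis .
  qed (simp add: E_def pos_powr_def F0)
  define P where "P x = indicator {1..} x * x powr (2 * (a1 - 1 + \<eta>))" for x :: real
  have P: "integrable lborel P" unfolding P_def using a \<eta> by (intro powr_integrable_at_inf) auto
  have P0: "0 \<le> P x" for x by (simp add: P_def)
  define Q where "Q u = C\<^sup>2 * P (- u) + 2 * F (1 - u) + 2 * F (- u)" for u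
  have Q: "integrable lborel Q"
    using lborel_integrable_real_affine[OF P, of "-1" 0] lborel_integrable_real_affine[OF F, of "-1" 0]
      lborel_integrable_real_affine[OF F, of "-1" 1] unfolding Q_def by simp
  have DQ: "(D u)\<^sup>2 \<le> Q u" for u
  proof (cases "u < - 1")
    case True
    then have "(D u)\<^sup>2 = C\<^sup>2 * P (- u)"
      by (simp add: D_def P_def power_mult_distrib)
        (simp add: power2_eq_square powr_add[symmetric], metis (no_types, opaque_lifting) add.commute add_diff_eq)
    then show ?thesis using F0 by (simp add: Q_def)
  next
    case False
    then have "(D u)\<^sup>2 \<le> 2 * (E (1 - u))\<^sup>2 + 2 * (E (- u))\<^sup>2"
      using norm_add_power2_le[of "E (1 - u)" "E (- u)"] by (simp add: D_def)
    also have "\<dots> \<le> C\<^sup>2 * P (- u) + (2 * F (1 - u) + 2 * F (- u))"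
      using P0[of "- u"] EF[of "1 - u"] EF[of "- u"] False by (simp add: add_increasing)
    finally show ?thesis by (simp add: Q_def)
  qed
  have "integrable lborel (\<lambda>u. (D u)\<^sup>2)"
    by (rule Bochner_Integration.integrable_bound[OF Q])
      (use Dm in \<open>auto intro!: AE_I2 order_trans[OF DQ abs_ge_self]\<close>)
  with that Dm D0 bound show ?thesis by blast
qed

definition moving_average_kernel :: "real \<Rightarrow> real \<Rightarrow> real \<Rightarrow> real" where
  "moving_average_kernel h t u = fractional_kernel (h - 1/2) t u / Gamma (h + 1/2)"

lemma borel_measurable_moving_average_kernel [measurable]: "moving_average_kernel h t \<in> borel_measurable borel"
  unfolding moving_average_kernel_def[abs_def] by measurable

text \<open>The derivative of the reciprocal is \<open>- Digamma z / Gamma z\<close>, which is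
  continuous and hence bounded on a compact interval of positive numbers.\<close>

lemma inverse_Gamma_lipschitz:
  fixes \<mu> \<nu> :: real
  assumes "0 < \<mu>" "\<mu> \<le> \<nu>"
  obtains L where "0 \<le> L" "\<And>x. x \<in> {\<mu>..\<nu>} \<Longrightarrow> \<bar>1 / Gamma x\<bar> \<le> L"
    "\<And>x y. x \<in> {\<mu>..\<nu>} \<Longrightarrow> y \<in> {\<mu>..\<nu>} \<Longrightarrow> \<bar>1 / Gamma x - 1 / Gamma y\<bar> \<le> L * \<bar>x - y\<bar>"
proof -
  have pos: "x \<notin> \<int>\<^sub>\<le>\<^sub>0" if "x \<in> {\<mu>..\<nu>}" for x :: real
    using that assms by (auto simp: nonpos_Ints_def)
  have np: "{\<mu>..\<nu>} \<inter> \<int>\<^sub>\<le>\<^sub>0 = {}" using pos by auto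
  have nz: "Gamma x \<noteq> 0" if "x \<in> {\<mu>..\<nu>}" for x :: real
    using Gamma_real_pos[of x] that assms by (auto simp del: Gamma_real_pos)
  have contG: "continuous_on {\<mu>..\<nu>} (Gamma :: real \<Rightarrow> real)"
    by (rule continuous_on_Gamma) (use pos in auto)
  have "bounded ((\<lambda>x. 1 / Gamma x) ` {\<mu>..\<nu>})"
    by (intro compact_imp_bounded compact_continuous_image continuous_intros contG) (use nz pos in auto)
  then obtain K1 where K1: "\<And>x. x \<in> {\<mu>..\<nu>} \<Longrightarrow> \<bar>1 / Gamma x\<bar> \<le> K1"
    unfolding bounded_iff by (metis image_eqI real_norm_def)
  have "bounded ((\<lambda>x. Digamma x / Gamma x) ` {\<mu>..\<nu>})"
    by (intro compact_imp_bounded compact_continuous_image continuous_intros contG continuous_on_Polygamma np) (use nz pos in auto)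
  then obtain K2 where K2: "\<And>x. x \<in> {\<mu>..\<nu>} \<Longrightarrow> \<bar>Digamma x / Gamma x\<bar> \<le> K2"
    unfolding bounded_iff by (metis image_eqI real_norm_def)
  define L where "L = max 0 (max K1 K2)"
  have "norm (1 / Gamma x - 1 / Gamma y) \<le> L * norm (x - y)" if "x \<in> {\<mu>..\<nu>}" "y \<in> {\<mu>..\<nu>}" for x y :: real
  proof (rule field_differentiable_bound[where S = "{\<mu>..\<nu>}"])
    fix z :: real assume z: "z \<in> {\<mu>..\<nu>}"
    show "((\<lambda>x. 1 / Gamma x) has_field_derivative - (Digamma z / Gamma z)) (at z within {\<mu>..\<nu>})"
      using pos[OF z] nz[OF z] by (auto intro!: derivative_eq_intros simp: field_simps power2_eq_square)
    show "norm (- (Digamma z / Gamma z)) \<le> L" using K2[OF z] by (simp add: L_def)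
  qed (use that in auto)
  then have "\<bar>1 / Gamma x - 1 / Gamma y\<bar> \<le> L * \<bar>x - y\<bar>" if "x \<in> {\<mu>..\<nu>}" "y \<in> {\<mu>..\<nu>}" for x y :: real
    using that by simp
  moreover have "\<bar>1 / Gamma x\<bar> \<le> L" if "x \<in> {\<mu>..\<nu>}" for x :: real
    using K1[OF that] unfolding L_def by linarith
  ultimately show ?thesis by (intro that[of L]) (auto simp: L_def)
qed

text \<open>One function dominates both the Lipschitz quotient and the kernel itself, so that other
  times can be reached by scaling. The kernel is bounded by comparison with the exponent 0, that is
  Hurst parameter \<open>1/2\<close>, where it is the indicator of an interval.\<close>

lemma moving_average_kernel_hurst_bound:
  assumes "0 < \<mu>" "\<mu> \<le> \<nu>" "\<nu> < 1"
  obtains D where "D \<in> borel_measurable borel" "\<And>u. 0 \<le> D u" "integrable lborel (\<lambda>u. (D u)\<^sup>2)"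
    "\<And>h h' u. h \<in> {\<mu>..\<nu>} \<Longrightarrow> h' \<in> {\<mu>..\<nu>} \<Longrightarrow> \<bar>moving_average_kernel h 1 u - moving_average_kernel h' 1 u\<bar> \<le> \<bar>h - h'\<bar> * D u"
    "\<And>h u. h \<in> {\<mu>..\<nu>} \<Longrightarrow> \<bar>moving_average_kernel h 1 u\<bar> \<le> D u"
proof -
  \<comment> \<open>The interval of exponents is enlarged to contain 0, the exponent of the
    comparison kernel.\<close>
  define a0 where "a0 = min \<mu> (1/2) - 1/2"
  define a1 where "a1 = max \<nu> (1/2) - 1/2"
  define \<eta> where "\<eta> = min (a0 + 1/2) (1/2 - a1) / 2"
  have a: "- 1/2 < a0" "a0 \<le> a1" "a1 < 1/2" "0 \<in> {a0..a1}" and \<eta>: "0 < \<eta>" "\<eta> < a0 + 1/2" "\<eta> < 1/2 - a1"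
    using assms by (auto simp: a0_def a1_def \<eta>_def min_def max_def field_simps)
  obtain D where Dm[measurable]: "D \<in> borel_measurable borel" and D: "\<And>u. 0 \<le> D u" "integrable lborel (\<lambda>u. (D u)\<^sup>2)"
    "\<And>a b u. a \<in> {a0..a1} \<Longrightarrow> b \<in> {a0..a1} \<Longrightarrow> \<bar>fractional_kernel a 1 u - fractional_kernel b 1 u\<bar> \<le> \<bar>a - b\<bar> * D u"
    using fractional_kernel_hurst_bound[OF a(1-3) \<eta>] by metis
  obtain L where L: "0 \<le> L" "\<And>x. x \<in> {\<mu> + 1/2..\<nu> + 1/2} \<Longrightarrow> \<bar>1 / Gamma x\<bar> \<le> L"
    "\<And>x y. x \<in> {\<mu> + 1/2..\<nu> + 1/2} \<Longrightarrow> y \<in> {\<mu> + 1/2..\<nu> + 1/2} \<Longrightarrow> \<bar>1 / Gamma x - 1 / Gamma y\<bar> \<le> L * \<bar>x - y\<bar>"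
    using inverse_Gamma_lipschitz[of "\<mu> + 1/2" "\<nu> + 1/2"] assms by auto
  have mem: "h - 1/2 \<in> {a0..a1}" if "h \<in> {\<mu>..\<nu>}" for h using that by (auto simp: a0_def a1_def)
  have f0: "\<bar>fractional_kernel 0 1 u\<bar> = indicator {0..<1} u" for u
    by (auto simp: fractional_kernel_def pos_powr_def indicator_def)
  have fb: "\<bar>fractional_kernel (h - 1/2) 1 u\<bar> \<le> indicator {0..<1} u + D u" if "h \<in> {\<mu>..\<nu>}" for h u
  proof -
    have "\<bar>fractional_kernel (h - 1/2) 1 u - fractional_kernel 0 1 u\<bar> \<le> \<bar>(h - 1/2) - 0\<bar> * D u"
      by (intro D(3) mem that a(4))
    also have "\<dots> \<le> 1 * D u" using that assms D(1) by (intro mult_right_mono) auto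
    finally show ?thesis using f0[of u] by linarith
  qed
  define G where "G u = L * (indicator {0..<1} u + 2 * D u)" for u
  have [measurable]: "G \<in> borel_measurable borel" unfolding G_def[abs_def] by measurable
  have G0: "0 \<le> G u" for u using L(1) D(1) by (auto simp: G_def)
  have GI: "integrable lborel (\<lambda>u. (G u)\<^sup>2)"
  proof -
    have "(\<lambda>u. (norm (indicator {0..<1} u :: real))\<^sup>2) = indicator {0..<1::real}"
      by (auto simp: indicator_def)
    then have "integrable lborel (\<lambda>u. (norm (indicator {0..<1::real} u :: real))\<^sup>2)"
      by simp
    then have "integrable lborel (\<lambda>u. (norm (L *\<^sub>R indicator {0..<1} u + (2 * L) *\<^sub>R D u))\<^sup>2)"
      using D(2) by (intro integrable_L2_lincomb) auto
    then show ?thesis by (simp add: G_def algebra_simps)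
  qed
  have b1: "\<bar>moving_average_kernel h 1 u - moving_average_kernel h' 1 u\<bar> \<le> \<bar>h - h'\<bar> * G u"
    if h: "h \<in> {\<mu>..\<nu>}" "h' \<in> {\<mu>..\<nu>}" for h h' u
  proof -
    have "moving_average_kernel h 1 u - moving_average_kernel h' 1 u
        = 1 / Gamma (h + 1/2) * (fractional_kernel (h - 1/2) 1 u - fractional_kernel (h' - 1/2) 1 u)
          + (1 / Gamma (h + 1/2) - 1 / Gamma (h' + 1/2)) * fractional_kernel (h' - 1/2) 1 u"
      unfolding moving_average_kernel_def by (simp add: algebra_simps)
    then have "\<bar>moving_average_kernel h 1 u - moving_average_kernel h' 1 u\<bar>
        \<le> \<bar>1 / Gamma (h + 1/2)\<bar> * \<bar>fractional_kernel (h - 1/2) 1 u - fractional_kernel (h' - 1/2) 1 u\<bar>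
          + \<bar>1 / Gamma (h + 1/2) - 1 / Gamma (h' + 1/2)\<bar> * \<bar>fractional_kernel (h' - 1/2) 1 u\<bar>"
      by (simp only: abs_mult[symmetric] abs_triangle_ineq)
    also have "\<dots> \<le> L * (\<bar>(h - 1/2) - (h' - 1/2)\<bar> * D u) + (L * \<bar>(h + 1/2) - (h' + 1/2)\<bar>) * (indicator {0..<1} u + D u)"
      using h L(1) D(1) by (intro add_mono mult_mono L D mem fb) auto
    also have "\<dots> = \<bar>h - h'\<bar> * G u" by (simp add: G_def algebra_simps)
    finally show ?thesis .
  qed
  have b2: "\<bar>moving_average_kernel h 1 u\<bar> \<le> G u" if "h \<in> {\<mu>..\<nu>}" for h u
  proof -
    have "\<bar>moving_average_kernel h 1 u\<bar> = \<bar>1 / Gamma (h + 1/2)\<bar> * \<bar>fractional_kernel (h - 1/2) 1 u\<bar>"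
      by (simp add: moving_average_kernel_def abs_mult[symmetric])
    also have "\<dots> \<le> L * (indicator {0..<1} u + D u)"
      using that L(1) by (intro mult_mono L fb) auto
    also have "\<dots> \<le> G u" unfolding G_def using L(1) D(1) by (intro mult_left_mono) auto
    finally show ?thesis .
  qed
  from that[OF _ G0 GI b1 b2] show ?thesis by simp
qed

text \<open>The substitution \<open>u = s + (t - s) * v\<close> shows stationarity and
  self-similarity of the increments together.\<close>

lemma fractional_kernel_increment:
  assumes "s < t"
  shows "moving_average_kernel h t (s + (t - s) * v) - moving_average_kernel h s (s + (t - s) * v)
    = (t - s) powr (h - 1/2) * moving_average_kernel h 1 v"
proof -
  have "t - (s + (t - s) * v) = (t - s) * (1 - v)" "s - (s + (t - s) * v) = (t - s) * (- v)"
    by (simp_all add: algebra_simps)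
  with assms show ?thesis
    unfolding moving_average_kernel_def fractional_kernel_def
    by (simp only: pos_powr_mult diff_gt_0_iff_gt) (simp add: algebra_simps diff_divide_distrib[symmetric])
qed

lemma moving_average_kernel_0: "moving_average_kernel h 0 u = 0"
  by (simp add: moving_average_kernel_def fractional_kernel_def)

lemma moving_average_kernel_scale:
  assumes "0 < t"
  shows "moving_average_kernel h t (t * v) = t powr (h - 1/2) * moving_average_kernel h 1 v"
  using fractional_kernel_increment[OF assms, of h v] by (simp add: moving_average_kernel_0)

lemma moving_average_kernel_square_integrable:
  assumes "0 < h" "h < 1" "0 \<le> t"
  shows "integrable lborel (\<lambda>u. (norm (moving_average_kernel h t u))\<^sup>2)"
proof (cases "t = 0")
  case False
  obtain D where D: "\<And>u. 0 \<le> D u" "integrable lborel (\<lambda>u. (D u)\<^sup>2)" "\<And>u. \<bar>moving_average_kernel h 1 u\<bar> \<le> D u"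
    using moving_average_kernel_hurst_bound[of h h] assms by (metis atLeastAtMost_singleton order_refl singletonI)
  have "(norm (moving_average_kernel h 1 u))\<^sup>2 \<le> (D u)\<^sup>2" for u
    using D(3)[of u] by (intro power_mono) auto
  then have "integrable lborel (\<lambda>u. (norm (moving_average_kernel h 1 u))\<^sup>2)"
    by (intro Bochner_Integration.integrable_bound[OF D(2)]) auto
  then have "integrable lborel (\<lambda>v. (t powr (h - 1/2))\<^sup>2 * (norm (moving_average_kernel h 1 v))\<^sup>2)"
    by (rule integrable_mult_right)
  then have "integrable lborel (\<lambda>v. (norm (moving_average_kernel h t (0 + t * v)))\<^sup>2)"
    using assms False by (simp add: moving_average_kernel_scale power_mult_distrib)
  then show ?thesis using False by (subst (asm) lborel_integrable_real_affine_iff) auto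
qed (simp add: moving_average_kernel_0)

lemma moving_average_kernel_increment:
  assumes "s < t"
  shows "(\<integral>u. (norm (moving_average_kernel h t u - moving_average_kernel h s u))\<^sup>2 \<partial>lborel)
    = (\<integral>u. (norm (moving_average_kernel h 1 u))\<^sup>2 \<partial>lborel) * (t - s) powr (2 * h)"
proof -
  have "(\<integral>u. (norm (moving_average_kernel h t u - moving_average_kernel h s u))\<^sup>2 \<partial>lborel)
      = (t - s) * (\<integral>v. (norm (moving_average_kernel h t (s + (t - s) * v) - moving_average_kernel h s (s + (t - s) * v)))\<^sup>2 \<partial>lborel)"
    using lborel_integral_real_affine[of "t - s" "\<lambda>u. (norm (moving_average_kernel h t u - moving_average_kernel h s u))\<^sup>2" s] assms
    by simp
  also have "\<dots> = (t - s) * ((t - s) powr (h - 1/2))\<^sup>2 * (\<integral>u. (norm (moving_average_kernel h 1 u))\<^sup>2 \<partial>lborel)"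
    unfolding fractional_kernel_increment[OF assms] by (simp add: power_mult_distrib)
  also have "(t - s) * ((t - s) powr (h - 1/2))\<^sup>2 = (t - s) powr (1 + ((h - 1/2) + (h - 1/2)))"
    unfolding powr_add power2_eq_square using assms by simp
  finally show ?thesis by simp
qed

lemma hurst_kernel_moving_average:
  "hurst_kernel moving_average_kernel (\<lambda>h. \<integral>u. (norm (moving_average_kernel h 1 u))\<^sup>2 \<partial>lborel)"
proof
  fix h :: real assume h: "0 < h" "h < 1"
  show "0 < (\<integral>u. (norm (moving_average_kernel h 1 u))\<^sup>2 \<partial>lborel)"
  proof (rule L2_norm_pos[OF moving_average_kernel_square_integrable[OF h]])
    fix x :: real assume x: "0 < x" "x < 1"
    then show "moving_average_kernel h 1 x \<noteq> 0"
      using h Gamma_real_pos[of "h + 1/2"] by (auto simp del: Gamma_real_pos simp: moving_average_kernel_def fractional_kernel_def pos_powr_def)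
  qed auto
next
  fix h s t :: real
  show "(\<integral>u. (norm (moving_average_kernel h t u - moving_average_kernel h s u))\<^sup>2 \<partial>lborel)
      = (\<integral>u. (norm (moving_average_kernel h 1 u))\<^sup>2 \<partial>lborel) * \<bar>t - s\<bar> powr (2 * h)"
    using moving_average_kernel_increment[of s t h] moving_average_kernel_increment[of t s h]
    by (cases s t rule: linorder_cases) (auto simp: norm_minus_commute abs_minus_commute)
next
  fix \<mu> \<nu> T :: real assume a: "0 < \<mu>" "\<mu> \<le> \<nu>" "\<nu> < 1" "0 \<le> T"
  obtain D where [measurable]: "D \<in> borel_measurable borel" and D: "\<And>u. 0 \<le> D u" "integrable lborel (\<lambda>u. (D u)\<^sup>2)"
    "\<And>h h' u. h \<in> {\<mu>..\<nu>} \<Longrightarrow> h' \<in> {\<mu>..\<nu>} \<Longrightarrow> \<bar>moving_average_kernel h 1 u - moving_average_kernel h' 1 u\<bar> \<le> \<bar>h - h'\<bar> * D u"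
    "\<And>h u. h \<in> {\<mu>..\<nu>} \<Longrightarrow> \<bar>moving_average_kernel h 1 u\<bar> \<le> D u"
    using moving_average_kernel_hurst_bound[OF a(1-3)] by metis
  define I where "I = (\<integral>u. (D u)\<^sup>2 \<partial>lborel)"
  define \<eta> where "\<eta> = min \<mu> (1 - \<nu>) / 2"
  have \<eta>: "0 < \<eta>" "\<nu> + \<eta> < 1" "0 < \<mu> - \<eta>" "0 < \<nu> + \<eta>" "\<mu> - \<eta> < 1"
    using a by (auto simp: \<eta>_def min_def field_simps)
  define K where "K = 4 / \<eta> * (2 * (T + 1))"
  have I0: "0 \<le> I" by (simp add: I_def)
  define C where "C = 2 * ((T + 1)\<^sup>2 * I) + 2 * (K\<^sup>2 * I)"
  have pT: "t powr x \<le> T + 1" if "t \<in> {0..T}" "0 \<le> x" "x \<le> 1" for t x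
  proof -
    have "t powr x \<le> (T + 1) powr x" using that by (intro powr_mono2) auto
    also have "\<dots> \<le> (T + 1) powr 1" using that a by (intro powr_mono) auto
    finally show ?thesis using a by simp
  qed
  show "\<exists>D\<ge>0. \<forall>h\<in>{\<mu>..\<nu>}. \<forall>h'\<in>{\<mu>..\<nu>}. \<forall>t\<in>{0..T}.
      (\<integral>u. (norm (moving_average_kernel h t u - moving_average_kernel h' t u))\<^sup>2 \<partial>lborel) \<le> D * (h - h')\<^sup>2"
  proof (intro exI[of _ C] conjI ballI)
    show C0: "0 \<le> C" using I0 by (simp add: C_def)
    fix h h' t assume h: "h \<in> {\<mu>..\<nu>}" "h' \<in> {\<mu>..\<nu>}" and t: "t \<in> {0..T}"
    show "(\<integral>u. (norm (moving_average_kernel h t u - moving_average_kernel h' t u))\<^sup>2 \<partial>lborel) \<le> C * (h - h')\<^sup>2"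
    proof (cases "t = 0")
      case False
      with t have t0: "0 < t" by auto
      define p where "p = t powr (h - 1/2)"
      define p' where "p' = t powr (h' - 1/2)"
      \<comment> \<open>The factor \<open>t powr (h - 1/2)\<close> is unbounded near
        \<open>t = 0\<close> if \<open>h < 1/2\<close>; combined with the Jacobian \<open>t\<close>
        of the substitution it becomes a power with positive exponent.\<close>
      have tp: "t * p\<^sup>2 = (t powr h)\<^sup>2" "t * (p - p')\<^sup>2 = (t powr h - t powr h')\<^sup>2"
      proof -
        have "t powr h = sqrt t * p" "t powr h' = sqrt t * p'"
          using t0 by (simp_all add: p_def p'_def powr_half_sqrt[symmetric] flip: powr_add)
        then show "t * p\<^sup>2 = (t powr h)\<^sup>2" "t * (p - p')\<^sup>2 = (t powr h - t powr h')\<^sup>2"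
          using t0 by (simp_all add: power_mult_distrib flip: right_diff_distrib)
      qed
      have 1: "(t powr h)\<^sup>2 \<le> (T + 1)\<^sup>2" using h a t by (intro power_mono pT) auto
      have "\<bar>t powr h - t powr h'\<bar> \<le> \<bar>h - h'\<bar> * (4 / \<eta> * (t powr (\<mu> - \<eta>) + t powr (\<nu> + \<eta>)))"
        using h t0 \<eta> by (intro powr_exponent_lipschitz) auto
      also have "\<dots> \<le> \<bar>h - h'\<bar> * (4 / \<eta> * ((T + 1) + (T + 1)))"
        using t \<eta> by (intro mult_left_mono add_mono pT) auto
      also have "\<dots> = \<bar>h - h'\<bar> * K" by (simp add: K_def)
      finally have "\<bar>t powr h - t powr h'\<bar>\<^sup>2 \<le> (\<bar>h - h'\<bar> * K)\<^sup>2" by (intro power_mono) auto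
      then have 2: "(t powr h - t powr h')\<^sup>2 \<le> (h - h')\<^sup>2 * K\<^sup>2" by (simp add: power_mult_distrib)
      have pt: "(norm (moving_average_kernel h t (0 + t * v) - moving_average_kernel h' t (0 + t * v)))\<^sup>2
          \<le> (2 * p\<^sup>2 * (h - h')\<^sup>2 + 2 * (p - p')\<^sup>2) * (D v)\<^sup>2" for v
      proof -
        define k k' where "k = moving_average_kernel h 1 v" and "k' = moving_average_kernel h' 1 v"
        \<comment> \<open>The decomposition separates the change of the kernel at time 1 from the
          change of the scaling factor.\<close>
        have "(norm (moving_average_kernel h t (0 + t * v) - moving_average_kernel h' t (0 + t * v)))\<^sup>2
            = (norm (p * (k - k') + (p - p') * k'))\<^sup>2"
          using t0 by (simp add: moving_average_kernel_scale p_def p'_def k_def k'_def algebra_simps)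
        also have "\<dots> \<le> 2 * (p\<^sup>2 * \<bar>k - k'\<bar>\<^sup>2) + 2 * ((p - p')\<^sup>2 * \<bar>k'\<bar>\<^sup>2)"
          using norm_add_power2_le[of "p * (k - k')" "(p - p') * k'"] by (simp add: power_mult_distrib)
        also have "\<dots> \<le> 2 * (p\<^sup>2 * (\<bar>h - h'\<bar> * D v)\<^sup>2) + 2 * ((p - p')\<^sup>2 * (D v)\<^sup>2)"
          unfolding k_def k'_def using D(3)[OF h] D(4)[OF h(2)] by (intro add_mono mult_left_mono power_mono) auto
        finally show ?thesis by (simp add: power_mult_distrib algebra_simps)
      qed
      have "(\<integral>u. (norm (moving_average_kernel h t u - moving_average_kernel h' t u))\<^sup>2 \<partial>lborel)
          = t * (\<integral>v. (norm (moving_average_kernel h t (0 + t * v) - moving_average_kernel h' t (0 + t * v)))\<^sup>2 \<partial>lborel)"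
        using lborel_integral_real_affine[of t "\<lambda>u. (norm (moving_average_kernel h t u - moving_average_kernel h' t u))\<^sup>2" 0] t0
        by simp
      also have "\<dots> \<le> t * (\<integral>v. (2 * p\<^sup>2 * (h - h')\<^sup>2 + 2 * (p - p')\<^sup>2) * (D v)\<^sup>2 \<partial>lborel)"
        using t0 D(2) by (intro mult_left_mono integral_mono_AE' AE_I2 pt) auto
      also have "\<dots> = (2 * (t * p\<^sup>2) * (h - h')\<^sup>2 + 2 * (t * (p - p')\<^sup>2)) * I"
        unfolding integral_mult_right_zero I_def[symmetric] by (simp add: algebra_simps)
      also have "\<dots> \<le> (2 * (T + 1)\<^sup>2 * (h - h')\<^sup>2 + 2 * ((h - h')\<^sup>2 * K\<^sup>2)) * I"
        unfolding tp using 1 2 I0 by (intro mult_right_mono add_mono mult_left_mono) auto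
      also have "\<dots> = C * (h - h')\<^sup>2" by (simp add: C_def algebra_simps)
      finally show ?thesis .
    qed (simp add: moving_average_kernel_0 C0)
  qed
qed (use moving_average_kernel_square_integrable in \<open>auto simp: moving_average_kernel_0\<close>)

section \<open>Gaussian vectors\<close>

text \<open>A centred Gaussian process with covariance \<open>Q\<close>, expressed by characteristic
  functions of linear combinations, the form in which the law is obtained and used. Times may repeat
  and come in any order, as they later become integration variables.\<close>

definition gaussian_cov :: "'a measure \<Rightarrow> (real \<Rightarrow> 'a \<Rightarrow> real) \<Rightarrow> (real \<Rightarrow> real \<Rightarrow> real) \<Rightarrow> bool" where
  "gaussian_cov M X Q \<longleftrightarrow> (\<forall>s. X s \<in> borel_measurable M) \<and>
    (\<forall>(n :: nat) \<theta> \<tau>.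
      (CLINT w|M. iexp (\<Sum>j<n. \<theta> j * X (\<tau> j) w))
        = of_real (exp (- (\<Sum>i<n. \<Sum>j<n. \<theta> i * \<theta> j * Q (\<tau> i) (\<tau> j)) / 2)))"

text \<open>Kac's criterion. For fixed \<open>\<beta>\<close>, the law of \<open>U\<close> is unchanged when the probability is weighted by
  \<open>2 + cos (\<beta> V)\<close> or \<open>2 + sin (\<beta> V)\<close>, because its characteristic function is; conditioning on an event of \<open>U\<close>
  therefore does not change the characteristic function of \<open>V\<close>.\<close>

lemma (in prob_space) Levy_uniqueness_weighted:
  fixes U g :: "'a \<Rightarrow> real"
  assumes [measurable]: "U \<in> borel_measurable M" "g \<in> borel_measurable M"
    and g: "\<And>w. 0 \<le> g w" "\<And>w. g w \<le> K" "expectation g = G" "0 < G"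
    and eq: "\<And>a. (CLINT w|M. of_real (g w) * iexp (a * U w)) = of_real G * \<phi> a"
    and U: "real_distribution L" "char L = \<phi>" and A: "A \<in> sets borel"
  shows "expectation (\<lambda>w. g w * indicator A (U w)) = G * measure L A"
proof -
  define M' where "M' = density M (\<lambda>w. ennreal (g w / G))"
  have gi: "integrable M (\<lambda>w. g w * f w)" if [measurable]: "f \<in> borel_measurable M" and "\<And>w. \<bar>f w\<bar> \<le> 1" for f :: "'a \<Rightarrow> real"
  proof (rule integrable_const_bound[of _ K])
    have "g w * \<bar>f w\<bar> \<le> K * 1" for w using g that by (intro mult_mono) (auto intro: order_trans[OF g(1,2)])
    then show "AE w in M. norm (g w * f w) \<le> K" using g by (auto simp: abs_mult)
  qed simp
  have "prob_space M'"
  proof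
    have "emeasure M' (space M') = (\<integral>\<^sup>+w. ennreal (g w / G) \<partial>M)" by (simp add: M'_def emeasure_density)
    also have "\<dots> = ennreal (\<integral>w. g w / G \<partial>M)"
      using gi[of "\<lambda>_. 1"] g by (intro nn_integral_eq_integral) auto
    also have "\<dots> = 1" using g by simp
    finally show "emeasure M' (space M') = 1" .
  qed
  then interpret M': prob_space M' .
  have [measurable]: "U \<in> borel_measurable M'" by (simp add: M'_def)
  have "real_distribution (distr M' borel U)" by (rule M'.real_distribution_distr) simp
  moreover have "char (distr M' borel U) = \<phi>"
  proof
    fix a
    have "char (distr M' borel U) a = (CLINT w|M'. iexp (a * U w))"
      unfolding char_def by (subst integral_distr) auto
    also have "\<dots> = (CLINT w|M. (g w / G) *\<^sub>R iexp (a * U w))"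
      unfolding M'_def using g by (subst integral_density) auto
    also have "\<dots> = (CLINT w|M. (of_real (g w) * iexp (a * U w)) / of_real G)"
      by (simp add: scaleR_conv_of_real)
    also have "\<dots> = \<phi> a" using g(4) unfolding integral_divide_zero eq by simp
    finally show "char (distr M' borel U) a = \<phi> a" .
  qed
  ultimately have L: "distr M' borel U = L" using Levy_uniqueness U by blast
  have "measure L A = measure M' (U -` A \<inter> space M')" unfolding L[symmetric] using A by (subst measure_distr) auto
  also have "\<dots> = (\<integral>w. indicator A (U w) \<partial>M')"
  proof -
    have "(\<integral>w. indicator A (U w) \<partial>M') = (\<integral>w. indicator (U -` A \<inter> space M') w \<partial>M')"
      by (intro Bochner_Integration.integral_cong) (auto simp: indicator_def)
    also have "\<dots> = measure M' (U -` A \<inter> space M')" by simp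
    finally show ?thesis ..
  qed
  also have "\<dots> = (\<integral>w. (g w / G) *\<^sub>R indicator A (U w) \<partial>M)"
    unfolding M'_def using g A by (subst integral_density) auto
  also have "\<dots> = expectation (\<lambda>w. g w * indicator A (U w)) / G" by simp
  finally show ?thesis using g(4) by simp
qed

lemma cos_sin_mult_iexp:
  "of_real (cos y) * iexp x = (iexp (x + y) + iexp (x + - y)) / 2"
  "of_real (sin y) * iexp x = (iexp (x + y) - iexp (x + - y)) / (2 * \<i>)"
proof -
  have e: "iexp y = of_real (cos y) + \<i> * of_real (sin y)" for y
    by (simp add: exp_Euler cos_of_real sin_of_real)
  have "iexp (x + y) = iexp x * (of_real (cos y) + \<i> * of_real (sin y))"
    "iexp (x + - y) = iexp x * (of_real (cos y) - \<i> * of_real (sin y))"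
    using e[of y] e[of "- y"] by (simp_all only: of_real_add distrib_left exp_add) (simp_all add: algebra_simps)
  note * = this
  show "of_real (cos y) * iexp x = (iexp (x + y) + iexp (x + - y)) / 2"
    "of_real (sin y) * iexp x = (iexp (x + y) - iexp (x + - y)) / (2 * \<i>)"
    unfolding * by (simp_all add: field_simps)
qed

lemma (in prob_space) distr_pair_eq_if_char_factorises:
  fixes U V :: "'a \<Rightarrow> real"
  assumes [measurable]: "U \<in> borel_measurable M" "V \<in> borel_measurable M"
    and L: "real_distribution L1" "real_distribution L2"
    and char: "\<And>a b. (CLINT w|M. iexp (a * U w + b * V w)) = char L1 a * char L2 b"
  shows "distr M (borel \<Otimes>\<^sub>M borel) (\<lambda>w. (U w, V w)) = L1 \<Otimes>\<^sub>M L2"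
proof (rule pair_measure_eqI[symmetric])
  interpret L1: real_distribution L1 by fact
  interpret L2: real_distribution L2 by fact
  show "sigma_finite_measure L1" "sigma_finite_measure L2" by unfold_locales
  show "sets (L1 \<Otimes>\<^sub>M L2) = sets (distr M (borel \<Otimes>\<^sub>M borel) (\<lambda>w. (U w, V w)))"
    by (simp cong: sets_pair_measure_cong)
  fix A B assume "A \<in> sets L1" "B \<in> sets L2"
  then have [measurable]: "A \<in> sets borel" "B \<in> sets borel" by auto
  have U1: "(CLINT w|M. iexp (a * U w)) = char L1 a" for a using char[of a 0] L2.char_zero by simp
  have i1: "integrable M (\<lambda>w. iexp (a * U w + b * V w))" for a b by (rule integrable_iexp_rv) measurable
  have i0: "integrable M (\<lambda>w. iexp (a * U w))" for a by (rule integrable_iexp_rv) measurable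
  define p where "p = measure L1 A"
  have c: "expectation (\<lambda>w. cos (b * V w) * indicator A (U w)) = Re (char L2 b) * p"
    and s: "expectation (\<lambda>w. sin (b * V w) * indicator A (U w)) = Im (char L2 b) * p" for b
  proof -
    define c where "c = (char L2 b + char L2 (- b)) / 2"
    define s where "s = (char L2 b - char L2 (- b)) / (2 * \<i>)"
    \<comment> \<open>By this symmetry the combinations for the cosine and the sine are real
      numbers, as is required of \<open>F\<close> in the key step below.\<close>
    have cn: "char L2 (- b) = cnj (char L2 b)"
      unfolding char_def Bochner_Integration.integral_cnj[symmetric]
      by (intro Bochner_Integration.integral_cong refl) (simp add: exp_cnj)
    have c': "c = of_real (Re (char L2 b))" and s': "s = of_real (Im (char L2 b))"
      unfolding c_def s_def cn complex_add_cnj complex_diff_cnj by (auto simp: complex_eq_iff)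
    have E1: "(CLINT w|M. of_real (cos (b * V w)) * iexp (a * U w)) = c * char L1 a" for a
    proof -
      have "of_real (cos (b * V w)) * iexp (a * U w) = (iexp (a * U w + b * V w) + iexp (a * U w + (- b) * V w)) / 2" for w
        using cos_sin_mult_iexp[of "b * V w" "a * U w"] by simp
      then have "(CLINT w|M. of_real (cos (b * V w)) * iexp (a * U w))
         = ((CLINT w|M. iexp (a * U w + b * V w)) + (CLINT w|M. iexp (a * U w + (- b) * V w))) / 2"
        using i1 by (simp only: integral_divide_zero Bochner_Integration.integral_add)
      then show ?thesis unfolding char c_def by (simp add: algebra_simps)
    qed
    have E2: "(CLINT w|M. of_real (sin (b * V w)) * iexp (a * U w)) = s * char L1 a" for a
    proof -
      have "of_real (sin (b * V w)) * iexp (a * U w) = (iexp (a * U w + b * V w) - iexp (a * U w + (- b) * V w)) / (2 * \<i>)" for w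
        using cos_sin_mult_iexp[of "b * V w" "a * U w"] by simp
      then have "(CLINT w|M. of_real (sin (b * V w)) * iexp (a * U w))
         = ((CLINT w|M. iexp (a * U w + b * V w)) - (CLINT w|M. iexp (a * U w + (- b) * V w))) / (2 * \<i>)"
        using i1 by (simp only: integral_divide_zero Bochner_Integration.integral_diff)
      then show ?thesis unfolding char s_def by (simp add: algebra_simps)
    qed
    have key: "expectation (\<lambda>w. f w * indicator A (U w)) = F * p"
      if [measurable]: "f \<in> borel_measurable M" and f: "\<And>w. \<bar>f w\<bar> \<le> 1"
        and E: "\<And>a. (CLINT w|M. of_real (f w) * iexp (a * U w)) = of_real F * char L1 a" for f F
    proof -
      have fi: "integrable M f" by (rule integrable_const_bound[of _ 1]) (use f in auto)
      have "of_real (expectation f) = (of_real F :: complex)"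
        using E[of 0] L1.char_zero by (simp add: integral_complex_of_real)
      then have Ef: "expectation f = F" by simp
      have F1: "\<bar>F\<bar> \<le> 1"
      proof -
        have "\<bar>F\<bar> \<le> expectation (\<lambda>w. \<bar>f w\<bar>)" unfolding Ef[symmetric] by (rule integral_abs_bound)
        also have "\<dots> \<le> expectation (\<lambda>w. 1)" using fi f by (intro integral_mono) auto
        finally show ?thesis by (simp add: prob_space)
      qed
      have fE: "integrable M (\<lambda>w. of_real (f w) * iexp (a * U w))" for a
        by (rule integrable_const_bound[of _ 1]) (use f in \<open>auto simp: norm_mult\<close>)
      \<comment> \<open>The cosine and the sine change sign; adding 2 gives a weight between 1 and 3
        with positive total mass \<open>2 + F\<close>. The contribution of the constant 2 is
        subtracted afterwards.\<close>
      have "expectation (\<lambda>w. (2 + f w) * indicator A (U w)) = (2 + F) * p" unfolding p_def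
      proof (rule Levy_uniqueness_weighted[OF _ _ _ _ _ _ _ L(1) refl, where K = 3])
        show "0 \<le> 2 + f w" "2 + f w \<le> 3" for w using f[of w] by (auto simp: abs_le_iff)
        show "expectation (\<lambda>w. 2 + f w) = 2 + F" using fi Ef by (simp add: prob_space)
        show "(CLINT w|M. of_real (2 + f w) * iexp (a * U w)) = of_real (2 + F) * char L1 a" for a
        proof -
          have "(CLINT w|M. of_real (2 + f w) * iexp (a * U w)) = (CLINT w|M. 2 * iexp (a * U w) + of_real (f w) * iexp (a * U w))"
            by (simp add: algebra_simps)
          also have "\<dots> = of_real (2 + F) * char L1 a"
            using i0[of a] fE[of a] U1[of a] E[of a]
            by (subst Bochner_Integration.integral_add) (auto simp: algebra_simps)
          finally show ?thesis .
        qed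
      qed (use F1 in auto)
      moreover have "expectation (\<lambda>w. 1 * indicator A (U w)) = 1 * p" unfolding p_def
        by (rule Levy_uniqueness_weighted[OF _ _ _ _ _ _ _ L(1) refl, where K = 1])
          (use U1 in \<open>auto simp: prob_space\<close>)
      moreover have "integrable M (\<lambda>w. indicator A (U w) :: real)" "integrable M (\<lambda>w. f w * indicator A (U w))"
        by (rule integrable_const_bound[of _ 1], auto simp: abs_mult indicator_def f)+
      ultimately show ?thesis by (simp add: algebra_simps)
    qed
    show "expectation (\<lambda>w. cos (b * V w) * indicator A (U w)) = Re (char L2 b) * p"
      by (rule key) (use E1 c' in auto)
    show "expectation (\<lambda>w. sin (b * V w) * indicator A (U w)) = Im (char L2 b) * p"
      by (rule key) (use E2 s' in auto)
  qed
  have iA: "expectation (\<lambda>w. indicator A (U w)) = p" using c[of 0] L2.char_zero by simp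
  have "expectation (\<lambda>w. indicator A (U w) * indicator B (V w)) = p * measure L2 B"
  \<comment> \<open>For \<open>p = 0\<close> the indicator of \<open>A\<close> cannot be normalised
    to a probability weight, but then it vanishes almost surely.\<close>
  proof (cases "p = 0")
    case True
    have "AE w in M. indicator A (U w) = (0 :: real)"
    proof (subst integral_nonneg_eq_0_iff_AE[symmetric])
      show "integrable M (\<lambda>w. indicator A (U w) :: real)" by (rule integrable_const_bound[of _ 1]) (auto simp: indicator_def)
    qed (use iA True in auto)
    then have "expectation (\<lambda>w. indicator A (U w) * indicator B (V w)) = expectation (\<lambda>w. 0 :: real)"
      by (intro integral_cong_AE) (auto elim: eventually_mono)
    then show ?thesis using True by simp
  next
    case False
    then have "p > 0" unfolding p_def by (simp add: zero_less_measure_iff)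
    show ?thesis
    proof (rule Levy_uniqueness_weighted[OF _ _ _ _ iA _ _ L(2) refl, where K = 1])
      fix b
      have i: "integrable M (\<lambda>w. cos (b * V w) * indicator A (U w))" "integrable M (\<lambda>w. sin (b * V w) * indicator A (U w))"
        by (rule integrable_const_bound[of _ 1], auto simp: abs_mult indicator_def)+
      have "(CLINT w|M. of_real (indicator A (U w)) * iexp (b * V w))
        = (CLINT w|M. of_real (cos (b * V w) * indicator A (U w)) + \<i> * of_real (sin (b * V w) * indicator A (U w)))"
        by (intro Bochner_Integration.integral_cong refl) (simp add: exp_Euler algebra_simps flip: cos_of_real sin_of_real)
      also have "\<dots> = of_real (Re (char L2 b) * p) + \<i> * of_real (Im (char L2 b) * p)"
        using i c[of b] s[of b]
        by (subst Bochner_Integration.integral_add)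
          (auto simp del: of_real_mult simp: integral_complex_of_real)
      also have "\<dots> = of_real p * char L2 b" by (simp add: complex_eq_iff)
      finally show "(CLINT w|M. of_real (indicator A (U w)) * iexp (b * V w)) = of_real p * char L2 b" .
    qed (use \<open>p > 0\<close> in \<open>auto simp: indicator_def\<close>)
  qed
  moreover have "expectation (\<lambda>w. indicator A (U w) * indicator B (V w)) = measure M ((\<lambda>w. (U w, V w)) -` (A \<times> B) \<inter> space M)"
  proof -
    have "expectation (\<lambda>w. indicator A (U w) * indicator B (V w)) = expectation (indicator ((\<lambda>w. (U w, V w)) -` (A \<times> B) \<inter> space M) :: 'a \<Rightarrow> real)"
      by (intro Bochner_Integration.integral_cong) (auto simp: indicator_def)
    then show ?thesis by simp
  qed
  ultimately have "measure M ((\<lambda>w. (U w, V w)) -` (A \<times> B) \<inter> space M) = measure L1 A * measure L2 B" by (simp add: p_def)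
  then show "emeasure L1 A * emeasure L2 B = emeasure (distr M (borel \<Otimes>\<^sub>M borel) (\<lambda>w. (U w, V w))) (A \<times> B)"
    by (subst emeasure_distr) (auto simp: L1.emeasure_eq_measure L2.emeasure_eq_measure emeasure_eq_measure simp flip: ennreal_mult)
qed

section \<open>Centred Gaussian densities in the plane\<close>

definition gauss2_density :: "real \<Rightarrow> real \<Rightarrow> real \<Rightarrow> real \<Rightarrow> real \<Rightarrow> real" where
  "gauss2_density a b c x z =
    exp (- (c * x\<^sup>2 - 2 * b * x * z + a * z\<^sup>2) / (2 * (a * c - b\<^sup>2))) / (2 * pi * sqrt (a * c - b\<^sup>2))"

lemma gauss2_density_nonneg: "0 < a * c - b\<^sup>2 \<Longrightarrow> 0 \<le> gauss2_density a b c x z"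
  by (simp add: gauss2_density_def)

text \<open>Completing the square shows that the quadratic form in the exponent is
  nonnegative.\<close>

lemma gauss2_density_le:
  assumes "0 < a" "0 < a * c - b\<^sup>2"
  shows "gauss2_density a b c x z \<le> 1 / (2 * pi * sqrt (a * c - b\<^sup>2))"
proof -
  have "c * x\<^sup>2 - 2 * b * x * z + a * z\<^sup>2 = ((a * z - b * x)\<^sup>2 + (a * c - b\<^sup>2) * x\<^sup>2) / a"
    using assms(1) by (simp add: power2_eq_square field_simps)
  also have "\<dots> \<ge> 0" using assms by simp
  finally have "exp (- (c * x\<^sup>2 - 2 * b * x * z + a * z\<^sup>2) / (2 * (a * c - b\<^sup>2))) \<le> 1"
    using assms by (simp add: divide_nonpos_pos del: minus_add_distrib minus_diff_eq)
  then show ?thesis unfolding gauss2_density_def using assms by (intro divide_right_mono) auto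
qed

lemma char_normal_density:
  assumes "0 < s"
  shows "char (density lborel (normal_density 0 s)) a = of_real (exp (- (a\<^sup>2 * s\<^sup>2) / 2))"
  using integral_normal_density_iexp[OF assms, of a] by (simp add: char_def mult.commute)

text \<open>The joint density is the marginal density of the first coordinate times the conditional
  density of the second, which has mean \<open>b / a * x\<close> and variance
  \<open>(a * c - b\<^sup>2) / a\<close>.\<close>

lemma normal_density_mult_eq_gauss2_density:
  assumes a: "0 < a" and d: "0 < a * c - b\<^sup>2"
  shows "normal_density 0 (sqrt a) x * normal_density 0 (sqrt ((a * c - b\<^sup>2) / a)) (z - b / a * x) = gauss2_density a b c x z"
proof -
  define D where "D = a * c - b\<^sup>2"
  have D: "D > 0" using d by (simp add: D_def)
  have s: "sqrt (2 * pi * (sqrt a)\<^sup>2) * sqrt (2 * pi * (sqrt (D / a))\<^sup>2) = 2 * pi * sqrt D"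
  proof -
    have "sqrt (2 * pi * a) * sqrt (2 * pi * (D / a)) = sqrt ((2 * pi)\<^sup>2 * D)"
      unfolding real_sqrt_mult[symmetric] using a by (simp add: power2_eq_square)
    also have "\<dots> = 2 * pi * sqrt D" by (simp add: real_sqrt_mult)
    finally show ?thesis using a D by simp
  qed
  have e: "- (x - 0)\<^sup>2 / (2 * (sqrt a)\<^sup>2) + - (z - b / a * x - 0)\<^sup>2 / (2 * (sqrt (D / a))\<^sup>2) = - (c * x\<^sup>2 - 2 * b * x * z + a * z\<^sup>2) / (2 * D)"
  proof -
    have sD: "(sqrt (D / a))\<^sup>2 = D / a" "(sqrt a)\<^sup>2 = a" using a D by simp_all
    have c: "c = (D + b\<^sup>2) / a" using a by (simp add: D_def)
    show ?thesis unfolding sD c using a D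
      by (simp add: divide_simps) (simp add: power2_eq_square algebra_simps)
  qed
  have "normal_density 0 (sqrt a) x * normal_density 0 (sqrt (D / a)) (z - b / a * x)
      = 1 / (sqrt (2 * pi * (sqrt a)\<^sup>2) * sqrt (2 * pi * (sqrt (D / a))\<^sup>2))
        * exp (- (x - 0)\<^sup>2 / (2 * (sqrt a)\<^sup>2) + - (z - b / a * x - 0)\<^sup>2 / (2 * (sqrt (D / a))\<^sup>2))"
    unfolding normal_density_def exp_add by simp
  then show ?thesis unfolding s e by (simp add: gauss2_density_def D_def)
qed

text \<open>The residual \<open>V - b / a * U\<close> is uncorrelated with \<open>U\<close>, so the
  joint characteristic function factorises and the two are independent; undoing the shear gives the
  joint density with variances \<open>a\<close>, \<open>c\<close> and covariance
  \<open>b\<close>.\<close>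

lemma (in prob_space) nn_integral_gauss2:
  fixes U V :: "'a \<Rightarrow> real" and F :: "real \<Rightarrow> real \<Rightarrow> ennreal"
  assumes [measurable]: "U \<in> borel_measurable M" "V \<in> borel_measurable M"
    and ab: "0 < a" "0 < a * c - b\<^sup>2"
    and char: "\<And>\<alpha> \<beta>. (CLINT w|M. iexp (\<alpha> * U w + \<beta> * V w)) = of_real (exp (- (\<alpha>\<^sup>2 * a + 2 * \<alpha> * \<beta> * b + \<beta>\<^sup>2 * c) / 2))"
    and F[measurable]: "(\<lambda>(x, z). F x z) \<in> borel_measurable (borel \<Otimes>\<^sub>M borel)"
  shows "(\<integral>\<^sup>+w. F (U w) (V w) \<partial>M) = (\<integral>\<^sup>+x. \<integral>\<^sup>+z. F x z * ennreal (gauss2_density a b c x z) \<partial>lborel \<partial>lborel)"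
proof -
  define \<tau> where "\<tau> = sqrt ((a * c - b\<^sup>2) / a)"
  have \<tau>: "0 < \<tau>" "\<tau>\<^sup>2 = (a * c - b\<^sup>2) / a" using ab by (simp_all add: \<tau>_def)
  define L1 where "L1 = density lborel (\<lambda>x. ennreal (normal_density 0 (sqrt a) x))"
  define L2 where "L2 = density lborel (\<lambda>x. ennreal (normal_density 0 \<tau> x))"
  have L: "real_distribution L1" "real_distribution L2"
    unfolding L1_def L2_def real_distribution_def real_distribution_axioms_def
    using ab \<tau> by (auto intro!: prob_space_normal_density)
  interpret L2: real_distribution L2 by fact
  have [measurable_cong]: "sets L1 = sets borel" "sets L2 = sets borel" by (simp_all add: L1_def L2_def)
  define V' where "V' w = V w - b / a * U w" for w
  have [measurable]: "V' \<in> borel_measurable M" unfolding V'_def[abs_def] by measurable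
  have "(CLINT w|M. iexp (\<alpha> * U w + \<beta> * V' w)) = char L1 \<alpha> * char L2 \<beta>" for \<alpha> \<beta>
  proof -
    have "(CLINT w|M. iexp (\<alpha> * U w + \<beta> * V' w)) = (CLINT w|M. iexp ((\<alpha> - \<beta> * b / a) * U w + \<beta> * V w))"
      by (simp add: V'_def algebra_simps)
    also have "\<dots> = of_real (exp (- ((\<alpha> - \<beta> * b / a)\<^sup>2 * a + 2 * (\<alpha> - \<beta> * b / a) * \<beta> * b + \<beta>\<^sup>2 * c) / 2))"
      by (rule char)
    also have "(\<alpha> - \<beta> * b / a)\<^sup>2 * a + 2 * (\<alpha> - \<beta> * b / a) * \<beta> * b + \<beta>\<^sup>2 * c = \<alpha>\<^sup>2 * (sqrt a)\<^sup>2 + \<beta>\<^sup>2 * \<tau>\<^sup>2"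
      using ab(1) unfolding \<tau>(2) by (simp add: power2_eq_square field_simps)
    also have "of_real (exp (- (\<alpha>\<^sup>2 * (sqrt a)\<^sup>2 + \<beta>\<^sup>2 * \<tau>\<^sup>2) / 2)) = char L1 \<alpha> * char L2 \<beta>"
      unfolding L1_def L2_def using ab \<tau>(1)
      by (subst (1 2) char_normal_density) (auto simp: add_divide_distrib simp flip: of_real_mult exp_add)
    finally show ?thesis .
  qed
  from distr_pair_eq_if_char_factorises[OF _ _ L this]
  have D: "distr M (borel \<Otimes>\<^sub>M borel) (\<lambda>w. (U w, V' w)) = L1 \<Otimes>\<^sub>M L2" by simp
  have "(\<integral>\<^sup>+w. F (U w) (V w) \<partial>M) = (\<integral>\<^sup>+w. (\<lambda>(x, v). F x (v + b / a * x)) (U w, V' w) \<partial>M)" by (simp add: V'_def)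
  also have "\<dots> = (\<integral>\<^sup>+p. (\<lambda>(x, v). F x (v + b / a * x)) p \<partial>distr M (borel \<Otimes>\<^sub>M borel) (\<lambda>w. (U w, V' w)))"
    by (subst nn_integral_distr) auto
  also have "\<dots> = (\<integral>\<^sup>+x. \<integral>\<^sup>+v. F x (v + b / a * x) \<partial>L2 \<partial>L1)"
    unfolding D by (subst L2.nn_integral_fst[symmetric]) auto
  also have "\<dots> = (\<integral>\<^sup>+x. \<integral>\<^sup>+z. F x z * ennreal (gauss2_density a b c x z) \<partial>lborel \<partial>lborel)"
  proof -
    have "(\<integral>\<^sup>+v. F x (v + b / a * x) \<partial>L2) = (\<integral>\<^sup>+z. ennreal (normal_density 0 \<tau> (z - b / a * x)) * F x z \<partial>lborel)" for x
    proof -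
      have "(\<integral>\<^sup>+v. F x (v + b / a * x) \<partial>L2) = (\<integral>\<^sup>+v. ennreal (normal_density 0 \<tau> v) * F x (v + b / a * x) \<partial>lborel)"
        unfolding L2_def by (subst nn_integral_density) auto
      also have "\<dots> = (\<integral>\<^sup>+z. ennreal (normal_density 0 \<tau> (z - b / a * x)) * F x z \<partial>lborel)"
        using nn_integral_real_affine[of "\<lambda>z. ennreal (normal_density 0 \<tau> (z - b / a * x)) * F x z" 1 "b / a * x"]
        by (simp add: add.commute)
      finally show ?thesis .
    qed
    then have "(\<integral>\<^sup>+x. \<integral>\<^sup>+v. F x (v + b / a * x) \<partial>L2 \<partial>L1)
      = (\<integral>\<^sup>+x. ennreal (normal_density 0 (sqrt a) x) * (\<integral>\<^sup>+z. ennreal (normal_density 0 \<tau> (z - b / a * x)) * F x z \<partial>lborel) \<partial>lborel)"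
      unfolding L1_def by (subst nn_integral_density) auto
    also have "\<dots> = (\<integral>\<^sup>+x. \<integral>\<^sup>+z. F x z * ennreal (gauss2_density a b c x z) \<partial>lborel \<partial>lborel)"
      by (intro nn_integral_cong, subst nn_integral_cmult[symmetric])
        (auto simp: \<tau>_def mult_ac normal_density_mult_eq_gauss2_density[OF ab, symmetric] ennreal_mult intro!: nn_integral_cong)
    finally show ?thesis .
  qed
  finally show ?thesis .
qed

lemma (in prob_space) distr_gauss2_rescaled:
  fixes U V :: "'a \<Rightarrow> real"
  assumes [measurable]: "U \<in> borel_measurable M" "V \<in> borel_measurable M"
    and ab: "0 < a" "0 < a * c - b\<^sup>2"
    and char: "\<And>\<alpha> \<beta>. (CLINT w|M. iexp (\<alpha> * U w + \<beta> * V w)) = of_real (exp (- (\<alpha>\<^sup>2 * a + 2 * \<alpha> * \<beta> * b + \<beta>\<^sup>2 * c) / 2))"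
    and de: "0 < d" "0 < e"
  shows "distr M (borel \<Otimes>\<^sub>M borel) (\<lambda>w. ((U w - y) / d, (V w - y) / e))
    = density (lborel \<Otimes>\<^sub>M lborel) (\<lambda>p. ennreal (d * e * gauss2_density a b c (y + d * fst p) (y + e * snd p)))"
proof (rule measure_eqI)
  show "sets (distr M (borel \<Otimes>\<^sub>M borel) (\<lambda>w. ((U w - y) / d, (V w - y) / e)))
    = sets (density (lborel \<Otimes>\<^sub>M lborel) (\<lambda>p. ennreal (d * e * gauss2_density a b c (y + d * fst p) (y + e * snd p))))"
    by (simp cong: sets_pair_measure_cong)
  fix A assume "A \<in> sets (distr M (borel \<Otimes>\<^sub>M borel) (\<lambda>w. ((U w - y) / d, (V w - y) / e)))"
  then have [measurable]: "A \<in> sets (borel \<Otimes>\<^sub>M borel)" by simp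
  have [measurable]: "(\<lambda>p. gauss2_density a b c (fst p) (snd p)) \<in> borel_measurable (borel \<Otimes>\<^sub>M borel)"
    unfolding gauss2_density_def by measurable
  have gm: "(\<lambda>x. gauss2_density a b c (f x) (g x)) \<in> borel_measurable L"
    if [measurable]: "f \<in> borel_measurable L" "g \<in> borel_measurable L" for f g and L :: "'s measure"
    unfolding gauss2_density_def by measurable
  note gm[measurable (raw)]
  have "emeasure (distr M (borel \<Otimes>\<^sub>M borel) (\<lambda>w. ((U w - y) / d, (V w - y) / e))) A
      = (\<integral>\<^sup>+w. indicator A ((U w - y) / d, (V w - y) / e) \<partial>M)"
    by (subst nn_integral_indicator[symmetric], simp, subst nn_integral_distr) auto
  also have "\<dots> = (\<integral>\<^sup>+x. \<integral>\<^sup>+z. indicator A ((x - y) / d, (z - y) / e) * ennreal (gauss2_density a b c x z) \<partial>lborel \<partial>lborel)"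
    by (rule nn_integral_gauss2[OF _ _ ab char]) auto
  also have "\<dots> = (\<integral>\<^sup>+x. ennreal e * (\<integral>\<^sup>+z. indicator A ((x - y) / d, z) * ennreal (gauss2_density a b c x (y + e * z)) \<partial>lborel) \<partial>lborel)"
  proof (intro nn_integral_cong)
    fix x
    show "(\<integral>\<^sup>+z. indicator A ((x - y) / d, (z - y) / e) * ennreal (gauss2_density a b c x z) \<partial>lborel)
      = ennreal e * (\<integral>\<^sup>+z. indicator A ((x - y) / d, z) * ennreal (gauss2_density a b c x (y + e * z)) \<partial>lborel)"
      using nn_integral_real_affine[of "\<lambda>z. indicator A ((x - y) / d, (z - y) / e) * ennreal (gauss2_density a b c x z)" e y] de
      by simp
  qed
  also have "\<dots> = ennreal d * (\<integral>\<^sup>+x. ennreal e * (\<integral>\<^sup>+z. indicator A (x, z) * ennreal (gauss2_density a b c (y + d * x) (y + e * z)) \<partial>lborel) \<partial>lborel)"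
    using nn_integral_real_affine[of "\<lambda>x. ennreal e * (\<integral>\<^sup>+z. indicator A ((x - y) / d, z) * ennreal (gauss2_density a b c x (y + e * z)) \<partial>lborel)" d y] de
    by simp
  also have "\<dots> = (\<integral>\<^sup>+x. \<integral>\<^sup>+z. ennreal (d * e * gauss2_density a b c (y + d * x) (y + e * z)) * indicator A (x, z) \<partial>lborel \<partial>lborel)"
    using de gauss2_density_nonneg[OF ab(2)]
    by (simp add: nn_integral_cmult[symmetric] ennreal_mult mult_ac)
  also have "\<dots> = (\<integral>\<^sup>+p. ennreal (d * e * gauss2_density a b c (y + d * fst p) (y + e * snd p)) * indicator A p \<partial>(lborel \<Otimes>\<^sub>M lborel))"
    by (subst lborel.nn_integral_fst[symmetric]) auto
  also have "\<dots> = emeasure (density (lborel \<Otimes>\<^sub>M lborel) (\<lambda>p. ennreal (d * e * gauss2_density a b c (y + d * fst p) (y + e * snd p)))) A"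
    by (subst emeasure_density) auto
  finally show "emeasure (distr M (borel \<Otimes>\<^sub>M borel) (\<lambda>w. ((U w - y) / d, (V w - y) / e))) A
    = emeasure (density (lborel \<Otimes>\<^sub>M lborel) (\<lambda>p. ennreal (d * e * gauss2_density a b c (y + d * fst p) (y + e * snd p)))) A" .
qed

lemma borel_measurable_gauss2_density [measurable (raw)]:
  assumes [measurable]: "a \<in> borel_measurable L" "b \<in> borel_measurable L" "c \<in> borel_measurable L"
    "f \<in> borel_measurable L" "g \<in> borel_measurable L"
  shows "(\<lambda>x. gauss2_density (a x) (b x) (c x) (f x) (g x)) \<in> borel_measurable L"
  unfolding gauss2_density_def by measurable

text \<open>The expectation of the rescaled product for a Gaussian pair, after the substitution that
  moves the scales \<open>d\<close> and \<open>e\<close> into the arguments of the density. In this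
  form it remains meaningful at scale 0, where only the density at \<open>(y, y)\<close> is
  left.\<close>

definition gauss2_form :: "(real \<Rightarrow> real) \<Rightarrow> (real \<Rightarrow> real) \<Rightarrow> real \<Rightarrow> real \<Rightarrow> real \<Rightarrow> real \<Rightarrow> real \<Rightarrow> real \<Rightarrow> real" where
  "gauss2_form \<phi> \<psi> y d e a b c =
    (\<integral>p. \<phi> (fst p) * \<psi> (snd p) * gauss2_density a b c (y + d * fst p) (y + e * snd p) \<partial>(lborel \<Otimes>\<^sub>M lborel))"

lemma gauss2_form_integrand:
  assumes \<phi>: "integrable lborel \<phi>" and \<psi>: "integrable lborel \<psi>" and ab: "0 < a" "0 < m" "m\<^sup>2 \<le> a * c - b\<^sup>2"
  shows "\<bar>\<phi> (fst p) * \<psi> (snd p) * gauss2_density a b c x z\<bar> \<le> \<bar>\<phi> (fst p) * \<psi> (snd p)\<bar> * (1 / (2 * pi * m))"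
    and "integrable (lborel \<Otimes>\<^sub>M lborel) (\<lambda>p. \<phi> (fst p) * \<psi> (snd p) * gauss2_density a b c (y + d * fst p) (y + e * snd p))"
    and "\<bar>gauss2_form \<phi> \<psi> y d e a b c\<bar> \<le> (\<integral>x. \<bar>\<phi> x\<bar> \<partial>lborel) * (\<integral>x. \<bar>\<psi> x\<bar> \<partial>lborel) / (2 * pi * m)"
proof -
  have D: "0 < a * c - b\<^sup>2" using ab by (smt (verit) zero_less_power)
  have [measurable]: "\<phi> \<in> borel_measurable borel" "\<psi> \<in> borel_measurable borel" using \<phi> \<psi> by auto
  have bd: "\<bar>gauss2_density a b c x z\<bar> \<le> 1 / (2 * pi * m)" for x z
  proof -
    have "\<bar>gauss2_density a b c x z\<bar> \<le> 1 / (2 * pi * sqrt (a * c - b\<^sup>2))"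
      using gauss2_density_nonneg[OF D] gauss2_density_le[OF ab(1) D] by simp
    also have "\<dots> \<le> 1 / (2 * pi * m)"
      using ab real_le_rsqrt[OF ab(3)] by (intro divide_left_mono mult_left_mono mult_pos_pos) (use ab D in auto)
    finally show ?thesis .
  qed
  show pt: "\<bar>\<phi> (fst p) * \<psi> (snd p) * gauss2_density a b c x z\<bar> \<le> \<bar>\<phi> (fst p) * \<psi> (snd p)\<bar> * (1 / (2 * pi * m))" for p x z
    unfolding abs_mult[of "\<phi> (fst p) * \<psi> (snd p)"] by (intro mult_left_mono bd) auto
  have I: "integrable (lborel \<Otimes>\<^sub>M lborel) (\<lambda>p. \<bar>\<phi> (fst p) * \<psi> (snd p)\<bar> * (1 / (2 * pi * m)))"
    by (intro integrable_mult_left integrable_abs lborel_pair.integrable_fst_mult_snd \<phi> \<psi>)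
  show "integrable (lborel \<Otimes>\<^sub>M lborel) (\<lambda>p. \<phi> (fst p) * \<psi> (snd p) * gauss2_density a b c (y + d * fst p) (y + e * snd p))"
  proof (rule Bochner_Integration.integrable_bound[OF I])
    show "AE p in lborel \<Otimes>\<^sub>M lborel. norm (\<phi> (fst p) * \<psi> (snd p) * gauss2_density a b c (y + d * fst p) (y + e * snd p))
        \<le> norm (\<bar>\<phi> (fst p) * \<psi> (snd p)\<bar> * (1 / (2 * pi * m)))"
      unfolding real_norm_def by (intro AE_I2 order_trans[OF pt abs_ge_self])
  qed measurable
  have "\<bar>gauss2_form \<phi> \<psi> y d e a b c\<bar> \<le> (\<integral>p. \<bar>\<phi> (fst p) * \<psi> (snd p) * gauss2_density a b c (y + d * fst p) (y + e * snd p)\<bar> \<partial>(lborel \<Otimes>\<^sub>M lborel))"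
    unfolding gauss2_form_def by (rule integral_abs_bound)
  also have "\<dots> \<le> (\<integral>p. \<bar>\<phi> (fst p) * \<psi> (snd p)\<bar> * (1 / (2 * pi * m)) \<partial>(lborel \<Otimes>\<^sub>M lborel))"
    by (rule integral_mono'[OF I]) (use pt ab in auto)
  also have "\<dots> = (\<integral>p. \<bar>\<phi> (fst p)\<bar> * \<bar>\<psi> (snd p)\<bar> \<partial>(lborel \<Otimes>\<^sub>M lborel)) * (1 / (2 * pi * m))"
    by (simp add: abs_mult)
  also have "(\<integral>p. \<bar>\<phi> (fst p)\<bar> * \<bar>\<psi> (snd p)\<bar> \<partial>(lborel \<Otimes>\<^sub>M lborel)) = (\<integral>x. \<bar>\<phi> x\<bar> \<partial>lborel) * (\<integral>x. \<bar>\<psi> x\<bar> \<partial>lborel)"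
    by (intro lborel_pair.integrable_fst_mult_snd(2) integrable_abs \<phi> \<psi>)
  finally show "\<bar>gauss2_form \<phi> \<psi> y d e a b c\<bar> \<le> (\<integral>x. \<bar>\<phi> x\<bar> \<partial>lborel) * (\<integral>x. \<bar>\<psi> x\<bar> \<partial>lborel) / (2 * pi * m)" by simp
qed

text \<open>A common lower bound \<open>m\<^sup>2\<close> for the determinants supplies an
  integrable majorant and passes to the limiting parameters, at which the density is therefore
  continuous.\<close>

lemma gauss2_form_tendsto:
  fixes d e a b c :: "nat \<Rightarrow> real"
  assumes \<phi>: "integrable lborel \<phi>" and \<psi>: "integrable lborel \<psi>" and "0 < m"
    and n: "\<And>n. 0 < a n" "\<And>n. m\<^sup>2 \<le> a n * c n - (b n)\<^sup>2"
    and lim: "d \<longlonglongrightarrow> d'" "e \<longlonglongrightarrow> e'" "a \<longlonglongrightarrow> a'" "b \<longlonglongrightarrow> b'" "c \<longlonglongrightarrow> c'"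
  shows "(\<lambda>n. gauss2_form \<phi> \<psi> y (d n) (e n) (a n) (b n) (c n)) \<longlonglongrightarrow> gauss2_form \<phi> \<psi> y d' e' a' b' c'"
  unfolding gauss2_form_def
proof (rule integral_dominated_convergence)
  have [measurable]: "\<phi> \<in> borel_measurable borel" "\<psi> \<in> borel_measurable borel" using \<phi> \<psi> by auto
  show "integrable (lborel \<Otimes>\<^sub>M lborel) (\<lambda>p. \<bar>\<phi> (fst p) * \<psi> (snd p)\<bar> * (1 / (2 * pi * m)))"
    by (intro integrable_mult_left integrable_abs lborel_pair.integrable_fst_mult_snd \<phi> \<psi>)
  have "(\<lambda>n. a n * c n - (b n)\<^sup>2) \<longlonglongrightarrow> a' * c' - b'\<^sup>2" by (intro tendsto_intros lim)
  from LIMSEQ_le_const[OF this, of "m\<^sup>2"] have "m\<^sup>2 \<le> a' * c' - b'\<^sup>2" using n(2) by auto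
  then have D: "a' * c' - b'\<^sup>2 \<noteq> 0" "sqrt (a' * c' - b'\<^sup>2) \<noteq> 0" using \<open>0 < m\<close> by (smt (verit) zero_less_power, smt (verit) zero_less_power real_sqrt_gt_zero)
  show "AE p in lborel \<Otimes>\<^sub>M lborel. (\<lambda>n. \<phi> (fst p) * \<psi> (snd p) * gauss2_density (a n) (b n) (c n) (y + d n * fst p) (y + e n * snd p))
      \<longlonglongrightarrow> \<phi> (fst p) * \<psi> (snd p) * gauss2_density a' b' c' (y + d' * fst p) (y + e' * snd p)"
    unfolding gauss2_density_def using D by (intro AE_I2 tendsto_intros lim) auto
  show "AE p in lborel \<Otimes>\<^sub>M lborel. norm (\<phi> (fst p) * \<psi> (snd p) * gauss2_density (a n) (b n) (c n) (y + d n * fst p) (y + e n * snd p))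
      \<le> \<bar>\<phi> (fst p) * \<psi> (snd p)\<bar> * (1 / (2 * pi * m))" for n
    using gauss2_form_integrand(1)[OF \<phi> \<psi> n(1) \<open>0 < m\<close> n(2)] by (intro AE_I2) simp
  show "(\<lambda>p. \<phi> (fst p) * \<psi> (snd p) * gauss2_density a' b' c' (y + d' * fst p) (y + e' * snd p)) \<in> borel_measurable (lborel \<Otimes>\<^sub>M lborel)"
    by measurable
  show "(\<lambda>p. \<phi> (fst p) * \<psi> (snd p) * gauss2_density (a n) (b n) (c n) (y + d n * fst p) (y + e n * snd p)) \<in> borel_measurable (lborel \<Otimes>\<^sub>M lborel)" for n
    by measurable
qed

lemma (in prob_space) gauss2_expectation:
  fixes U V :: "'a \<Rightarrow> real"
  assumes UV[measurable]: "U \<in> borel_measurable M" "V \<in> borel_measurable M"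
    and ab: "0 < a" "0 < m" "m\<^sup>2 \<le> a * c - b\<^sup>2"
    and char: "\<And>\<alpha> \<beta>. (CLINT w|M. iexp (\<alpha> * U w + \<beta> * V w)) = of_real (exp (- (\<alpha>\<^sup>2 * a + 2 * \<alpha> * \<beta> * b + \<beta>\<^sup>2 * c) / 2))"
    and de: "0 < d" "0 < e" and \<phi>: "integrable lborel \<phi>" and \<psi>: "integrable lborel \<psi>"
  shows "integrable M (\<lambda>w. \<phi> ((U w - y) / d) / d * (\<psi> ((V w - y) / e) / e))"
    and "expectation (\<lambda>w. \<phi> ((U w - y) / d) / d * (\<psi> ((V w - y) / e) / e)) = gauss2_form \<phi> \<psi> y d e a b c"
proof -
  have D: "0 < a * c - b\<^sup>2" using ab by (smt (verit) zero_less_power)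
  have [measurable]: "\<phi> \<in> borel_measurable borel" "\<psi> \<in> borel_measurable borel" using \<phi> \<psi> by auto
  define T where "T w = ((U w - y) / d, (V w - y) / e)" for w
  have [measurable]: "T \<in> M \<rightarrow>\<^sub>M borel \<Otimes>\<^sub>M borel" unfolding T_def[abs_def] by measurable
  define g where "g p = d * e * gauss2_density a b c (y + d * fst p) (y + e * snd p)" for p
  have g0: "0 \<le> g p" for p using de gauss2_density_nonneg[OF D] by (simp add: g_def)
  have [measurable]: "g \<in> borel_measurable (lborel \<Otimes>\<^sub>M lborel)" unfolding g_def[abs_def] by measurable
  define F where "F p = \<phi> (fst p) / d * (\<psi> (snd p) / e)" for p
  have Fm[measurable]: "F \<in> borel_measurable (borel \<Otimes>\<^sub>M borel)" unfolding F_def[abs_def] by measurable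
  have Fm'[measurable]: "F \<in> borel_measurable (lborel \<Otimes>\<^sub>M lborel)" unfolding F_def[abs_def] by measurable
  have L: "distr M (borel \<Otimes>\<^sub>M borel) T = density (lborel \<Otimes>\<^sub>M lborel) (\<lambda>p. ennreal (g p))"
    unfolding T_def g_def by (rule distr_gauss2_rescaled[OF UV ab(1) D char de])
  have gF: "g p * F p = \<phi> (fst p) * \<psi> (snd p) * gauss2_density a b c (y + d * fst p) (y + e * snd p)" for p
    using de by (simp add: g_def F_def)
  have "integrable (density (lborel \<Otimes>\<^sub>M lborel) (\<lambda>p. ennreal (g p))) F"
    using gauss2_form_integrand(2)[OF \<phi> \<psi> ab] g0 by (subst integrable_density) (auto simp: gF)
  then have "integrable M (\<lambda>w. F (T w))" unfolding L[symmetric] by (subst (asm) integrable_distr_eq) auto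
  then show "integrable M (\<lambda>w. \<phi> ((U w - y) / d) / d * (\<psi> ((V w - y) / e) / e))" by (simp add: F_def T_def)
  have "expectation (\<lambda>w. F (T w)) = integral\<^sup>L (distr M (borel \<Otimes>\<^sub>M borel) T) F"
    by (rule integral_distr[symmetric]) auto
  also have "\<dots> = gauss2_form \<phi> \<psi> y d e a b c"
    unfolding L gauss2_form_def using g0 by (subst integral_density) (auto simp: gF)
  finally show "expectation (\<lambda>w. \<phi> ((U w - y) / d) / d * (\<psi> ((V w - y) / e) / e)) = gauss2_form \<phi> \<psi> y d e a b c"
    by (simp add: F_def T_def)
qed

lemma gauss2_form_0:
  assumes \<phi>: "integrable lborel \<phi>" and \<psi>: "integrable lborel \<psi>"
  shows "gauss2_form \<phi> \<psi> y 0 0 a b c = (\<integral>x. \<phi> x \<partial>lborel) * (\<integral>x. \<psi> x \<partial>lborel) * gauss2_density a b c y y"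
  unfolding gauss2_form_def using lborel_pair.integrable_fst_mult_snd(2)[OF \<phi> \<psi>] by simp

section \<open>Local functionals of Gaussian processes\<close>

text \<open>\<open>U\<close> is the law of a random time. The number \<open>m p\<close> bounds the
  square root of the Gram determinant at a pair of times from below, so the joint density is at most
  \<open>1 / (2 * pi * m p)\<close>. Integrability of \<open>1 / m p\<close> makes second moments
  finite, with bounds that do not depend on the scales.\<close>

locale gaussian_functional = prob_space M + U: prob_space U
  for M :: "'a measure" and U :: "real measure" +
  fixes X :: "real \<Rightarrow> 'a \<Rightarrow> real" and Q :: "real \<Rightarrow> real \<Rightarrow> real" and m :: "real \<times> real \<Rightarrow> real"
  assumes sets_U [measurable_cong]: "sets U = sets borel"
    and X_measurable [measurable]: "(\<lambda>(s, w). X s w) \<in> borel_measurable (borel \<Otimes>\<^sub>M M)"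
    and cov: "gaussian_cov M X Q" and Q_sym: "Q s u = Q u s"
    and det: "AE p in U \<Otimes>\<^sub>M U. 0 < m p \<and> (m p)\<^sup>2 \<le> Q (fst p) (fst p) * Q (snd p) (snd p) - (Q (fst p) (snd p))\<^sup>2"
    and m_integrable: "integrable (U \<Otimes>\<^sub>M U) (\<lambda>p. 1 / m p)"
begin

lemma X_measurable' [measurable (raw)]:
  assumes [measurable]: "f \<in> borel_measurable L" "g \<in> L \<rightarrow>\<^sub>M M"
  shows "(\<lambda>x. X (f x) (g x)) \<in> borel_measurable L"
  using measurable_compose[OF measurable_Pair[OF assms] X_measurable] by simp

lemma iexp_pair:
  "(CLINT w|M. iexp (\<alpha> * X s w + \<beta> * X u w)) = of_real (exp (- (\<alpha>\<^sup>2 * Q s s + 2 * \<alpha> * \<beta> * Q s u + \<beta>\<^sup>2 * Q u u) / 2))"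
proof -
  define \<theta> \<tau> where "\<theta> j = (if j = 0 then \<alpha> else \<beta>)" and "\<tau> j = (if j = 0 then s else u)" for j :: nat
  have 2: "{..<2::nat} = {0, 1}" by auto
  have "(CLINT w|M. iexp (\<Sum>j<2. \<theta> j * X (\<tau> j) w))
      = of_real (exp (- (\<Sum>i<2. \<Sum>j<2. \<theta> i * \<theta> j * Q (\<tau> i) (\<tau> j)) / 2))"
    using cov unfolding gaussian_cov_def by blast
  also have "(\<lambda>w. \<Sum>j<2. \<theta> j * X (\<tau> j) w) = (\<lambda>w. \<alpha> * X s w + \<beta> * X u w)"
    by (simp add: 2 \<theta>_def \<tau>_def)
  also have "(\<Sum>i<2. \<Sum>j<2. \<theta> i * \<theta> j * Q (\<tau> i) (\<tau> j)) = \<alpha>\<^sup>2 * Q s s + 2 * \<alpha> * \<beta> * Q s u + \<beta>\<^sup>2 * Q u u"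
    by (simp add: 2 \<theta>_def \<tau>_def Q_sym[of u s] power2_eq_square algebra_simps)
  finally show ?thesis .
qed

text \<open>Read off from a characteristic function having modulus at most 1.\<close>

lemma Q_diag_nonneg: "0 \<le> Q s s"
proof -
  have "norm (CLINT w|M. iexp (1 * X s w + 0 * X s w)) \<le> expectation (\<lambda>w. norm (iexp (1 * X s w + 0 * X s w)))"
    by (rule integral_norm_bound)
  also have "\<dots> = 1" by (simp add: prob_space)
  finally show ?thesis unfolding iexp_pair by simp
qed

lemma Q_diag_pos:
  assumes "0 < m p" "(m p)\<^sup>2 \<le> Q (fst p) (fst p) * Q (snd p) (snd p) - (Q (fst p) (snd p))\<^sup>2"
  shows "0 < Q (fst p) (fst p)"
proof (rule ccontr)
  assume "\<not> 0 < Q (fst p) (fst p)"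
  then have "Q (fst p) (fst p) = 0" using Q_diag_nonneg[of "fst p"] by simp
  then have "(m p)\<^sup>2 \<le> 0" using assms(2) zero_le_power2[of "Q (fst p) (snd p)"]
    by (metis diff_0 dual_order.trans mult_zero_left neg_le_0_iff_le)
  then show False using assms(1) zero_less_power[of "m p" 2] by simp
qed

definition A :: "(real \<Rightarrow> real) \<Rightarrow> real \<Rightarrow> real \<Rightarrow> 'a \<Rightarrow> real" where
  "A \<phi> y d w = (\<integral>s. \<phi> ((X s w - y) / d) / d \<partial>U)"

lemma borel_measurable_A [measurable]:
  assumes [measurable]: "\<phi> \<in> borel_measurable borel"
  shows "A \<phi> y d \<in> borel_measurable M"
  unfolding A_def[abs_def] by measurable

lemma pair_expectation:
  assumes \<phi>: "integrable lborel \<phi>" and \<psi>: "integrable lborel \<psi>" and de: "0 < d" "0 < e"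
    and p: "0 < m p" "(m p)\<^sup>2 \<le> Q (fst p) (fst p) * Q (snd p) (snd p) - (Q (fst p) (snd p))\<^sup>2"
  shows "integrable M (\<lambda>w. \<phi> ((X (fst p) w - y) / d) / d * (\<psi> ((X (snd p) w - y) / e) / e))"
    and "expectation (\<lambda>w. \<phi> ((X (fst p) w - y) / d) / d * (\<psi> ((X (snd p) w - y) / e) / e))
      = gauss2_form \<phi> \<psi> y d e (Q (fst p) (fst p)) (Q (fst p) (snd p)) (Q (snd p) (snd p))"
    and "expectation (\<lambda>w. \<bar>\<phi> ((X (fst p) w - y) / d) / d * (\<psi> ((X (snd p) w - y) / e) / e)\<bar>)
      \<le> (\<integral>x. \<bar>\<phi> x\<bar> \<partial>lborel) * (\<integral>x. \<bar>\<psi> x\<bar> \<partial>lborel) / (2 * pi) * (1 / m p)"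
proof -
  note q = Q_diag_pos[OF p]
  note E = gauss2_expectation[OF _ _ q p iexp_pair de]
  show "integrable M (\<lambda>w. \<phi> ((X (fst p) w - y) / d) / d * (\<psi> ((X (snd p) w - y) / e) / e))"
    "expectation (\<lambda>w. \<phi> ((X (fst p) w - y) / d) / d * (\<psi> ((X (snd p) w - y) / e) / e))
      = gauss2_form \<phi> \<psi> y d e (Q (fst p) (fst p)) (Q (fst p) (snd p)) (Q (snd p) (snd p))"
    by (intro E \<phi> \<psi>; simp)+
  have "expectation (\<lambda>w. \<bar>\<phi> ((X (fst p) w - y) / d) / d * (\<psi> ((X (snd p) w - y) / e) / e)\<bar>)
      = expectation (\<lambda>w. \<bar>\<phi> ((X (fst p) w - y) / d)\<bar> / d * (\<bar>\<psi> ((X (snd p) w - y) / e)\<bar> / e))"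
    using de by (simp add: abs_mult)
  also have "\<dots> = gauss2_form (\<lambda>x. \<bar>\<phi> x\<bar>) (\<lambda>x. \<bar>\<psi> x\<bar>) y d e (Q (fst p) (fst p)) (Q (fst p) (snd p)) (Q (snd p) (snd p))"
    by (intro E integrable_abs \<phi> \<psi>; simp)
  also have "\<dots> \<le> (\<integral>x. \<bar>\<phi> x\<bar> \<partial>lborel) * (\<integral>x. \<bar>\<psi> x\<bar> \<partial>lborel) / (2 * pi) * (1 / m p)"
    using gauss2_form_integrand(3)[OF integrable_abs[OF \<phi>] integrable_abs[OF \<psi>] q p, of y d e]
    by (auto simp: abs_le_iff)
  finally show "expectation (\<lambda>w. \<bar>\<phi> ((X (fst p) w - y) / d) / d * (\<psi> ((X (snd p) w - y) / e) / e)\<bar>)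
      \<le> (\<integral>x. \<bar>\<phi> x\<bar> \<partial>lborel) * (\<integral>x. \<bar>\<psi> x\<bar> \<partial>lborel) / (2 * pi) * (1 / m p)" .
qed

lemma joint_integrable:
  assumes \<phi>: "integrable lborel \<phi>" and \<psi>: "integrable lborel \<psi>" and de: "0 < d" "0 < e"
  shows "integrable (M \<Otimes>\<^sub>M (U \<Otimes>\<^sub>M U)) (\<lambda>(w, p). \<phi> ((X (fst p) w - y) / d) / d * (\<psi> ((X (snd p) w - y) / e) / e))"
proof -
  interpret UU: pair_prob_space U U ..
  interpret MUU: pair_sigma_finite M "U \<Otimes>\<^sub>M U" ..
  have [measurable]: "\<phi> \<in> borel_measurable borel" "\<psi> \<in> borel_measurable borel" using \<phi> \<psi> by auto
  define K where "K = (\<integral>x. \<bar>\<phi> x\<bar> \<partial>lborel) * (\<integral>x. \<bar>\<psi> x\<bar> \<partial>lborel) / (2 * pi)"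
  have "(\<integral>\<^sup>+v. ennreal (norm (case v of (w, p) \<Rightarrow> \<phi> ((X (fst p) w - y) / d) / d * (\<psi> ((X (snd p) w - y) / e) / e))) \<partial>(M \<Otimes>\<^sub>M (U \<Otimes>\<^sub>M U)))
      = (\<integral>\<^sup>+p. \<integral>\<^sup>+w. ennreal \<bar>\<phi> ((X (fst p) w - y) / d) / d * (\<psi> ((X (snd p) w - y) / e) / e)\<bar> \<partial>M \<partial>(U \<Otimes>\<^sub>M U))"
    by (subst MUU.nn_integral_snd[symmetric]) auto
  also have "\<dots> \<le> (\<integral>\<^sup>+p. ennreal (K * (1 / m p)) \<partial>(U \<Otimes>\<^sub>M U))"
  proof (rule nn_integral_mono_AE, use det in eventually_elim)
    case (elim p)
    note E = pair_expectation[OF \<phi> \<psi> de elim[THEN conjunct1] elim[THEN conjunct2], of y]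
    have "(\<integral>\<^sup>+w. ennreal \<bar>\<phi> ((X (fst p) w - y) / d) / d * (\<psi> ((X (snd p) w - y) / e) / e)\<bar> \<partial>M)
        = ennreal (expectation (\<lambda>w. \<bar>\<phi> ((X (fst p) w - y) / d) / d * (\<psi> ((X (snd p) w - y) / e) / e)\<bar>))"
      using E(1) by (intro nn_integral_eq_integral integrable_abs) auto
    also have "\<dots> \<le> ennreal (K * (1 / m p))" unfolding K_def by (rule ennreal_leI[OF E(3)])
    finally show ?case .
  qed
  also have "\<dots> < \<infinity>"
  proof -
    have "integrable (U \<Otimes>\<^sub>M U) (\<lambda>p. K * (1 / m p))" by (rule integrable_mult_right[OF m_integrable])
    from integrableD(2)[OF this] show ?thesis by (simp add: less_top)
  qed
  finally show ?thesis by (simp add: integrable_iff_bounded)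
qed

text \<open>For almost every path the product of the values at two times is integrable by the second
  moment bound. The integral of its absolute value is the square of a single integral, so finiteness
  is inherited by the latter.\<close>

lemma AE_integrable_A:
  assumes \<phi>: "integrable lborel \<phi>" and d: "0 < d"
  shows "AE w in M. integrable U (\<lambda>s. \<phi> ((X s w - y) / d) / d)"
proof -
  interpret UU: pair_prob_space U U ..
  interpret MUU: pair_sigma_finite M "U \<Otimes>\<^sub>M U" ..
  have [measurable]: "\<phi> \<in> borel_measurable borel" using \<phi> by auto
  have "AE w in M. integrable (U \<Otimes>\<^sub>M U) (\<lambda>p. \<phi> ((X (fst p) w - y) / d) / d * (\<phi> ((X (snd p) w - y) / d) / d))"
    using MUU.AE_integrable_fst'[OF joint_integrable[OF \<phi> \<phi> d d, of y]] by simp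
  with AE_space show ?thesis
  proof eventually_elim
    case (elim w)
    define a where "a s = \<phi> ((X s w - y) / d) / d" for s
    have [measurable]: "a \<in> borel_measurable U" unfolding a_def[abs_def] using elim(1) by measurable
    have "integrable (U \<Otimes>\<^sub>M U) (\<lambda>p. a (fst p) * a (snd p))" using elim(2) by (simp add: a_def)
    then have "(\<integral>\<^sup>+p. ennreal (norm (a (fst p) * a (snd p))) \<partial>(U \<Otimes>\<^sub>M U)) < \<infinity>" by (simp add: integrable_iff_bounded)
    also have "(\<integral>\<^sup>+p. ennreal (norm (a (fst p) * a (snd p))) \<partial>(U \<Otimes>\<^sub>M U)) = (\<integral>\<^sup>+s. ennreal (norm (a s)) \<partial>U) * (\<integral>\<^sup>+s. ennreal (norm (a s)) \<partial>U)"
      by (subst U.nn_integral_fst[symmetric]) (auto simp: abs_mult ennreal_mult nn_integral_cmult nn_integral_multc)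
    finally have "(\<integral>\<^sup>+s. ennreal (norm (a s)) \<partial>U) < \<infinity>"
      by (auto simp: ennreal_mult_less_top less_top[symmetric])
    then show ?case by (simp add: integrable_iff_bounded a_def[symmetric])
  qed
qed

lemma A_second_moment:
  assumes \<phi>: "integrable lborel \<phi>" and \<psi>: "integrable lborel \<psi>" and de: "0 < d" "0 < e"
  shows "integrable M (\<lambda>w. A \<phi> y d w * A \<psi> y e w)"
    and "expectation (\<lambda>w. A \<phi> y d w * A \<psi> y e w)
      = (\<integral>p. expectation (\<lambda>w. \<phi> ((X (fst p) w - y) / d) / d * (\<psi> ((X (snd p) w - y) / e) / e)) \<partial>(U \<Otimes>\<^sub>M U))"
proof -
  interpret UU: pair_prob_space U U ..
  interpret MUU: pair_sigma_finite M "U \<Otimes>\<^sub>M U" ..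
  have [measurable]: "\<phi> \<in> borel_measurable borel" "\<psi> \<in> borel_measurable borel" using \<phi> \<psi> by auto
  note J = joint_integrable[OF \<phi> \<psi> de, of y]
  have eq: "AE w in M. A \<phi> y d w * A \<psi> y e w
      = (\<integral>p. \<phi> ((X (fst p) w - y) / d) / d * (\<psi> ((X (snd p) w - y) / e) / e) \<partial>(U \<Otimes>\<^sub>M U))"
    using AE_integrable_A[OF \<phi> de(1), of y] AE_integrable_A[OF \<psi> de(2), of y]
    by eventually_elim (unfold A_def, rule UU.integrable_fst_mult_snd(2)[symmetric])
  have i: "integrable M (\<lambda>w. \<integral>p. \<phi> ((X (fst p) w - y) / d) / d * (\<psi> ((X (snd p) w - y) / e) / e) \<partial>(U \<Otimes>\<^sub>M U))"
    using MUU.integrable_fst'[OF J] by simp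
  show "integrable M (\<lambda>w. A \<phi> y d w * A \<psi> y e w)"
    using i eq by (subst integrable_cong_AE[OF _ _ eq]) auto
  have "expectation (\<lambda>w. A \<phi> y d w * A \<psi> y e w)
      = (\<integral>w. \<integral>p. \<phi> ((X (fst p) w - y) / d) / d * (\<psi> ((X (snd p) w - y) / e) / e) \<partial>(U \<Otimes>\<^sub>M U) \<partial>M)"
    using i by (intro integral_cong_AE eq) auto
  also have "\<dots> = (\<integral>p. expectation (\<lambda>w. \<phi> ((X (fst p) w - y) / d) / d * (\<psi> ((X (snd p) w - y) / e) / e)) \<partial>(U \<Otimes>\<^sub>M U))"
    by (rule MUU.Fubini_integral[OF J, symmetric])
  finally show "expectation (\<lambda>w. A \<phi> y d w * A \<psi> y e w)
      = (\<integral>p. expectation (\<lambda>w. \<phi> ((X (fst p) w - y) / d) / d * (\<psi> ((X (snd p) w - y) / e) / e)) \<partial>(U \<Otimes>\<^sub>M U))" .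
qed

end

text \<open>The majorant \<open>K * (1 / m p)\<close> is the same for all \<open>n\<close>, so
  pointwise convergence of the covariances suffices, whether the scales tend to 0 or stay
  fixed.\<close>

lemma A_second_moment_tendsto:
  fixes X :: "nat \<Rightarrow> real \<Rightarrow> 'a \<Rightarrow> real" and Q :: "nat \<Rightarrow> real \<Rightarrow> real \<Rightarrow> real"
  assumes G: "\<And>n. gaussian_functional M U (X n) (Q n) m"
    and lim: "\<And>s u. (\<lambda>n. Q n s u) \<longlonglongrightarrow> Q' s u"
    and Q'[measurable]: "(\<lambda>(s, u). Q' s u) \<in> borel_measurable (borel \<Otimes>\<^sub>M borel)"
    and \<phi>: "integrable lborel \<phi>" and \<psi>: "integrable lborel \<psi>" and de: "\<And>n. 0 < d n" "\<And>n. 0 < e n"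
    and de_lim: "d \<longlonglongrightarrow> d'" "e \<longlonglongrightarrow> e'"
  shows "(\<lambda>n. \<integral>w. gaussian_functional.A U (X n) \<phi> y (d n) w * gaussian_functional.A U (X n) \<psi> y (e n) w \<partial>M)
    \<longlonglongrightarrow> (\<integral>p. gauss2_form \<phi> \<psi> y d' e' (Q' (fst p) (fst p)) (Q' (fst p) (snd p)) (Q' (snd p) (snd p)) \<partial>(U \<Otimes>\<^sub>M U))"
proof -
  interpret G: gaussian_functional M U "X n" "Q n" m for n by (rule G)
  have [measurable]: "\<phi> \<in> borel_measurable borel" "\<psi> \<in> borel_measurable borel" using \<phi> \<psi> by auto
  define K where "K = (\<integral>x. \<bar>\<phi> x\<bar> \<partial>lborel) * (\<integral>x. \<bar>\<psi> x\<bar> \<partial>lborel) / (2 * pi)"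
  have AE: "AE p in U \<Otimes>\<^sub>M U. \<forall>n. 0 < m p \<and> (m p)\<^sup>2 \<le> Q n (fst p) (fst p) * Q n (snd p) (snd p) - (Q n (fst p) (snd p))\<^sup>2"
    using G.det by (subst AE_all_countable) blast
  have Q'm[measurable (raw)]: "(\<lambda>x. Q' (f x) (g x)) \<in> borel_measurable L"
    if [measurable]: "f \<in> borel_measurable L" "g \<in> borel_measurable L" for f g and L :: "'s measure"
    using measurable_compose[OF measurable_Pair[OF that] Q'] by simp
  show ?thesis
    unfolding G.A_second_moment(2)[OF \<phi> \<psi> de]
  proof (rule integral_dominated_convergence)
    show "integrable (U \<Otimes>\<^sub>M U) (\<lambda>p. K * (1 / m p))" using G.m_integrable by (rule integrable_mult_right)
    show "(\<lambda>p. gauss2_form \<phi> \<psi> y d' e' (Q' (fst p) (fst p)) (Q' (fst p) (snd p)) (Q' (snd p) (snd p))) \<in> borel_measurable (U \<Otimes>\<^sub>M U)"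
      unfolding gauss2_form_def by measurable
    show "(\<lambda>p. \<integral>w. \<phi> ((X n (fst p) w - y) / d n) / d n * (\<psi> ((X n (snd p) w - y) / e n) / e n) \<partial>M) \<in> borel_measurable (U \<Otimes>\<^sub>M U)" for n
      by measurable
    show "AE p in U \<Otimes>\<^sub>M U. (\<lambda>n. \<integral>w. \<phi> ((X n (fst p) w - y) / d n) / d n * (\<psi> ((X n (snd p) w - y) / e n) / e n) \<partial>M)
        \<longlonglongrightarrow> gauss2_form \<phi> \<psi> y d' e' (Q' (fst p) (fst p)) (Q' (fst p) (snd p)) (Q' (snd p) (snd p))"
      using AE
    proof eventually_elim
      case (elim p)
      then have p: "0 < m p" "\<And>n. (m p)\<^sup>2 \<le> Q n (fst p) (fst p) * Q n (snd p) (snd p) - (Q n (fst p) (snd p))\<^sup>2" by auto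
      show ?case unfolding G.pair_expectation(2)[OF \<phi> \<psi> de p]
        by (intro gauss2_form_tendsto[OF \<phi> \<psi> p(1)] G.Q_diag_pos p lim de_lim)
    qed
    show "AE p in U \<Otimes>\<^sub>M U. norm (\<integral>w. \<phi> ((X n (fst p) w - y) / d n) / d n * (\<psi> ((X n (snd p) w - y) / e n) / e n) \<partial>M)
        \<le> K * (1 / m p)" for n
      using G.det[of n]
    proof eventually_elim
      case (elim p)
      note E = G.pair_expectation(3)[OF \<phi> \<psi> de elim[THEN conjunct1] elim[THEN conjunct2], of y]
      show ?case unfolding K_def real_norm_def by (rule order_trans[OF integral_abs_bound E])
    qed
  qed
qed

text \<open>The uniform bound \<open>K\<close> permits truncating the exponential series at one
  order \<open>k0\<close> for all the variables, with an error of at most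
  \<open>K ^ Suc k0 / fact (Suc k0)\<close>; what remains involves finitely many moments.\<close>

lemma iexp_expectation_tendsto_of_moments:
  fixes Z :: "nat \<Rightarrow> 'a \<Rightarrow> real" and Z' :: "'b \<Rightarrow> real"
  assumes M: "prob_space M" and N: "prob_space N"
    and [measurable]: "\<And>n. Z n \<in> borel_measurable M" "Z' \<in> borel_measurable N"
    and K: "\<And>n w. \<bar>Z n w\<bar> \<le> K" "\<And>w. \<bar>Z' w\<bar> \<le> K"
    and lim: "\<And>k. (\<lambda>n. \<integral>w. (Z n w) ^ k \<partial>M) \<longlonglongrightarrow> (\<integral>w. (Z' w) ^ k \<partial>N)"
  shows "(\<lambda>n. CLINT w|M. iexp (Z n w)) \<longlonglongrightarrow> (CLINT w|N. iexp (Z' w))"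
proof (rule LIMSEQ_I)
  fix r :: real assume "r > 0"
  have K0: "0 \<le> K" using K(2)[of undefined] by simp
  have "(\<lambda>k. K ^ k / fact k) \<longlonglongrightarrow> 0" 
    using summable_LIMSEQ_zero[OF summable_exp[of K]] by (simp add: divide_inverse mult.commute)
  then have "\<forall>\<^sub>F k in sequentially. K ^ k / fact k < r / 4" using \<open>r > 0\<close> by (intro order_tendstoD) auto
  then obtain k0 where "\<forall>k\<ge>k0. K ^ k / fact k < r / 4" by (auto simp: eventually_sequentially)
  \<comment> \<open>The remainder after the term of order \<open>k0\<close> has order
    \<open>Suc k0\<close>, which is why the bound is taken at the next index.\<close>
  then have k0: "K ^ Suc k0 / fact (Suc k0) < r / 4" by (meson le_SucI order_refl)
  have approx: "norm ((CLINT w|L. iexp (V w)) - (\<Sum>k\<le>k0. \<i> ^ k / fact k * of_real (\<integral>w. (V w) ^ k \<partial>L))) \<le> r / 4"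
    if L: "prob_space L" and [measurable]: "V \<in> borel_measurable L" and V: "\<And>w. \<bar>V w\<bar> \<le> K" for V and L :: "'s measure"
  proof -
    interpret L: prob_space L by fact
    have vi: "integrable L (\<lambda>w. (V w) ^ k)" for k
      by (rule L.integrable_const_bound[of _ "K ^ k"]) (auto simp: power_abs V intro!: power_mono)
    have ci: "integrable L (\<lambda>w. (\<i> * of_real (V w)) ^ k / fact k)" for k
    proof -
      have "integrable L (\<lambda>w. complex_of_real ((V w) ^ k))" using vi by (rule integrable_of_real)
      then show ?thesis by (simp add: power_mult_distrib)
    qed
    have si: "integrable L (\<lambda>w. \<Sum>k\<le>k0. (\<i> * of_real (V w)) ^ k / fact k)"
      by (intro Bochner_Integration.integrable_sum ci)
    have ei: "integrable L (\<lambda>w. iexp (V w))" by (rule L.integrable_iexp_rv) simp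
    have "(CLINT w|L. (\<Sum>k\<le>k0. (\<i> * of_real (V w)) ^ k / fact k)) = (\<Sum>k\<le>k0. \<i> ^ k / fact k * of_real (\<integral>w. (V w) ^ k \<partial>L))"
    proof (subst Bochner_Integration.integral_sum[OF ci], intro sum.cong refl)
      fix k
      have "(CLINT w|L. (\<i> * of_real (V w)) ^ k / fact k) = (CLINT w|L. \<i> ^ k / fact k * of_real ((V w) ^ k))"
        by (simp add: power_mult_distrib)
      then show "(CLINT w|L. (\<i> * of_real (V w)) ^ k / fact k) = \<i> ^ k / fact k * of_real (\<integral>w. (V w) ^ k \<partial>L)"
        by (simp only: integral_mult_right_zero integral_complex_of_real)
    qed
    then have "norm ((CLINT w|L. iexp (V w)) - (\<Sum>k\<le>k0. \<i> ^ k / fact k * of_real (\<integral>w. (V w) ^ k \<partial>L)))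
        = norm (CLINT w|L. iexp (V w) - (\<Sum>k\<le>k0. (\<i> * of_real (V w)) ^ k / fact k))"
      using si ei by simp
    also have "\<dots> \<le> (\<integral>w. norm (iexp (V w) - (\<Sum>k\<le>k0. (\<i> * of_real (V w)) ^ k / fact k)) \<partial>L)"
      by (rule integral_norm_bound)
    also have "\<dots> \<le> (\<integral>w. K ^ Suc k0 / fact (Suc k0) \<partial>L)"
    proof (rule integral_mono)
      fix w
      have "norm (iexp (V w) - (\<Sum>k\<le>k0. (\<i> * of_real (V w)) ^ k / fact k)) \<le> \<bar>V w\<bar> ^ Suc k0 / fact (Suc k0)"
        by (rule iexp_approx1)
      also have "\<dots> \<le> K ^ Suc k0 / fact (Suc k0)" using V by (intro divide_right_mono power_mono) auto
      finally show "norm (iexp (V w) - (\<Sum>k\<le>k0. (\<i> * of_real (V w)) ^ k / fact k)) \<le> K ^ Suc k0 / fact (Suc k0)" .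
    qed (use si ei in auto)
    also have "\<dots> \<le> r / 4" using k0 by (simp add: L.prob_space)
    finally show ?thesis .
  qed
  have "(\<lambda>n. \<Sum>k\<le>k0. \<i> ^ k / fact k * of_real (\<integral>w. (Z n w) ^ k \<partial>M))
      \<longlonglongrightarrow> (\<Sum>k\<le>k0. \<i> ^ k / fact k * complex_of_real (\<integral>w. (Z' w) ^ k \<partial>N))"
    by (intro tendsto_intros lim)
  from LIMSEQ_D[OF this, of "r / 4"] \<open>r > 0\<close> obtain n0 where n0: "norm ((\<Sum>k\<le>k0. \<i> ^ k / fact k * of_real (\<integral>w. (Z n w) ^ k \<partial>M))
      - (\<Sum>k\<le>k0. \<i> ^ k / fact k * complex_of_real (\<integral>w. (Z' w) ^ k \<partial>N))) < r / 4" if "n \<ge> n0" for n by auto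
  show "\<exists>no. \<forall>n\<ge>no. norm ((CLINT w|M. iexp (Z n w)) - (CLINT w|N. iexp (Z' w))) < r"
  proof (intro exI allI impI)
    fix n assume "n0 \<le> n"
    define a b c d where "a = (CLINT w|M. iexp (Z n w))" and "b = (CLINT w|N. iexp (Z' w))"
      and "c = (\<Sum>k\<le>k0. \<i> ^ k / fact k * complex_of_real (\<integral>w. (Z n w) ^ k \<partial>M))"
      and "d = (\<Sum>k\<le>k0. \<i> ^ k / fact k * complex_of_real (\<integral>w. (Z' w) ^ k \<partial>N))"
    have "norm (a - c) \<le> r / 4" unfolding a_def c_def by (intro approx M K) simp
    moreover have "norm (b - d) \<le> r / 4" unfolding b_def d_def by (intro approx N K) simp
    moreover have "norm (c - d) < r / 4" unfolding c_def d_def by (rule n0[OF \<open>n0 \<le> n\<close>])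
    moreover have "norm (a - b) \<le> norm (a - c) + norm (c - d) + norm (b - d)"
      using norm_triangle_ineq[of "a - c" "c - d"] norm_triangle_ineq4[of "a - d" "b - d"] by simp
    ultimately show "norm ((CLINT w|M. iexp (Z n w)) - (CLINT w|N. iexp (Z' w))) < r"
      using \<open>r > 0\<close> unfolding a_def b_def by linarith
  qed
qed

section \<open>Law of the functional smoothed by a Gaussian\<close>

lemma std_normal_density_scaled:
  assumes "0 < \<epsilon>"
  shows "complex_of_real (std_normal_density (v / \<epsilon>) / \<epsilon>)
    = of_real (1 / (\<epsilon> * sqrt (2 * pi))) * (CLINT \<xi>|std_normal_distribution. iexp (\<xi> / \<epsilon> * v))"
proof -
  have "(CLINT \<xi>|std_normal_distribution. iexp (\<xi> / \<epsilon> * v)) = char std_normal_distribution (v / \<epsilon>)"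
    unfolding char_def by (simp add: mult.commute)
  then have c: "(CLINT \<xi>|std_normal_distribution. iexp (\<xi> / \<epsilon> * v)) = of_real (exp (- (v / \<epsilon>)\<^sup>2 / 2))"
    by (simp only: char_std_normal_distribution)
  show ?thesis by (subst c) (simp add: std_normal_density_def)
qed

text \<open>The Gaussian kernel is a mixture of characters, so moments of the smoothed functional are integrals of
  finite-dimensional characteristic functions.\<close>

lemma smoothed_moment:
  fixes X :: "real \<Rightarrow> 'a \<Rightarrow> real"
  assumes M: "prob_space M" and U: "prob_space U" "sets U = sets borel"
    and X: "(\<lambda>(s, w). X s w) \<in> borel_measurable (borel \<Otimes>\<^sub>M M)" and "0 < \<epsilon>"
  defines "D \<equiv> U \<Otimes>\<^sub>M std_normal_distribution"
  shows "of_real (\<integral>w. (\<integral>s. std_normal_density ((X s w - y) / \<epsilon>) / \<epsilon> \<partial>U) ^ k \<partial>M)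
    = of_real ((1 / (\<epsilon> * sqrt (2 * pi))) ^ k) *
      (CLINT p|Pi\<^sub>M {..<k} (\<lambda>_. D). iexp (- (\<Sum>j<k. snd (p j) / \<epsilon> * y)) *
        (CLINT w|M. iexp (\<Sum>j<k. snd (p j) / \<epsilon> * X (fst (p j)) w)))"
    and "(\<lambda>p. iexp (- (\<Sum>j<k. snd (p j) / \<epsilon> * y)) * (CLINT w|M. iexp (\<Sum>j<k. snd (p j) / \<epsilon> * X (fst (p j)) w)))
      \<in> borel_measurable (Pi\<^sub>M {..<k} (\<lambda>_. D))"
proof -
  interpret prob_space M by fact
  interpret U: prob_space U by fact
  interpret S: prob_space std_normal_distribution by (rule prob_space_normal_density) simp
  interpret US: pair_prob_space U std_normal_distribution ..
  note [measurable_cong] = U(2)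
  have D: "prob_space D" unfolding D_def by unfold_locales
  interpret D: prob_space D by fact
  interpret PD: product_sigma_finite "\<lambda>_::nat. D" by unfold_locales
  define P where "P = Pi\<^sub>M {..<k} (\<lambda>_. D)"
  interpret P: prob_space P unfolding P_def by (intro prob_space_PiM D)
  interpret MP: pair_sigma_finite M P by unfold_locales
  interpret MP': pair_prob_space M P by unfold_locales
  have Xm[measurable (raw)]: "(\<lambda>x. X (f x) (g x)) \<in> borel_measurable L"
    if [measurable]: "f \<in> borel_measurable L" "g \<in> L \<rightarrow>\<^sub>M M" for f g and L :: "'s measure"
    using measurable_compose[OF measurable_Pair[OF that] X] by simp
  have [measurable_cong]: "sets D = sets (borel \<Otimes>\<^sub>M borel)" unfolding D_def by (intro sets_pair_measure_cong U) auto
  have comp: "(\<lambda>p. p j) \<in> P \<rightarrow>\<^sub>M borel \<Otimes>\<^sub>M borel" if "j < k" for j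
    using measurable_component_singleton[of j "{..<k}" "\<lambda>_. D"] that by (simp add: P_def cong: measurable_cong_sets)
  have sm: "(\<lambda>v. \<Sum>j<k. snd (f v j) / \<epsilon> * X (fst (f v j)) (g v)) \<in> borel_measurable L"
    if f: "f \<in> L \<rightarrow>\<^sub>M P" and [measurable]: "g \<in> L \<rightarrow>\<^sub>M M" for f g and L :: "'s measure"
  proof (rule borel_measurable_sum)
    fix j assume "j \<in> {..<k}"
    then have [measurable]: "(\<lambda>v. f v j) \<in> L \<rightarrow>\<^sub>M borel \<Otimes>\<^sub>M borel"
      using measurable_compose[OF f comp[of j]] by simp
    show "(\<lambda>v. snd (f v j) / \<epsilon> * X (fst (f v j)) (g v)) \<in> borel_measurable L" by measurable
  qed
  have ym[measurable]: "(\<lambda>p. \<Sum>j<k. snd (p j) / \<epsilon> * y) \<in> borel_measurable P"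
  proof (rule borel_measurable_sum)
    fix j assume "j \<in> {..<k}"
    then have [measurable]: "(\<lambda>p. p j) \<in> P \<rightarrow>\<^sub>M borel \<Otimes>\<^sub>M borel" by (simp add: comp)
    show "(\<lambda>p. snd (p j) / \<epsilon> * y) \<in> borel_measurable P" by measurable
  qed
  have [measurable]: "(\<lambda>v. \<Sum>j<k. snd (snd v j) / \<epsilon> * X (fst (snd v j)) (fst v)) \<in> borel_measurable (M \<Otimes>\<^sub>M P)"
    "(\<lambda>v. \<Sum>j<k. snd (fst v j) / \<epsilon> * X (fst (fst v j)) (snd v)) \<in> borel_measurable (P \<Otimes>\<^sub>M M)"
    by (intro sm; simp)+
  show "(\<lambda>p. iexp (- (\<Sum>j<k. snd (p j) / \<epsilon> * y)) * (CLINT w|M. iexp (\<Sum>j<k. snd (p j) / \<epsilon> * X (fst (p j)) w)))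
      \<in> borel_measurable (Pi\<^sub>M {..<k} (\<lambda>_. D))"
    unfolding P_def[symmetric] by measurable
  define c where "c = complex_of_real (1 / (\<epsilon> * sqrt (2 * pi)))"
  define G where "G w = (\<integral>s. std_normal_density ((X s w - y) / \<epsilon>) / \<epsilon> \<partial>U)" for w
  define e where "e w q = iexp (snd q / \<epsilon> * (X (fst q) w - y))" for w q
  have G: "of_real (G w) = c * (CLINT q|D. e w q)" if [measurable]: "w \<in> space M" for w
  proof -
    have [measurable]: "e w \<in> borel_measurable D" unfolding e_def[abs_def] by measurable
    have ei: "integrable D (e w)" by (rule D.integrable_const_bound[of _ 1]) (auto simp: e_def)
    have "of_real (G w) = (CLINT s|U. of_real (std_normal_density ((X s w - y) / \<epsilon>) / \<epsilon>))"
      by (simp only: G_def integral_complex_of_real)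
    also have "\<dots> = (CLINT s|U. c * (CLINT \<xi>|std_normal_distribution. e w (s, \<xi>)))"
      unfolding std_normal_density_scaled[OF \<open>0 < \<epsilon>\<close>] by (simp add: e_def c_def)
    also have "\<dots> = c * (CLINT q|D. e w q)"
      using US.integral_fst'[OF ei[unfolded D_def]] by (simp add: D_def)
    finally show ?thesis .
  qed
  \<comment> \<open>The power of an average is an average over \<open>k\<close> independent copies
    \<open>p j\<close> of the pair of time and frequency.\<close>
  have pow: "of_real (G w ^ k) = c ^ k * (CLINT p|P. \<Prod>j<k. e w (p j))" if [measurable]: "w \<in> space M" for w
  proof -
    have [measurable]: "e w \<in> borel_measurable D" unfolding e_def[abs_def] by measurable
    have ei: "integrable D (e w)" by (rule D.integrable_const_bound[of _ 1]) (auto simp: e_def)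
    have "(CLINT p|P. \<Prod>j<k. e w (p j)) = (\<Prod>j<k. CLINT q|D. e w q)"
      unfolding P_def by (rule PD.product_integral_prod) (auto intro: ei)
    then show ?thesis using that by (simp add: G power_mult_distrib)
  qed
  have prod: "(\<Prod>j<k. e w (p j)) = iexp (- (\<Sum>j<k. snd (p j) / \<epsilon> * y)) * iexp (\<Sum>j<k. snd (p j) / \<epsilon> * X (fst (p j)) w)" for w p
  proof -
    have "(\<Prod>j<k. e w (p j)) = exp (\<Sum>j<k. \<i> * complex_of_real (snd (p j) / \<epsilon> * (X (fst (p j)) w - y)))"
      by (simp add: e_def exp_sum)
    also have "(\<Sum>j<k. \<i> * complex_of_real (snd (p j) / \<epsilon> * (X (fst (p j)) w - y)))
        = \<i> * complex_of_real (- (\<Sum>j<k. snd (p j) / \<epsilon> * y)) + \<i> * complex_of_real (\<Sum>j<k. snd (p j) / \<epsilon> * X (fst (p j)) w)"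
      by (simp add: sum_distrib_left sum_subtractf[symmetric] algebra_simps)
    finally show ?thesis by (simp only: exp_add)
  qed
  have J: "integrable (M \<Otimes>\<^sub>M P) (\<lambda>(w, p). iexp (- (\<Sum>j<k. snd (p j) / \<epsilon> * y)) * iexp (\<Sum>j<k. snd (p j) / \<epsilon> * X (fst (p j)) w))"
  proof (rule MP'.integrable_const_bound[of _ 1])
    show "(\<lambda>(w, p). iexp (- (\<Sum>j<k. snd (p j) / \<epsilon> * y)) * iexp (\<Sum>j<k. snd (p j) / \<epsilon> * X (fst (p j)) w)) \<in> borel_measurable (M \<Otimes>\<^sub>M P)"
      unfolding split_beta by measurable
  qed (auto simp: norm_mult)
  have "of_real (\<integral>w. G w ^ k \<partial>M) = (CLINT w|M. of_real (G w ^ k))" by (rule integral_complex_of_real[symmetric])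
  also have "\<dots> = (CLINT w|M. c ^ k * (CLINT p|P. \<Prod>j<k. e w (p j)))"
    by (intro Bochner_Integration.integral_cong refl pow)
  also have "\<dots> = c ^ k * (CLINT w|M. CLINT p|P. iexp (- (\<Sum>j<k. snd (p j) / \<epsilon> * y)) * iexp (\<Sum>j<k. snd (p j) / \<epsilon> * X (fst (p j)) w))"
    by (simp only: prod integral_mult_right_zero)
  also have "(CLINT w|M. CLINT p|P. iexp (- (\<Sum>j<k. snd (p j) / \<epsilon> * y)) * iexp (\<Sum>j<k. snd (p j) / \<epsilon> * X (fst (p j)) w))
     = (CLINT p|P. CLINT w|M. iexp (- (\<Sum>j<k. snd (p j) / \<epsilon> * y)) * iexp (\<Sum>j<k. snd (p j) / \<epsilon> * X (fst (p j)) w))"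
    by (rule MP.Fubini_integral[OF J, symmetric])
  finally show "of_real (\<integral>w. (\<integral>s. std_normal_density ((X s w - y) / \<epsilon>) / \<epsilon> \<partial>U) ^ k \<partial>M)
    = of_real ((1 / (\<epsilon> * sqrt (2 * pi))) ^ k) *
      (CLINT p|Pi\<^sub>M {..<k} (\<lambda>_. D). iexp (- (\<Sum>j<k. snd (p j) / \<epsilon> * y)) *
        (CLINT w|M. iexp (\<Sum>j<k. snd (p j) / \<epsilon> * X (fst (p j)) w)))"
    by (simp only: G_def c_def P_def of_real_power integral_mult_right_zero)
qed

lemma std_normal_density_le_1: "std_normal_density v \<le> 1"
proof -
  have "1 \<le> sqrt (2 * pi)" using pi_gt3 by (intro real_le_rsqrt) auto
  then have "exp (- v\<^sup>2 / 2) / sqrt (2 * pi) \<le> 1 / 1" by (intro frac_le) auto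
  then show ?thesis by (simp add: std_normal_density_def)
qed

text \<open>At a fixed scale the smoothed functional is bounded by \<open>1 / \<epsilon>\<close>,
  and its moments depend on the process only through finite-dimensional characteristic functions,
  which converge with the covariances.\<close>

lemma smoothed_iexp_tendsto:
  fixes X :: "nat \<Rightarrow> real \<Rightarrow> 'a \<Rightarrow> real" and Y :: "real \<Rightarrow> 'b \<Rightarrow> real"
  assumes M: "prob_space M" and N: "prob_space N" and U: "prob_space U" "sets U = sets borel"
    and X: "\<And>n. (\<lambda>(s, w). X n s w) \<in> borel_measurable (borel \<Otimes>\<^sub>M M)" "\<And>n. gaussian_cov M (X n) (Q n)"
    and Y: "(\<lambda>(s, w). Y s w) \<in> borel_measurable (borel \<Otimes>\<^sub>M N)" "gaussian_cov N Y Q'"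
    and lim: "\<And>s u. (\<lambda>n. Q n s u) \<longlonglongrightarrow> Q' s u" and "0 < \<epsilon>"
  shows "(\<lambda>n. CLINT w|M. iexp (\<theta> * (\<integral>s. std_normal_density ((X n s w - y) / \<epsilon>) / \<epsilon> \<partial>U)))
    \<longlonglongrightarrow> (CLINT w|N. iexp (\<theta> * (\<integral>s. std_normal_density ((Y s w - y) / \<epsilon>) / \<epsilon> \<partial>U)))"
proof (rule iexp_expectation_tendsto_of_moments[OF M N])
  interpret M: prob_space M by fact
  interpret N: prob_space N by fact
  interpret U: prob_space U by fact
  note [measurable_cong] = U(2)
  interpret S: prob_space std_normal_distribution by (rule prob_space_normal_density) simp
  interpret US: pair_prob_space U std_normal_distribution ..
  define D where "D = U \<Otimes>\<^sub>M std_normal_distribution"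
  have D: "prob_space D" unfolding D_def by unfold_locales
  have [measurable (raw)]: "(\<lambda>x. X n (f x) (g x)) \<in> borel_measurable L"
    if [measurable]: "f \<in> borel_measurable L" "g \<in> L \<rightarrow>\<^sub>M M" for f g n and L :: "'s measure"
    using measurable_compose[OF measurable_Pair[OF that] X(1)[of n]] by simp
  have [measurable (raw)]: "(\<lambda>x. Y (f x) (g x)) \<in> borel_measurable L"
    if [measurable]: "f \<in> borel_measurable L" "g \<in> L \<rightarrow>\<^sub>M N" for f g and L :: "'s measure"
    using measurable_compose[OF measurable_Pair[OF that] Y(1)] by simp
  show "(\<lambda>w. \<theta> * (\<integral>s. std_normal_density ((X n s w - y) / \<epsilon>) / \<epsilon> \<partial>U)) \<in> borel_measurable M" for n by measurable
  show "(\<lambda>w. \<theta> * (\<integral>s. std_normal_density ((Y s w - y) / \<epsilon>) / \<epsilon> \<partial>U)) \<in> borel_measurable N" by measurable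
  have bd: "\<bar>\<theta> * (\<integral>s. std_normal_density (h s) / \<epsilon> \<partial>U)\<bar> \<le> \<bar>\<theta>\<bar> * (1 / \<epsilon>)" for h
  proof -
    have "\<bar>\<integral>s. std_normal_density (h s) / \<epsilon> \<partial>U\<bar> \<le> (\<integral>s. \<bar>std_normal_density (h s) / \<epsilon>\<bar> \<partial>U)" by (rule integral_abs_bound)
    also have "\<dots> \<le> (\<integral>s. 1 / \<epsilon> \<partial>U)"
      using \<open>0 < \<epsilon>\<close> std_normal_density_le_1 by (intro integral_mono') (auto intro!: divide_right_mono)
    also have "\<dots> = 1 / \<epsilon>" by (simp add: U.prob_space)
    finally show ?thesis unfolding abs_mult by (rule mult_left_mono) simp
  qed
  show "\<bar>\<theta> * (\<integral>s. std_normal_density ((X n s w - y) / \<epsilon>) / \<epsilon> \<partial>U)\<bar> \<le> \<bar>\<theta>\<bar> * (1 / \<epsilon>)" for n w by (rule bd)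
  show "\<bar>\<theta> * (\<integral>s. std_normal_density ((Y s w - y) / \<epsilon>) / \<epsilon> \<partial>U)\<bar> \<le> \<bar>\<theta>\<bar> * (1 / \<epsilon>)" for w by (rule bd)
  fix k :: nat
  interpret P: prob_space "Pi\<^sub>M {..<k} (\<lambda>_. D)" by (intro prob_space_PiM D)
  define E where "E p = iexp (- (\<Sum>j<k. snd (p j) / \<epsilon> * y))" for p :: "nat \<Rightarrow> real \<times> real"
  have "(\<lambda>n. CLINT p|Pi\<^sub>M {..<k} (\<lambda>_. D). E p * (CLINT w|M. iexp (\<Sum>j<k. snd (p j) / \<epsilon> * X n (fst (p j)) w)))
    \<longlonglongrightarrow> (CLINT p|Pi\<^sub>M {..<k} (\<lambda>_. D). E p * (CLINT w|N. iexp (\<Sum>j<k. snd (p j) / \<epsilon> * Y (fst (p j)) w)))"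
  proof (rule integral_dominated_convergence[where w = "\<lambda>_. 1"])
    show "AE p in Pi\<^sub>M {..<k} (\<lambda>_. D). (\<lambda>n. E p * (CLINT w|M. iexp (\<Sum>j<k. snd (p j) / \<epsilon> * X n (fst (p j)) w)))
      \<longlonglongrightarrow> E p * (CLINT w|N. iexp (\<Sum>j<k. snd (p j) / \<epsilon> * Y (fst (p j)) w))"
    proof (intro AE_I2 tendsto_mult tendsto_const)
      fix p :: "nat \<Rightarrow> real \<times> real"
      define \<theta> \<tau> where "\<theta> j = snd (p j) / \<epsilon>" and "\<tau> j = fst (p j)" for j
      have "(CLINT w|M. iexp (\<Sum>j<k. \<theta> j * X n (\<tau> j) w)) = of_real (exp (- (\<Sum>i<k. \<Sum>j<k. \<theta> i * \<theta> j * Q n (\<tau> i) (\<tau> j)) / 2))" for n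
        using X(2)[of n] unfolding gaussian_cov_def by blast
      moreover have "(CLINT w|N. iexp (\<Sum>j<k. \<theta> j * Y (\<tau> j) w)) = of_real (exp (- (\<Sum>i<k. \<Sum>j<k. \<theta> i * \<theta> j * Q' (\<tau> i) (\<tau> j)) / 2))"
        using Y(2) unfolding gaussian_cov_def by blast
      moreover have "(\<lambda>n. complex_of_real (exp (- (\<Sum>i<k. \<Sum>j<k. \<theta> i * \<theta> j * Q n (\<tau> i) (\<tau> j)) / 2)))
          \<longlonglongrightarrow> of_real (exp (- (\<Sum>i<k. \<Sum>j<k. \<theta> i * \<theta> j * Q' (\<tau> i) (\<tau> j)) / 2))"
        by (intro tendsto_intros lim; simp)
      ultimately show "(\<lambda>n. CLINT w|M. iexp (\<Sum>j<k. snd (p j) / \<epsilon> * X n (fst (p j)) w))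
          \<longlonglongrightarrow> (CLINT w|N. iexp (\<Sum>j<k. snd (p j) / \<epsilon> * Y (fst (p j)) w))"
        by (simp add: \<theta>_def \<tau>_def)
    qed
    show "AE p in Pi\<^sub>M {..<k} (\<lambda>_. D). norm (E p * (CLINT w|M. iexp (\<Sum>j<k. snd (p j) / \<epsilon> * X n (fst (p j)) w))) \<le> 1" for n
    proof (rule AE_I2)
      fix p :: "nat \<Rightarrow> real \<times> real"
      have "norm (CLINT w|M. iexp (\<Sum>j<k. snd (p j) / \<epsilon> * X n (fst (p j)) w)) \<le> (\<integral>w. norm (iexp (\<Sum>j<k. snd (p j) / \<epsilon> * X n (fst (p j)) w)) \<partial>M)"
        by (rule integral_norm_bound)
      also have "\<dots> = 1" unfolding norm_exp_i_times by (simp add: M.prob_space)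
      finally show "norm (E p * (CLINT w|M. iexp (\<Sum>j<k. snd (p j) / \<epsilon> * X n (fst (p j)) w))) \<le> 1"
        by (simp only: norm_mult E_def norm_exp_i_times mult_1)
    qed
    show "(\<lambda>p. E p * (CLINT w|N. iexp (\<Sum>j<k. snd (p j) / \<epsilon> * Y (fst (p j)) w))) \<in> borel_measurable (Pi\<^sub>M {..<k} (\<lambda>_. D))"
      unfolding E_def D_def by (rule smoothed_moment(2)[OF N U Y(1) \<open>0 < \<epsilon>\<close>])
    show "(\<lambda>p. E p * (CLINT w|M. iexp (\<Sum>j<k. snd (p j) / \<epsilon> * X n (fst (p j)) w))) \<in> borel_measurable (Pi\<^sub>M {..<k} (\<lambda>_. D))" for n
      unfolding E_def D_def by (rule smoothed_moment(2)[OF M U X(1) \<open>0 < \<epsilon>\<close>])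
  qed simp
  then have "(\<lambda>n. complex_of_real (\<integral>w. (\<integral>s. std_normal_density ((X n s w - y) / \<epsilon>) / \<epsilon> \<partial>U) ^ k \<partial>M))
    \<longlonglongrightarrow> of_real (\<integral>w. (\<integral>s. std_normal_density ((Y s w - y) / \<epsilon>) / \<epsilon> \<partial>U) ^ k \<partial>N)"
    unfolding smoothed_moment(1)[OF M U X(1) \<open>0 < \<epsilon>\<close>] smoothed_moment(1)[OF N U Y(1) \<open>0 < \<epsilon>\<close>] E_def D_def
    by (intro tendsto_mult tendsto_const)
  then have "(\<lambda>n. \<integral>w. (\<integral>s. std_normal_density ((X n s w - y) / \<epsilon>) / \<epsilon> \<partial>U) ^ k \<partial>M)
    \<longlonglongrightarrow> (\<integral>w. (\<integral>s. std_normal_density ((Y s w - y) / \<epsilon>) / \<epsilon> \<partial>U) ^ k \<partial>N)"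
    by (simp only: tendsto_of_real_iff)
  then have "(\<lambda>n. \<theta> ^ k * (\<integral>w. (\<integral>s. std_normal_density ((X n s w - y) / \<epsilon>) / \<epsilon> \<partial>U) ^ k \<partial>M))
    \<longlonglongrightarrow> \<theta> ^ k * (\<integral>w. (\<integral>s. std_normal_density ((Y s w - y) / \<epsilon>) / \<epsilon> \<partial>U) ^ k \<partial>N)"
    by (intro tendsto_intros)
  then show "(\<lambda>n. \<integral>w. (\<theta> * (\<integral>s. std_normal_density ((X n s w - y) / \<epsilon>) / \<epsilon> \<partial>U)) ^ k \<partial>M)
    \<longlonglongrightarrow> (\<integral>w. (\<theta> * (\<integral>s. std_normal_density ((Y s w - y) / \<epsilon>) / \<epsilon> \<partial>U)) ^ k \<partial>N)"
    unfolding power_mult_distrib integral_mult_right_zero .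
qed

text \<open>Gaussian decay in the crude form \<open>exp (- r) \<le> 1 / r\<close> with
  \<open>r\<close> of order \<open>1 / \<epsilon>\<^sup>2\<close>; one power of \<epsilon> remains
  after division by \<epsilon>, so the bound vanishes with \<epsilon>.\<close>

lemma std_normal_density_tail:
  assumes "0 < \<epsilon>" "0 < \<eta>" "\<eta> \<le> \<bar>v\<bar>"
  shows "std_normal_density (v / \<epsilon>) / \<epsilon> \<le> 2 * \<epsilon> / \<eta>\<^sup>2"
proof -
  define r where "r = (v / \<epsilon>)\<^sup>2 / 2"
  have v: "\<eta>\<^sup>2 \<le> v\<^sup>2" using power_mono[OF assms(3), of 2] assms(2) by simp
  then have v2: "0 < v\<^sup>2" using assms(2) by (smt (verit) zero_less_power)
  then have r: "0 < r" using assms by (simp add: r_def)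
  have "1 \<le> sqrt (2 * pi)" using pi_gt3 by (intro real_le_rsqrt) auto
  then have "std_normal_density (v / \<epsilon>) \<le> exp (- r) / 1"
    unfolding std_normal_density_def r_def by (simp add: field_simps mult_left_le_one_le divide_le_eq)
  also have "exp (- r) \<le> 1 / r"
  proof -
    have "r \<le> exp r" using exp_ge_add_one_self[of r] by linarith
    then have "1 / exp r \<le> 1 / r" using r by (intro frac_le) auto
    then show ?thesis by (simp add: exp_minus inverse_eq_divide)
  qed
  finally have "std_normal_density (v / \<epsilon>) / \<epsilon> \<le> 1 / r / \<epsilon>" using assms by (intro divide_right_mono) auto
  also have "\<dots> = 2 * \<epsilon> / v\<^sup>2" using assms v2 by (simp add: r_def power_divide power2_eq_square)
  also have "\<dots> \<le> 2 * \<epsilon> / \<eta>\<^sup>2" using assms v v2 by (intro divide_left_mono) auto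
  finally show ?thesis .
qed

text \<open>\<open>l\<close> is integrable and continuous at \<open>y\<close> but possibly
  unbounded. Near \<open>y\<close> it is bounded by continuity, and dominated convergence applies;
  away from \<open>y\<close> the kernel is uniformly small and the integral of \<open>l\<close> is
  finite.\<close>

lemma normal_smoothing_tendsto:
  fixes l :: "real \<Rightarrow> real"
  assumes l: "integrable lborel l" "\<And>x. 0 \<le> l x" "isCont l y" and \<epsilon>: "\<And>k. 0 < \<epsilon> k" "\<epsilon> \<longlonglongrightarrow> 0"
  shows "(\<lambda>k. \<integral>x. std_normal_density ((x - y) / \<epsilon> k) / \<epsilon> k * l x \<partial>lborel) \<longlonglongrightarrow> l y"
proof -
  have [measurable]: "l \<in> borel_measurable borel" using l(1) by auto
  obtain \<eta> where \<eta>: "0 < \<eta>" "\<And>x. \<bar>x - y\<bar> < \<eta> \<Longrightarrow> \<bar>l x - l y\<bar> < 1"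
    using l(3) unfolding continuous_at_eps_delta dist_real_def by (metis zero_less_one)
  define l1 where "l1 x = indicator {y - \<eta><..<y + \<eta>} x * l x" for x
  define l2 where "l2 x = l x - l1 x" for x
  have l12: "0 \<le> l1 x" "l1 x \<le> l x" "0 \<le> l2 x" "l2 x \<le> l x" for x using l(2)[of x] by (auto simp: l1_def l2_def indicator_def)
  have [measurable]: "l1 \<in> borel_measurable borel" "l2 \<in> borel_measurable borel"
    unfolding l1_def[abs_def] l2_def[abs_def] by measurable
  have i1: "integrable lborel l1" and i2: "integrable lborel l2"
    by (rule Bochner_Integration.integrable_bound[OF l(1)]; use l12 in \<open>auto intro!: AE_I2 order_trans[OF _ abs_ge_self]\<close>)+
  have l1b: "l1 x \<le> l y + 1" for x using \<eta>(2)[of x] l(2)[of y] by (auto simp: l1_def indicator_def abs_less_iff)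
  define g where "g k x = std_normal_density ((x - y) / \<epsilon> k) / \<epsilon> k" for k x
  have g0: "0 \<le> g k x" for k x using \<epsilon>(1)[of k] by (simp add: g_def)
  have gb: "g k x \<le> 1 / \<epsilon> k" for k x
    unfolding g_def using \<epsilon>(1)[of k] by (intro divide_right_mono std_normal_density_le_1) auto
  have [measurable]: "g k \<in> borel_measurable borel" for k unfolding g_def[abs_def] by measurable
  have gi: "integrable lborel (\<lambda>x. g k x * f x)" if "integrable lborel f" for k f
  proof (rule Bochner_Integration.integrable_bound[OF integrable_mult_right[OF integrable_abs[OF that], of "1 / \<epsilon> k"]])
    show "AE x in lborel. norm (g k x * f x) \<le> norm (1 / \<epsilon> k * \<bar>f x\<bar>)"
      unfolding norm_mult using g0[of k] gb[of k] \<epsilon>(1)[of k] by (intro AE_I2 mult_mono) auto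
  qed (use that in measurable)
  have 1: "(\<lambda>k. \<integral>x. g k x * l1 x \<partial>lborel) \<longlonglongrightarrow> l y"
  proof -
    have "(\<integral>x. g k x * l1 x \<partial>lborel) = (\<integral>z. std_normal_density z * l1 (y + \<epsilon> k * z) \<partial>lborel)" for k
      using lborel_integral_real_affine[of "\<epsilon> k" "\<lambda>x. g k x * l1 x" y] \<epsilon>(1)[of k] by (simp add: g_def)
    moreover have "(\<lambda>k. \<integral>z. std_normal_density z * l1 (y + \<epsilon> k * z) \<partial>lborel) \<longlonglongrightarrow> (\<integral>z. std_normal_density z * l y \<partial>lborel)"
    proof (rule integral_dominated_convergence[where w = "\<lambda>z. std_normal_density z * (l y + 1)"])
      show "AE z in lborel. (\<lambda>k. std_normal_density z * l1 (y + \<epsilon> k * z)) \<longlonglongrightarrow> std_normal_density z * l y"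
      proof (intro AE_I2 tendsto_mult tendsto_const)
        fix z
        have e: "(\<lambda>k. y + \<epsilon> k * z) \<longlonglongrightarrow> y" using tendsto_add[OF tendsto_const[of y] tendsto_mult_right[OF \<epsilon>(2), of z]] by simp
        have "(\<lambda>k. l (y + \<epsilon> k * z)) \<longlonglongrightarrow> l y" by (rule isCont_tendsto_compose[OF l(3) e])
        moreover have "\<forall>\<^sub>F k in sequentially. l (y + \<epsilon> k * z) = l1 (y + \<epsilon> k * z)"
          using order_tendstoD(1)[OF e, of "y - \<eta>"] order_tendstoD(2)[OF e, of "y + \<eta>"] \<eta>(1)
          by (auto elim: eventually_elim2 simp: l1_def)
        ultimately show "(\<lambda>k. l1 (y + \<epsilon> k * z)) \<longlonglongrightarrow> l y" by (rule Lim_transform_eventually)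
      qed
      show "AE z in lborel. norm (std_normal_density z * l1 (y + \<epsilon> k * z)) \<le> std_normal_density z * (l y + 1)" for k
        using l12(1) l1b by (intro AE_I2) (auto simp: abs_mult intro!: mult_left_mono)
    qed auto
    ultimately show ?thesis by simp
  qed
  have 2: "(\<lambda>k. \<integral>x. g k x * l2 x \<partial>lborel) \<longlonglongrightarrow> 0"
  proof (rule tendsto_sandwich[OF _ _ tendsto_const])
    show "\<forall>\<^sub>F k in sequentially. 0 \<le> (\<integral>x. g k x * l2 x \<partial>lborel)" using g0 l12 by simp
    show "(\<lambda>k. 2 * \<epsilon> k / \<eta>\<^sup>2 * (\<integral>x. l2 x \<partial>lborel)) \<longlonglongrightarrow> 0"
      by (rule tendsto_eq_intros \<epsilon>(2) refl | use \<eta>(1) in simp)+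
    show "\<forall>\<^sub>F k in sequentially. (\<integral>x. g k x * l2 x \<partial>lborel) \<le> 2 * \<epsilon> k / \<eta>\<^sup>2 * (\<integral>x. l2 x \<partial>lborel)"
    proof (intro always_eventually allI)
      fix k
      have "g k x * l2 x \<le> 2 * \<epsilon> k / \<eta>\<^sup>2 * l2 x" for x
      proof (cases "\<bar>x - y\<bar> < \<eta>")
        case True
        then have "l2 x = 0" by (auto simp: l2_def l1_def indicator_def abs_less_iff)
        then show ?thesis by simp
      next
        case False
        then show ?thesis unfolding g_def using \<epsilon>(1)[of k] \<eta>(1) l12(3)[of x]
          by (intro mult_right_mono std_normal_density_tail) auto
      qed
      then have "(\<integral>x. g k x * l2 x \<partial>lborel) \<le> (\<integral>x. 2 * \<epsilon> k / \<eta>\<^sup>2 * l2 x \<partial>lborel)"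
        using gi i2 by (intro integral_mono) auto
      then show "(\<integral>x. g k x * l2 x \<partial>lborel) \<le> 2 * \<epsilon> k / \<eta>\<^sup>2 * (\<integral>x. l2 x \<partial>lborel)"
        by (simp only: integral_mult_right_zero)
    qed
  qed
  have "(\<integral>x. g k x * l x \<partial>lborel) = (\<integral>x. g k x * l1 x \<partial>lborel) + (\<integral>x. g k x * l2 x \<partial>lborel)" for k
    using gi[OF i1] gi[OF i2] by (subst Bochner_Integration.integral_add[symmetric]) (auto simp: l2_def algebra_simps)
  then have "(\<lambda>k. \<integral>x. g k x * l x \<partial>lborel) \<longlonglongrightarrow> l y" using tendsto_add[OF 1 2] by simp
  then show ?thesis by (simp add: g_def)
qed

text \<open>Serves the second passage to the limit, in which the covariance is already that of the
  limit process and the smoothing scale tends to 0.\<close>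

lemma gauss2_form_integral_tendsto:
  assumes Q[measurable]: "(\<lambda>(s, u). Q s u) \<in> borel_measurable (borel \<Otimes>\<^sub>M borel)" and U: "prob_space U" "sets U = sets borel"
    and det: "AE p in U \<Otimes>\<^sub>M U. 0 < m p \<and> 0 < Q (fst p) (fst p) \<and> (m p)\<^sup>2 \<le> Q (fst p) (fst p) * Q (snd p) (snd p) - (Q (fst p) (snd p))\<^sup>2"
    and m: "integrable (U \<Otimes>\<^sub>M U) (\<lambda>p. 1 / m p)"
    and \<phi>: "integrable lborel \<phi>" and \<psi>: "integrable lborel \<psi>" and de: "d \<longlonglongrightarrow> d'" "e \<longlonglongrightarrow> e'"
  shows "(\<lambda>n. \<integral>p. gauss2_form \<phi> \<psi> y (d n) (e n) (Q (fst p) (fst p)) (Q (fst p) (snd p)) (Q (snd p) (snd p)) \<partial>(U \<Otimes>\<^sub>M U))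
    \<longlonglongrightarrow> (\<integral>p. gauss2_form \<phi> \<psi> y d' e' (Q (fst p) (fst p)) (Q (fst p) (snd p)) (Q (snd p) (snd p)) \<partial>(U \<Otimes>\<^sub>M U))"
proof (rule integral_dominated_convergence)
  note [measurable_cong] = U(2)
  have [measurable]: "\<phi> \<in> borel_measurable borel" "\<psi> \<in> borel_measurable borel" using \<phi> \<psi> by auto
  have [measurable (raw)]: "(\<lambda>x. Q (f x) (g x)) \<in> borel_measurable L"
    if [measurable]: "f \<in> borel_measurable L" "g \<in> borel_measurable L" for f g and L :: "'s measure"
    using measurable_compose[OF measurable_Pair[OF that] Q] by simp
  define K where "K = (\<integral>x. \<bar>\<phi> x\<bar> \<partial>lborel) * (\<integral>x. \<bar>\<psi> x\<bar> \<partial>lborel) / (2 * pi)"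
  show "integrable (U \<Otimes>\<^sub>M U) (\<lambda>p. K * (1 / m p))" using m by (rule integrable_mult_right)
  have fm: "(\<lambda>p. gauss2_form \<phi> \<psi> y a b (Q (fst p) (fst p)) (Q (fst p) (snd p)) (Q (snd p) (snd p))) \<in> borel_measurable (U \<Otimes>\<^sub>M U)" for a b
    unfolding gauss2_form_def by measurable
  show "(\<lambda>p. gauss2_form \<phi> \<psi> y d' e' (Q (fst p) (fst p)) (Q (fst p) (snd p)) (Q (snd p) (snd p))) \<in> borel_measurable (U \<Otimes>\<^sub>M U)"
    "(\<lambda>p. gauss2_form \<phi> \<psi> y (d n) (e n) (Q (fst p) (fst p)) (Q (fst p) (snd p)) (Q (snd p) (snd p))) \<in> borel_measurable (U \<Otimes>\<^sub>M U)" for n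
    by (rule fm)+
  show "AE p in U \<Otimes>\<^sub>M U. (\<lambda>n. gauss2_form \<phi> \<psi> y (d n) (e n) (Q (fst p) (fst p)) (Q (fst p) (snd p)) (Q (snd p) (snd p)))
      \<longlonglongrightarrow> gauss2_form \<phi> \<psi> y d' e' (Q (fst p) (fst p)) (Q (fst p) (snd p)) (Q (snd p) (snd p))"
    using det by eventually_elim (rule gauss2_form_tendsto[OF \<phi> \<psi>], auto intro: de)
  show "AE p in U \<Otimes>\<^sub>M U. norm (gauss2_form \<phi> \<psi> y (d n) (e n) (Q (fst p) (fst p)) (Q (fst p) (snd p)) (Q (snd p) (snd p))) \<le> K * (1 / m p)" for n
    using det
  proof eventually_elim
    case (elim p)
    then show ?case using gauss2_form_integrand(3)[OF \<phi> \<psi>, of _ "m p"] by (simp add: K_def)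
  qed
qed

text \<open>Both functionals have nearly the same second moments as, and nearly the same mixed moment with, the smoothed
  functional, which is thus close in \<open>L\<^sup>2\<close>; the law of the latter depends on finite-dimensional distributions only.\<close>

theorem gaussian_local_functional_limit:
  fixes X :: "nat \<Rightarrow> real \<Rightarrow> 'a \<Rightarrow> real" and Y :: "real \<Rightarrow> 'b \<Rightarrow> real" and L :: "'b \<Rightarrow> real"
  assumes G: "\<And>n. gaussian_functional M U (X n) (Q n) m"
    and N: "prob_space N" and Y: "(\<lambda>(s, w). Y s w) \<in> borel_measurable (borel \<Otimes>\<^sub>M N)" "gaussian_cov N Y Q'"
    and lim: "\<And>s u. (\<lambda>n. Q n s u) \<longlonglongrightarrow> Q' s u"
    and Q': "(\<lambda>(s, u). Q' s u) \<in> borel_measurable (borel \<Otimes>\<^sub>M borel)"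
    and L[measurable]: "L \<in> borel_measurable N"
    and local_time: "AE w in N. \<exists>l \<in> borel_measurable borel. (\<forall>x. 0 \<le> l x) \<and> isCont l y \<and> l y = L w \<and>
      distr U borel (\<lambda>s. Y s w) = density lborel (\<lambda>x. ennreal (l x))"
    and f: "integrable lborel f" and \<delta>: "\<And>n. 0 < \<delta> n" "\<delta> \<longlonglongrightarrow> 0"
  shows "weak_conv_m (\<lambda>n. distr M borel (\<lambda>w. \<integral>s. f ((X n s w - y) / \<delta> n) / \<delta> n \<partial>U)) (distr N borel (\<lambda>w. (\<integral>x. f x \<partial>lborel) * L w))"
proof -
  interpret G: gaussian_functional M U "X n" "Q n" m for n by (rule G)
  interpret N: prob_space N by fact
  interpret UU: pair_prob_space U U ..
  have [measurable]: "f \<in> borel_measurable borel" using f by auto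
  have [measurable (raw)]: "(\<lambda>x. Y (g x) (h x)) \<in> borel_measurable K"
    if [measurable]: "g \<in> borel_measurable K" "h \<in> K \<rightarrow>\<^sub>M N" for g h and K :: "'s measure"
    using measurable_compose[OF measurable_Pair[OF that] Y(1)] by simp
  define F where "F = (\<integral>x. f x \<partial>lborel)"
  define \<epsilon> where "\<epsilon> k = 1 / real (Suc k)" for k
  have \<epsilon>: "0 < \<epsilon> k" "\<epsilon> \<longlonglongrightarrow> 0" for k
    using LIMSEQ_inverse_real_of_nat by (auto simp: \<epsilon>_def[abs_def] inverse_eq_divide)
  have g: "integrable lborel std_normal_density" "(\<integral>x. std_normal_density x \<partial>lborel) = 1" by auto
  \<comment> \<open>The limit in \<open>n\<close> of a mixed second moment whose scales tend to
    \<open>d\<close> and \<open>e\<close>.\<close>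
  define J where "J \<phi> \<psi> d e = (\<integral>p. gauss2_form \<phi> \<psi> y d e (Q' (fst p) (fst p)) (Q' (fst p) (snd p)) (Q' (snd p) (snd p)) \<partial>(U \<Otimes>\<^sub>M U))"
    for \<phi> \<psi> d e
  define A where "A n = G.A n f y (\<delta> n)" for n
  define S where "S k n = G.A n std_normal_density y (\<epsilon> k)" for k n
  define S' where "S' k w = (\<integral>s. std_normal_density ((Y s w - y) / \<epsilon> k) / \<epsilon> k \<partial>U)" for k w
  have [measurable]: "A n \<in> borel_measurable M" "S k n \<in> borel_measurable M" for k n
    unfolding A_def S_def by measurable
  have [measurable]: "S' k \<in> borel_measurable N" for k unfolding S'_def[abs_def] by measurable

  \<comment> \<open>The limit over \<open>n\<close> of the squared \<open>L2\<close> distance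
    between \<open>A n\<close> and \<open>F * S k n\<close>. The scale of \<open>f\<close> has
    become 0 because \<delta> tends to 0, while the smoothing scale \<open>\<epsilon> k\<close>
    stays.\<close>
  define \<Delta> where "\<Delta> k = J f f 0 0 - 2 * F * J f std_normal_density 0 (\<epsilon> k) + F\<^sup>2 * J std_normal_density std_normal_density (\<epsilon> k) (\<epsilon> k)" for k
  have sq: "(A n w - F * S k n w)\<^sup>2 = A n w * A n w - 2 * F * (A n w * S k n w) + F\<^sup>2 * (S k n w * S k n w)" for n k w
    by (simp add: power2_eq_square algebra_simps)
  have iAA: "integrable M (\<lambda>w. A n w * A n w)" and iAS: "integrable M (\<lambda>w. A n w * S k n w)"
    and iSS: "integrable M (\<lambda>w. S k n w * S k n w)" for n k
    unfolding A_def S_def by (intro G.A_second_moment f g \<delta> \<epsilon>)+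
  have L2i: "integrable M (\<lambda>w. (A n w - F * S k n w)\<^sup>2)" for n k
    unfolding sq by (intro Bochner_Integration.integrable_add Bochner_Integration.integrable_diff integrable_mult_right iAA iAS iSS)
  have L2: "(\<lambda>n. \<integral>w. (A n w - F * S k n w)\<^sup>2 \<partial>M) \<longlonglongrightarrow> \<Delta> k" for k
  proof -
    have "(\<integral>w. (A n w - F * S k n w)\<^sup>2 \<partial>M) = (\<integral>w. A n w * A n w \<partial>M) - 2 * F * (\<integral>w. A n w * S k n w \<partial>M) + F\<^sup>2 * (\<integral>w. S k n w * S k n w \<partial>M)" for n
      unfolding sq using iAA iAS iSS by simp
    then show ?thesis unfolding \<Delta>_def J_def A_def S_def
      by (auto intro!: tendsto_add tendsto_diff tendsto_mult_left A_second_moment_tendsto[OF G lim Q'] f g \<delta> \<epsilon> tendsto_const)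
  qed
  have \<Delta>0: "\<Delta> \<longlonglongrightarrow> 0"
  proof -
    \<comment> \<open>The determinant bound survives the limit of the covariances, and it excludes a
      vanishing variance of the limit.\<close>
    have det: "AE p in U \<Otimes>\<^sub>M U. 0 < m p \<and> 0 < Q' (fst p) (fst p) \<and> (m p)\<^sup>2 \<le> Q' (fst p) (fst p) * Q' (snd p) (snd p) - (Q' (fst p) (snd p))\<^sup>2"
    proof -
      have "AE p in U \<Otimes>\<^sub>M U. \<forall>n. 0 < m p \<and> (m p)\<^sup>2 \<le> Q n (fst p) (fst p) * Q n (snd p) (snd p) - (Q n (fst p) (snd p))\<^sup>2"
        using G.det by (subst AE_all_countable) blast
      then show ?thesis
      proof eventually_elim
        case (elim p)
        have "(\<lambda>n. Q n (fst p) (fst p) * Q n (snd p) (snd p) - (Q n (fst p) (snd p))\<^sup>2)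
            \<longlonglongrightarrow> Q' (fst p) (fst p) * Q' (snd p) (snd p) - (Q' (fst p) (snd p))\<^sup>2"
          by (intro tendsto_intros lim)
        from LIMSEQ_le_const[OF this, of "(m p)\<^sup>2"] have d: "(m p)\<^sup>2 \<le> Q' (fst p) (fst p) * Q' (snd p) (snd p) - (Q' (fst p) (snd p))\<^sup>2"
          using elim by blast
        have "0 \<le> Q' (fst p) (fst p)"
          by (rule LIMSEQ_le_const[OF lim]) (auto intro: G.Q_diag_nonneg)
        moreover have "Q' (fst p) (fst p) \<noteq> 0"
        proof
          assume "Q' (fst p) (fst p) = 0"
          then have "(m p)\<^sup>2 + (Q' (fst p) (snd p))\<^sup>2 \<le> 0" using d by simp
          then show False using elim by (simp add: sum_power2_le_zero_iff)
        qed
        ultimately show ?case using elim d by simp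
      qed
    qed
    note T = gauss2_form_integral_tendsto[OF Q' G.U.prob_space_axioms G.sets_U det G.m_integrable, of _ _ _ _ _ _ y]
    have "\<Delta> \<longlonglongrightarrow> J f f 0 0 - 2 * F * J f std_normal_density 0 0 + F\<^sup>2 * J std_normal_density std_normal_density 0 0"
      unfolding \<Delta>_def J_def
      by (intro tendsto_add tendsto_diff tendsto_mult_left tendsto_const T f g \<epsilon>)
    \<comment> \<open>At scale 0 the three forms are \<open>F\<^sup>2\<close>, \<open>F\<close> and
      1 times the same integral of the density at \<open>(y, y)\<close>, so the sum is a multiple of
      \<open>F\<^sup>2 - 2 * F * F + F\<^sup>2\<close>.\<close>
    also have "J f f 0 0 - 2 * F * J f std_normal_density 0 0 + F\<^sup>2 * J std_normal_density std_normal_density 0 0 = 0"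
      unfolding J_def gauss2_form_0[OF f f] gauss2_form_0[OF f g(1)] gauss2_form_0[OF g(1) g(1)] g(2) F_def[symmetric]
      by (simp add: power2_eq_square)
    finally show ?thesis .
  qed
  have \<Delta>_nonneg: "0 \<le> \<Delta> k" for k by (rule LIMSEQ_le_const[OF L2]) auto

  have SY: "(\<lambda>n. CLINT w|M. iexp (\<theta> * S k n w)) \<longlonglongrightarrow> (CLINT w|N. iexp (\<theta> * S' k w))" for \<theta> k
    unfolding S_def S'_def G.A_def
    by (rule smoothed_iexp_tendsto[OF G.prob_space_axioms N G.U.prob_space_axioms G.sets_U G.X_measurable G.cov Y lim \<epsilon>(1)])

  \<comment> \<open>For almost every path the smoothed functional of the limit process is the
    Gaussian smoothing of its occupation density at \<open>y\<close>.\<close>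
  have S'L: "AE w in N. (\<lambda>k. S' k w) \<longlonglongrightarrow> L w"
    using local_time AE_space
  proof eventually_elim
    case (elim w)
    from elim(1) obtain l where [measurable]: "l \<in> borel_measurable borel" and l: "\<And>x. 0 \<le> l x" "isCont l y" "l y = L w"
      and D: "distr U borel (\<lambda>s. Y s w) = density lborel (\<lambda>x. ennreal (l x))" by blast
    have [measurable]: "(\<lambda>s. Y s w) \<in> borel_measurable U" using elim(2) by measurable
    have "prob_space (distr U borel (\<lambda>s. Y s w))" by (rule G.U.prob_space_distr) simp
    from prob_space.emeasure_space_1[OF this] have "(\<integral>\<^sup>+x. ennreal (l x) \<partial>lborel) = 1"
      unfolding D by (simp add: emeasure_density)
    then have li: "integrable lborel l" using l(1) by (simp add: integrable_iff_bounded)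
    have "S' k w = (\<integral>x. std_normal_density ((x - y) / \<epsilon> k) / \<epsilon> k \<partial>distr U borel (\<lambda>s. Y s w))" for k
      unfolding S'_def by (subst integral_distr) auto
    also have "\<dots> k = (\<integral>x. std_normal_density ((x - y) / \<epsilon> k) / \<epsilon> k * l x \<partial>lborel)" for k
      unfolding D using l(1) by (subst integral_density) (auto simp: mult.commute)
    finally show ?case using normal_smoothing_tendsto[OF li l(1,2) \<epsilon>] l(3) by simp
  qed
  have YL: "(\<lambda>k. CLINT w|N. iexp (\<theta> * S' k w)) \<longlonglongrightarrow> (CLINT w|N. iexp (\<theta> * L w))" for \<theta>
  proof (rule integral_dominated_convergence[where w = "\<lambda>_. 1"])
    show "AE w in N. (\<lambda>k. iexp (\<theta> * S' k w)) \<longlonglongrightarrow> iexp (\<theta> * L w)"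
      using S'L by eventually_elim (intro tendsto_intros)
  qed auto

  have main: "(\<lambda>n. CLINT w|M. iexp (\<theta> * A n w)) \<longlonglongrightarrow> (CLINT w|N. iexp (\<theta> * (F * L w)))" for \<theta>
  proof (rule LIMSEQ_I)
    fix r :: real assume "r > 0"
    \<comment> \<open>The index \<open>k\<close> is fixed by two conditions that do not involve
      \<open>n\<close>, and \<open>n\<close> is taken large afterwards; each of the three errors is
      below \<open>r / 3\<close>.\<close>
    have "(\<lambda>k. \<bar>\<theta>\<bar> * sqrt (\<Delta> k)) \<longlonglongrightarrow> \<bar>\<theta>\<bar> * sqrt 0" by (intro tendsto_intros \<Delta>0)
    then have "\<forall>\<^sub>F k in sequentially. \<bar>\<theta>\<bar> * sqrt (\<Delta> k) < r / 3" using \<open>r > 0\<close> by (intro order_tendstoD) auto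
    moreover have "\<forall>\<^sub>F k in sequentially. dist (CLINT w|N. iexp (\<theta> * F * S' k w)) (CLINT w|N. iexp (\<theta> * F * L w)) < r / 3"
      by (rule tendstoD[OF YL]) (use \<open>r > 0\<close> in simp)
    ultimately obtain k where k: "\<bar>\<theta>\<bar> * sqrt (\<Delta> k) < r / 3"
      "dist (CLINT w|N. iexp (\<theta> * F * S' k w)) (CLINT w|N. iexp (\<theta> * F * L w)) < r / 3"
      by (metis (mono_tags, lifting) eventually_conj eventually_happens' sequentially_bot)
    have "(\<lambda>n. \<bar>\<theta>\<bar> * sqrt (\<integral>w. (A n w - F * S k n w)\<^sup>2 \<partial>M)) \<longlonglongrightarrow> \<bar>\<theta>\<bar> * sqrt (\<Delta> k)" by (intro tendsto_intros L2)
    then have "\<forall>\<^sub>F n in sequentially. \<bar>\<theta>\<bar> * sqrt (\<integral>w. (A n w - F * S k n w)\<^sup>2 \<partial>M) < r / 3"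
      using k(1) by (intro order_tendstoD)
    moreover have "\<forall>\<^sub>F n in sequentially. dist (CLINT w|M. iexp (\<theta> * F * S k n w)) (CLINT w|N. iexp (\<theta> * F * S' k w)) < r / 3"
      by (rule tendstoD[OF SY]) (use \<open>r > 0\<close> in simp)
    ultimately have "\<forall>\<^sub>F n in sequentially. norm ((CLINT w|M. iexp (\<theta> * A n w)) - (CLINT w|N. iexp (\<theta> * (F * L w)))) < r"
    proof eventually_elim
      case (elim n)
      have e: "(\<theta> * A n w - \<theta> * F * S k n w)\<^sup>2 = \<theta>\<^sup>2 * (A n w - F * S k n w)\<^sup>2" for w
        by (simp add: power2_eq_square algebra_simps)
      have "norm ((CLINT w|M. iexp (\<theta> * A n w)) - (CLINT w|M. iexp (\<theta> * F * S k n w)))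
          \<le> sqrt (\<integral>w. (\<theta> * A n w - \<theta> * F * S k n w)\<^sup>2 \<partial>M)"
        using L2i[of n k] by (intro G.norm_iexp_expectation_diff_le) (auto simp: e)
      also have "\<dots> = \<bar>\<theta>\<bar> * sqrt (\<integral>w. (A n w - F * S k n w)\<^sup>2 \<partial>M)" unfolding e by (simp add: real_sqrt_mult)
      finally have "dist (CLINT w|M. iexp (\<theta> * A n w)) (CLINT w|M. iexp (\<theta> * F * S k n w)) < r / 3"
        using elim(1) by (simp add: dist_norm)
      with elim(2) k(2) have "dist (CLINT w|M. iexp (\<theta> * A n w)) (CLINT w|N. iexp (\<theta> * F * L w)) < r / 3 + r / 3 + r / 3"
        by (meson add_strict_mono dist_triangle le_less_trans add_mono order_refl)
      then show ?case by (simp add: dist_norm mult.assoc)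
    qed
    then show "\<exists>no. \<forall>n\<ge>no. norm ((CLINT w|M. iexp (\<theta> * A n w)) - (CLINT w|N. iexp (\<theta> * (F * L w)))) < r"
      by (simp add: eventually_sequentially)
  qed
  show ?thesis
  proof (rule levy_continuity)
    have Aeq: "(\<lambda>w. \<integral>s. f ((X n s w - y) / \<delta> n) / \<delta> n \<partial>U) = A n" for n by (simp add: A_def G.A_def fun_eq_iff)
    show "real_distribution (distr M borel (\<lambda>w. \<integral>s. f ((X n s w - y) / \<delta> n) / \<delta> n \<partial>U))" for n
      unfolding Aeq by (rule G.real_distribution_distr) simp
    show "real_distribution (distr N borel (\<lambda>w. (\<integral>x. f x \<partial>lborel) * L w))"
      by (rule N.real_distribution_distr) simp
    show "(\<lambda>n. char (distr M borel (\<lambda>w. \<integral>s. f ((X n s w - y) / \<delta> n) / \<delta> n \<partial>U)) \<theta>)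
        \<longlonglongrightarrow> char (distr N borel (\<lambda>w. (\<integral>x. f x \<partial>lborel) * L w)) \<theta>" for \<theta>
      unfolding Aeq char_def F_def[symmetric] using main[of \<theta>] by (simp add: integral_distr)
  qed
qed

section \<open>Local nondeterminism\<close>

lemma integrable_L2_inner:
  fixes p q :: "'s \<Rightarrow> 'b::euclidean_space"
  assumes [measurable]: "p \<in> borel_measurable N" "q \<in> borel_measurable N"
    and sq: "integrable N (\<lambda>u. (norm (p u))\<^sup>2)" "integrable N (\<lambda>u. (norm (q u))\<^sup>2)"
  shows "integrable N (\<lambda>u. p u \<bullet> q u)"
proof (rule Bochner_Integration.integrable_bound[of _ "\<lambda>u. (norm (p u))\<^sup>2 + (norm (q u))\<^sup>2"])
  show "AE u in N. norm (p u \<bullet> q u) \<le> norm ((norm (p u))\<^sup>2 + (norm (q u))\<^sup>2)"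
  proof (rule AE_I2)
    fix u
    have "\<bar>p u \<bullet> q u\<bar> \<le> norm (p u) * norm (q u)" by (rule Cauchy_Schwarz_ineq2)
    moreover have "0 \<le> (norm (p u) - norm (q u))\<^sup>2 + (norm (p u))\<^sup>2 + (norm (q u))\<^sup>2" by simp
    ultimately show "norm (p u \<bullet> q u) \<le> norm ((norm (p u))\<^sup>2 + (norm (q u))\<^sup>2)"
      unfolding power2_diff by simp
  qed
qed (use sq in auto)

text \<open>Polarisation: covariances are determined by the squared norms of values and of
  increments.\<close>

lemma integral_L2_inner:
  fixes p q :: "'s \<Rightarrow> 'b::euclidean_space"
  assumes meas: "p \<in> borel_measurable N" "q \<in> borel_measurable N"
    and sq: "integrable N (\<lambda>u. (norm (p u))\<^sup>2)" "integrable N (\<lambda>u. (norm (q u))\<^sup>2)"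
  shows "(\<integral>u. p u \<bullet> q u \<partial>N) = ((\<integral>u. (norm (p u))\<^sup>2 \<partial>N) + (\<integral>u. (norm (q u))\<^sup>2 \<partial>N) - (\<integral>u. (norm (p u - q u))\<^sup>2 \<partial>N)) / 2"
proof -
  have e: "p u \<bullet> q u = ((norm (p u))\<^sup>2 + (norm (q u))\<^sup>2 - (norm (p u - q u))\<^sup>2) / 2" for u
    by (simp add: power2_norm_eq_inner inner_diff inner_commute)
  show ?thesis unfolding e using sq integrable_L2_diff[OF meas sq] by simp
qed

lemma integral_norm_power2_lincomb:
  fixes p q :: "'s \<Rightarrow> 'b::euclidean_space"
  assumes meas: "p \<in> borel_measurable N" "q \<in> borel_measurable N"
    and sq: "integrable N (\<lambda>u. (norm (p u))\<^sup>2)" "integrable N (\<lambda>u. (norm (q u))\<^sup>2)"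
  shows "(\<integral>u. (norm (a *\<^sub>R p u + b *\<^sub>R q u))\<^sup>2 \<partial>N)
    = a\<^sup>2 * (\<integral>u. (norm (p u))\<^sup>2 \<partial>N) + 2 * a * b * (\<integral>u. p u \<bullet> q u \<partial>N) + b\<^sup>2 * (\<integral>u. (norm (q u))\<^sup>2 \<partial>N)"
proof -
  have e: "(norm (a *\<^sub>R p u + b *\<^sub>R q u))\<^sup>2 = a\<^sup>2 * (norm (p u))\<^sup>2 + 2 * a * b * (p u \<bullet> q u) + b\<^sup>2 * (norm (q u))\<^sup>2" for u
    unfolding power2_norm_eq_inner
    by (simp add: inner_add inner_commute power2_eq_square algebra_simps)
  show ?thesis unfolding e using sq integrable_L2_inner[OF meas sq] by simp
qed

text \<open>\<open>R f X\<close> reads: \<open>X\<close> is a version of the integral of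
  \<open>f\<close>. It is a relation because integrals are determined only almost surely; it covers
  the Wiener integral of real integrands and the spectral integral of complex ones.\<close>

locale gaussian_integral = prob_space M for M :: "'a measure" +
  fixes R :: "(real \<Rightarrow> 'c::euclidean_space) \<Rightarrow> ('a \<Rightarrow> real) \<Rightarrow> bool"
  assumes R_measurable: "R f X \<Longrightarrow> f \<in> borel_measurable borel" "R f X \<Longrightarrow> X \<in> borel_measurable M"
    and R_square_integrable: "R f X \<Longrightarrow> integrable lborel (\<lambda>u. (norm (f u))\<^sup>2)"
    and R_lincomb: "R f X \<Longrightarrow> R g Y \<Longrightarrow> R (\<lambda>u. a *\<^sub>R f u + b *\<^sub>R g u) (\<lambda>w. a * X w + b * Y w)"
    and R_iexp: "R f X \<Longrightarrow> (CLINT w|M. iexp (X w)) = of_real (exp (- (\<integral>u. (norm (f u))\<^sup>2 \<partial>lborel) / 2))"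
begin

lemma R_sum:
  fixes n :: nat
  assumes "\<And>j. j \<le> n \<Longrightarrow> R (f j) (X j)"
  shows "R (\<lambda>u. \<Sum>j\<le>n. \<theta> j *\<^sub>R f j u) (\<lambda>w. \<Sum>j\<le>n. \<theta> j * X j w)"
  using assms
proof (induction n)
  case 0
  then show ?case using R_lincomb[of "f 0" "X 0" "f 0" "X 0" "\<theta> 0" 0] by simp
next
  case (Suc n)
  then have "R (\<lambda>u. \<Sum>j\<le>n. \<theta> j *\<^sub>R f j u) (\<lambda>w. \<Sum>j\<le>n. \<theta> j * X j w)" by simp
  from R_lincomb[OF this Suc.prems[of "Suc n"], of 1 "\<theta> (Suc n)"] show ?case by simp
qed

text \<open>A linear combination of values is an integral of the same combination of kernels, so its
  characteristic function is known; expanding the squared norm of the combined kernel yields the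
  covariance.\<close>

lemma gaussian_cov_R:
  assumes R: "\<And>s. R (\<kappa> s) (X s)"
  shows "gaussian_cov M X (\<lambda>s u. \<integral>v. \<kappa> s v \<bullet> \<kappa> u v \<partial>lborel)"
  unfolding gaussian_cov_def
proof (intro conjI allI)
  fix s
  show "X s \<in> borel_measurable M" by (intro R_measurable(2)[OF R])
next
  fix n :: nat and \<theta> \<tau> :: "nat \<Rightarrow> real"
  show "(CLINT w|M. iexp (\<Sum>j<n. \<theta> j * X (\<tau> j) w))
      = of_real (exp (- (\<Sum>i<n. \<Sum>j<n. \<theta> i * \<theta> j * (\<integral>v. \<kappa> (\<tau> i) v \<bullet> \<kappa> (\<tau> j) v \<partial>lborel)) / 2))"
  proof (cases n)
    case 0
    then show ?thesis by (simp add: prob_space)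
  next
    \<comment> \<open>\<open>R_sum\<close> treats nonempty sums, indexed up to and including the
      last term, hence the passage from \<open>n\<close> to \<open>m\<close>.\<close>
    case (Suc m)
    have n: "{..<n} = {..m}" using Suc by auto
    have Rj: "R (\<kappa> (\<tau> j)) (X (\<tau> j))" for j by (rule R)
    have int: "integrable lborel (\<lambda>v. \<kappa> (\<tau> i) v \<bullet> \<kappa> (\<tau> j) v)" for i j
      using Rj[of i] Rj[of j]
      by (intro integrable_L2_inner R_square_integrable) (auto dest: R_measurable)
    have "(\<integral>v. (norm (\<Sum>j\<le>m. \<theta> j *\<^sub>R \<kappa> (\<tau> j) v))\<^sup>2 \<partial>lborel)
        = (\<integral>v. (\<Sum>i\<le>m. \<Sum>j\<le>m. \<theta> i * \<theta> j * (\<kappa> (\<tau> i) v \<bullet> \<kappa> (\<tau> j) v)) \<partial>lborel)"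
      by (intro Bochner_Integration.integral_cong refl)
        (simp add: power2_norm_eq_inner inner_sum_left inner_sum_right sum_distrib_left, intro sum.cong refl, simp add: inner_commute)
    also have "\<dots> = (\<Sum>i\<le>m. \<integral>v. (\<Sum>j\<le>m. \<theta> i * \<theta> j * (\<kappa> (\<tau> i) v \<bullet> \<kappa> (\<tau> j) v)) \<partial>lborel)"
      using int by (intro Bochner_Integration.integral_sum Bochner_Integration.integrable_sum integrable_mult_right) auto
    also have "\<dots> = (\<Sum>i\<le>m. \<Sum>j\<le>m. \<integral>v. \<theta> i * \<theta> j * (\<kappa> (\<tau> i) v \<bullet> \<kappa> (\<tau> j) v) \<partial>lborel)"
      using int by (intro sum.cong refl Bochner_Integration.integral_sum integrable_mult_right) auto
    also have "\<dots> = (\<Sum>i\<le>m. \<Sum>j\<le>m. \<theta> i * \<theta> j * (\<integral>v. \<kappa> (\<tau> i) v \<bullet> \<kappa> (\<tau> j) v \<partial>lborel))"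
      by simp
    finally show ?thesis using R_iexp[OF R_sum[of m "\<lambda>j. \<kappa> (\<tau> j)" "\<lambda>j. X (\<tau> j)" \<theta>, OF Rj]] unfolding n by simp
  qed
qed

end

text \<open>With \<open>x = q / p \<le> 1\<close>, the inequality of weighted means gives
  \<open>(1 + x) powr h \<le> 1 + h * x\<close>, and \<open>x \<le> x powr h\<close>.\<close>

lemma powr_add_le_bernoulli:
  fixes p q :: real
  assumes "0 < q" "q \<le> p" "0 < h" "h < 1"
  shows "(p + q) powr h \<le> p powr h + h * q powr h"
proof -
  define x where "x = q / p"
  have x: "0 < x" "x \<le> 1" using assms by (auto simp: x_def)
  have "(1 + x) powr h * 1 powr (1 - h) \<le> h * (1 + x) + (1 - h) * 1"
    using assms x by (intro Youngs_inequality_0) auto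
  then have "(1 + x) powr h \<le> 1 + h * x" by (simp add: algebra_simps)
  also have "x \<le> x powr h" using x assms powr_mono'[of h 1 x] by simp
  finally have 1: "(1 + x) powr h \<le> 1 + h * x powr h" using assms by simp
  have "(p + q) powr h = p powr h * (1 + x) powr h"
  proof -
    have "p + q = p * (1 + x)" using assms by (simp add: x_def field_simps)
    then show ?thesis using assms x by (simp add: powr_mult)
  qed
  also have "\<dots> \<le> p powr h * (1 + h * x powr h)" using 1 by (intro mult_left_mono) auto
  also have "\<dots> = p powr h + h * q powr h" using assms by (simp add: x_def powr_divide field_simps)
  finally show ?thesis .
qed

lemma powr_double: "x powr (2 * a) = (x powr a)\<^sup>2" for x a :: real
  by (simp add: power2_eq_square flip: powr_add)

text \<open>The left-hand side is the covariance of consecutive increments, of lengths \<open>p\<close> and \<open>q\<close>, of a fractional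
  Brownian motion.\<close>

lemma increment_correlation_le:
  fixes p q :: real
  assumes "0 < p" "0 < q" "0 < h" "h < 1"
  shows "\<bar>(p + q) powr (2 * h) - p powr (2 * h) - q powr (2 * h)\<bar> / 2 \<le> max h (1/2) * (p powr h * q powr h)"
proof -
  have main: "\<bar>(p + q) powr (2 * h) - p powr (2 * h) - q powr (2 * h)\<bar> / 2 \<le> max h (1/2) * (p powr h * q powr h)"
    if "0 < q" "q \<le> p" for p q
  proof -
    define P Q S where "P = p powr h" and "Q = q powr h" and "S = (p + q) powr h"
    have Q: "0 < Q" "Q \<le> P" using that assms by (auto simp: P_def Q_def intro: powr_mono2)
    have S: "P \<le> S" "S \<le> P + h * Q" using that assms
      by (auto simp: P_def Q_def S_def intro: powr_mono2 powr_add_le_bernoulli)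
    \<comment> \<open>The upper estimate amounts to a correlation of at most \<open>h\<close>; the
      lower one uses monotonicity alone and gives at least \<open>- 1/2\<close>. Hence the constant
      \<open>max h (1/2)\<close>, which is below 1.\<close>
    have "S\<^sup>2 \<le> (P + h * Q)\<^sup>2" using S Q by (intro power_mono) auto
    also have "\<dots> = P\<^sup>2 + 2 * h * (P * Q) + h\<^sup>2 * Q\<^sup>2" by (simp add: power2_eq_square algebra_simps)
    also have "h\<^sup>2 * Q\<^sup>2 \<le> 1 * Q\<^sup>2" using assms by (intro mult_right_mono) (auto simp: power_le_one)
    finally have up: "S\<^sup>2 - P\<^sup>2 - Q\<^sup>2 \<le> 2 * (h * (P * Q))" by simp
    have "P\<^sup>2 \<le> S\<^sup>2" using S Q by (intro power_mono) auto
    moreover have "Q\<^sup>2 \<le> P * Q" using Q by (simp add: power2_eq_square mult_right_mono)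
    ultimately have lo: "- (P * Q) \<le> S\<^sup>2 - P\<^sup>2 - Q\<^sup>2" by simp
    have PQ: "0 \<le> P * Q" using Q by simp
    have "h * (P * Q) \<le> max h (1/2) * (P * Q)" by (rule mult_right_mono[OF _ PQ]) simp
    moreover have "1/2 * (P * Q) \<le> max h (1/2) * (P * Q)" by (rule mult_right_mono[OF _ PQ]) simp
    moreover note up lo
    ultimately have "\<bar>S\<^sup>2 - P\<^sup>2 - Q\<^sup>2\<bar> / 2 \<le> max h (1/2) * (P * Q)"
      by (simp only: abs_le_iff pos_divide_le_eq[OF zero_less_numeral]) linarith
    then show ?thesis by (simp add: P_def Q_def S_def powr_double)
  qed
  show ?thesis
    using main[of q p] main[of p q] assms by (cases "q \<le> p") (auto simp: algebra_simps)
qed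

text \<open>Subtracting \<open>m * A\<close> and \<open>m * B\<close> from the diagonal leaves a
  nonnegative form, whose determinant is nonnegative; restoring them adds
  \<open>m\<^sup>2 * (A * B)\<close> and nonnegative cross terms.\<close>

lemma gram_det_lower_bound:
  fixes q11 q12 q22 :: real
  assumes pd: "\<And>\<alpha> \<beta>. m * (\<alpha>\<^sup>2 * A + \<beta>\<^sup>2 * B) \<le> \<alpha>\<^sup>2 * q11 + 2 * \<alpha> * \<beta> * q12 + \<beta>\<^sup>2 * q22"
    and nn: "0 \<le> m" "0 \<le> A" "0 \<le> B"
  shows "m\<^sup>2 * (A * B) \<le> q11 * q22 - q12\<^sup>2"
proof -
  define a b where "a = q11 - m * A" and "b = q22 - m * B"
  have q: "0 \<le> \<alpha>\<^sup>2 * a + 2 * \<alpha> * \<beta> * q12 + \<beta>\<^sup>2 * b" for \<alpha> \<beta>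
    using pd[of \<alpha> \<beta>] by (simp add: a_def b_def algebra_simps)
  have ab: "0 \<le> a" "0 \<le> b" using q[of 1 0] q[of 0 1] by auto
  have "q12\<^sup>2 \<le> a * b"
  proof (cases "a = 0")
    case True
    have "q12 = 0"
    proof (rule ccontr)
      assume n: "q12 \<noteq> 0"
      \<comment> \<open>For \<open>a = 0\<close> the form is affine in its first coefficient; this
        coefficient makes its value \<open>- 1\<close>.\<close>
      have "0 \<le> 2 * (- (b + 1) / (2 * q12)) * q12 + b" using q[of "- (b + 1) / (2 * q12)" 1] True by simp
      also have "\<dots> = - 1" using n by (simp add: field_simps)
      finally show False by simp
    qed
    then show ?thesis using True by simp
  next
    case False
    \<comment> \<open>The vector \<open>(q12, - a)\<close> gives the value \<open>a\<close> times
      the determinant.\<close>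
    have "0 \<le> a * (a * b - q12\<^sup>2)" using q[of q12 "- a"] by (simp add: power2_eq_square algebra_simps)
    then show ?thesis using False ab by (simp add: zero_le_mult_iff)
  qed
  moreover have "q11 * q22 = a * b + a * (m * B) + (m * A) * b + m\<^sup>2 * (A * B)"
    by (simp add: a_def b_def power2_eq_square algebra_simps)
  moreover have "0 \<le> a * (m * B)" "0 \<le> (m * A) * b" using ab nn by auto
  ultimately show ?thesis by linarith
qed

text \<open>The pair \<open>x'\<close>, \<open>d'\<close> has correlation at most \<open>c\<close>,
  so its form is at least \<open>1 - c\<close> times the diagonal form. The squared norm of a
  perturbed vector is at least half the original one minus that of the error. The relative errors
  \<open>(1 - c) / 8\<close> add up to at most \<open>(1 - c) / 4\<close>, which leaves
  \<open>(1 - c) / 2 - (1 - c) / 4\<close>.\<close>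

lemma perturbed_gram_bound:
  fixes x x' d d' :: "'s \<Rightarrow> 'b::euclidean_space"
  assumes [measurable]: "x \<in> borel_measurable N" "x' \<in> borel_measurable N" "d \<in> borel_measurable N" "d' \<in> borel_measurable N"
    and sq: "integrable N (\<lambda>u. (norm (x u))\<^sup>2)" "integrable N (\<lambda>u. (norm (x' u))\<^sup>2)"
      "integrable N (\<lambda>u. (norm (d u))\<^sup>2)" "integrable N (\<lambda>u. (norm (d' u))\<^sup>2)"
    and A: "(\<integral>u. (norm (x' u))\<^sup>2 \<partial>N) = A\<^sup>2" "0 \<le> A" and B: "(\<integral>u. (norm (d' u))\<^sup>2 \<partial>N) = B\<^sup>2" "0 \<le> B"
    and c: "\<bar>\<integral>u. x' u \<bullet> d' u \<partial>N\<bar> \<le> c * (A * B)" "0 \<le> c"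
    and e: "(\<integral>u. (norm (x u - x' u))\<^sup>2 \<partial>N) \<le> (1 - c) / 8 * A\<^sup>2" "(\<integral>u. (norm (d u - d' u))\<^sup>2 \<partial>N) \<le> (1 - c) / 8 * B\<^sup>2"
  shows "(1 - c) / 4 * (\<alpha>\<^sup>2 * A\<^sup>2 + \<beta>\<^sup>2 * B\<^sup>2) \<le> (\<integral>u. (norm (\<alpha> *\<^sub>R x u + \<beta> *\<^sub>R d u))\<^sup>2 \<partial>N)"
proof -
  define P where "P u = \<alpha> *\<^sub>R x' u + \<beta> *\<^sub>R d' u" for u
  define E where "E u = \<alpha> *\<^sub>R (x u - x' u) + \<beta> *\<^sub>R (d u - d' u)" for u
  define S where "S u = \<alpha> *\<^sub>R x u + \<beta> *\<^sub>R d u" for u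
  have [measurable]: "P \<in> borel_measurable N" "E \<in> borel_measurable N" unfolding P_def[abs_def] E_def[abs_def] by measurable
  have PI: "integrable N (\<lambda>u. (norm (P u))\<^sup>2)" unfolding P_def by (intro integrable_L2_lincomb sq) auto
  have SI: "integrable N (\<lambda>u. (norm (S u))\<^sup>2)" unfolding S_def by (intro integrable_L2_lincomb sq) auto
  have dx: "integrable N (\<lambda>u. (norm (x u - x' u))\<^sup>2)" by (intro integrable_L2_diff sq) auto
  have dd: "integrable N (\<lambda>u. (norm (d u - d' u))\<^sup>2)" by (intro integrable_L2_diff sq) auto
  have EI: "integrable N (\<lambda>u. (norm (E u))\<^sup>2)" unfolding E_def by (intro integrable_L2_lincomb dx dd) auto
  have SPE: "S u = P u + E u" for u by (simp add: S_def P_def E_def algebra_simps)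
  have pw: "(norm (P u))\<^sup>2 / 2 - (norm (E u))\<^sup>2 \<le> (norm (S u))\<^sup>2" for u
    using norm_add_power2_le[of "S u" "- E u"] by (simp add: SPE)
  have "(\<integral>u. (norm (P u))\<^sup>2 / 2 - (norm (E u))\<^sup>2 \<partial>N) \<le> (\<integral>u. (norm (S u))\<^sup>2 \<partial>N)"
    using PI EI SI pw by (intro integral_mono) auto
  then have 1: "(\<integral>u. (norm (P u))\<^sup>2 \<partial>N) / 2 - (\<integral>u. (norm (E u))\<^sup>2 \<partial>N) \<le> (\<integral>u. (norm (S u))\<^sup>2 \<partial>N)"
    using PI EI by simp
  have "(\<integral>u. (norm (E u))\<^sup>2 \<partial>N) \<le> (\<integral>u. 2 * (\<alpha>\<^sup>2 * (norm (x u - x' u))\<^sup>2) + 2 * (\<beta>\<^sup>2 * (norm (d u - d' u))\<^sup>2) \<partial>N)"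
    using EI dx dd norm_add_power2_le[of "\<alpha> *\<^sub>R (x u - x' u)" "\<beta> *\<^sub>R (d u - d' u)" for u]
    by (intro integral_mono) (auto simp: E_def power_mult_distrib)
  also have "\<dots> = 2 * (\<alpha>\<^sup>2 * (\<integral>u. (norm (x u - x' u))\<^sup>2 \<partial>N)) + 2 * (\<beta>\<^sup>2 * (\<integral>u. (norm (d u - d' u))\<^sup>2 \<partial>N))"
    using dx dd by simp
  also have "\<dots> \<le> 2 * (\<alpha>\<^sup>2 * ((1 - c) / 8 * A\<^sup>2)) + 2 * (\<beta>\<^sup>2 * ((1 - c) / 8 * B\<^sup>2))"
    by (intro add_mono mult_left_mono e) auto
  finally have 2: "(\<integral>u. (norm (E u))\<^sup>2 \<partial>N) \<le> (1 - c) / 4 * (\<alpha>\<^sup>2 * A\<^sup>2 + \<beta>\<^sup>2 * B\<^sup>2)"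
    by (simp add: field_simps)
  have "(\<integral>u. (norm (P u))\<^sup>2 \<partial>N) = \<alpha>\<^sup>2 * A\<^sup>2 + 2 * \<alpha> * \<beta> * (\<integral>u. x' u \<bullet> d' u \<partial>N) + \<beta>\<^sup>2 * B\<^sup>2"
    unfolding P_def by (subst integral_norm_power2_lincomb) (use sq A B in auto)
  moreover have "\<bar>2 * \<alpha> * \<beta> * (\<integral>u. x' u \<bullet> d' u \<partial>N)\<bar> \<le> c * (\<alpha>\<^sup>2 * A\<^sup>2 + \<beta>\<^sup>2 * B\<^sup>2)"
  proof -
    have "\<bar>2 * \<alpha> * \<beta> * (\<integral>u. x' u \<bullet> d' u \<partial>N)\<bar> = 2 * \<bar>\<alpha>\<bar> * \<bar>\<beta>\<bar> * \<bar>\<integral>u. x' u \<bullet> d' u \<partial>N\<bar>" by (simp add: abs_mult)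
    also have "\<dots> \<le> 2 * \<bar>\<alpha>\<bar> * \<bar>\<beta>\<bar> * (c * (A * B))" using c by (intro mult_left_mono) auto
    also have "\<dots> = c * (2 * (\<bar>\<alpha>\<bar> * A) * (\<bar>\<beta>\<bar> * B))" by simp
    also have "\<dots> \<le> c * ((\<bar>\<alpha>\<bar> * A)\<^sup>2 + (\<bar>\<beta>\<bar> * B)\<^sup>2)"
      using c(2) sum_squares_bound[of "\<bar>\<alpha>\<bar> * A" "\<bar>\<beta>\<bar> * B"] by (intro mult_left_mono) auto
    finally show ?thesis by (simp add: power_mult_distrib)
  qed
  ultimately have 3: "(1 - c) * (\<alpha>\<^sup>2 * A\<^sup>2 + \<beta>\<^sup>2 * B\<^sup>2) \<le> (\<integral>u. (norm (P u))\<^sup>2 \<partial>N)"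
    by (simp add: algebra_simps abs_le_iff)
  show ?thesis using 1 2 3 unfolding S_def by simp
qed

text \<open>\<open>h\<^sub>m\<close> stands for the supremum of \<open>H\<close>; its gap to \<beta>
  controls the errors for all frozen Hurst parameters at once.\<close>

locale multifractional_kernel = hurst_kernel k V
  for k :: "real \<Rightarrow> real \<Rightarrow> real \<Rightarrow> 'c::euclidean_space" and V +
  fixes H :: "real \<Rightarrow> real" and \<mu> \<nu> \<beta> h\<^sub>m C t\<^sub>0 :: real
  assumes \<mu>: "0 < \<mu>" and \<nu>: "\<nu> < 1" and H_range: "0 \<le> s \<Longrightarrow> H s \<in> {\<mu>..\<nu>}"
    and H_hoelder: "0 \<le> s \<Longrightarrow> 0 \<le> u \<Longrightarrow> \<bar>H s - H u\<bar> \<le> C * \<bar>s - u\<bar> powr \<beta>"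
    and C: "0 \<le> C" and H_le: "0 \<le> s \<Longrightarrow> H s \<le> h\<^sub>m" and h\<^sub>m: "h\<^sub>m < \<beta>" and t\<^sub>0: "0 \<le> t\<^sub>0"
begin

definition "h = H t\<^sub>0"

text \<open>The kernel of the rescaled increment \<open>\<rho> powr (- h) * (B (t\<^sub>0 + \<rho> *
  s) - B t\<^sub>0)\<close>.\<close>

definition \<kappa> :: "real \<Rightarrow> real \<Rightarrow> real \<Rightarrow> 'c" where
  "\<kappa> \<rho> s v = \<rho> powr (- h) *\<^sub>R (k (H (t\<^sub>0 + \<rho> * s)) (t\<^sub>0 + \<rho> * s) v - k h t\<^sub>0 v)"

definition Q :: "real \<Rightarrow> real \<Rightarrow> real \<Rightarrow> real" where
  "Q \<rho> s u = (\<integral>v. \<kappa> \<rho> s v \<bullet> \<kappa> \<rho> u v \<partial>lborel)"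

text \<open>For nonnegative times, the covariance of the fractional Brownian motion with Hurst
  parameter \<open>h\<close>.\<close>

definition Q\<^sub>0 :: "real \<Rightarrow> real \<Rightarrow> real" where
  "Q\<^sub>0 s u = V h * (s powr (2 * h) + u powr (2 * h) - \<bar>s - u\<bar> powr (2 * h)) / 2"

lemma h: "0 < h" "h < 1" "h \<in> {\<mu>..\<nu>}"
  using H_range[OF t\<^sub>0] \<mu> \<nu> by (auto simp: h_def)

lemma H_01: "0 \<le> s \<Longrightarrow> 0 < H s" "0 \<le> s \<Longrightarrow> H s < 1"
  using H_range[of s] \<mu> \<nu> by auto

lemma h\<^sub>m_pos: "0 < h\<^sub>m"
  using H_01(1)[OF t\<^sub>0] H_le[OF t\<^sub>0] by simp

lemma borel_measurable_\<kappa> [measurable]: "\<kappa> \<rho> s \<in> borel_measurable borel"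
  unfolding \<kappa>_def[abs_def] by measurable

lemma \<kappa>_0: "\<kappa> \<rho> 0 v = 0"
  by (simp add: \<kappa>_def h_def)

lemma \<kappa>_square_integrable:
  assumes "0 < \<rho>" "0 \<le> s"
  shows "integrable lborel (\<lambda>v. (norm (\<kappa> \<rho> s v))\<^sup>2)"
proof -
  have "0 \<le> t\<^sub>0 + \<rho> * s" using assms t\<^sub>0 by simp
  then have "integrable lborel (\<lambda>v. (norm (k (H (t\<^sub>0 + \<rho> * s)) (t\<^sub>0 + \<rho> * s) v - k h t\<^sub>0 v))\<^sup>2)"
    using h t\<^sub>0 by (intro integrable_L2_diff square_integrable H_01) auto
  then show ?thesis by (simp add: \<kappa>_def power_mult_distrib)
qed

text \<open>Replacing \<open>H\<close> by \<open>h\<close> gives fractional increments, whose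
  rescaled norm does not depend on \<open>n\<close>. The Lipschitz dependence on the Hurst parameter
  and the Hoelder continuity of \<open>H\<close> bound the error of the replacement, after
  rescaling, by a multiple of \<open>r n powr (\<beta> - h)\<close> in norm, and
  \<open>h < \<beta>\<close>.\<close>

lemma increment_tendsto:
  assumes r: "\<And>n. 0 < r n" "r \<longlonglongrightarrow> 0" and su: "0 \<le> s" "0 \<le> u"
  shows "(\<lambda>n. \<integral>v. (norm (\<kappa> (r n) s v - \<kappa> (r n) u v))\<^sup>2 \<partial>lborel) \<longlonglongrightarrow> V h * \<bar>s - u\<bar> powr (2 * h)"
proof (rule integral_norm_power2_tendsto)
  define f where "f n v = r n powr (- h) *\<^sub>R (k h (t\<^sub>0 + r n * s) v - k h (t\<^sub>0 + r n * u) v)" for n v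
  have fm[measurable]: "f n \<in> borel_measurable lborel" for n unfolding f_def[abs_def] by measurable
  have nn: "0 \<le> t\<^sub>0 + r n * x" if "0 \<le> x" for n x using that t\<^sub>0 r(1)[of n] by simp
  show "f n \<in> borel_measurable lborel" for n by measurable
  have ki: "integrable lborel (\<lambda>v. (norm (k h (t\<^sub>0 + r n * s) v - k h (t\<^sub>0 + r n * u) v))\<^sup>2)" for n
    using h nn su by (intro integrable_L2_diff square_integrable) auto
  then show fi: "integrable lborel (\<lambda>v. (norm (f n v))\<^sup>2)" for n by (simp add: f_def power_mult_distrib)
  show "(\<integral>v. (norm (f n v))\<^sup>2 \<partial>lborel) = V h * \<bar>s - u\<bar> powr (2 * h)" for n
  proof -
    have "(\<integral>v. (norm (f n v))\<^sup>2 \<partial>lborel) = (r n powr (- h))\<^sup>2 * (V h * \<bar>(t\<^sub>0 + r n * s) - (t\<^sub>0 + r n * u)\<bar> powr (2 * h))"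
      using h nn su by (simp add: f_def power_mult_distrib increment)
    also have "\<bar>(t\<^sub>0 + r n * s) - (t\<^sub>0 + r n * u)\<bar> = r n * \<bar>s - u\<bar>"
      using r(1)[of n] by (simp add: abs_mult flip: right_diff_distrib)
    also have "(r n powr (- h))\<^sup>2 * (V h * (r n * \<bar>s - u\<bar>) powr (2 * h)) = V h * \<bar>s - u\<bar> powr (2 * h)"
      using r(1)[of n] unfolding powr_double by (simp add: powr_mult powr_minus power_mult_distrib power_inverse field_simps)
    finally show ?thesis .
  qed
  show di: "integrable lborel (\<lambda>v. (norm (\<kappa> (r n) s v - \<kappa> (r n) u v))\<^sup>2)" for n
    using r su by (intro integrable_L2_diff \<kappa>_square_integrable) auto
  define T where "T = t\<^sub>0 + max s u"
  obtain D where D: "D \<ge> 0" "\<And>a b t. a \<in> {\<mu>..\<nu>} \<Longrightarrow> b \<in> {\<mu>..\<nu>} \<Longrightarrow> t \<in> {0..T} \<Longrightarrow>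
      (\<integral>v. (norm (k a t v - k b t v))\<^sup>2 \<partial>lborel) \<le> D * (a - b)\<^sup>2"
    using hurst_lipschitz[of \<mu> \<nu> T] \<mu> \<nu> h(3) t\<^sub>0 su by (auto simp: T_def)
  \<comment> \<open>The kernels are compared at the same time, so the bound for a change of the
    Hurst parameter applies; the term at \<open>t\<^sub>0\<close> cancels in the increment.\<close>
  define e where "e n x v = k (H (t\<^sub>0 + r n * x)) (t\<^sub>0 + r n * x) v - k h (t\<^sub>0 + r n * x) v" for n x v
  have [measurable]: "e n x \<in> borel_measurable lborel" for n x unfolding e_def[abs_def] by measurable
  have ei: "integrable lborel (\<lambda>v. (norm (e n x v))\<^sup>2)" if "0 \<le> x" for n x
    unfolding e_def using h nn that by (intro integrable_L2_diff square_integrable H_01) auto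
  have e_le: "(\<integral>v. (norm (e n x v))\<^sup>2 \<partial>lborel) \<le> D * (C * (r n * x) powr \<beta>)\<^sup>2" if "0 \<le> x" "x \<le> max s u" "r n \<le> 1" for n x
  proof -
    have "r n * x \<le> 1 * max s u" using that r(1)[of n] by (intro mult_mono) auto
    then have "(\<integral>v. (norm (e n x v))\<^sup>2 \<partial>lborel) \<le> D * (H (t\<^sub>0 + r n * x) - h)\<^sup>2"
      unfolding e_def using nn[OF that(1)] h by (intro D(2) H_range) (auto simp: T_def)
    also have "\<dots> \<le> D * (C * (r n * x) powr \<beta>)\<^sup>2"
    proof (intro mult_left_mono D(1))
      have "\<bar>H (t\<^sub>0 + r n * x) - h\<bar> \<le> C * (r n * x) powr \<beta>"
        using H_hoelder[of "t\<^sub>0 + r n * x" t\<^sub>0] nn[OF that(1)] t\<^sub>0 r(1)[of n] that by (simp add: h_def abs_mult)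
      then have "\<bar>H (t\<^sub>0 + r n * x) - h\<bar>\<^sup>2 \<le> (C * (r n * x) powr \<beta>)\<^sup>2" by (intro power_mono) auto
      then show "(H (t\<^sub>0 + r n * x) - h)\<^sup>2 \<le> (C * (r n * x) powr \<beta>)\<^sup>2" by simp
    qed
    finally show ?thesis .
  qed
  define K where "K = 2 * (D * (C * s powr \<beta>)\<^sup>2) + 2 * (D * (C * u powr \<beta>)\<^sup>2)"
  have bd: "(\<integral>v. (norm (\<kappa> (r n) s v - \<kappa> (r n) u v - f n v))\<^sup>2 \<partial>lborel) \<le> K * r n powr (2 * (\<beta> - h))" if "r n \<le> 1" for n
  proof -
    have "\<kappa> (r n) s v - \<kappa> (r n) u v - f n v = r n powr (- h) *\<^sub>R (e n s v - e n u v)" for v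
      by (simp add: \<kappa>_def f_def e_def algebra_simps)
    then have "(\<integral>v. (norm (\<kappa> (r n) s v - \<kappa> (r n) u v - f n v))\<^sup>2 \<partial>lborel)
        = (r n powr (- h))\<^sup>2 * (\<integral>v. (norm (e n s v - e n u v))\<^sup>2 \<partial>lborel)"
      by (simp add: power_mult_distrib)
    also have "(\<integral>v. (norm (e n s v - e n u v))\<^sup>2 \<partial>lborel) \<le> (\<integral>v. 2 * (norm (e n s v))\<^sup>2 + 2 * (norm (e n u v))\<^sup>2 \<partial>lborel)"
      using norm_add_power2_le[of "e n s v" "- e n u v" for v] ei su
      by (intro integral_mono integrable_L2_diff) auto
    also have "\<dots> \<le> 2 * (D * (C * (r n * s) powr \<beta>)\<^sup>2) + 2 * (D * (C * (r n * u) powr \<beta>)\<^sup>2)"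
      using e_le[of s n] e_le[of u n] ei su that by simp
    also have "\<dots> = K * (r n powr \<beta>)\<^sup>2"
      using r(1)[of n] su by (simp add: K_def powr_mult power_mult_distrib algebra_simps)
    finally have "(\<integral>v. (norm (\<kappa> (r n) s v - \<kappa> (r n) u v - f n v))\<^sup>2 \<partial>lborel) \<le> (r n powr (- h))\<^sup>2 * (K * (r n powr \<beta>)\<^sup>2)"
      by (simp add: mult_left_mono)
    also have "\<dots> = K * r n powr (2 * (\<beta> - h))"
      using r(1)[of n] by (simp add: powr_double powr_diff powr_minus power_divide divide_inverse power_inverse)
    finally show ?thesis .
  qed
  have "(\<lambda>n. r n powr (2 * (\<beta> - h))) \<longlonglongrightarrow> 0 powr (2 * (\<beta> - h))"
    using r h\<^sub>m H_le[OF t\<^sub>0] by (intro tendsto_powr') (auto simp: h_def less_imp_le)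
  then have "(\<lambda>n. K * r n powr (2 * (\<beta> - h))) \<longlonglongrightarrow> K * 0" by (intro tendsto_intros) simp
  then have lim: "(\<lambda>n. K * r n powr (2 * (\<beta> - h))) \<longlonglongrightarrow> 0" by simp
  have "\<forall>\<^sub>F n in sequentially. r n < 1" using r(2) by (rule order_tendstoD) simp
  then show "(\<lambda>n. \<integral>v. (norm (\<kappa> (r n) s v - \<kappa> (r n) u v - f n v))\<^sup>2 \<partial>lborel) \<longlonglongrightarrow> 0"
  proof (intro tendsto_sandwich[OF _ _ tendsto_const lim])
    assume "\<forall>\<^sub>F n in sequentially. r n < 1"
    then show "\<forall>\<^sub>F n in sequentially. (\<integral>v. (norm (\<kappa> (r n) s v - \<kappa> (r n) u v - f n v))\<^sup>2 \<partial>lborel) \<le> K * r n powr (2 * (\<beta> - h))"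
      by eventually_elim (rule bd, simp)
  qed simp
qed (auto simp: borel_measurable_\<kappa>)

text \<open>The kernel \<kappa> vanishes at \<open>s = 0\<close>, so all norms in the polarisation
  identity are norms of increments.\<close>

lemma Q_tendsto:
  assumes r: "\<And>n. 0 < r n" "r \<longlonglongrightarrow> 0" and su: "0 \<le> s" "0 \<le> u"
  shows "(\<lambda>n. Q (r n) s u) \<longlonglongrightarrow> Q\<^sub>0 s u"
proof -
  have "(\<lambda>n. Q (r n) s u) = (\<lambda>n. ((\<integral>v. (norm (\<kappa> (r n) s v - \<kappa> (r n) 0 v))\<^sup>2 \<partial>lborel)
      + (\<integral>v. (norm (\<kappa> (r n) u v - \<kappa> (r n) 0 v))\<^sup>2 \<partial>lborel) - (\<integral>v. (norm (\<kappa> (r n) s v - \<kappa> (r n) u v))\<^sup>2 \<partial>lborel)) / 2)"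
    unfolding Q_def \<kappa>_0 using r su by (subst integral_L2_inner) (auto intro!: \<kappa>_square_integrable)
  also have "\<dots> \<longlonglongrightarrow> (V h * \<bar>s - 0\<bar> powr (2 * h) + V h * \<bar>u - 0\<bar> powr (2 * h) - V h * \<bar>s - u\<bar> powr (2 * h)) / 2"
    by (intro tendsto_intros increment_tendsto r su) auto
  finally show ?thesis using su by (simp add: Q\<^sub>0_def algebra_simps)
qed

lemma Q_sym: "Q \<rho> s u = Q \<rho> u s"
  by (simp add: Q_def inner_commute)

lemma Q\<^sub>0_kernel:
  assumes "0 \<le> s" "0 \<le> u"
  shows "Q\<^sub>0 s u = (\<integral>v. k h s v \<bullet> k h u v \<partial>lborel)"
proof -
  have n: "(\<integral>v. (norm (k h s v))\<^sup>2 \<partial>lborel) = V h * s powr (2 * h)" if "0 \<le> s" for s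
    using increment[of h 0 s] h that by (simp add: kernel_0)
  show ?thesis using assms h
    by (subst integral_L2_inner) (auto intro!: square_integrable simp: n increment Q\<^sub>0_def algebra_simps)
qed

lemma eventually_powr_less:
  fixes t p \<epsilon> :: real
  assumes "0 < p" "0 < \<epsilon>" "0 \<le> t"
  shows "\<forall>\<^sub>F \<rho> in at_right 0. (\<rho> * t) powr p < \<epsilon>"
proof -
  have "((\<lambda>\<rho>. (\<rho> * t) powr p) \<longlongrightarrow> (0 * t) powr p) (at_right 0)"
    using assms by (intro tendsto_powr' tendsto_intros)
      (auto intro!: tendsto_ident_at simp: eventually_at_filter intro: mult_nonneg_nonneg)
  then show ?thesis using assms by (intro order_tendstoD) auto
qed

text \<open>The kernels with parameters \<open>a\<close> and \<open>h\<close> are compared at time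
  1, where the squared norm is \<open>V\<close>; hence the condition \<open>1 \<le> T\<close>. The
  factor \<open>1/2\<close> comes from the square of a sum.\<close>

lemma V_ge:
  assumes D: "\<And>a b t. a \<in> {\<mu>..\<nu>} \<Longrightarrow> b \<in> {\<mu>..\<nu>} \<Longrightarrow> t \<in> {0..T} \<Longrightarrow>
      (\<integral>v. (norm (k a t v - k b t v))\<^sup>2 \<partial>lborel) \<le> D * (a - b)\<^sup>2" and "1 \<le> T" and a: "a \<in> {\<mu>..\<nu>}"
  shows "V h / 2 - D * (a - h)\<^sup>2 \<le> V a"
proof -
  have a01: "0 < a" "a < 1" using a \<mu> \<nu> by auto
  have n: "(\<integral>v. (norm (k b 1 v))\<^sup>2 \<partial>lborel) = V b" if "0 < b" "b < 1" for b
    using increment[of b 0 1] that by (simp add: kernel_0)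
  have "V h \<le> (\<integral>v. 2 * (norm (k a 1 v))\<^sup>2 + 2 * (norm (k a 1 v - k h 1 v))\<^sup>2 \<partial>lborel)"
    unfolding n[OF h(1,2), symmetric]
    using norm_add_power2_le[of "k a 1 v" "- (k a 1 v - k h 1 v)" for v] a01 h
    by (intro integral_mono Bochner_Integration.integrable_add integrable_mult_right integrable_L2_diff square_integrable)
      (auto simp: norm_minus_commute)
  also have "\<dots> = 2 * V a + 2 * (\<integral>v. (norm (k a 1 v - k h 1 v))\<^sup>2 \<partial>lborel)"
    unfolding n[OF a01, symmetric] using a01 h
    by (subst Bochner_Integration.integral_add) (auto intro!: integrable_L2_diff square_integrable)
  also have "\<dots> \<le> 2 * V a + 2 * (D * (a - h)\<^sup>2)" using D[of a h 1] a h \<open>1 \<le> T\<close> by simp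
  finally show ?thesis by simp
qed

text \<open>The Gram determinant of the two values equals that of the consecutive increments from
  \<open>t\<^sub>0\<close> to \<open>s'\<close> and from \<open>s'\<close> to \<open>u'\<close>.
  Both are compared with increments of the kernel with the single parameter \<open>a\<close>, that
  of the earlier time, for which the correlation of consecutive increments is bounded away from 1 in
  modulus; \<open>e1\<close> and \<open>e2\<close> say that the two replacements are relatively
  small.\<close>

lemma gram_det_ge:
  fixes s u \<rho> :: real
  defines "a \<equiv> H (t\<^sub>0 + \<rho> * s)" and "b \<equiv> H (t\<^sub>0 + \<rho> * u)" and "c \<equiv> max \<nu> (1/2)"
  assumes \<rho>: "0 < \<rho>" and su: "0 < s" "s < u"
    and e1: "(\<integral>v. (norm (k a t\<^sub>0 v - k h t\<^sub>0 v))\<^sup>2 \<partial>lborel) \<le> (1 - c) / 8 * (V a * (\<rho> * s) powr (2 * a))"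
    and e2: "(\<integral>v. (norm (k b (t\<^sub>0 + \<rho> * u) v - k a (t\<^sub>0 + \<rho> * u) v))\<^sup>2 \<partial>lborel) \<le> (1 - c) / 8 * (V a * (\<rho> * (u - s)) powr (2 * a))"
  shows "((1 - c) / 4 * V a * (\<rho> powr (a - h))\<^sup>2 * (s * (u - s)) powr a)\<^sup>2 \<le> Q \<rho> s s * Q \<rho> u u - (Q \<rho> s u)\<^sup>2"
proof -
  define z w s' u' where "z = \<rho> * s" and "w = \<rho> * (u - s)" and "s' = t\<^sub>0 + \<rho> * s" and "u' = t\<^sub>0 + \<rho> * u"
  have z: "0 < z" "s' - t\<^sub>0 = z" and w: "0 < w" "u' - s' = w" "u' - t\<^sub>0 = z + w" and s': "0 \<le> s'" "0 \<le> u'"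
    using \<rho> su t\<^sub>0 by (auto simp: z_def w_def s'_def u'_def algebra_simps)
  have a: "0 < a" "a < 1" "a \<le> \<nu>" and b: "0 < b" "b < 1"
    using H_01 H_range s' by (auto simp: a_def b_def s'_def u'_def)
  have c: "0 \<le> c" "c < 1" "max a (1/2) \<le> c" using \<nu> a by (auto simp: c_def)
  have Va: "0 < V a" using V_pos a by simp
  define x x' d d' where "x v = k a s' v - k h t\<^sub>0 v" and "x' v = k a s' v - k a t\<^sub>0 v"
    and "d v = k b u' v - k a s' v" and "d' v = k a u' v - k a s' v" for v
  have [measurable]: "x \<in> borel_measurable lborel" "x' \<in> borel_measurable lborel"
      "d \<in> borel_measurable lborel" "d' \<in> borel_measurable lborel"
    unfolding x_def[abs_def] x'_def[abs_def] d_def[abs_def] d'_def[abs_def] by measurable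
  have sq: "integrable lborel (\<lambda>v. (norm (x v))\<^sup>2)" "integrable lborel (\<lambda>v. (norm (x' v))\<^sup>2)"
      "integrable lborel (\<lambda>v. (norm (d v))\<^sup>2)" "integrable lborel (\<lambda>v. (norm (d' v))\<^sup>2)"
    unfolding x_def x'_def d_def d'_def using a b h s' t\<^sub>0
    by (auto intro!: integrable_L2_diff square_integrable)
  define A B where "A = sqrt (V a) * z powr a" and "B = sqrt (V a) * w powr a"
  have A: "(\<integral>v. (norm (x' v))\<^sup>2 \<partial>lborel) = A\<^sup>2" "0 \<le> A"
    unfolding x'_def using a s' t\<^sub>0 z Va by (auto simp: increment A_def power_mult_distrib powr_double)
  have B: "(\<integral>v. (norm (d' v))\<^sup>2 \<partial>lborel) = B\<^sup>2" "0 \<le> B"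
    unfolding d'_def using a s' t\<^sub>0 w Va by (auto simp: increment B_def power_mult_distrib powr_double)
  have corr: "\<bar>\<integral>v. x' v \<bullet> d' v \<partial>lborel\<bar> \<le> c * (A * B)"
  proof -
    \<comment> \<open>The sign is reversed so that the polarisation identity, which contains a
      difference, sees the increment over both intervals.\<close>
    have "(\<integral>v. (norm (x' v - - d' v))\<^sup>2 \<partial>lborel) = V a * (z + w) powr (2 * a)"
    proof -
      have "x' v - - d' v = k a u' v - k a t\<^sub>0 v" for v by (simp add: x'_def d'_def)
      then show ?thesis using increment[of a t\<^sub>0 u'] a s' t\<^sub>0 z w by simp
    qed
    moreover have "(\<integral>v. x' v \<bullet> - d' v \<partial>lborel) = (A\<^sup>2 + B\<^sup>2 - (\<integral>v. (norm (x' v - - d' v))\<^sup>2 \<partial>lborel)) / 2"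
      using sq A(1) B(1) by (subst integral_L2_inner) auto
    ultimately have I: "(\<integral>v. x' v \<bullet> d' v \<partial>lborel) = V a * ((z + w) powr (2 * a) - z powr (2 * a) - w powr (2 * a)) / 2"
      using Va unfolding A_def B_def power_mult_distrib powr_double by (simp add: algebra_simps)
    have "\<bar>\<integral>v. x' v \<bullet> d' v \<partial>lborel\<bar> = V a * (\<bar>(z + w) powr (2 * a) - z powr (2 * a) - w powr (2 * a)\<bar> / 2)"
      unfolding I using Va by (simp add: abs_mult)
    also have "\<dots> \<le> V a * (max a (1/2) * (z powr a * w powr a))"
      using Va z w a by (intro mult_left_mono increment_correlation_le) auto
    also have "\<dots> = max a (1/2) * (A * B)" using Va by (simp add: A_def B_def)
    also have "\<dots> \<le> c * (A * B)" using c A B by (intro mult_right_mono) auto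
    finally show ?thesis .
  qed
  have "(\<integral>v. (norm (x v - x' v))\<^sup>2 \<partial>lborel) \<le> (1 - c) / 8 * A\<^sup>2"
    using e1 Va by (simp add: x_def x'_def A_def z_def power_mult_distrib powr_double)
  moreover have "(\<integral>v. (norm (d v - d' v))\<^sup>2 \<partial>lborel) \<le> (1 - c) / 8 * B\<^sup>2"
    using e2 Va by (simp add: d_def d'_def B_def w_def u'_def power_mult_distrib powr_double)
  ultimately have pg: "(1 - c) / 4 * (\<alpha>\<^sup>2 * A\<^sup>2 + \<gamma>\<^sup>2 * B\<^sup>2) \<le> (\<integral>v. (norm (\<alpha> *\<^sub>R x v + \<gamma> *\<^sub>R d v))\<^sup>2 \<partial>lborel)" for \<alpha> \<gamma>
    by (intro perturbed_gram_bound[where x' = x' and d' = d'] sq A B corr c) auto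
  define q11 q12 q22 where "q11 = (\<integral>v. (norm (x v))\<^sup>2 \<partial>lborel)" and "q12 = (\<integral>v. x v \<bullet> d v \<partial>lborel)"
    and "q22 = (\<integral>v. (norm (d v))\<^sup>2 \<partial>lborel)"
  have lin: "(\<integral>v. (norm (\<alpha> *\<^sub>R x v + \<gamma> *\<^sub>R d v))\<^sup>2 \<partial>lborel) = \<alpha>\<^sup>2 * q11 + 2 * \<alpha> * \<gamma> * q12 + \<gamma>\<^sup>2 * q22" for \<alpha> \<gamma>
    unfolding q11_def q12_def q22_def by (intro integral_norm_power2_lincomb sq) auto
  have det: "((1 - c) / 4)\<^sup>2 * (A\<^sup>2 * B\<^sup>2) \<le> q11 * q22 - q12\<^sup>2"
    using pg c by (intro gram_det_lower_bound) (auto simp: lin)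
  define p where "p = \<rho> powr (- h)"
  have \<kappa>s: "\<kappa> \<rho> s v = p *\<^sub>R x v" and \<kappa>u: "\<kappa> \<rho> u v = p *\<^sub>R (x v + d v)" for v
    by (simp_all add: \<kappa>_def x_def d_def a_def b_def s'_def u'_def p_def)
  have Qss: "Q \<rho> s s = p\<^sup>2 * q11"
    unfolding Q_def \<kappa>s q11_def power2_norm_eq_inner by (simp add: power2_eq_square)
  have Quu: "Q \<rho> u u = p\<^sup>2 * (q11 + 2 * q12 + q22)"
    using lin[of 1 1] unfolding Q_def \<kappa>u power2_norm_eq_inner by (simp add: power2_eq_square)
  have Qsu: "Q \<rho> s u = p\<^sup>2 * (q11 + q12)"
  proof -
    have "(\<integral>v. x v \<bullet> (x v + d v) \<partial>lborel) = (\<integral>v. (norm (x v))\<^sup>2 + x v \<bullet> d v \<partial>lborel)"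
      by (simp add: inner_add power2_norm_eq_inner)
    also have "\<dots> = q11 + q12" unfolding q11_def q12_def
      using sq by (intro Bochner_Integration.integral_add integrable_L2_inner) auto
    finally show ?thesis by (simp add: Q_def \<kappa>s \<kappa>u power2_eq_square)
  qed
  \<comment> \<open>Passing from \<open>x\<close>, \<open>d\<close> to \<open>x\<close>,
    \<open>x + d\<close> is a shear and preserves the determinant; the rescaling contributes the
    fourth power of \<open>p\<close>.\<close>
  have "Q \<rho> s s * Q \<rho> u u - (Q \<rho> s u)\<^sup>2 = (p\<^sup>2)\<^sup>2 * (q11 * q22 - q12\<^sup>2)"
    unfolding Qss Quu Qsu by (simp add: power2_eq_square algebra_simps)
  also have "\<dots> \<ge> (p\<^sup>2)\<^sup>2 * (((1 - c) / 4)\<^sup>2 * (A\<^sup>2 * B\<^sup>2))"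
    by (intro mult_left_mono det) auto
  also have "(p\<^sup>2)\<^sup>2 * (((1 - c) / 4)\<^sup>2 * (A\<^sup>2 * B\<^sup>2)) = ((1 - c) / 4 * (p\<^sup>2 * (A * B)))\<^sup>2"
    by (simp add: power_mult_distrib power_divide)
  also have "p\<^sup>2 * (A * B) = V a * (\<rho> powr (a - h))\<^sup>2 * (s * (u - s)) powr a"
  proof -
    have "A * B = V a * (z powr a * w powr a)" using Va by (simp add: A_def B_def)
    also have "z powr a * w powr a = (\<rho> powr a)\<^sup>2 * (s * (u - s)) powr a"
      using \<rho> su by (simp add: z_def w_def powr_mult power2_eq_square)
    finally have AB: "A * B = V a * ((\<rho> powr a)\<^sup>2 * (s * (u - s)) powr a)" .
    have "\<rho> powr (a - h) = p * \<rho> powr a" by (simp add: p_def flip: powr_add)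
    then show ?thesis unfolding AB by (simp add: power_mult_distrib)
  qed
  finally show ?thesis by (simp add: mult.assoc)
qed

text \<open>For an increment of length \<open>z\<close> the squared error is of order
  \<open>z powr (2 * \<beta>)\<close> and the squared norm of order \<open>z powr (2 * a)\<close>
  with \<open>a \<le> h\<^sub>m < \<beta>\<close>. Up to constants the quotient is at most
  \<open>(\<rho> * t) powr (2 * (\<beta> - h\<^sub>m))\<close>, whatever the two times, so one
  threshold for \<rho> serves all pairs.\<close>

lemma local_nondeterminism:
  assumes t: "0 < t"
  obtains c where "0 < c" "\<forall>\<^sub>F \<rho> in at_right 0. \<forall>s\<in>{0<..t}. \<forall>u\<in>{0<..t}. s \<noteq> u \<longrightarrow>
    (c * (min s u * \<bar>s - u\<bar>) powr \<nu>)\<^sup>2 \<le> Q \<rho> s s * Q \<rho> u u - (Q \<rho> s u)\<^sup>2"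
proof -
  define T where "T = t\<^sub>0 + t + 1"
  obtain D where D: "D \<ge> 0" "\<And>a b t. a \<in> {\<mu>..\<nu>} \<Longrightarrow> b \<in> {\<mu>..\<nu>} \<Longrightarrow> t \<in> {0..T} \<Longrightarrow>
      (\<integral>v. (norm (k a t v - k b t v))\<^sup>2 \<partial>lborel) \<le> D * (a - b)\<^sup>2"
    using hurst_lipschitz[of \<mu> \<nu> T] \<mu> \<nu> h(3) t\<^sub>0 t by (auto simp: T_def)
  have \<beta>: "0 < \<beta>" using h\<^sub>m h\<^sub>m_pos by simp
  define c where "c = max \<nu> (1/2)"
  have c: "0 \<le> c" "c < 1" using \<nu> by (auto simp: c_def)
  \<comment> \<open>Once the error in \<open>V_ge\<close> is at most \<open>m\<close>, it gives
    \<open>V a \<ge> V h / 2 - m\<close>, which is \<open>m\<close> for this choice.\<close>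
  define m where "m = V h / 4"
  have m: "0 < m" using V_pos h by (simp add: m_def)
  \<comment> \<open>A lower bound for \<open>\<rho> powr (a - h)\<close>, independent of \<rho> and
    of the times.\<close>
  define g where "g = exp (- (C * t powr \<beta> / \<beta>))"
  have g: "0 < g" by (simp add: g_def)
  define t1 where "t1 = max 1 t"
  \<comment> \<open>The last factor passes from the exponent \<open>a\<close> to \<nu>: after
    division by \<open>t1\<^sup>2\<close> the product \<open>s * (u - s)\<close> is at most 1, so
    the larger exponent gives the smaller power.\<close>
  define c' where "c' = (1 - c) / 4 * m * g\<^sup>2 * (t1\<^sup>2) powr (- \<nu>)"
  have c': "0 < c'" using c m g by (auto simp: c'_def t1_def)
  \<comment> \<open>The \<open>+ 1\<close> keeps the denominator positive when
    \<open>D * C\<^sup>2\<close> vanishes; \<epsilon> makes the perturbation relatively small and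
    \<open>\<epsilon>'\<close> keeps \<open>V a\<close> away from 0.\<close>
  define \<epsilon> where "\<epsilon> = (1 - c) / 8 * m / (D * C\<^sup>2 + 1)"
  define \<epsilon>' where "\<epsilon>' = m / (D * C\<^sup>2 + 1)"
  have DC: "0 < D * C\<^sup>2 + 1" using D(1) by (simp add: add_nonneg_pos)
  have \<epsilon>: "0 < \<epsilon>" "0 < \<epsilon>'" using c m DC by (auto simp: \<epsilon>_def \<epsilon>'_def)
  have "\<forall>\<^sub>F \<rho> in at_right 0. (\<rho> * t) powr (2 * (\<beta> - h\<^sub>m)) < \<epsilon>"
    using h\<^sub>m \<epsilon> t by (intro eventually_powr_less) auto
  moreover have "\<forall>\<^sub>F \<rho> in at_right 0. (\<rho> * t) powr (2 * \<beta>) < \<epsilon>'"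
    using \<beta> \<epsilon> t by (intro eventually_powr_less) auto
  moreover have "\<forall>\<^sub>F \<rho> in at_right 0. \<rho> \<in> {0<..<min 1 (1 / t)}"
    using t by (intro eventually_at_right_real) auto
  ultimately have "\<forall>\<^sub>F \<rho> in at_right 0. \<forall>s\<in>{0<..t}. \<forall>u\<in>{0<..t}. s \<noteq> u \<longrightarrow>
    (c' * (min s u * \<bar>s - u\<bar>) powr \<nu>)\<^sup>2 \<le> Q \<rho> s s * Q \<rho> u u - (Q \<rho> s u)\<^sup>2"
  proof eventually_elim
    case (elim \<rho>)
    then have \<rho>: "0 < \<rho>" "\<rho> \<le> 1" "\<rho> * t \<le> 1" using t by (auto simp: field_simps)
    have ordered: "(c' * (s * (u - s)) powr \<nu>)\<^sup>2 \<le> Q \<rho> s s * Q \<rho> u u - (Q \<rho> s u)\<^sup>2"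
      if su: "0 < s" "s < u" "u \<le> t" for s u
    proof -
      define s' u' where "s' = t\<^sub>0 + \<rho> * s" and "u' = t\<^sub>0 + \<rho> * u"
      have \<rho>t: "\<rho> * u \<le> 1" "\<rho> * s \<le> \<rho> * t" "\<rho> * (u - s) \<le> \<rho> * t" "\<rho> * u \<le> t"
      proof -
        show 1: "\<rho> * s \<le> \<rho> * t" "\<rho> * (u - s) \<le> \<rho> * t" using \<rho> su by (auto intro!: mult_left_mono)
        have "\<rho> * u \<le> \<rho> * t" using \<rho> su by (intro mult_left_mono) auto
        with \<rho>(3) show "\<rho> * u \<le> 1" by linarith
        have "\<rho> * u \<le> 1 * t" using \<rho> su by (intro mult_mono) auto
        then show "\<rho> * u \<le> t" by simp
      qed
      have s': "0 \<le> s'" "0 \<le> u'" using \<rho> su t\<^sub>0 by (auto simp: s'_def u'_def)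
      define a b where "a = H s'" and "b = H u'"
      have a: "a \<in> {\<mu>..\<nu>}" "b \<in> {\<mu>..\<nu>}" "0 < a" "a \<le> h\<^sub>m"
        using H_range[OF s'(1)] H_range[OF s'(2)] \<mu> H_le[OF s'(1)] by (auto simp: a_def b_def)
      have ah: "\<bar>a - h\<bar> \<le> C * (\<rho> * s) powr \<beta>"
        using H_hoelder[OF s'(1) t\<^sub>0] \<rho> su by (simp add: a_def h_def s'_def abs_mult)
      have ba: "\<bar>b - a\<bar> \<le> C * (\<rho> * (u - s)) powr \<beta>"
        using H_hoelder[OF s'(2,1)] \<rho> su by (simp add: a_def b_def u'_def s'_def abs_mult flip: right_diff_distrib)
      have sqb: "D * y\<^sup>2 \<le> D * C\<^sup>2 * z powr (2 * \<beta>)" if "\<bar>y\<bar> \<le> C * z powr \<beta>" for y z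
      proof -
        have "\<bar>y\<bar>\<^sup>2 \<le> (C * z powr \<beta>)\<^sup>2" using that by (intro power_mono) auto
        then show ?thesis using D(1) by (simp add: power_mult_distrib powr_double mult_left_mono mult.assoc)
      qed
      have Va: "m \<le> V a"
      proof -
        have "D * (a - h)\<^sup>2 \<le> D * C\<^sup>2 * (\<rho> * s) powr (2 * \<beta>)" by (rule sqb[OF ah])
        also have "\<dots> \<le> D * C\<^sup>2 * (\<rho> * t) powr (2 * \<beta>)"
          using D(1) \<rho> su \<rho>t \<beta> by (intro mult_left_mono powr_mono2) auto
        also have "\<dots> \<le> (D * C\<^sup>2 + 1) * \<epsilon>'" using elim(2) D(1) by (intro mult_mono) auto
        also have "\<dots> = m" using DC by (simp add: \<epsilon>'_def)
        finally show ?thesis using V_ge[of T D a, OF D(2) _ a(1)] t t\<^sub>0 by (simp add: T_def m_def)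
      qed
      have err: "D * y\<^sup>2 \<le> (1 - c) / 8 * (V a * z powr (2 * a))"
        if "\<bar>y\<bar> \<le> C * z powr \<beta>" "0 < z" "z \<le> \<rho> * t" for y z
      proof -
        have "D * y\<^sup>2 \<le> D * C\<^sup>2 * z powr (2 * \<beta>)" by (rule sqb[OF that(1)])
        also have "z powr (2 * \<beta>) = z powr (2 * (\<beta> - a)) * z powr (2 * a)" by (simp flip: powr_add)
        also have "D * C\<^sup>2 * (z powr (2 * (\<beta> - a)) * z powr (2 * a)) \<le> (D * C\<^sup>2 + 1) * (\<epsilon> * z powr (2 * a))"
        proof (intro mult_mono)
          have "z powr (2 * (\<beta> - a)) \<le> z powr (2 * (\<beta> - h\<^sub>m))" using that \<rho> a by (intro powr_mono') auto
          also have "\<dots> \<le> (\<rho> * t) powr (2 * (\<beta> - h\<^sub>m))" using that h\<^sub>m by (intro powr_mono2) auto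
          finally show "z powr (2 * (\<beta> - a)) \<le> \<epsilon>" using elim(1) by simp
        qed (use D(1) \<epsilon> in auto)
        also have "\<dots> = ((D * C\<^sup>2 + 1) * \<epsilon>) * z powr (2 * a)" by simp
        also have "(D * C\<^sup>2 + 1) * \<epsilon> = (1 - c) / 8 * m"
          unfolding \<epsilon>_def times_divide_eq_right[symmetric, of "D * C\<^sup>2 + 1"] using DC by (metis less_irrefl nonzero_mult_div_cancel_left times_divide_eq_right)
        also have "(1 - c) / 8 * m * z powr (2 * a) = (1 - c) / 8 * (m * z powr (2 * a))" by simp
        also have "\<dots> \<le> (1 - c) / 8 * (V a * z powr (2 * a))"
          using c Va by (intro mult_left_mono mult_right_mono) auto
        finally show ?thesis .
      qed
      have e1: "(\<integral>v. (norm (k a t\<^sub>0 v - k h t\<^sub>0 v))\<^sup>2 \<partial>lborel) \<le> (1 - c) / 8 * (V a * (\<rho> * s) powr (2 * a))"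
        using D(2)[OF a(1) h(3), of t\<^sub>0] err[OF ah] \<rho> su \<rho>t t\<^sub>0 t by (simp add: T_def)
      have e2: "(\<integral>v. (norm (k b u' v - k a u' v))\<^sup>2 \<partial>lborel) \<le> (1 - c) / 8 * (V a * (\<rho> * (u - s)) powr (2 * a))"
        using D(2)[OF a(2,1), of u'] err[OF ba] \<rho> su \<rho>t t\<^sub>0 t by (simp add: T_def u'_def)
      \<comment> \<open>The increments scale with the exponent \<open>a\<close>, but the
        normalisation uses \<open>h\<close>. The mismatch stays bounded because \<open>a - h\<close>
        is of order \<open>(\<rho> * s) powr \<beta>\<close>, which outweighs the logarithm of
        \<rho>.\<close>
      have ga: "g \<le> \<rho> powr (a - h)"
      proof -
        have "\<bar>a - h\<bar> * \<bar>ln \<rho>\<bar> \<le> (C * (\<rho> * s) powr \<beta>) * (\<rho> powr (- \<beta>) / \<beta>)"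
        proof (intro mult_mono ah)
          have "\<beta> * \<bar>ln \<rho>\<bar> \<le> \<rho> powr (- \<beta>)"
            using ln_le_minus_one[of "\<rho> powr (- \<beta>)"] \<rho> by (simp add: ln_powr abs_if)
          then show "\<bar>ln \<rho>\<bar> \<le> \<rho> powr (- \<beta>) / \<beta>" using \<beta> by (simp add: field_simps)
        qed (use C in auto)
        also have "\<dots> = C * s powr \<beta> / \<beta>"
          using \<rho> su by (simp add: powr_mult powr_minus)
        also have "\<dots> \<le> C * t powr \<beta> / \<beta>"
          using su \<beta> C by (intro divide_right_mono mult_left_mono powr_mono2) auto
        finally have "\<bar>(a - h) * ln \<rho>\<bar> \<le> C * t powr \<beta> / \<beta>" by (simp add: abs_mult)
        then have "- (C * t powr \<beta> / \<beta>) \<le> (a - h) * ln \<rho>" by linarith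
        then show ?thesis using \<rho> by (simp add: g_def powr_def)
      qed
      have y: "(t1\<^sup>2) powr (- \<nu>) * (s * (u - s)) powr \<nu> \<le> (s * (u - s)) powr a"
      proof -
        define y where "y = s * (u - s)"
        have "y \<le> t1 * t1" unfolding y_def using su by (intro mult_mono) (auto simp: t1_def)
        then have y: "0 < y" "y \<le> t1\<^sup>2" using su by (auto simp: y_def power2_eq_square)
        have t1: "1 \<le> t1\<^sup>2" by (simp add: t1_def)
        then have "(t1\<^sup>2) powr (- \<nu>) * y powr \<nu> = (y / t1\<^sup>2) powr \<nu>"
          using y powr_divide[of y "t1\<^sup>2" \<nu>] by (simp add: powr_minus) (simp add: divide_inverse)
        also have "\<dots> \<le> (y / t1\<^sup>2) powr a"
        proof (rule powr_mono')
          show "y / t1\<^sup>2 \<le> 1" using y t1 by (subst pos_divide_le_eq) linarith+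
        qed (use a y in auto)
        also have "\<dots> \<le> y powr a"
        proof (rule powr_mono2)
          have "0 < t1\<^sup>2" using t1 by linarith
          then show "y / t1\<^sup>2 \<le> y" using mult_left_mono[OF t1, of y] y by (subst pos_divide_le_eq) auto
        qed (use a y in auto)
        finally show ?thesis by (simp add: y_def)
      qed
      have "c' * (s * (u - s)) powr \<nu> = (1 - c) / 4 * m * g\<^sup>2 * ((t1\<^sup>2) powr (- \<nu>) * (s * (u - s)) powr \<nu>)"
        by (simp add: c'_def)
      also have "\<dots> \<le> (1 - c) / 4 * V a * (\<rho> powr (a - h))\<^sup>2 * (s * (u - s)) powr a"
        using c m g Va ga y by (intro mult_mono power_mono) auto
      finally have "(c' * (s * (u - s)) powr \<nu>)\<^sup>2 \<le> ((1 - c) / 4 * V a * (\<rho> powr (a - h))\<^sup>2 * (s * (u - s)) powr a)\<^sup>2"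
        using c' by (intro power_mono) auto
      also have "\<dots> \<le> Q \<rho> s s * Q \<rho> u u - (Q \<rho> s u)\<^sup>2"
        unfolding a_def c_def s'_def
        by (rule gram_det_ge) (use \<rho> su e1 e2 in \<open>auto simp: a_def b_def c_def s'_def u'_def\<close>)
      finally show ?thesis .
    qed
    show ?case
    proof (intro ballI impI)
      fix s u assume su: "s \<in> {0<..t}" "u \<in> {0<..t}" "s \<noteq> u"
      show "(c' * (min s u * \<bar>s - u\<bar>) powr \<nu>)\<^sup>2 \<le> Q \<rho> s s * Q \<rho> u u - (Q \<rho> s u)\<^sup>2"
      proof (cases "s < u")
        case True
        then show ?thesis using ordered[of s u] su by (simp add: min_def)
      next
        case False
        then show ?thesis using ordered[of u s] su by (simp add: min_def Q_sym[of \<rho> u s] mult.commute)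
      qed
    qed
  qed
  with c' that show ?thesis by blast
qed

end

section \<open>Convergence to the local time\<close>

lemma gaussian_integral_wiener:
  assumes BM: "std_brownian_motion M W"
  shows "gaussian_integral M (has_wiener_integral M W UNIV :: (real \<Rightarrow> real) \<Rightarrow> _)"
proof -
  interpret prob_space M using BM by (simp add: std_brownian_motion_def)
  have W: "W t \<in> borel_measurable M" for t using BM by (simp add: std_brownian_motion_def)
  show ?thesis
  proof
    fix f g :: "real \<Rightarrow> real" and X Y a b
    assume f: "has_wiener_integral M W UNIV f X"
    then show "f \<in> borel_measurable borel" "X \<in> borel_measurable M"
      by (auto simp: has_wiener_integral_def set_borel_measurable_def)
    show "integrable lborel (\<lambda>u. (norm (f u))\<^sup>2)"
      "(CLINT w|M. iexp (X w)) = of_real (exp (- (\<integral>u. (norm (f u))\<^sup>2 \<partial>lborel) / 2))"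
      using has_wiener_integral_iexp[OF BM f] by simp_all
    assume "has_wiener_integral M W UNIV g Y"
    from has_wiener_integral_lincomb[where W = W, OF W f this, of a b]
    show "has_wiener_integral M W UNIV (\<lambda>u. a *\<^sub>R f u + b *\<^sub>R g u) (\<lambda>w. a * X w + b * Y w)" by simp
  qed
qed

lemma gaussian_integral_spectral:
  assumes BM: "std_brownian_motion M W"
  shows "gaussian_integral M (\<lambda>f X. has_spectral_integral M W f (\<lambda>w. complex_of_real (X w)))"
proof -
  interpret prob_space M using BM by (simp add: std_brownian_motion_def)
  have W: "W t \<in> borel_measurable M" for t using BM by (simp add: std_brownian_motion_def)
  show ?thesis
  proof
    fix f g and X Y :: "'a \<Rightarrow> real" and a b :: real
    assume f: "has_spectral_integral M W f (\<lambda>w. complex_of_real (X w))"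
    then have "(\<lambda>w. complex_of_real (X w)) \<in> borel_measurable M"
      by (auto simp: has_spectral_integral_def has_wiener_integral_def)
    from measurable_compose[OF this borel_measurable_Re] show "X \<in> borel_measurable M" by simp
    show "f \<in> borel_measurable borel" "integrable lborel (\<lambda>u. (norm (f u))\<^sup>2)"
      "(CLINT w|M. iexp (X w)) = of_real (exp (- (\<integral>u. (norm (f u))\<^sup>2 \<partial>lborel) / 2))"
      using has_spectral_integral_iexp[OF BM f] by simp_all
    assume "has_spectral_integral M W g (\<lambda>w. complex_of_real (Y w))"
    from has_spectral_integral_lincomb[where W = W, OF W f this, of a b]
    show "has_spectral_integral M W (\<lambda>u. a *\<^sub>R f u + b *\<^sub>R g u) (\<lambda>w. complex_of_real (a * X w + b * Y w))"
      by (simp add: scaleR_conv_of_real)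
  qed
qed

text \<open>Extended by 0, the two integrands add up to the kernel up to the Gamma factor, off the
  points 0 and \<open>t\<close>, so linearity merges the two integrals into one over the
  line.\<close>

lemma moving_average_value_wiener:
  assumes BM: "std_brownian_motion M W" and X: "X \<in> borel_measurable M" and "0 \<le> t"
    and val: "is_mbm_value Moving_Average M W h t X"
  shows "has_wiener_integral M W UNIV (moving_average_kernel h t) X"
proof -
  have W: "W t \<in> borel_measurable M" for t using BM by (simp add: std_brownian_motion_def)
  define f1 f2 where "f1 u = (t - u) powr (h - 1/2) - (- u) powr (h - 1/2)" and "f2 u = (t - u) powr (h - 1/2)" for u
  from val obtain I J where I: "has_wiener_integral M W {..0} f1 I" and J: "has_wiener_integral M W {0..t} f2 J"
    and eq: "AE w in M. X w = 1 / Gamma (h + 1/2) * (I w + J w)"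
    unfolding is_mbm_value.simps f1_def[abs_def] f2_def[abs_def] by blast
  have [measurable]: "I \<in> borel_measurable M" "J \<in> borel_measurable M"
    using I J by (auto simp: has_wiener_integral_def)
  have [measurable]: "f1 \<in> borel_measurable borel" "f2 \<in> borel_measurable borel"
    unfolding f1_def[abs_def] f2_def[abs_def] by measurable
  define c where "c = 1 / Gamma (h + 1/2)"
  have I': "has_wiener_integral M W UNIV (\<lambda>u. indicator {..0} u * f1 u) I"
    by (rule has_wiener_integral_cong_AE[OF I]) (auto simp: set_borel_measurable_def)
  have J': "has_wiener_integral M W UNIV (\<lambda>u. indicator {0..t} u * f2 u) J"
    by (rule has_wiener_integral_cong_AE[OF J]) (auto simp: set_borel_measurable_def)
  show ?thesis
  proof (rule has_wiener_integral_cong_AE[OF has_wiener_integral_lincomb[where W = W, OF W I' J', of c c]])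
    show "AE w in M. c *\<^sub>R I w + c *\<^sub>R J w = X w"
      using eq by eventually_elim (simp add: c_def distrib_left add_divide_distrib)
    \<comment> \<open>For positive \<open>t\<close> the point \<open>u = 0\<close> lies in both
      intervals and would count twice; it is discarded as a null set.\<close>
    have "AE u in lborel. u \<noteq> 0" "AE u in lborel. u \<noteq> t" by (rule AE_lborel_singleton)+
    then show "AE u in lborel. indicator UNIV u *\<^sub>R (c *\<^sub>R (indicator {..0} u * f1 u) + c *\<^sub>R (indicator {0..t} u * f2 u))
        = indicator UNIV u *\<^sub>R moving_average_kernel h t u"
    proof eventually_elim
      case (elim u)
      consider "u < 0" | "0 < u" "u < t" | "0 < u" "t < u" using elim by linarith
      then show ?case
        using \<open>0 \<le> t\<close> by cases (auto simp: moving_average_kernel_def fractional_kernel_def pos_powr_def f1_def f2_def c_def)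
    qed
  qed (auto simp: set_borel_measurable_def X)
qed

section \<open>Averages over a uniform time\<close>

lemma nn_integral_abs_powr_finite:
  fixes \<nu> t :: real
  assumes "\<nu> < 1" "0 \<le> t"
  shows "(\<integral>\<^sup>+v. ennreal (indicator {-t..t} v * \<bar>v\<bar> powr (- \<nu>)) \<partial>lborel) < \<infinity>"
proof -
  define w where "w v = indicator {0<..t} v * v powr (- \<nu>)" for v :: real
  have w: "integrable lborel w" unfolding w_def using assms by (intro powr_integrable_at_0) auto
  then have "integrable lborel (\<lambda>v. w v + w (- v))"
    using lborel_integrable_real_affine[OF w, of "-1" 0] by simp
  moreover have "(\<lambda>v. w v + w (- v)) = (\<lambda>v. indicator {-t..t} v * \<bar>v\<bar> powr (- \<nu>))"
    by (auto simp: fun_eq_iff w_def indicator_def)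
  ultimately have "integrable lborel (\<lambda>v. indicator {-t..t} v * \<bar>v\<bar> powr (- \<nu>))" by simp
  then show ?thesis by (subst (asm) integrable_iff_bounded) (simp add: abs_mult)
qed

definition unif :: "real \<Rightarrow> real measure" where
  "unif t = density lborel (\<lambda>s. ennreal (indicator {0..t} s / t))"

lemma sets_unif [simp, measurable_cong]: "sets (unif t) = sets borel"
  by (simp add: unif_def)

lemma AE_unif: "0 < t \<Longrightarrow> AE s in unif t. s \<in> {0<..t}"
  unfolding unif_def using AE_lborel_singleton[of 0]
  by (subst AE_density) (auto elim!: eventually_mono simp: indicator_def split: if_splits)

lemma prob_space_unif: "0 < t \<Longrightarrow> prob_space (unif t)"
proof
  assume t: "0 < t"
  have "emeasure (unif t) (space (unif t)) = (\<integral>\<^sup>+s. ennreal (1 / t) * indicator {0..t} s \<partial>lborel)"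
    unfolding unif_def by (subst emeasure_density) (auto intro!: nn_integral_cong simp: indicator_def)
  also have "\<dots> = 1" using t by (simp add: nn_integral_cmult flip: ennreal_mult)
  finally show "emeasure (unif t) (space (unif t)) = 1" .
qed

lemma integral_unif:
  fixes h :: "real \<Rightarrow> real"
  assumes "0 < t" and [measurable]: "h \<in> borel_measurable borel"
  shows "(\<integral>s. h s \<partial>unif t) = (LINT s:{0..t}|lborel. h s) / t"
proof -
  have "(\<integral>s. h s \<partial>unif t) = (\<integral>s. (indicator {0..t} s / t) *\<^sub>R h s \<partial>lborel)"
    unfolding unif_def using assms(1) by (subst integral_density) auto
  also have "\<dots> = (\<integral>s. (indicator {0..t} s *\<^sub>R h s) / t \<partial>lborel)" by simp
  finally show ?thesis unfolding set_lebesgue_integral_def by simp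
qed

text \<open>The minimum is one of the two times, so the integrand is at most
  \<open>s powr (- \<nu>) * \<bar>s - u\<bar> powr (- \<nu>)\<close> plus the same with the times
  exchanged. The inner integral over \<open>u\<close> is bounded uniformly in \<open>s\<close>, and
  both singularities are integrable because \<open>\<nu> < 1\<close>.\<close>

lemma integrable_unif_det_bound:
  fixes \<nu> t :: real
  assumes \<nu>: "0 < \<nu>" "\<nu> < 1" and t: "0 < t"
  shows "integrable (unif t \<Otimes>\<^sub>M unif t) (\<lambda>p. (min (fst p) (snd p) * \<bar>fst p - snd p\<bar>) powr (- \<nu>))"
proof -
  interpret U: prob_space "unif t" using t by (rule prob_space_unif)
  interpret UU: pair_prob_space "unif t" "unif t" ..
  define a where "a s = ennreal (s powr (- \<nu>))" for s :: real
  define b where "b v = ennreal (\<bar>v\<bar> powr (- \<nu>))" for v :: real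
  have [measurable]: "a \<in> borel_measurable borel" "b \<in> borel_measurable borel"
    unfolding a_def[abs_def] b_def[abs_def] by measurable
  define I where "I = (\<integral>\<^sup>+v. ennreal (indicator {-t..t} v * \<bar>v\<bar> powr (- \<nu>)) \<partial>lborel)"
  have I: "I < \<infinity>" unfolding I_def using \<nu> t by (intro nn_integral_abs_powr_finite) auto
  have b: "(\<integral>\<^sup>+u. b (s - u) \<partial>unif t) \<le> ennreal (1 / t) * I" if "s \<in> {0<..t}" for s
  proof -
    have "(\<integral>\<^sup>+u. b (s - u) \<partial>unif t) = (\<integral>\<^sup>+u. ennreal (indicator {0..t} u / t) * b (s - u) \<partial>lborel)"
      unfolding unif_def by (subst nn_integral_density) auto
    also have "\<dots> = (\<integral>\<^sup>+v. ennreal (indicator {0..t} (s - v) / t) * b v \<partial>lborel)"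
      using nn_integral_real_affine[of "\<lambda>u. ennreal (indicator {0..t} u / t) * b (s - u)" "-1" s] by simp
    also have "\<dots> \<le> (\<integral>\<^sup>+v. ennreal (1 / t) * ennreal (indicator {-t..t} v * \<bar>v\<bar> powr (- \<nu>)) \<partial>lborel)"
    proof (rule nn_integral_mono)
      fix v
      show "ennreal (indicator {0..t} (s - v) / t) * b v \<le> ennreal (1 / t) * ennreal (indicator {-t..t} v * \<bar>v\<bar> powr (- \<nu>))"
        using that t by (cases "s - v \<in> {0..t}") (auto simp: b_def indicator_def)
    qed
    also have "\<dots> = ennreal (1 / t) * I" unfolding I_def by (rule nn_integral_cmult) measurable
    finally show ?thesis .
  qed
  have a: "(\<integral>\<^sup>+s. a s \<partial>unif t) \<le> ennreal (1 / t) * I"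
  proof -
    have "(\<integral>\<^sup>+s. a s \<partial>unif t) = (\<integral>\<^sup>+s. ennreal (indicator {0..t} s / t) * a s \<partial>lborel)"
      unfolding unif_def by (subst nn_integral_density) auto
    also have "\<dots> \<le> (\<integral>\<^sup>+v. ennreal (1 / t) * ennreal (indicator {-t..t} v * \<bar>v\<bar> powr (- \<nu>)) \<partial>lborel)"
    proof (rule nn_integral_mono)
      fix v
      show "ennreal (indicator {0..t} v / t) * a v \<le> ennreal (1 / t) * ennreal (indicator {-t..t} v * \<bar>v\<bar> powr (- \<nu>))"
        using t by (cases "v \<in> {0..t}") (auto simp: a_def indicator_def)
    qed
    also have "\<dots> = ennreal (1 / t) * I" unfolding I_def by (rule nn_integral_cmult) measurable
    finally show ?thesis .
  qed
  have AE2: "AE p in unif t \<Otimes>\<^sub>M unif t. fst p \<in> {0<..t} \<and> snd p \<in> {0<..t}"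
  proof (rule UU.AE_pair_measure)
    show "AE x in unif t. AE y in unif t. fst (x, y) \<in> {0<..t} \<and> snd (x, y) \<in> {0<..t}"
    proof (rule eventually_mono[OF AE_unif[OF t]])
      fix x assume "x \<in> {0<..t}"
      then show "AE y in unif t. fst (x, y) \<in> {0<..t} \<and> snd (x, y) \<in> {0<..t}"
        by (intro eventually_mono[OF AE_unif[OF t]]) simp
    qed
  qed measurable
  have half: "(\<integral>\<^sup>+s. \<integral>\<^sup>+u. a s * b (s - u) \<partial>unif t \<partial>unif t) \<le> (ennreal (1 / t) * I) * (ennreal (1 / t) * I)"
  proof -
    have "(\<integral>\<^sup>+s. \<integral>\<^sup>+u. a s * b (s - u) \<partial>unif t \<partial>unif t) = (\<integral>\<^sup>+s. a s * (\<integral>\<^sup>+u. b (s - u) \<partial>unif t) \<partial>unif t)"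
      by (simp add: nn_integral_cmult)
    also have "\<dots> \<le> (\<integral>\<^sup>+s. a s * (ennreal (1 / t) * I) \<partial>unif t)"
      by (intro nn_integral_mono_AE eventually_mono[OF AE_unif[OF t]] mult_left_mono b) simp_all
    also have "\<dots> = (\<integral>\<^sup>+s. a s \<partial>unif t) * (ennreal (1 / t) * I)" by (simp add: nn_integral_multc)
    also have "\<dots> \<le> (ennreal (1 / t) * I) * (ennreal (1 / t) * I)" by (intro mult_right_mono a) auto
    finally show ?thesis .
  qed
  have "(\<integral>\<^sup>+p. ennreal (norm ((min (fst p) (snd p) * \<bar>fst p - snd p\<bar>) powr (- \<nu>))) \<partial>(unif t \<Otimes>\<^sub>M unif t))
    \<le> (\<integral>\<^sup>+p. a (fst p) * b (fst p - snd p) + a (snd p) * b (snd p - fst p) \<partial>(unif t \<Otimes>\<^sub>M unif t))"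
  proof (intro nn_integral_mono_AE eventually_mono[OF AE2])
    fix p :: "real \<times> real" assume "fst p \<in> {0<..t} \<and> snd p \<in> {0<..t}"
    then have "(min (fst p) (snd p) * \<bar>fst p - snd p\<bar>) powr (- \<nu>) = (min (fst p) (snd p)) powr (- \<nu>) * \<bar>fst p - snd p\<bar> powr (- \<nu>)"
      by (simp add: powr_mult)
    also have "\<dots> \<le> (fst p powr (- \<nu>) + snd p powr (- \<nu>)) * \<bar>fst p - snd p\<bar> powr (- \<nu>)"
      by (intro mult_right_mono) (auto simp: min_def)
    finally have "ennreal ((min (fst p) (snd p) * \<bar>fst p - snd p\<bar>) powr (- \<nu>))
        \<le> ennreal ((fst p powr (- \<nu>) + snd p powr (- \<nu>)) * \<bar>fst p - snd p\<bar> powr (- \<nu>))" by (rule ennreal_leI)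
    then show "ennreal (norm ((min (fst p) (snd p) * \<bar>fst p - snd p\<bar>) powr (- \<nu>))) \<le> a (fst p) * b (fst p - snd p) + a (snd p) * b (snd p - fst p)"
      by (simp add: a_def b_def abs_minus_commute distrib_right flip: ennreal_mult ennreal_plus)
  qed
  also have "\<dots> = (\<integral>\<^sup>+p. a (fst p) * b (fst p - snd p) \<partial>(unif t \<Otimes>\<^sub>M unif t)) + (\<integral>\<^sup>+p. a (snd p) * b (snd p - fst p) \<partial>(unif t \<Otimes>\<^sub>M unif t))"
    by (intro nn_integral_add) measurable
  also have "(\<integral>\<^sup>+p. a (fst p) * b (fst p - snd p) \<partial>(unif t \<Otimes>\<^sub>M unif t)) = (\<integral>\<^sup>+s. \<integral>\<^sup>+u. a s * b (s - u) \<partial>unif t \<partial>unif t)"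
    by (subst U.nn_integral_fst[symmetric]) auto
  also have "(\<integral>\<^sup>+p. a (snd p) * b (snd p - fst p) \<partial>(unif t \<Otimes>\<^sub>M unif t)) = (\<integral>\<^sup>+s. \<integral>\<^sup>+u. a s * b (s - u) \<partial>unif t \<partial>unif t)"
    by (subst UU.nn_integral_snd[symmetric]) auto
  finally have "(\<integral>\<^sup>+p. ennreal (norm ((min (fst p) (snd p) * \<bar>fst p - snd p\<bar>) powr (- \<nu>))) \<partial>(unif t \<Otimes>\<^sub>M unif t))
      \<le> (ennreal (1 / t) * I) * (ennreal (1 / t) * I) + (ennreal (1 / t) * I) * (ennreal (1 / t) * I)"
    using half by (meson add_mono order_trans)
  also have "\<dots> < \<infinity>" using I by (auto simp: ennreal_mult_less_top)
  finally show ?thesis by (simp add: integrable_iff_bounded)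
qed

text \<open>\<open>Y\<close> is measurable on the half-line only; clamping the time at 0 gives a
  measurable function on the whole line with the same values under the uniform law. Averaging
  divides the occupation density by \<open>t\<close>.\<close>

lemma local_time_unif:
  fixes Y :: "real \<Rightarrow> real"
  assumes t: "0 < t" and Y: "Y \<in> borel_measurable (restrict_space borel {0..})"
    and l[measurable]: "l \<in> borel_measurable borel" and l0: "\<And>x. 0 \<le> l x"
    and occ: "occupation_measure Y {0..t} = density lborel (\<lambda>x. ennreal (l x))"
  shows "distr (unif t) borel (\<lambda>s. Y (max 0 s)) = density lborel (\<lambda>x. ennreal (l x / t))"
proof (rule measure_eqI)
  have Ym[measurable]: "(\<lambda>s. Y (max 0 s)) \<in> borel_measurable borel"
    by (rule measurable_compose[OF _ Y]) (auto intro!: measurable_restrict_space2)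
  fix A assume "A \<in> sets (distr (unif t) borel (\<lambda>s. Y (max 0 s)))"
  then have [measurable]: "A \<in> sets borel" by simp
  have Yt: "Y \<in> borel_measurable (restrict_space lborel {0..t})"
  proof (rule measurable_cong[THEN iffD1])
    show "(\<lambda>s. Y (max 0 s)) \<in> borel_measurable (restrict_space lborel {0..t})" by (intro measurable_restrict_space1) simp
  qed (auto simp: space_restrict_space)
  have "emeasure (distr (unif t) borel (\<lambda>s. Y (max 0 s))) A = (\<integral>\<^sup>+s. indicator A (Y (max 0 s)) \<partial>unif t)"
    by (subst nn_integral_indicator[symmetric], simp, subst nn_integral_distr) auto
  also have "\<dots> = (\<integral>\<^sup>+s. ennreal (indicator {0..t} s / t) * indicator A (Y (max 0 s)) \<partial>lborel)"
    unfolding unif_def by (subst nn_integral_density) auto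
  also have "\<dots> = (\<integral>\<^sup>+s. ennreal (1 / t) * (indicator A (Y s) * indicator {0..t} s) \<partial>lborel)"
    by (intro nn_integral_cong) (auto simp: indicator_def)
  also have "\<dots> = (\<integral>\<^sup>+s. ennreal (1 / t) * (indicator A (Y (max 0 s)) * indicator {0..t} s) \<partial>lborel)"
    by (intro nn_integral_cong) (auto simp: indicator_def)
  also have "\<dots> = ennreal (1 / t) * (\<integral>\<^sup>+s. indicator A (Y (max 0 s)) * indicator {0..t} s \<partial>lborel)"
    by (rule nn_integral_cmult) measurable
  also have "(\<integral>\<^sup>+s. indicator A (Y (max 0 s)) * indicator {0..t} s \<partial>lborel) = (\<integral>\<^sup>+s. indicator A (Y s) * indicator {0..t} s \<partial>lborel)"
    by (intro nn_integral_cong) (auto simp: indicator_def)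
  also have "\<dots> = (\<integral>\<^sup>+s. indicator A (Y s) \<partial>restrict_space lborel {0..t})"
    by (subst nn_integral_restrict_space) auto
  also have "\<dots> = emeasure (occupation_measure Y {0..t}) A"
    unfolding occupation_measure_def using Yt
    by (subst nn_integral_indicator[symmetric], simp, subst nn_integral_distr) auto
  also have "\<dots> = (\<integral>\<^sup>+x. ennreal (l x) * indicator A x \<partial>lborel)" unfolding occ by (subst emeasure_density) auto
  also have "ennreal (1 / t) * \<dots> = (\<integral>\<^sup>+x. ennreal (1 / t) * (ennreal (l x) * indicator A x) \<partial>lborel)"
    by (rule nn_integral_cmult[symmetric]) measurable
  also have "\<dots> = (\<integral>\<^sup>+x. ennreal (l x / t) * indicator A x \<partial>lborel)"
    using t l0 by (intro nn_integral_cong) (simp add: mult.assoc[symmetric] flip: ennreal_mult)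
  also have "\<dots> = emeasure (density lborel (\<lambda>x. ennreal (l x / t))) A" by (subst emeasure_density) auto
  finally show "emeasure (distr (unif t) borel (\<lambda>s. Y (max 0 s))) A = emeasure (density lborel (\<lambda>x. ennreal (l x / t))) A" .
qed simp

text \<open>Serves the time interval of length 0, where the occupation density vanishes almost
  everywhere and its value at one level is wanted.\<close>

lemma continuous_ae_zero_imp_zero:
  fixes l :: "real \<Rightarrow> real"
  assumes "isCont l y" "AE x in lborel. l x = 0"
  shows "l y = 0"
proof (rule ccontr)
  assume "l y \<noteq> 0"
  then have "\<forall>\<^sub>F x in nhds y. l x \<noteq> 0"
    using assms(1) by (intro tendsto_imp_eventually_ne) (auto simp: isCont_def tendsto_nhds_iff)
  then obtain d where d: "0 < d" "\<And>x. dist x y < d \<Longrightarrow> l x \<noteq> 0" by (auto simp: eventually_nhds_metric)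
  show False
    by (rule AE_lborel_interval_contradiction[OF assms(2), of "y - d" "y + d"]) (use d in \<open>auto simp: dist_real_def\<close>)
qed

lemma weak_conv_m_offset:
  assumes "weak_conv_m (\<lambda>n. P (n + n0)) P'"
  shows "weak_conv_m P P'"
  unfolding weak_conv_m_def weak_conv_def
proof (intro allI impI)
  fix x assume "isCont (cdf P') x"
  then have "(\<lambda>n. cdf (P (n + n0)) x) \<longlonglongrightarrow> cdf P' x"
    using assms by (simp add: weak_conv_m_def weak_conv_def)
  then show "(\<lambda>n. cdf (P n) x) \<longlonglongrightarrow> cdf P' x" by (rule LIMSEQ_offset)
qed

section \<open>Limit of the local functionals of the multifractional process\<close>

context multifractional_kernel
begin

lemma eventually_local_nondeterminism_sequence:
  assumes "0 < t" "\<And>n. 0 < r n" "r \<longlonglongrightarrow> 0"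
  obtains c n0 where "0 < c" "\<And>n s u. n0 \<le> n \<Longrightarrow> s \<in> {0<..t} \<Longrightarrow> u \<in> {0<..t} \<Longrightarrow> s \<noteq> u \<Longrightarrow>
    (c * (min s u * \<bar>s - u\<bar>) powr \<nu>)\<^sup>2 \<le> Q (r n) s s * Q (r n) u u - (Q (r n) s u)\<^sup>2"
proof -
  obtain c where c: "0 < c" "\<forall>\<^sub>F \<rho> in at_right 0. \<forall>s\<in>{0<..t}. \<forall>u\<in>{0<..t}. s \<noteq> u \<longrightarrow>
    (c * (min s u * \<bar>s - u\<bar>) powr \<nu>)\<^sup>2 \<le> Q \<rho> s s * Q \<rho> u u - (Q \<rho> s u)\<^sup>2"
    using local_nondeterminism[OF assms(1)] by blast
  have "filterlim r (at_right 0) sequentially"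
    using assms(2) by (intro tendsto_imp_filterlim_at_right[OF assms(3)] always_eventually) simp
  from filterlim_iff[THEN iffD1, OF this, rule_format, OF c(2)]
  obtain n0 where n0: "\<forall>n\<ge>n0. \<forall>s\<in>{0<..t}. \<forall>u\<in>{0<..t}. s \<noteq> u \<longrightarrow>
      (c * (min s u * \<bar>s - u\<bar>) powr \<nu>)\<^sup>2 \<le> Q (r n) s s * Q (r n) u u - (Q (r n) s u)\<^sup>2"
    unfolding eventually_sequentially by blast
  show ?thesis by (rule that[OF c(1)]) (use n0 in blast)
qed

text \<open>The relations \<open>R\<close> and \<open>R'\<close> stay abstract, which treats both
  representations at once. The relation between \<psi>, \<theta> and \<rho> is what turns the
  normalised time integral into an average along the rescaled process.\<close>

theorem local_time_limit:
  fixes B :: "real \<Rightarrow> 'a \<Rightarrow> real" and Y :: "real \<Rightarrow> 'b \<Rightarrow> real" and l :: "real \<Rightarrow> real \<Rightarrow> 'b \<Rightarrow> real"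
  assumes R: "gaussian_integral M R" and B_R: "\<And>s. 0 \<le> s \<Longrightarrow> R (k (H s) s) (B s)"
    and B: "(\<lambda>(s, w). B s w) \<in> borel_measurable (restrict_space borel {0..} \<Otimes>\<^sub>M M)"
    and R': "gaussian_integral N R'" and Y_R': "\<And>s. 0 \<le> s \<Longrightarrow> R' (k h s) (Y s)"
    and Y: "(\<lambda>(s, w). Y s w) \<in> borel_measurable (restrict_space borel {0..} \<Otimes>\<^sub>M N)"
    and l: "continuous_local_time N Y l" and f: "integrable lborel f"
    and \<theta>: "\<And>\<rho>. 0 < \<rho> \<Longrightarrow> 0 < \<theta> \<rho>" "\<And>\<rho>. 0 < \<rho> \<Longrightarrow> \<psi> \<rho> / \<theta> \<rho> = \<rho> powr (1 - h)"
      "((\<lambda>\<rho>. \<theta> \<rho> / \<rho> powr h) \<longlongrightarrow> 0) (at_right 0)" and t: "0 \<le> t"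
  shows "conv_in_law_at_right_0 M (\<lambda>\<rho> w. 1 / \<psi> \<rho> *
      (LINT s:{t\<^sub>0..\<rho> * t + t\<^sub>0}|lborel. f ((B s w - B t\<^sub>0 w - \<rho> powr h * y) / \<theta> \<rho>)))
    N (\<lambda>w. (LINT x|lborel. f x) * l t y w)"
  unfolding conv_in_law_at_right_0_def
proof (intro allI impI)
  fix r :: "nat \<Rightarrow> real" assume "(\<forall>n. 0 < r n) \<and> r \<longlonglongrightarrow> 0"
  then have r: "\<And>n. 0 < r n" "r \<longlonglongrightarrow> 0" by auto
  interpret M: gaussian_integral M R by fact
  interpret N: gaussian_integral N R' by fact
  have [measurable]: "f \<in> borel_measurable borel" using f by auto
  have [measurable]: "l t y \<in> borel_measurable N" using l t by (auto simp: continuous_local_time_def)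
  \<comment> \<open>Joint measurability is given for nonnegative times; composition with the clamp
    extends it to the whole line.\<close>
  have clamp: "(\<lambda>v. (max 0 (fst v :: real), snd v)) \<in> borel \<Otimes>\<^sub>M K \<rightarrow>\<^sub>M restrict_space borel {0..} \<Otimes>\<^sub>M K" for K :: "'k measure"
    by (intro measurable_Pair measurable_restrict_space2 borel_measurable_max) auto
  have B'[measurable]: "(\<lambda>(s, w). B (max 0 s) w) \<in> borel_measurable (borel \<Otimes>\<^sub>M M)"
    using measurable_compose[OF clamp B] by (simp add: split_beta')
  have Y'[measurable]: "(\<lambda>(s, w). Y (max 0 s) w) \<in> borel_measurable (borel \<Otimes>\<^sub>M N)"
    using measurable_compose[OF clamp Y] by (simp add: split_beta')
  have Bm[measurable (raw)]: "(\<lambda>x. B (max 0 (p x)) (q x)) \<in> borel_measurable L"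
    if [measurable]: "p \<in> borel_measurable L" "q \<in> L \<rightarrow>\<^sub>M M" for p q and L :: "'s measure"
    using measurable_compose[OF measurable_Pair[OF that] B'] by simp
  define I where "I \<rho> w = 1 / \<psi> \<rho> * (LINT s:{t\<^sub>0..\<rho> * t + t\<^sub>0}|lborel. f ((B s w - B t\<^sub>0 w - \<rho> powr h * y) / \<theta> \<rho>))" for \<rho> w
  define F where "F = (LINT x|lborel. f x)"
  from l have l_AE: "AE w in N. continuous_on ({0..} \<times> UNIV) (\<lambda>(t, x). l t x w) \<and> (\<forall>x. 0 \<le> l t x w) \<and>
      occupation_measure (\<lambda>s. Y s w) {0..t} = density lborel (\<lambda>x. ennreal (l t x w))"
    unfolding continuous_local_time_def by (rule conjE) (erule eventually_mono, use t in blast)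
  have lc: "continuous_on UNIV (\<lambda>x. l t x w)" if "continuous_on ({0..} \<times> UNIV) (\<lambda>(t, x). l t x w)" for w
  proof -
    have "continuous_on UNIV (\<lambda>x. (t, x))" by (intro continuous_intros)
    from continuous_on_compose2[OF that this] t show ?thesis by auto
  qed
  have lb: "(\<lambda>x. l t x w) \<in> borel_measurable borel" "isCont (\<lambda>x. l t x w) y"
    if "continuous_on ({0..} \<times> UNIV) (\<lambda>(t, x). l t x w)" for w
    using lc[OF that] by (auto intro: borel_measurable_continuous_onI simp: continuous_on_eq_continuous_at)
  show "weak_conv_m (\<lambda>n. distr M borel (I (r n))) (distr N borel (\<lambda>w. F * l t y w))"
  \<comment> \<open>The uniform law requires a positive \<open>t\<close>. For \<open>t = 0\<close>
    the functional is an integral over a point and the occupation measure is null; continuity of the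
    local time in \<open>x\<close> then makes it vanish at \<open>y\<close> almost surely, so both
    laws are concentrated at 0.\<close>
  proof (cases "t = 0")
    case True
    have I0: "I \<rho> w = 0" for \<rho> w
    proof -
      have "indicator {t\<^sub>0} s *\<^sub>R g s = indicator {t\<^sub>0} s *\<^sub>R g t\<^sub>0" for g :: "real \<Rightarrow> real" and s
        by (simp add: indicator_def)
      then have "(LINT s:{t\<^sub>0}|lborel. g s) = 0" for g :: "real \<Rightarrow> real"
        unfolding set_lebesgue_integral_def by (simp only:) simp
      then show ?thesis using True by (simp add: I_def)
    qed
    have "AE w in N. l t y w = 0"
      using l_AE
    proof eventually_elim
      case (elim w)
      note [measurable] = lb(1)[OF elim[THEN conjunct1]]
      have "emeasure (density lborel (\<lambda>x. ennreal (l t x w))) UNIV = 0"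
        unfolding elim[THEN conjunct2, THEN conjunct2, symmetric] occupation_measure_def distr_def
      proof -
        have "emeasure (restrict_space lborel {0..t}) S = 0" if "S \<subseteq> {0}" for S :: "real set"
          using True subset_singletonD[OF that] by (auto simp: emeasure_restrict_space)
        then show "emeasure (measure_of (space borel) (sets borel) (\<lambda>A. emeasure (restrict_space lborel {0..t})
            ((\<lambda>s. Y s w) -` A \<inter> space (restrict_space lborel {0..t})))) UNIV = 0"
          using True by (simp add: emeasure_measure_of_conv space_restrict_space)
      qed
      then have "(\<integral>\<^sup>+x. ennreal (l t x w) \<partial>lborel) = 0" by (simp add: emeasure_density)
      then have "AE x in lborel. l t x w = 0"
        using elim by (subst (asm) nn_integral_0_iff_AE) (auto simp: ennreal_eq_0_iff intro: order_antisym elim!: eventually_mono)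
      then show ?case by (rule continuous_ae_zero_imp_zero[OF lb(2)[OF elim[THEN conjunct1]]])
    qed
    then have "distr N borel (\<lambda>w. F * l t y w) = distr N borel (\<lambda>w. 0)"
      by (intro distr_cong_AE) (auto elim: eventually_mono)
    then have "distr N borel (\<lambda>w. F * l t y w) = distr M borel (I (r n))" for n
      unfolding I0[abs_def] by (simp add: M.distr_const N.distr_const)
    then show ?thesis by (simp add: weak_conv_m_def weak_conv_def)
  next
    case False
    with t have t: "0 < t" by simp
    obtain c n0 where c: "0 < c" and nd: "\<And>n s u. n0 \<le> n \<Longrightarrow> s \<in> {0<..t} \<Longrightarrow> u \<in> {0<..t} \<Longrightarrow> s \<noteq> u \<Longrightarrow>
      (c * (min s u * \<bar>s - u\<bar>) powr \<nu>)\<^sup>2 \<le> Q (r n) s s * Q (r n) u u - (Q (r n) s u)\<^sup>2"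
      using eventually_local_nondeterminism_sequence[OF t r] by blast
    \<comment> \<open>The determinant bound holds from the index \<open>n0\<close> on, so the
      sequence is shifted to have it for all \<open>n\<close>.\<close>
    define \<rho> where "\<rho> n = r (n + n0)" for n
    have \<rho>: "\<And>n. 0 < \<rho> n" "\<rho> \<longlonglongrightarrow> 0" using r LIMSEQ_ignore_initial_segment[OF r(2)] by (auto simp: \<rho>_def[abs_def])
    define X where "X n s w = \<rho> n powr (- h) * (B (t\<^sub>0 + \<rho> n * max 0 s) w - B t\<^sub>0 w)" for n s w
    define QX where "QX n s u = Q (\<rho> n) (max 0 s) (max 0 u)" for n s u
    define QY where "QY s u = Q\<^sub>0 (max 0 s) (max 0 u)" for s u
    define \<delta> where "\<delta> n = \<theta> (\<rho> n) / \<rho> n powr h" for n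
    \<comment> \<open>The square of \<open>m p\<close> is the lower bound for the Gram determinant;
      \<open>1 / m p\<close> is integrable because \<open>\<nu> < 1\<close>.\<close>
    define m where "m p = c * (min (fst p) (snd p) * \<bar>fst p - snd p\<bar>) powr \<nu>" for p :: "real \<times> real"
    \<comment> \<open>Averaging over \<open>unif t\<close> divides by \<open>t\<close>; the
      compensating factor is put into the function, and it cancels the \<open>1 / t\<close> of the
      averaged local time.\<close>
    define g where "g x = t * f x" for x
    interpret U: prob_space "unif t" using t by (rule prob_space_unif)
    interpret UU: pair_prob_space "unif t" "unif t" ..
    have Xm: "(\<lambda>(s, w). X n s w) \<in> borel_measurable (borel \<Otimes>\<^sub>M M)" for n
    proof -
      have "max 0 (t\<^sub>0 + \<rho> n * max 0 s) = t\<^sub>0 + \<rho> n * max 0 s" "max 0 t\<^sub>0 = t\<^sub>0" for s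
        using \<rho>(1)[of n] t\<^sub>0 by simp_all
      then have "X n s w = \<rho> n powr (- h) * (B (max 0 (t\<^sub>0 + \<rho> n * max 0 s)) w - B (max 0 t\<^sub>0) w)" for s w
        by (simp only: X_def)
      then show ?thesis by simp
    qed
    have covX: "gaussian_cov M (X n) (QX n)" for n
      unfolding QX_def Q_def
    proof (rule M.gaussian_cov_R)
      fix s
      have "R (\<lambda>v. \<rho> n powr (- h) *\<^sub>R k (H (t\<^sub>0 + \<rho> n * max 0 s)) (t\<^sub>0 + \<rho> n * max 0 s) v + (- (\<rho> n powr (- h))) *\<^sub>R k (H t\<^sub>0) t\<^sub>0 v)
          (\<lambda>w. \<rho> n powr (- h) * B (t\<^sub>0 + \<rho> n * max 0 s) w + (- (\<rho> n powr (- h))) * B t\<^sub>0 w)"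
        using \<rho>(1)[of n] t\<^sub>0 by (intro M.R_lincomb B_R) auto
      then show "R (\<kappa> (\<rho> n) (max 0 s)) (X n s)"
        by (simp add: \<kappa>_def[abs_def] X_def[abs_def] h_def algebra_simps)
    qed
    have covY: "gaussian_cov N (\<lambda>s. Y (max 0 s)) QY"
      using N.gaussian_cov_R[of "\<lambda>s. k h (max 0 s)" "\<lambda>s. Y (max 0 s)"] Y_R' by (simp add: QY_def[abs_def] Q\<^sub>0_kernel)
    have "AE p in unif t \<Otimes>\<^sub>M unif t. fst p \<in> {0<..t} \<and> snd p \<in> {0<..t} \<and> fst p \<noteq> snd p"
    proof (rule UU.AE_pair_measure)
      show "AE s in unif t. AE u in unif t. fst (s, u) \<in> {0<..t} \<and> snd (s, u) \<in> {0<..t} \<and> fst (s, u) \<noteq> snd (s, u)"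
      proof (rule eventually_mono[OF AE_unif[OF t]])
        fix s assume s: "s \<in> {0<..t}"
        have "AE u in unif t. u \<noteq> s"
          unfolding unif_def by (subst AE_density) (auto intro: eventually_mono[OF AE_lborel_singleton[of s]])
        then show "AE u in unif t. fst (s, u) \<in> {0<..t} \<and> snd (s, u) \<in> {0<..t} \<and> fst (s, u) \<noteq> snd (s, u)"
          by (rule eventually_elim2[OF AE_unif[OF t]]) (use s in simp)
      qed
    qed measurable
    then have det: "AE p in unif t \<Otimes>\<^sub>M unif t. 0 < m p \<and> (m p)\<^sup>2 \<le> QX n (fst p) (fst p) * QX n (snd p) (snd p) - (QX n (fst p) (snd p))\<^sup>2" for n
    proof (rule eventually_mono)
      fix p :: "real \<times> real" assume p: "fst p \<in> {0<..t} \<and> snd p \<in> {0<..t} \<and> fst p \<noteq> snd p"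
      then have "max 0 (fst p) = fst p" "max 0 (snd p) = snd p" "min (fst p) (snd p) * \<bar>fst p - snd p\<bar> \<noteq> 0" by auto
      then show "0 < m p \<and> (m p)\<^sup>2 \<le> QX n (fst p) (fst p) * QX n (snd p) (snd p) - (QX n (fst p) (snd p))\<^sup>2"
        using nd[of "n + n0" "fst p" "snd p"] p c by (simp add: m_def QX_def \<rho>_def del: mult_eq_0_iff)
    qed
    have \<nu>0: "0 < \<nu>" using h by simp
    have "integrable (unif t \<Otimes>\<^sub>M unif t) (\<lambda>p. (1 / c) * (min (fst p) (snd p) * \<bar>fst p - snd p\<bar>) powr (- \<nu>))"
      using \<nu>0 \<nu> t by (intro integrable_mult_right integrable_unif_det_bound)
    moreover have "(1 / c) * (min (fst p) (snd p) * \<bar>fst p - snd p\<bar>) powr (- \<nu>) = 1 / m p" for p :: "real \<times> real"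
      by (simp add: m_def powr_minus field_simps)
    ultimately have m_int: "integrable (unif t \<Otimes>\<^sub>M unif t) (\<lambda>p. 1 / m p)" by simp
    have GX: "gaussian_functional M (unif t) (X n) (QX n) m" for n
    proof
      show "sets (unif t) = sets borel" by simp
      show "(\<lambda>(s, w). X n s w) \<in> borel_measurable (borel \<Otimes>\<^sub>M M)" by (rule Xm)
      show "gaussian_cov M (X n) (QX n)" by (rule covX)
      show "QX n s u = QX n u s" for s u unfolding QX_def by (rule Q_sym)
    qed (rule det m_int)+
    have QYm: "(\<lambda>(s, u). QY s u) \<in> borel_measurable (borel \<Otimes>\<^sub>M borel)"
      unfolding QY_def Q\<^sub>0_def by measurable
    have LT: "AE w in N. \<exists>l' \<in> borel_measurable borel. (\<forall>x. 0 \<le> l' x) \<and> isCont l' y \<and> l' y = l t y w / t \<and>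
        distr (unif t) borel (\<lambda>s. Y (max 0 s) w) = density lborel (\<lambda>x. ennreal (l' x))"
      using l_AE AE_space
    proof eventually_elim
      case (elim w)
      note [measurable] = lb(1)[OF elim(1)[THEN conjunct1]]
      have Yw: "(\<lambda>s. Y s w) \<in> borel_measurable (restrict_space borel {0..})"
        using measurable_Pair1[OF Y elim(2)] by simp
      show ?case
      proof (intro bexI[of _ "\<lambda>x. l t x w / t"] conjI allI)
        show "isCont (\<lambda>x. l t x w / t) y" using lb(2)[OF elim(1)[THEN conjunct1]] t by (intro continuous_intros) auto
        show "distr (unif t) borel (\<lambda>s. Y (max 0 s) w) = density lborel (\<lambda>x. ennreal (l t x w / t))"
          using elim(1) by (intro local_time_unif[OF t Yw]) auto
      qed (use elim(1) t in auto)
    qed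
    have \<delta>0: "0 < \<delta> n" for n using \<theta>(1)[of "\<rho> n"] \<rho>(1)[of n] by (simp add: \<delta>_def)
    have "filterlim \<rho> (at_right 0) sequentially"
      using \<rho>(1) by (intro tendsto_imp_filterlim_at_right[OF \<rho>(2)] always_eventually) simp
    from filterlim_compose[OF \<theta>(3) this] have \<delta>lim: "\<delta> \<longlonglongrightarrow> 0" by (simp add: \<delta>_def[abs_def])
    have gi: "integrable lborel g" unfolding g_def using f by simp
    have lim: "(\<lambda>n. QX n s u) \<longlonglongrightarrow> QY s u" for s u
      unfolding QX_def QY_def by (rule Q_tendsto[OF \<rho>]) auto
    have W: "weak_conv_m (\<lambda>n. distr M borel (\<lambda>w. \<integral>s. g ((X n s w - y) / \<delta> n) / \<delta> n \<partial>unif t))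
        (distr N borel (\<lambda>w. (\<integral>x. g x \<partial>lborel) * (l t y w / t)))"
      by (rule gaussian_local_functional_limit[OF GX N.prob_space_axioms _ covY lim QYm _ LT gi \<delta>0 \<delta>lim]) measurable
    have "(\<integral>x. g x \<partial>lborel) * (l t y w / t) = F * l t y w" for w
      using t by (simp add: g_def F_def)
    moreover have "(\<integral>s. g ((X n s w - y) / \<delta> n) / \<delta> n \<partial>unif t) = I (\<rho> n) w" if w: "w \<in> space M" for n w
    proof -
      define b where "b s = B (max 0 s) w" for s
      have bm[measurable]: "b \<in> borel_measurable borel"
        unfolding b_def using measurable_Pair1[OF B' w] by simp
      define G where "G s = f ((b s - b t\<^sub>0 - \<rho> n powr h * y) / \<theta> (\<rho> n))" for s
      have [measurable]: "G \<in> borel_measurable borel" unfolding G_def by measurable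
      have pos: "0 < \<rho> n" "0 < \<theta> (\<rho> n)" using \<rho>(1) \<theta>(1) by auto
      have \<psi>: "\<psi> (\<rho> n) = \<theta> (\<rho> n) * \<rho> n powr (1 - h)" using \<theta>(2)[OF pos(1)] pos by (simp add: field_simps)
      \<comment> \<open>The level \<open>y\<close> at scale \<open>\<delta> n\<close> for the
        rescaled process is the level \<open>\<rho> n powr h * y\<close> at scale
        \<open>\<theta> (\<rho> n)\<close> for the increment of \<open>B\<close>.\<close>
      have "(X n s w - y) / \<delta> n = (b (t\<^sub>0 + \<rho> n * s) - b t\<^sub>0 - \<rho> n powr h * y) / \<theta> (\<rho> n)" if "0 \<le> s" for s
        using pos that t\<^sub>0 by (simp add: X_def \<delta>_def b_def powr_minus field_simps)
      then have eq: "indicator {0..t} s *\<^sub>R (g ((X n s w - y) / \<delta> n) / \<delta> n) = t / \<delta> n * (indicator {t\<^sub>0..\<rho> n * t + t\<^sub>0} (t\<^sub>0 + \<rho> n * s) *\<^sub>R G (t\<^sub>0 + \<rho> n * s))" for s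
        using pos by (auto simp: indicator_def g_def G_def zero_le_mult_iff)
      have "(\<lambda>s. X n s w) \<in> borel_measurable borel"
        using measurable_Pair1[OF Xm w] by simp
      then have "(\<integral>s. g ((X n s w - y) / \<delta> n) / \<delta> n \<partial>unif t) = (LINT s:{0..t}|lborel. g ((X n s w - y) / \<delta> n) / \<delta> n) / t"
        using t by (intro integral_unif) (auto simp: g_def)
      also have "\<dots> = (\<integral>s. t / \<delta> n * (indicator {t\<^sub>0..\<rho> n * t + t\<^sub>0} (t\<^sub>0 + \<rho> n * s) *\<^sub>R G (t\<^sub>0 + \<rho> n * s)) \<partial>lborel) / t"
        unfolding set_lebesgue_integral_def eq ..
      also have "\<dots> = (\<integral>s. indicator {t\<^sub>0..\<rho> n * t + t\<^sub>0} (t\<^sub>0 + \<rho> n * s) *\<^sub>R G (t\<^sub>0 + \<rho> n * s) \<partial>lborel) / \<delta> n"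
        using t by simp
      \<comment> \<open>The substitution contributes \<open>1 / \<rho> n\<close>; together with
        \<open>1 / \<delta> n\<close> this is \<open>1 / \<psi> (\<rho> n)\<close>.\<close>
      also have "(\<integral>s. indicator {t\<^sub>0..\<rho> n * t + t\<^sub>0} (t\<^sub>0 + \<rho> n * s) *\<^sub>R G (t\<^sub>0 + \<rho> n * s) \<partial>lborel) = (LINT s:{t\<^sub>0..\<rho> n * t + t\<^sub>0}|lborel. G s) / \<rho> n"
        unfolding set_lebesgue_integral_def
        using lborel_integral_real_affine[of "\<rho> n" "\<lambda>s. indicator {t\<^sub>0..\<rho> n * t + t\<^sub>0} s *\<^sub>R G s" t\<^sub>0] pos by simp
      also have "(LINT s:{t\<^sub>0..\<rho> n * t + t\<^sub>0}|lborel. G s) = (LINT s:{t\<^sub>0..\<rho> n * t + t\<^sub>0}|lborel. f ((B s w - B t\<^sub>0 w - \<rho> n powr h * y) / \<theta> (\<rho> n)))"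
        unfolding set_lebesgue_integral_def using t\<^sub>0
        by (intro Bochner_Integration.integral_cong) (auto simp: G_def b_def indicator_def)
      finally show ?thesis
        using pos by (simp add: I_def \<psi> \<delta>_def powr_diff mult.commute)
    qed
    then have "distr M borel (\<lambda>w. \<integral>s. g ((X n s w - y) / \<delta> n) / \<delta> n \<partial>unif t) = distr M borel (I (\<rho> n))" for n
      by (intro distr_cong) auto
    ultimately have "weak_conv_m (\<lambda>n. distr M borel (I (r (n + n0)))) (distr N borel (\<lambda>w. F * l t y w))"
      using W by (simp add: \<rho>_def)
    then show ?thesis by (rule weak_conv_m_offset)
  qed
qed

end

theorem theorem5p3:
  fixes M :: "'a measure" and N :: "'b measure"
    and W B :: "real \<Rightarrow> 'a \<Rightarrow> real" and W' Y :: "real \<Rightarrow> 'b \<Rightarrow> real"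
    and l :: "real \<Rightarrow> real \<Rightarrow> 'b \<Rightarrow> real"
    and r :: mbm_representation
    and H f \<theta> \<psi> :: "real \<Rightarrow> real"
    and \<mu> \<nu> \<beta> \<xi> t\<^sub>0 t y :: real
  assumes "0 < \<mu>" and "\<nu> < 1"
    and "\<And>s. 0 \<le> s \<Longrightarrow> H s \<in> {\<mu>..\<nu>}"
    and "\<exists>C. \<forall>s\<ge>0. \<forall>u\<ge>0. \<bar>H s - H u\<bar> \<le> C * \<bar>s - u\<bar> powr \<beta>"
    and "(SUP s\<in>{0..}. H s) < \<beta>"
    and "multifractional_bm r M W H B"
    and "0 \<le> t\<^sub>0"
    and "fractional_bm r N W' (H t\<^sub>0) Y"
    and "continuous_local_time N Y l"
    and "integrable lborel f"
    and "0 < \<xi>" and "\<xi> < 1 / (2 * (SUP s\<in>{0..}. H s)) - 1/2"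
    and "integrable lborel (\<lambda>x. \<bar>f x\<bar> * \<bar>x\<bar> powr \<xi>)"
    and "(LINT x|lborel. f x) \<noteq> 0"
    and "\<And>\<rho>. 0 < \<rho> \<Longrightarrow> 0 < \<theta> \<rho>" and "\<And>\<rho>. 0 < \<rho> \<Longrightarrow> 0 < \<psi> \<rho>"
    and "\<And>\<rho>. 0 < \<rho> \<Longrightarrow> \<psi> \<rho> / \<theta> \<rho> = \<rho> powr (1 - H t\<^sub>0)"
    and "(\<lambda>\<rho>. \<theta> \<rho> / \<rho> powr H t\<^sub>0) \<in> o[at_right 0](\<lambda>_. 1)"
    and "0 \<le> t"
  shows "conv_in_law_at_right_0
           M (\<lambda>\<rho> \<omega>. 1 / \<psi> \<rho> *
                (LINT s:{t\<^sub>0..\<rho> * t + t\<^sub>0}|lborel.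
                   f ((B s \<omega> - B t\<^sub>0 \<omega> - \<rho> powr H t\<^sub>0 * y) / \<theta> \<rho>)))
           N (\<lambda>\<omega>. (LINT x|lborel. f x) * l t y \<omega>)"
proof -
  have BM: "std_brownian_motion M W" and Bm: "(\<lambda>(s, w). B s w) \<in> borel_measurable (restrict_space borel {0..} \<Otimes>\<^sub>M M)"
    and Bv: "\<And>s. 0 \<le> s \<Longrightarrow> is_mbm_value r M W (H s) s (B s)"
    using assms(6) by (auto simp: multifractional_bm_def)
  have BM': "std_brownian_motion N W'" and Ym: "(\<lambda>(s, w). Y s w) \<in> borel_measurable (restrict_space borel {0..} \<Otimes>\<^sub>M N)"
    and Yv: "\<And>s. 0 \<le> s \<Longrightarrow> is_mbm_value r N W' (H t\<^sub>0) s (Y s)"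
    using assms(8) by (auto simp: multifractional_bm_def)
  have Bs: "B s \<in> borel_measurable M" and Ys: "Y s \<in> borel_measurable N" if "0 \<le> s" for s
    using measurable_Pair2[OF Bm, of s] measurable_Pair2[OF Ym, of s] that by (simp_all add: space_restrict_space)
  obtain C where C: "\<And>s u. 0 \<le> s \<Longrightarrow> 0 \<le> u \<Longrightarrow> \<bar>H s - H u\<bar> \<le> C * \<bar>s - u\<bar> powr \<beta>"
    using assms(4) by blast
  \<comment> \<open>The hypothesis names no sign for the Hoelder constant; the maximum provides the
    nonnegativity that the locale asks for.\<close>
  define D where "D = max C 0"
  have "C * \<bar>s - u\<bar> powr \<beta> \<le> D * \<bar>s - u\<bar> powr \<beta>" for s u
    unfolding D_def by (intro mult_right_mono) auto
  with C have D: "\<bar>H s - H u\<bar> \<le> D * \<bar>s - u\<bar> powr \<beta>" if "0 \<le> s" "0 \<le> u" for s u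
    using that by (meson order_trans)
  \<comment> \<open>Boundedness by \<nu> makes the supremum an actual upper bound, so that it can
    serve as \<open>h\<^sub>m\<close>.\<close>
  have "bdd_above (H ` {0..})" using assms(3) by (intro bdd_aboveI2[of _ _ \<nu>]) auto
  then have H_le: "H s \<le> (SUP s\<in>{0..}. H s)" if "0 \<le> s" for s using that by (intro cSUP_upper) auto
  have ax: "multifractional_kernel_axioms H \<mu> \<nu> \<beta> (SUP s\<in>{0..}. H s) D t\<^sub>0"
    using assms(1,2,3,5,7) D H_le by (auto simp: multifractional_kernel_axioms_def D_def)
  have \<theta>: "((\<lambda>\<rho>. \<theta> \<rho> / \<rho> powr H t\<^sub>0) \<longlongrightarrow> 0) (at_right 0)"
    using smalloD_tendsto[OF assms(18)] by simp
  show ?thesis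
  proof (cases r)
    case Moving_Average
    interpret multifractional_kernel moving_average_kernel "\<lambda>h. \<integral>u. (norm (moving_average_kernel h 1 u))\<^sup>2 \<partial>lborel" H \<mu> \<nu> \<beta> "SUP s\<in>{0..}. H s" D t\<^sub>0
      by (intro multifractional_kernel.intro hurst_kernel_moving_average ax)
    show ?thesis
    proof (rule local_time_limit[unfolded h_def, OF gaussian_integral_wiener[OF BM] _ Bm
          gaussian_integral_wiener[OF BM'] _ Ym assms(9,10,15,17) \<theta> assms(19)])
      show "has_wiener_integral M W UNIV (moving_average_kernel (H s) s) (B s)" if "0 \<le> s" for s
        using Bv that by (intro moving_average_value_wiener[OF BM Bs]) (simp_all add: Moving_Average)
      show "has_wiener_integral N W' UNIV (moving_average_kernel (H t\<^sub>0) s) (Y s)" if "0 \<le> s" for s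
        using Yv that by (intro moving_average_value_wiener[OF BM' Ys]) (simp_all add: Moving_Average)
    qed
  next
    case Harmonizable
    interpret multifractional_kernel harmonizable_kernel "\<lambda>h. \<integral>u. (norm (harmonizable_kernel h 1 u))\<^sup>2 \<partial>lborel" H \<mu> \<nu> \<beta> "SUP s\<in>{0..}. H s" D t\<^sub>0
      by (intro multifractional_kernel.intro hurst_kernel_harmonizable ax)
    show ?thesis
      by (rule local_time_limit[unfolded h_def, OF gaussian_integral_spectral[OF BM] _ Bm
            gaussian_integral_spectral[OF BM'] _ Ym assms(9,10,15,17) \<theta> assms(19)])
        (use Bv Yv in \<open>simp_all add: Harmonizable harmonizable_kernel_def[abs_def]\<close>)
  qed
qed

end
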